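(* Let $\Gamma_t$, $\Phi$, $v$, $f$, $G_T$ be as in the context. Assume that $\nabla_{\Gamma(t)}\cdot v\in L^\infty(G_T)$ and that $\dot f$ and $\nabla_{\Gamma(t)}f$ (material derivative and tangential derivatives of $(x,t)\mapsto f((x,t),u)$ at fixed $u$) are Lipschitz continuous with respect to $u$. Let $u_0\in L^\infty(\Gamma_0)$. Then the Kruzkov entropy solution of $$\dot u+u\,\nabla_\Gamma\cdot v+\nabla_\Gamma\cdot f(\cdot,u)=0\ \text{ on }G_T,\qquad u(\cdot,0)=u_0\ \text{ on }\Gamma_0,$$ is unique; that is, any two Kruzkov entropy solutions $u,\bar u\in L^\infty(G_T)$ with the same initial datum $u_0$ coincide almost everywhere in $G_T$.
   Context: Geometry. $T>0$; for $t\in[0,T]$, $\Gamma_t=\Gamma(t)\subset\mathbb R^{n+1}$ is a smooth closed (compact, without boundary) hypersurface with unit normal $\nu$. There is a smooth map $\Phi:\Gamma_0\times[0,T]\to\mathbb R^{n+1}$ with $\Phi(\cdot,0)=\mathrm{Id}$ and $\Phi(\cdot,t):\Gamma_0\to\Gamma_t$ a diffeomorphism for every $t$. The velocity is $v(\Phi(y,t),t)=\partial_t\Phi(y,t)$. $G_T=\bigcup_{t\in(0,T)}\Gamma_t\times\{t\}$. Derivatives. $\nabla_\Gamma g=\nabla\overline g-(\nabla\overline g\cdot\nu)\nu=(\underline D_1g,\dots,\underline D_{n+1}g)$ is the tangential gradient on $\Gamma_t$ ($\overline g$ any extension of $g$), $\nabla_\Gamma\cdot W=\sum_j\underline D_jW_j$.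 The material derivative is $\dot g=\partial_tg+v\cdot\nabla g$, i.e. $\dot g(\Phi(y,t),t)=\frac{d}{dt}[g(\Phi(y,t),t)]$. Flux. $f=f((x,t),u)\in\mathbb R^{n+1}$ is smooth with all derivatives bounded, $f((x,t),s)$ is tangent to $\Gamma_t$ at $x$ for all $x\in\Gamma_t$, $t\in[0,T]$, $s\in\mathbb R$, and for each fixed $t,s$ the field $x\mapsto f((x,t),s)$ satisfies $\nabla_\Gamma\cdot f((\cdot,t),s)=0$ on $\Gamma_t$. In the PDE, $\nabla_\Gamma\cdot f(\cdot,u)$ denotes the total tangential divergence of $x\mapsto f((x,t),u(x,t))$. Kruzkov entropy solution. $u\in L^\infty(G_T)$ is a Kruzkov entropy solution with initial datum $u_0$ if $$\int_0^T\int_{\Gamma_t}\Big(|u-k|\dot\varphi-\operatorname{sign}(u-k)\,k\,(\nabla_\Gamma\cdot v)\,\varphi+\operatorname{sign}(u-k)\,(f(\cdot,u)-f(\cdot,k))\cdot\nabla_\Gamma\varphi\Big)+\int_{\Gamma_0}|u_0-k|\,\varphi(\cdot,0)\ge0$$ for all $k\in\mathbb R$ and all $\varphi\in C^1(\overline{G_T})$ with $\varphi\ge0$ and $\varphi(\cdot,T)=0$. *)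

theory Defs
  imports "HOL-Analysis.Analysis"
begin

text \<open>
  With \<open>n = CARD('n)\<close> (so \<open>n \<ge> 1\<close>), the parameter space is \<open>real ^ 'n\<close> and the ambient space
  \<open>\<real>\<^sup>n\<^sup>+\<^sup>1\<close> is \<open>real ^ ('n option)\<close>, because \<open>CARD('n option) = CARD('n) + 1\<close>.
\<close>

type_synonym 'n ambient = "real ^ ('n option)"


section \<open>Smooth functions\<close>

text \<open>
  \<open>iter_deriv [v1, ..., vk] f\<close> is the iterated directional derivative \<open>D_v1 ... D_vk f\<close>.
\<close>

primrec iter_deriv ::
  "'a list \<Rightarrow> ('a::real_normed_vector \<Rightarrow> 'b::real_normed_vector) \<Rightarrow> 'a \<Rightarrow> 'b" where
  "iter_deriv [] f = f"
| "iter_deriv (v # vs) f = (\<lambda>x. frechet_derivative (iter_deriv vs f) (at x) v)"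

definition smooth_extension ::
  "'a::euclidean_space set \<Rightarrow> ('a \<Rightarrow> 'b::real_normed_vector) \<Rightarrow> 'a set \<Rightarrow> ('a \<Rightarrow> 'b) \<Rightarrow> bool" where
  "smooth_extension S f U g \<longleftrightarrow>
     open U \<and> S \<subseteq> U \<and> (\<forall>x\<in>S. g x = f x) \<and>
     (\<forall>vs. \<forall>x\<in>U. iter_deriv vs g differentiable (at x))"

text \<open>
  On an arbitrary set, smooth means extendable to a smooth function on an open neighbourhood;
  on an open set this is ordinary smoothness.
\<close>

definition smooth_on :: "'a::euclidean_space set \<Rightarrow> ('a \<Rightarrow> 'b::real_normed_vector) \<Rightarrow> bool" where
  "smooth_on S f \<longleftrightarrow> (\<exists>U g. smooth_extension S f U g)"

text \<open>Only derivatives of order at least one are required to be bounded, not the function itself.\<close>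

definition smooth_bounded_derivs_on ::
  "'a::euclidean_space set \<Rightarrow> ('a \<Rightarrow> 'b::real_normed_vector) \<Rightarrow> bool" where
  "smooth_bounded_derivs_on S f \<longleftrightarrow>
     (\<exists>U g. smooth_extension S f U g \<and> (\<forall>vs. vs \<noteq> [] \<longrightarrow> bounded (iter_deriv vs g ` S)))"

definition C1_on :: "'a::euclidean_space set \<Rightarrow> ('a \<Rightarrow> 'b::real_normed_vector) \<Rightarrow> bool" where
  "C1_on S f \<longleftrightarrow>
     (\<exists>U g. open U \<and> S \<subseteq> U \<and> (\<forall>x\<in>S. g x = f x) \<and>
        (\<forall>x\<in>U. g differentiable (at x)) \<and>
        (\<forall>v. continuous_on U (\<lambda>x. frechet_derivative g (at x) v)))"


section \<open>Hypersurfaces\<close>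

definition local_param ::
  "('n::finite) ambient set \<Rightarrow> (real ^ 'n) set \<Rightarrow> (real ^ 'n \<Rightarrow> 'n ambient) \<Rightarrow> bool" where
  "local_param S U X \<longleftrightarrow>
     open U \<and> smooth_on U X \<and> (\<forall>z\<in>U. inj (frechet_derivative X (at z))) \<and>
     (\<exists>Y. homeomorphism U (X ` U) X Y) \<and> openin (top_of_set S) (X ` U)"

definition closed_hypersurface :: "('n::finite) ambient set \<Rightarrow> bool" where
  "closed_hypersurface S \<longleftrightarrow> compact S \<and> (\<forall>x\<in>S. \<exists>U X. local_param S U X \<and> x \<in> X ` U)"

definition tangent_space :: "('n::finite) ambient set \<Rightarrow> 'n ambient \<Rightarrow> 'n ambient set" where
  "tangent_space S x =
     {frechet_derivative X (at z) h | X U z h. local_param S U X \<and> z \<in> U \<and> X z = x}"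

definition unit_normal :: "('n::finite) ambient set \<Rightarrow> 'n ambient \<Rightarrow> 'n ambient \<Rightarrow> bool" where
  "unit_normal S x \<nu> \<longleftrightarrow> norm \<nu> = 1 \<and> (\<forall>w\<in>tangent_space S x. \<nu> \<bullet> w = 0)"

text \<open>
  The tangential gradient depends neither on the extension \<open>h\<close> nor on the orientation of
  the normal.
\<close>

definition tgrad ::
  "('n::finite) ambient set \<Rightarrow> ('n ambient \<Rightarrow> real) \<Rightarrow> 'n ambient \<Rightarrow> 'n ambient" where
  "tgrad S g x =
     (THE w. \<exists>\<nu> h d. unit_normal S x \<nu> \<and> (\<forall>y\<in>S. h y = g y) \<and> (GDERIV h x :> d) \<and>
        w = d - (d \<bullet> \<nu>) *\<^sub>R \<nu>)"

definition tdiv ::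
  "('n::finite) ambient set \<Rightarrow> ('n ambient \<Rightarrow> 'n ambient) \<Rightarrow> 'n ambient \<Rightarrow> real" where
  "tdiv S W x = (\<Sum>j\<in>UNIV. tgrad S (\<lambda>y. W y $ j) x $ j)"

definition area_density :: "(real ^ 'n \<Rightarrow> ('n::finite) ambient) \<Rightarrow> real ^ 'n \<Rightarrow> real" where
  "area_density X z =
     sqrt (det ((\<chi> i j. frechet_derivative X (at z) (axis i 1) \<bullet>
                         frechet_derivative X (at z) (axis j 1)) :: real ^ 'n ^ 'n))"

text \<open>
  The Riemannian surface measure, on the Borel sets of \<open>S\<close>. On a closed hypersurface the area
  formula in local parametrisations determines exactly one such measure.
\<close>

definition surface_measure :: "('n::finite) ambient set \<Rightarrow> 'n ambient measure" where
  "surface_measure S =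
     (THE \<mu>. sets \<mu> = sets (restrict_space borel S) \<and>
        (\<forall>U X B. local_param S U X \<and> B \<in> sets borel \<and> B \<subseteq> U \<longrightarrow>
           emeasure \<mu> (X ` B) = (\<integral>\<^sup>+z\<in>B. ennreal (area_density X z) \<partial>lborel)))"

definition Linfty :: "'a measure \<Rightarrow> ('a \<Rightarrow> real) set" where
  "Linfty M = {u. u \<in> borel_measurable M \<and> (\<exists>C. AE z in M. \<bar>u z\<bar> \<le> C)}"


section \<open>Moving hypersurfaces\<close>

definition evolving_hypersurface ::
  "real \<Rightarrow> (real \<Rightarrow> ('n::finite) ambient set) \<Rightarrow> ('n ambient \<Rightarrow> real \<Rightarrow> 'n ambient) \<Rightarrow>
   ('n ambient \<times> real \<Rightarrow> 'n ambient) \<Rightarrow> bool" where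
  "evolving_hypersurface T \<Gamma> \<Phi> v \<longleftrightarrow>
     T > 0 \<and>
     (\<forall>t\<in>{0..T}. closed_hypersurface (\<Gamma> t)) \<and>
     smooth_on (\<Gamma> 0 \<times> {0..T}) (\<lambda>(y, t). \<Phi> y t) \<and>
     (\<forall>y\<in>\<Gamma> 0. \<Phi> y 0 = y) \<and>
     (\<forall>t\<in>{0..T}. bij_betw (\<lambda>y. \<Phi> y t) (\<Gamma> 0) (\<Gamma> t) \<and>
        smooth_on (\<Gamma> 0) (\<lambda>y. \<Phi> y t) \<and>
        smooth_on (\<Gamma> t) (inv_into (\<Gamma> 0) (\<lambda>y. \<Phi> y t))) \<and>
     (\<forall>y\<in>\<Gamma> 0. \<forall>t\<in>{0..T}.
        ((\<lambda>s. \<Phi> y s) has_vector_derivative v (\<Phi> y t, t)) (at t within {0..T}))"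

definition spacetime :: "real \<Rightarrow> (real \<Rightarrow> ('n::finite) ambient set) \<Rightarrow> ('n ambient \<times> real) set" where
  "spacetime T \<Gamma> = (\<Union>t\<in>{0<..<T}. \<Gamma> t \<times> {t})"

text \<open>The measure \<open>d\<Gamma>\<^sub>t dt\<close> on the Borel sets of the space-time surface.\<close>

definition spacetime_measure ::
  "real \<Rightarrow> (real \<Rightarrow> ('n::finite) ambient set) \<Rightarrow> ('n ambient \<times> real) measure" where
  "spacetime_measure T \<Gamma> =
     measure_of (spacetime T \<Gamma>) (sets (restrict_space borel (spacetime T \<Gamma>)))
       (\<lambda>A. \<integral>\<^sup>+t\<in>{0<..<T}. emeasure (surface_measure (\<Gamma> t)) {x. (x, t) \<in> A} \<partial>lborel)"

definition material_deriv ::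
  "real \<Rightarrow> (real \<Rightarrow> ('n::finite) ambient set) \<Rightarrow> ('n ambient \<Rightarrow> real \<Rightarrow> 'n ambient) \<Rightarrow>
   ('n ambient \<times> real \<Rightarrow> 'b::real_normed_vector) \<Rightarrow> 'n ambient \<times> real \<Rightarrow> 'b" where
  "material_deriv T \<Gamma> \<Phi> g = (\<lambda>(x, t).
     let y = inv_into (\<Gamma> 0) (\<lambda>y. \<Phi> y t) x
     in vector_derivative (\<lambda>s. g (\<Phi> y s, s)) (at t within {0..T}))"


section \<open>The conservation law\<close>

definition admissible_flux ::
  "real \<Rightarrow> (real \<Rightarrow> ('n::finite) ambient set) \<Rightarrow> ('n ambient \<times> real \<Rightarrow> real \<Rightarrow> 'n ambient) \<Rightarrow> bool" where
  "admissible_flux T \<Gamma> f \<longleftrightarrow>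
     smooth_bounded_derivs_on (closure (spacetime T \<Gamma>) \<times> UNIV) (\<lambda>(z, s). f z s) \<and>
     (\<forall>t\<in>{0..T}. \<forall>x\<in>\<Gamma> t. \<forall>s.
        f (x, t) s \<in> tangent_space (\<Gamma> t) x \<and> tdiv (\<Gamma> t) (\<lambda>y. f (y, t) s) x = 0)"

definition test_functions ::
  "real \<Rightarrow> (real \<Rightarrow> ('n::finite) ambient set) \<Rightarrow> ('n ambient \<times> real \<Rightarrow> real) set" where
  "test_functions T \<Gamma> =
     {\<phi>. C1_on (closure (spacetime T \<Gamma>)) \<phi> \<and>
         (\<forall>z\<in>closure (spacetime T \<Gamma>). \<phi> z \<ge> 0) \<and> (\<forall>x\<in>\<Gamma> T. \<phi> (x, T) = 0)}"

text \<open>The library's \<open>sgn\<close> has \<open>sgn 0 = 0\<close>.\<close>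

definition kruzkov_entropy_solution ::
  "real \<Rightarrow> (real \<Rightarrow> ('n::finite) ambient set) \<Rightarrow> ('n ambient \<Rightarrow> real \<Rightarrow> 'n ambient) \<Rightarrow>
   ('n ambient \<times> real \<Rightarrow> 'n ambient) \<Rightarrow> ('n ambient \<times> real \<Rightarrow> real \<Rightarrow> 'n ambient) \<Rightarrow>
   ('n ambient \<Rightarrow> real) \<Rightarrow> ('n ambient \<times> real \<Rightarrow> real) \<Rightarrow> bool" where
  "kruzkov_entropy_solution T \<Gamma> \<Phi> v f u0 u \<longleftrightarrow>
     u \<in> Linfty (spacetime_measure T \<Gamma>) \<and>
     (\<forall>k. \<forall>\<phi>\<in>test_functions T \<Gamma>.
        (LINT t:{0<..<T}|lborel. LINT x|surface_measure (\<Gamma> t).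
             \<bar>u (x, t) - k\<bar> * material_deriv T \<Gamma> \<Phi> \<phi> (x, t)
           - sgn (u (x, t) - k) * k * tdiv (\<Gamma> t) (\<lambda>y. v (y, t)) x * \<phi> (x, t)
           + sgn (u (x, t) - k) *
               ((f (x, t) (u (x, t)) - f (x, t) k) \<bullet> tgrad (\<Gamma> t) (\<lambda>y. \<phi> (y, t)) x))
        + (LINT x|surface_measure (\<Gamma> 0). \<bar>u0 x - k\<bar> * \<phi> (x, 0)) \<ge> 0)"

end

theory Submission
  imports Defs
begin

text \<open>
  Kruzkov's doubling of variables, carried out with test functions of the ambient space: the entropy
  inequality of each solution is tested with \<open>(x, t) \<mapsto> \<tau> t * bump \<epsilon> (x - q)\<close>, where \<open>q\<close> and the
  constant \<open>k\<close> are the position and the value of the other solution at a second point. Everything is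
  pulled back by \<open>\<Phi>\<close> to \<open>\<Gamma> 0 \<times> {0<..<T}\<close>, with the Jacobian \<open>J\<close> of the flow as weight. In the sum of
  the two inequalities the singular derivatives of the mollifiers cancel up to differences of the
  velocity and of the flux at the two points. These are Lipschitz and hence compensate the factor
  \<open>1 / \<epsilon>\<close> in the gradient of the bump. No exact normalisation of the bump on the hypersurface is
  available, but the measure of a ball of radius \<open>\<epsilon>\<close> is comparable to \<open>\<epsilon> ^ n\<close> from both sides. Hence
  the limit \<open>\<epsilon> \<rightarrow> 0\<close> yields \<open>\<integral> - \<psi>' * \<bar>u - u'\<bar> \<le> \<Lambda> * (\<integral> \<psi> * \<bar>u - u'\<bar>)\<close> for a suitable decreasing weight \<open>\<psi>\<close>
  and a constant \<open>\<Lambda>\<close> independent of \<open>\<epsilon>\<close>; for \<open>\<psi> t = exp (- \<Lambda> * t) * (T - t)\<close> this forces \<open>u = u'\<close>.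
\<close>

section \<open>Change of variables\<close>

text \<open>A hypersurface has no translations, so the second variable cannot be removed by a shift.
  Its place is taken by averages of |g X - g X'| over kernels that concentrate on the diagonal; for
  integrable g they vanish in the limit even if the kernels only have bounded mass. Comparing with
  such kernels costs a constant factor: the term with \<open>\<psi>'\<close>, whose sign is
  favourable, is bounded below on a ball smaller than the support of the bump, every other term
  above on a larger ball. The ratio \<Lambda> of the two constants may be large, but \<psi> can be
  adapted to any \<Lambda>. Time is mollified at scale \<open>\<epsilon>\<^sup>2\<close>, space at
  scale \<epsilon>. During a time \<open>\<epsilon>\<^sup>2\<close> a point travels a distance of
  order \<open>\<epsilon>\<^sup>2\<close>, which is negligible against \<epsilon>; so positions at
  different times can be compared through their labels in \<open>\<Gamma> 0\<close>. Ambient test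
  functions suffice because the flux is tangent: its product with the tangential gradient is its
  product with the ambient gradient, and no geodesic distance has to be differentiated.\<close>

typedef 'n idx = "{..<CARD('n::finite)}"
  by (intro exI[of _ 0]) simp

setup_lifting type_definition_idx

instantiation idx :: (finite) wellorder
begin
lift_definition less_eq_idx :: "'a idx \<Rightarrow> 'a idx \<Rightarrow> bool" is "(\<le>)" .
lift_definition less_idx :: "'a idx \<Rightarrow> 'a idx \<Rightarrow> bool" is "(<)" .
instance
proof
  fix P :: "'a idx \<Rightarrow> bool" and a
  assume *: "\<And>x. (\<And>y. y < x \<Longrightarrow> P y) \<Longrightarrow> P x"
  show "P a"
  proof (induction "Rep_idx a" arbitrary: a rule: less_induct)
    case less
    show ?case by (rule *) (use less in \<open>auto simp: less_idx.rep_eq\<close>)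
  qed
qed (transfer; auto)+
end

instance idx :: (finite) finite
proof
  have "(UNIV :: 'a idx set) = Abs_idx ` {..<CARD('a)}"
    by (metis type_definition.Abs_image type_definition_idx)
  then show "finite (UNIV :: 'a idx set)" by (metis finite_imageI finite_lessThan)
qed

lemma card_idx [simp]: "CARD('n idx) = CARD('n::finite)"
  using type_definition.card[OF type_definition_idx] by simp

text \<open>Conjugation with \<open>e\<close> is a sign-preserving bijection between the
  permutations of the two index types, so the Leibniz sums agree term by term.\<close>

lemma det_relabel:
  fixes A :: "'a::comm_ring_1^'m^'m" and e :: "'n::finite \<Rightarrow> 'm::finite"
  assumes "bij e"
  shows "det (\<chi> i j. A $ (e i) $ (e j)) = det A"
proof -
  let ?S = "{p. p permutes (UNIV :: 'n set)}" and ?T = "{p. p permutes (UNIV :: 'm set)}"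
  have inj: "inj e" and bij: "bij_betw e UNIV UNIV" and bij': "bij_betw (inv e) UNIV UNIV"
    using assms bij_imp_bij_inv by (auto simp: bij_def)
  have [simp]: "inv e (e i) = i" "e (inv e j) = j" for i j
    using assms by (auto simp: bij_def surj_f_inv_f)
  have "det (\<chi> i j. A $ (e i) $ (e j)) =
        (\<Sum>p\<in>?S. of_int (sign p) * (\<Prod>i\<in>UNIV. A $ (e i) $ (e (p i))))"
    by (simp add: det_def)
  also have "\<dots> = (\<Sum>p\<in>?T. of_int (sign p) * (\<Prod>i\<in>UNIV. A $ i $ p i))"
  proof (rule sum.reindex_bij_witness[of _ "map_permutation UNIV (inv e)" "map_permutation UNIV e"])
    fix p assume p: "p \<in> ?S"
    show "map_permutation UNIV (inv e) (map_permutation UNIV e p) = p"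
      using p bij by (intro map_permutation_compose_inv) auto
    show "map_permutation UNIV e p \<in> ?T"
      using p bij map_permutation_permutes by blast
    have "(\<Prod>i\<in>UNIV. A $ i $ map_permutation UNIV e p i) =
          (\<Prod>i\<in>UNIV. A $ e i $ map_permutation UNIV e p (e i))"
      by (rule prod.reindex_bij_betw[OF bij, symmetric])
    then show "of_int (sign (map_permutation UNIV e p)) *
        (\<Prod>i\<in>UNIV. A $ i $ map_permutation UNIV e p i) =
        of_int (sign p) * (\<Prod>i\<in>UNIV. A $ e i $ e (p i))"
      using inj p by (simp add: map_permutation_apply sign_map_permutation)
  next
    fix p assume p: "p \<in> ?T"
    show "map_permutation UNIV e (map_permutation UNIV (inv e) p) = p"
      using p bij' by (intro map_permutation_compose_inv) auto
    show "map_permutation UNIV (inv e) p \<in> ?S"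
      using p bij' map_permutation_permutes by blast
  qed
  finally show ?thesis by (simp add: det_def)
qed

text \<open>Lebesgue measure is determined by its values on boxes, and the preimage of a box is the
  box with permuted sides.\<close>

lemma lborel_distr_relabel:
  fixes e :: "'n::finite \<Rightarrow> 'm::finite"
  assumes "bij e"
  shows "distr lborel borel (\<lambda>x::real^'m. \<chi> i. x $ e i) = lborel"
proof (rule lborel_eqI[symmetric])
  let ?Q = "\<lambda>x::real^'m. \<chi> i. x $ e i"
  have e[simp]: "inv e (e i) = i" "e (inv e j) = j" for i j
    using assms by (auto simp: bij_def surj_f_inv_f)
  have [measurable]: "?Q \<in> borel \<rightarrow>\<^sub>M borel"
    by (intro borel_measurable_continuous_onI continuous_intros)
  fix l u :: "real^'n"
  assume le: "\<And>b. b \<in> Basis \<Longrightarrow> l \<bullet> b \<le> u \<bullet> b"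
  let ?l = "\<chi> j. l $ inv e j" and ?u = "\<chi> j. u $ inv e j"
  have le': "l $ i \<le> u $ i" for i
    using le[of "axis i 1"] by (simp add: inner_axis)
  have "?Q -` box l u = box ?l ?u"
    by (simp add: set_eq_iff mem_box_cart) (metis e)
  then have "emeasure (distr lborel borel ?Q) (box l u) = emeasure lborel (box ?l ?u)"
    by (simp add: emeasure_distr)
  also have "\<dots> = (\<Prod>b\<in>Basis. (?u - ?l) \<bullet> b)"
    using le' by (subst emeasure_lborel_box) (auto simp: Basis_vec_def inner_axis)
  also have "(\<Prod>b\<in>Basis. (?u - ?l) \<bullet> b) = (\<Prod>j\<in>UNIV. (u - l) $ inv e j)"
    by (simp add: Basis_vec_def UNION_singleton_eq_range prod.reindex inj_on_def axis_eq_axis inner_axis)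
  also have "\<dots> = (\<Prod>i\<in>UNIV. (u - l) $ i)"
    using prod.reindex_bij_betw[OF bij_imp_bij_inv[OF assms], of "\<lambda>i. (u - l) $ i"] by simp
  also have "\<dots> = (\<Prod>b\<in>Basis. (u - l) \<bullet> b)"
    by (simp add: Basis_vec_def UNION_singleton_eq_range prod.reindex inj_on_def axis_eq_axis inner_axis)
  finally show "emeasure (distr lborel borel ?Q) (box l u) = (\<Prod>b\<in>Basis. (u - l) \<bullet> b)" .
qed simp

text \<open>The equivalence between a finite integral of the Jacobian and a finite measure of the
  image is used in both directions: a finite right-hand side gives the value, an infinite one rules
  out a finite left-hand side. The Borel function \<open>d\<close> stands for the Jacobian, since
  \<open>f'\<close> is only controlled on \<open>B\<close>.\<close>

lemma emeasure_image_wellorder: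
  fixes f :: "real^'n::{finite,wellorder} \<Rightarrow> real^'n::_"
  assumes B: "B \<in> sets borel" and fB: "f ` B \<in> sets borel"
    and der: "\<And>x. x \<in> B \<Longrightarrow> (f has_derivative f' x) (at x within B)"
    and inj: "inj_on f B"
    and d[measurable]: "d \<in> borel_measurable borel"
    and d_eq: "\<And>x. x \<in> B \<Longrightarrow> d x = \<bar>det (matrix (f' x))\<bar>"
  shows "emeasure lborel (f ` B) = (\<integral>\<^sup>+x\<in>B. ennreal (d x) \<partial>lborel)"
proof -
  note [measurable] = B
  have BL: "B \<in> sets lebesgue" using B by auto
  note iff = has_measure_differentiable_image[OF BL der inj]
  have eq: "(\<integral>\<^sup>+x\<in>B. ennreal (d x) \<partial>lborel) = (\<integral>\<^sup>+x. ennreal (indicator B x * d x) \<partial>lborel)"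
    by (intro nn_integral_cong) (auto simp: indicator_def)
  have nonneg: "0 \<le> indicator B x * d x" for x by (auto simp: indicator_def d_eq)
  have emeq: "emeasure lborel (f ` B) = emeasure lebesgue (f ` B)"
    using fB by simp
  show ?thesis
  proof (cases "(\<integral>\<^sup>+x\<in>B. ennreal (d x) \<partial>lborel)" rule: ennreal_cases)
    case (real m)
    have "((\<lambda>x. indicator B x * d x) has_integral m) UNIV"
      by (rule nn_integral_has_integral) (use real nonneg eq in auto)
    then have "((\<lambda>x. if x \<in> B then \<bar>det (matrix (f' x))\<bar> else 0) has_integral m) UNIV"
      by (rule has_integral_eq[rotated]) (auto simp: d_eq)
    then have "((\<lambda>x. \<bar>det (matrix (f' x))\<bar>) has_integral m) B"
      by (simp add: has_integral_restrict_UNIV)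
    then have "f ` B \<in> lmeasurable" "measure lebesgue (f ` B) = m"
      using iff by blast+
    then show ?thesis
      using real by (metis emeq emeasure_eq_measure2)
  next
    case top
    have "emeasure lborel (f ` B) = \<infinity>"
    proof (rule ccontr)
      assume *: "emeasure lborel (f ` B) \<noteq> \<infinity>"
      have "f ` B \<in> lmeasurable"
        using fB * by (intro fmeasurableI) (metis sets_completionI_sets sets_lborel, metis emeq infinity_ennreal_def top.not_eq_extremum)
      then have "((\<lambda>x. \<bar>det (matrix (f' x))\<bar>) has_integral measure lebesgue (f ` B)) B"
        using iff by metis
      from nn_integral_has_integral_lebesgue[OF _ this]
      have "(\<integral>\<^sup>+x. ennreal (indicator B x * \<bar>det (matrix (f' x))\<bar>) \<partial>lborel) = measure lebesgue (f ` B)"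
        by simp
      moreover have "(\<integral>\<^sup>+x. ennreal (indicator B x * \<bar>det (matrix (f' x))\<bar>) \<partial>lborel)
           = (\<integral>\<^sup>+x. ennreal (indicator B x * d x) \<partial>lborel)"
        by (intro nn_integral_cong) (auto simp: indicator_def d_eq)
      ultimately show False using eq top by simp
    qed
    then show ?thesis using top by simp
  qed
qed

text \<open>The library proves the change of variables formula only for well-ordered index types;
  it is transported along a relabelling of the coordinates.\<close>

lemma emeasure_image:
  fixes f :: "real^'n::finite \<Rightarrow> real^'n::_"
  assumes B: "B \<in> sets borel" and fB: "f ` B \<in> sets borel"
    and der: "\<And>x. x \<in> B \<Longrightarrow> (f has_derivative f' x) (at x within B)"
    and inj: "inj_on f B"
    and d[measurable]: "d \<in> borel_measurable borel"
    and d_eq: "\<And>x. x \<in> B \<Longrightarrow> d x = \<bar>det (matrix (f' x))\<bar>"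
  shows "emeasure lborel (f ` B) = (\<integral>\<^sup>+x\<in>B. ennreal (d x) \<partial>lborel)"
proof -
  note [measurable] = B fB
  obtain e :: "'n idx \<Rightarrow> 'n" where e: "bij e"
    using finite_same_card_bij[of "UNIV :: 'n idx set" "UNIV :: 'n set"] by auto
  have ee[simp]: "inv e (e i) = i" "e (inv e j) = j" for i j
    using e by (auto simp: bij_def surj_f_inv_f)
  define P :: "real^'n \<Rightarrow> real^('n idx)" where "P = (\<lambda>x. \<chi> k. x $ e k)"
  define Q :: "real^('n idx) \<Rightarrow> real^'n" where "Q = (\<lambda>y. \<chi> i. y $ inv e i)"
  have PQ[simp]: "P (Q y) = y" "Q (P x) = x" for x y
    by (auto simp: P_def Q_def vec_eq_iff)
  have linP: "linear P" and linQ: "linear Q"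
    by (auto simp: P_def Q_def linear_iff vec_eq_iff)
  have blP: "bounded_linear P" and blQ: "bounded_linear Q"
    using linP linQ by (auto simp: linear_conv_bounded_linear)
  have [measurable]: "P \<in> borel \<rightarrow>\<^sub>M borel" "Q \<in> borel \<rightarrow>\<^sub>M borel"
    using blP blQ by (auto intro!: borel_measurable_continuous_onI linear_continuous_on)
  have imP: "P ` S = Q -` S" for S
    by (auto simp: image_iff intro: PQ(1)[symmetric])
  have dP: "distr lborel borel P = lborel" and dQ: "distr lborel borel Q = lborel"
    unfolding P_def Q_def using lborel_distr_relabel[OF e] lborel_distr_relabel[OF bij_imp_bij_inv[OF e]]
    by auto
  have P_borel: "P ` S \<in> sets borel" if "S \<in> sets borel" for S
    using measurable_sets_borel[OF \<open>Q \<in> borel \<rightarrow>\<^sub>M borel\<close> that] by (simp add: imP)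
  have em: "emeasure lborel (P ` S) = emeasure lborel S" if "S \<in> sets borel" for S
  proof -
    have "emeasure lborel S = emeasure (distr lborel borel Q) S" by (simp add: dQ)
    also have "\<dots> = emeasure lborel (Q -` S)" using that by (subst emeasure_distr) auto
    finally show ?thesis by (simp add: imP)
  qed
  \<comment> \<open>The map in relabelled coordinates. Its Jacobian matrix is that of
    \<open>f\<close> with rows and columns permuted alike, so the determinant is unchanged.\<close>
  let ?F = "\<lambda>y. P (f (Q y))"
  have FB: "?F ` (P ` B) = P ` f ` B" by (auto simp: image_iff)
  have QPB: "Q ` P ` B \<subseteq> B" by auto
  have "emeasure lborel (?F ` (P ` B)) = (\<integral>\<^sup>+y\<in>P ` B. ennreal (d (Q y)) \<partial>lborel)"
  proof (rule emeasure_image_wellorder)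
    show "P ` B \<in> sets borel" "?F ` P ` B \<in> sets borel"
      using P_borel[OF B] P_borel[OF fB] FB by auto
    show "inj_on ?F (P ` B)"
      using inj by (auto simp: inj_on_def dest!: arg_cong[of _ _ Q])
    show "(\<lambda>y. d (Q y)) \<in> borel_measurable borel" by simp
    fix y assume y: "y \<in> P ` B"
    then have Qy: "Q y \<in> B" by auto
    have "(Q has_derivative Q) (at y within P ` B)" "(P has_derivative P) (at z within Z)" for z Z
      using blQ blP by (auto intro: bounded_linear_imp_has_derivative)
    moreover have "(f has_derivative f' (Q y)) (at (Q y) within Q ` P ` B)"
      by (rule has_derivative_subset[OF der[OF Qy] QPB])
    ultimately show "(?F has_derivative (\<lambda>h. P (f' (Q y) (Q h)))) (at y within P ` B)"
      using diff_chain_within[of Q Q y "P ` B" f] diff_chain_within[of "\<lambda>y. f (Q y)" _ y "P ` B" P P]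
      by (auto simp: o_def)
    have "Q (axis l 1) = axis (e l) 1" for l
      by (simp add: Q_def axis_def vec_eq_iff) (metis ee)
    then have "matrix (\<lambda>h. P (f' (Q y) (Q h))) = (\<chi> k l. matrix (f' (Q y)) $ (e k) $ (e l))"
      by (simp add: matrix_def P_def)
    then show "d (Q y) = \<bar>det (matrix (\<lambda>h. P (f' (Q y) (Q h))))\<bar>"
      using d_eq[OF Qy] det_relabel[OF e, of "matrix (f' (Q y))"] by simp
  qed
  also have "\<dots> = (\<integral>\<^sup>+y\<in>P ` B. ennreal (d (Q y)) \<partial>distr lborel borel P)" by (simp add: dP)
  also have "\<dots> = (\<integral>\<^sup>+x. ennreal (d (Q (P x))) * indicator (P ` B) (P x) \<partial>lborel)"
    using P_borel[OF B] by (subst nn_integral_distr) auto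
  also have "\<dots> = (\<integral>\<^sup>+x\<in>B. ennreal (d x) \<partial>lborel)"
    by (intro nn_integral_cong) (auto simp: indicator_def imP)
  finally show ?thesis using FB em[OF fB] by simp
qed

lemma nn_integral_image:
  fixes f :: "real^'n::finite \<Rightarrow> real^'n::_"
  assumes W[measurable]: "W \<in> sets borel"
    and img: "\<And>B. B \<in> sets borel \<Longrightarrow> B \<subseteq> W \<Longrightarrow> f ` B \<in> sets borel"
    and meas: "(\<lambda>x. indicator W x *\<^sub>R f x) \<in> borel_measurable borel"
    and der: "\<And>x. x \<in> W \<Longrightarrow> (f has_derivative f' x) (at x)"
    and inj: "inj_on f W"
    and d[measurable]: "d \<in> borel_measurable borel"
    and d_eq: "\<And>x. x \<in> W \<Longrightarrow> d x = \<bar>det (matrix (f' x))\<bar>"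
    and h[measurable]: "h \<in> borel_measurable borel"
  shows "(\<integral>\<^sup>+y\<in>f ` W. h y \<partial>lborel) = (\<integral>\<^sup>+x\<in>W. ennreal (d x) * h (f x) \<partial>lborel)"
proof -
  define T where "T = (\<lambda>x. indicator W x *\<^sub>R f x)"
  have [measurable]: "T \<in> borel \<rightarrow>\<^sub>M borel" using meas by (simp add: T_def)
  have T: "T x = f x" if "x \<in> W" for x using that by (simp add: T_def)
  have [measurable]: "f ` W \<in> sets borel" using img[OF W] by simp
  let ?N1 = "density lborel (indicator (f ` W))"
  let ?N0 = "density lborel (\<lambda>x. ennreal (d x) * indicator W x)"
  let ?N2 = "distr ?N0 borel T"
  have "?N1 = ?N2"
  proof (rule measure_eqI)
    fix E assume "E \<in> sets ?N1"
    then have [measurable]: "E \<in> sets borel" by simp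
    let ?B = "W \<inter> T -` E"
    have B: "?B \<in> sets borel" by measurable
    have "emeasure ?N1 E = emeasure lborel (f ` W \<inter> E)"
      by (simp add: emeasure_density indicator_inter_arith[symmetric] Int_commute)
    also have "f ` W \<inter> E = f ` ?B" by (auto simp: T)
    also have "emeasure lborel (f ` ?B) = (\<integral>\<^sup>+x\<in>?B. ennreal (d x) \<partial>lborel)"
    proof (rule emeasure_image)
      show "f ` ?B \<in> sets borel" using img[OF B] by auto
      show "(f has_derivative f' x) (at x within ?B)" if "x \<in> ?B" for x
        using der that has_derivative_at_withinI by blast
      show "inj_on f ?B" using inj by (rule inj_on_subset) auto
    qed (use B d_eq in auto)
    also have "\<dots> = (\<integral>\<^sup>+x. ennreal (d x) * indicator W x * indicator (T -` E) x \<partial>lborel)"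
      by (intro nn_integral_cong) (auto simp: indicator_def)
    also have "\<dots> = emeasure ?N0 (T -` E)"
      using measurable_sets_borel[OF \<open>T \<in> borel \<rightarrow>\<^sub>M borel\<close> \<open>E \<in> sets borel\<close>]
      by (subst emeasure_density) auto
    also have "\<dots> = emeasure ?N2 E"
      by (subst emeasure_distr) auto
    finally show "emeasure ?N1 E = emeasure ?N2 E" .
  qed simp
  then have "(\<integral>\<^sup>+y. h y \<partial>?N1) = (\<integral>\<^sup>+y. h y \<partial>?N2)" by simp
  moreover have "(\<integral>\<^sup>+y. h y \<partial>?N1) = (\<integral>\<^sup>+y\<in>f ` W. h y \<partial>lborel)"
    by (subst nn_integral_density) (auto simp: mult.commute)
  moreover have "(\<integral>\<^sup>+y. h y \<partial>?N2) = (\<integral>\<^sup>+x. ennreal (d x) * indicator W x * h (T x) \<partial>lborel)"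
    by (subst nn_integral_distr, simp, simp, subst nn_integral_density) auto
  moreover have "\<dots> = (\<integral>\<^sup>+x\<in>W. ennreal (d x) * h (f x) \<partial>lborel)"
    by (intro nn_integral_cong) (auto simp: indicator_def T)
  ultimately show ?thesis by simp
qed

section \<open>Continuously differentiable maps\<close>

text \<open>Continuity of the derivative is required direction by direction. In finite dimension
  this amounts to continuity in operator norm, which \<open>c1_strict_derivative\<close> recovers
  from the basis vectors.\<close>

definition c1 :: "'a::euclidean_space set \<Rightarrow> ('a \<Rightarrow> 'b::real_normed_vector) \<Rightarrow> bool" where
  "c1 U g \<longleftrightarrow> open U \<and> (\<forall>x\<in>U. g differentiable (at x)) \<and>
     (\<forall>v. continuous_on U (\<lambda>x. frechet_derivative g (at x) v))"

lemma c1_open: "c1 U g \<Longrightarrow> open U"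
  by (simp add: c1_def)

lemma c1_has_derivative:
  "c1 U g \<Longrightarrow> x \<in> U \<Longrightarrow> (g has_derivative frechet_derivative g (at x)) (at x)"
  by (simp add: c1_def frechet_derivative_works)

lemma c1_linear: "c1 U g \<Longrightarrow> x \<in> U \<Longrightarrow> linear (frechet_derivative g (at x))"
  using c1_has_derivative has_derivative_linear by blast

lemma c1_continuous_deriv:
  "c1 U g \<Longrightarrow> continuous_on U (\<lambda>x. frechet_derivative g (at x) v)"
  by (simp add: c1_def)

lemma c1_continuous_on: "c1 U g \<Longrightarrow> continuous_on U g"
  by (meson c1_has_derivative continuous_at_imp_continuous_on has_derivative_continuous)

lemma c1_subset: "c1 U g \<Longrightarrow> open V \<Longrightarrow> V \<subseteq> U \<Longrightarrow> c1 V g"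
  by (auto simp: c1_def intro: continuous_on_subset)

lemma frechet_derivative_cong_open:
  assumes "open U" "x \<in> U" "\<And>y. y \<in> U \<Longrightarrow> g y = f y" "g differentiable (at x)"
  shows "f differentiable (at x)" "frechet_derivative f (at x) = frechet_derivative g (at x)"
proof -
  have "(f has_derivative frechet_derivative g (at x)) (at x)"
    using assms frechet_derivative_works has_derivative_transform_within_open by metis
  then show "f differentiable (at x)" "frechet_derivative f (at x) = frechet_derivative g (at x)"
    using differentiableI frechet_derivative_at[symmetric] by blast+
qed

lemma c1_cong:
  assumes "c1 U g" "\<And>x. x \<in> U \<Longrightarrow> g x = f x"
  shows "c1 U f"
proof -
  have "frechet_derivative f (at x) = frechet_derivative g (at x)" "f differentiable (at x)"
    if "x \<in> U" for x
    using frechet_derivative_cong_open[of U x g f] assms that by (auto simp: c1_def)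
  then show ?thesis
    using assms by (auto simp: c1_def cong: continuous_on_cong)
qed

lemma smooth_extension_c1:
  assumes "smooth_extension S f U g"
  shows "c1 U (iter_deriv vs g)"
proof -
  have d: "iter_deriv ws g differentiable (at x)" if "x \<in> U" for ws x
    using assms that by (auto simp: smooth_extension_def)
  have "continuous_on U (\<lambda>x. frechet_derivative (iter_deriv vs g) (at x) v)" for v
    using d[of _ "v # vs"]
    by (intro continuous_at_imp_continuous_on) (auto intro: differentiable_imp_continuous_within)
  then show ?thesis
    using assms d by (auto simp: c1_def smooth_extension_def)
qed

lemma smooth_on_open_c1:
  assumes "smooth_on U X" "open U"
  shows "c1 U X"
proof -
  obtain W g where g: "smooth_extension U X W g"
    using assms by (auto simp: smooth_on_def)
  then have "c1 W g"
    using smooth_extension_c1[of U X W g "[]"] by simp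
  then show ?thesis
    using g assms(2) by (auto simp: smooth_extension_def intro!: c1_cong[of U g X] c1_subset[of W g U])
qed

text \<open>Mean value inequality for \<open>g\<close> minus its linear part at \<open>p\<close>.
  The estimate holds for two free points near \<open>p\<close> with one fixed linear map, so upper
  and lower Lipschitz bounds can be read off without an inverse function theorem.\<close>

lemma c1_strict_derivative:
  fixes g :: "'a::euclidean_space \<Rightarrow> 'b::real_normed_vector"
  assumes g: "c1 U g" and p: "p \<in> U" and e: "e > 0"
  shows "\<exists>\<eta>>0. ball p \<eta> \<subseteq> U \<and> (\<forall>x\<in>ball p \<eta>. \<forall>y\<in>ball p \<eta>.
           norm (g x - g y - frechet_derivative g (at p) (x - y)) \<le> e * norm (x - y))"
proof -
  let ?D = "\<lambda>x. frechet_derivative g (at x)"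
  \<comment> \<open>The operator norm is at most the sum of the norms on the basis vectors, so each
    of these gets an equal share of \<open>e\<close>.\<close>
  let ?d = "e / real DIM('a)"
  have d: "?d > 0" using e by simp
  have U: "open U" using g by (rule c1_open)
  have "\<forall>\<^sub>F x in nhds p. norm (?D x b - ?D p b) < ?d" for b
  proof -
    have "isCont (\<lambda>x. ?D x b) p"
      using c1_continuous_deriv[OF g] p U by (simp add: continuous_on_eq_continuous_at)
    then have "((\<lambda>x. ?D x b) \<longlongrightarrow> ?D p b) (nhds p)"
      by (metis isCont_def tendsto_at_iff_tendsto_nhds)
    then show ?thesis
      by (auto dest!: tendstoD[OF _ d] simp: dist_norm)
  qed
  then have "\<forall>\<^sub>F x in nhds p. \<forall>b\<in>Basis. norm (?D x b - ?D p b) < ?d"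
    by (simp add: eventually_ball_finite)
  moreover have "\<forall>\<^sub>F x in nhds p. x \<in> U"
    using U p by (rule eventually_nhds_in_open)
  ultimately have "\<forall>\<^sub>F x in nhds p. x \<in> U \<and> (\<forall>b\<in>Basis. norm (?D x b - ?D p b) < ?d)"
    by eventually_elim auto
  then obtain \<eta> where \<eta>: "\<eta> > 0"
    and close: "\<And>x. x \<in> ball p \<eta> \<Longrightarrow> x \<in> U \<and> (\<forall>b\<in>Basis. norm (?D x b - ?D p b) < ?d)"
    unfolding eventually_nhds_metric by (auto simp: dist_commute)
  have "norm (g x - g y - ?D p (x - y)) \<le> e * norm (x - y)"
    if xy: "x \<in> ball p \<eta>" "y \<in> ball p \<eta>" for x y
  proof -
    let ?h = "\<lambda>x. g x - ?D p x"
    have lin: "bounded_linear (?D p)"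
      using c1_has_derivative[OF g p] by (rule has_derivative_bounded_linear)
    have "norm (?h x - ?h y) \<le> e * norm (x - y)"
    proof (rule differentiable_bound[of "ball p \<eta>"])
      fix z assume z: "z \<in> ball p \<eta>"
      have gz: "(g has_derivative ?D z) (at z within ball p \<eta>)"
        using c1_has_derivative[OF g] close[OF z] has_derivative_at_withinI by blast
      show der: "(?h has_derivative (\<lambda>h. ?D z h - ?D p h)) (at z within ball p \<eta>)"
        by (intro has_derivative_diff gz bounded_linear_imp_has_derivative[OF lin])
      show "onorm (\<lambda>h. ?D z h - ?D p h) \<le> e"
      proof (rule onorm_bound)
        fix h
        have linz: "linear (\<lambda>h. ?D z h - ?D p h)"
          using der has_derivative_linear by blast
        have "norm (?D z h - ?D p h) = norm (\<Sum>b\<in>Basis. (h \<bullet> b) *\<^sub>R (?D z b - ?D p b))"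
          using linear_sum[OF linz, of "\<lambda>b. (h \<bullet> b) *\<^sub>R b" Basis] linear_scale[OF linz]
          by (simp add: euclidean_representation)
        also have "\<dots> \<le> (\<Sum>b\<in>(Basis::'a set). norm h * ?d)"
        proof (rule sum_norm_le)
          fix b :: 'a assume b: "b \<in> Basis"
          show "norm ((h \<bullet> b) *\<^sub>R (?D z b - ?D p b)) \<le> norm h * ?d"
            unfolding norm_scaleR
            by (rule mult_mono) (use Basis_le_norm[OF b, of h] close[OF z] b in \<open>auto simp: less_imp_le\<close>)
        qed
        also have "\<dots> = e * norm h" by simp
        finally show "norm (?D z h - ?D p h) \<le> e * norm h" .
      qed (use e in simp)
    qed (use xy in auto)
    moreover have "?h x - ?h y = g x - g y - ?D p (x - y)"
      by (simp add: linear_diff[OF bounded_linear.linear[OF lin]])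
    ultimately show ?thesis by simp
  qed
  then show ?thesis using \<eta> close by blast
qed

lemma c1_locally_lipschitz:
  fixes g :: "'a::euclidean_space \<Rightarrow> 'b::real_normed_vector"
  assumes g: "c1 U g" and p: "p \<in> U"
  obtains \<eta> L where "\<eta> > 0" "L > 0" "ball p \<eta> \<subseteq> U"
    "\<And>x y. x \<in> ball p \<eta> \<Longrightarrow> y \<in> ball p \<eta> \<Longrightarrow> norm (g x - g y) \<le> L * norm (x - y)"
proof -
  let ?D = "frechet_derivative g (at p)"
  obtain \<eta> where \<eta>: "\<eta> > 0" "ball p \<eta> \<subseteq> U" and
    *: "\<And>x y. x \<in> ball p \<eta> \<Longrightarrow> y \<in> ball p \<eta> \<Longrightarrow> norm (g x - g y - ?D (x - y)) \<le> 1 * norm (x - y)"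
    using c1_strict_derivative[OF g p, of 1] by auto
  obtain K where K: "K > 0" "\<And>h. norm (?D h) \<le> norm h * K"
    using bounded_linear.pos_bounded[OF has_derivative_bounded_linear[OF c1_has_derivative[OF g p]]]
    by blast
  have "norm (g x - g y) \<le> (K + 1) * norm (x - y)" if "x \<in> ball p \<eta>" "y \<in> ball p \<eta>" for x y
    using *[OF that] K(2)[of "x - y"] norm_triangle_sub[of "g x - g y" "?D (x - y)"]
    by (simp add: algebra_simps)
  then show thesis using that[of \<eta> "K + 1"] \<eta> K by auto
qed

text \<open>An injective linear map expands by at least some factor \<open>B > 0\<close>; the strict
  derivative with error \<open>B / 2\<close> leaves half of it.\<close>

lemma c1_locally_bilipschitz:
  fixes g :: "'a::euclidean_space \<Rightarrow> 'b::euclidean_space"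
  assumes g: "c1 U g" and p: "p \<in> U" and inj: "inj (frechet_derivative g (at p))"
  obtains \<eta> c where "\<eta> > 0" "c > 0" "ball p \<eta> \<subseteq> U"
    "\<And>x y. x \<in> ball p \<eta> \<Longrightarrow> y \<in> ball p \<eta> \<Longrightarrow> c * norm (x - y) \<le> norm (g x - g y)"
proof -
  let ?D = "frechet_derivative g (at p)"
  obtain B where B: "B > 0" "\<And>h. B * norm h \<le> norm (?D h)"
    using linear_inj_bounded_below_pos[OF c1_linear[OF g p] inj] by blast
  obtain \<eta> where \<eta>: "\<eta> > 0" "ball p \<eta> \<subseteq> U" and
    *: "\<And>x y. x \<in> ball p \<eta> \<Longrightarrow> y \<in> ball p \<eta> \<Longrightarrow> norm (g x - g y - ?D (x - y)) \<le> B / 2 * norm (x - y)"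
    using c1_strict_derivative[OF g p, of "B / 2"] B by auto
  have "B / 2 * norm (x - y) \<le> norm (g x - g y)" if "x \<in> ball p \<eta>" "y \<in> ball p \<eta>" for x y
    using *[OF that] B(2)[of "x - y"] norm_triangle_sub[of "?D (x - y)" "g x - g y"]
    by (simp add: norm_minus_commute algebra_simps)
  then show thesis using that[of \<eta> "B / 2"] \<eta> B by auto
qed

text \<open>Away from the zeros of \<beta> the quotient of \<alpha> and \<beta> is locally bounded
  by continuity, so only the zeros need an argument. With \<beta> a distance of two points this
  turns local Lipschitz estimates near the diagonal into a global one.\<close>

lemma compact_local_bound:
  fixes \<alpha> \<beta> :: "'a::metric_space \<Rightarrow> real"
  assumes K: "compact K" and \<alpha>: "continuous_on K \<alpha>" and \<beta>: "continuous_on K \<beta>"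
    and nonneg: "\<And>x. x \<in> K \<Longrightarrow> 0 \<le> \<beta> x"
    and local: "\<And>x. x \<in> K \<Longrightarrow> \<beta> x = 0 \<Longrightarrow> \<exists>N C. open N \<and> x \<in> N \<and> (\<forall>y\<in>N \<inter> K. \<alpha> y \<le> C * \<beta> y)"
  obtains C where "C > 0" "\<And>x. x \<in> K \<Longrightarrow> \<alpha> x \<le> C * \<beta> x"
proof -
  have "\<exists>N C. open N \<and> x \<in> N \<and> (\<forall>y\<in>N \<inter> K. \<alpha> y \<le> C * \<beta> y)" if x: "x \<in> K" for x
  proof (cases "\<beta> x = 0")
    case False
    with nonneg x have pos: "\<beta> x > 0" by (simp add: order_less_le)
    let ?C = "(\<bar>\<alpha> x\<bar> + 1) / (\<beta> x / 2)"
    have "(\<alpha> \<longlongrightarrow> \<alpha> x) (at x within K)" "(\<beta> \<longlongrightarrow> \<beta> x) (at x within K)"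
      using \<alpha> \<beta> x by (auto simp: continuous_on_def)
    then have "\<forall>\<^sub>F y in at x within K. \<alpha> y < \<bar>\<alpha> x\<bar> + 1" "\<forall>\<^sub>F y in at x within K. \<beta> y > \<beta> x / 2"
      using pos order_tendstoD(2)[of \<alpha> "\<alpha> x" _ "\<bar>\<alpha> x\<bar> + 1"] order_tendstoD(1)[of \<beta> "\<beta> x" _ "\<beta> x / 2"]
      by auto
    then have "\<forall>\<^sub>F y in at x within K. \<alpha> y \<le> ?C * \<beta> y"
    proof eventually_elim
      case (elim y)
      have "?C * (\<beta> x / 2) \<le> ?C * \<beta> y"
        using elim pos by (intro mult_left_mono) auto
      moreover have "?C * (\<beta> x / 2) = \<bar>\<alpha> x\<bar> + 1" using pos by simp
      ultimately show ?case using elim(1) by linarith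
    qed
    moreover have eq: "?C * \<beta> x = 2 * (\<bar>\<alpha> x\<bar> + 1)" using pos by simp
    have "\<alpha> x \<le> ?C * \<beta> x" unfolding eq
      using pos by (cases "\<alpha> x \<ge> 0") auto
    ultimately show ?thesis
      unfolding eventually_at_topological by (metis IntE)
  qed (use local x in auto)
  then obtain N C where N: "\<And>x. x \<in> K \<Longrightarrow> open (N x) \<and> x \<in> N x \<and> (\<forall>y\<in>N x \<inter> K. \<alpha> y \<le> C x * \<beta> y)"
    by metis
  then obtain F where F: "F \<subseteq> K" "finite F" "K \<subseteq> (\<Union>x\<in>F. N x)"
    using compactE_image[OF K, of K N] by (metis UN_I subsetI)
  let ?C = "1 + (\<Sum>x\<in>F. \<bar>C x\<bar>)"
  have "\<alpha> y \<le> ?C * \<beta> y" if y: "y \<in> K" for y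
  proof -
    obtain x where x: "x \<in> F" "y \<in> N x" using F y by blast
    have "\<bar>C x\<bar> \<le> (\<Sum>x\<in>F. \<bar>C x\<bar>)" using x F by (intro member_le_sum) auto
    then have "C x \<le> ?C" by linarith
    then have "C x * \<beta> y \<le> ?C * \<beta> y" using nonneg[OF y] by (rule mult_right_mono)
    then show ?thesis using N[of x] x F y by force
  qed
  moreover have "?C > 0" by (smt (verit) sum_nonneg)
  ultimately show thesis using that by blast
qed

text \<open>\<open>K\<close> need not be convex, so the mean value inequality is only available
  locally. On \<open>K \<times> K\<close> the distance vanishes exactly on the diagonal, where the
  local estimate applies.\<close>

lemma c1_lipschitz_on_compact:
  fixes g :: "'a::euclidean_space \<Rightarrow> 'b::real_normed_vector"
  assumes g: "c1 U g" and K: "compact K" "K \<subseteq> U"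
  obtains L where "L > 0" "\<And>x y. x \<in> K \<Longrightarrow> y \<in> K \<Longrightarrow> norm (g x - g y) \<le> L * norm (x - y)"
proof -
  have cg: "continuous_on K g" using c1_continuous_on[OF g] K continuous_on_subset by blast
  have cont: "continuous_on (K \<times> K) (\<lambda>z. g (fst z))" "continuous_on (K \<times> K) (\<lambda>z. g (snd z))"
    by (auto intro!: continuous_on_compose2[OF cg] continuous_intros)
  obtain L where L: "L > 0" "\<And>z. z \<in> K \<times> K \<Longrightarrow> norm (g (fst z) - g (snd z)) \<le> L * norm (fst z - snd z)"
  proof (rule compact_local_bound[of "K \<times> K" "\<lambda>z. norm (g (fst z) - g (snd z))" "\<lambda>z. norm (fst z - snd z)"])
    show "continuous_on (K \<times> K) (\<lambda>z. norm (g (fst z) - g (snd z)))"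
      by (intro continuous_intros cont)
    fix z assume z: "z \<in> K \<times> K" "norm (fst z - snd z) = 0"
    then obtain p where p: "z = (p, p)" "p \<in> K" by (cases z) auto
    then obtain \<eta> L where *: "\<eta> > 0" "L > 0" "ball p \<eta> \<subseteq> U"
      "\<And>x y. x \<in> ball p \<eta> \<Longrightarrow> y \<in> ball p \<eta> \<Longrightarrow> norm (g x - g y) \<le> L * norm (x - y)"
      using c1_locally_lipschitz[OF g, of p] K by blast
    then show "\<exists>N C. open N \<and> z \<in> N \<and> (\<forall>y\<in>N \<inter> K \<times> K. norm (g (fst y) - g (snd y)) \<le> C * norm (fst y - snd y))"
      using p by (intro exI[of _ "ball p \<eta> \<times> ball p \<eta>"] exI[of _ L]) (auto intro: open_Times)
  qed (use K in \<open>auto intro: compact_Times intro!: continuous_intros\<close>)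
  show thesis using that[of L] L by auto
qed

section \<open>Derivatives of transition maps\<close>

lemma has_derivative_iff_eventually:
  "(f has_derivative f') (at x) \<longleftrightarrow>
     bounded_linear f' \<and> (\<forall>e>0. \<forall>\<^sub>F y in nhds x. norm (f y - f x - f' (y - x)) \<le> e * norm (y - x))"
  unfolding has_derivative_at_alt eventually_nhds_metric by (simp add: dist_norm)

lemma derivative_lower_bound:
  fixes f :: "'a::real_normed_vector \<Rightarrow> 'b::real_normed_vector"
  assumes f: "(f has_derivative f') (at x)"
    and low: "\<forall>\<^sub>F y in nhds x. c * norm (y - x) \<le> norm (f y - f x)"
  shows "c * norm h \<le> norm (f' h)"
proof (cases "h = 0")
  case False
  show ?thesis
  proof (rule field_le_epsilon)
    fix e :: real assume "e > 0"
    then have e: "e / norm h > 0" using False by simp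
    have "\<forall>\<^sub>F y in nhds x. norm (f y - f x - f' (y - x)) \<le> e / norm h * norm (y - x)"
      using f e unfolding has_derivative_iff_eventually by blast
    with low have "\<forall>\<^sub>F y in nhds x. c * norm (y - x) \<le> norm (f' (y - x)) + e / norm h * norm (y - x)"
    proof eventually_elim
      case (elim y)
      then show ?case using norm_triangle_sub[of "f y - f x" "f' (y - x)"] by linarith
    qed
    then obtain d where d: "d > 0" and
      *: "\<And>y. dist y x < d \<Longrightarrow> c * norm (y - x) \<le> norm (f' (y - x)) + e / norm h * norm (y - x)"
      unfolding eventually_nhds_metric by blast
    define s where "s = d / 2 / norm h"
    have s: "s > 0" using d False by (simp add: s_def)
    have "dist (x + s *\<^sub>R h) x < d" using d False by (simp add: s_def dist_norm)
    from *[OF this] have "s * (c * norm h) \<le> s * (norm (f' h) + e)"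
      using s False linear_scale[OF has_derivative_linear[OF f], of s h] by (simp add: algebra_simps)
    then show "c * norm h \<le> norm (f' h) + e" using s by simp
  qed
qed (simp add: linear_0[OF has_derivative_linear[OF f]])

text \<open>\<open>Y\<close> maps into a space of higher dimension, so \<open>T\<close> cannot be
  differentiated as a composition with an inverse diffeomorphism. Instead the lower bound for
  \<open>Y\<close> shows that \<open>T\<close> is Lipschitz at \<open>z\<close>, and a linear left
  inverse of \<open>B\<close>, applied to the expansion of \<open>Y (T y) = X y\<close>, yields the
  expansion of \<open>T\<close>.\<close>

lemma transition_derivative:
  fixes X Y :: "'a::euclidean_space \<Rightarrow> 'b::euclidean_space" and T :: "'a \<Rightarrow> 'a"
  assumes X: "(X has_derivative A) (at z)" and Y: "(Y has_derivative B) (at (T z))"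
    and T: "isCont T z" and eq: "\<forall>\<^sub>F y in nhds z. Y (T y) = X y"
    and c: "c > 0" and low: "\<forall>\<^sub>F w in nhds (T z). c * norm (w - T z) \<le> norm (Y w - Y (T z))"
  shows "\<exists>D. (T has_derivative D) (at z) \<and> A = B \<circ> D"
proof -
  have linA: "linear A" and linB: "linear B"
    using X Y has_derivative_linear by blast+
  have "inj B"
  proof (rule injI)
    fix h k assume "B h = B k"
    then show "h = k"
      using derivative_lower_bound[OF Y low, of "h - k"] c linear_diff[OF linB, of h k]
      by (simp add: mult_le_0_iff)
  qed
  then obtain G where linG: "linear G" and G: "G \<circ> B = id"
    using linear_injective_left_inverse[OF linB] by blast
  have GB[simp]: "G (B h) = h" for h using G by (metis comp_apply id_apply)
  obtain KG where KG: "KG > 0" "\<And>h. norm (G h) \<le> KG * norm h"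
    using linear_bounded_pos[OF linG] by blast
  obtain KA where KA: "KA > 0" "\<And>h. norm (A h) \<le> KA * norm h"
    using linear_bounded_pos[OF linA] by blast
  have Tlim: "filterlim T (nhds (T z)) (nhds z)"
    using T by (metis isCont_def tendsto_at_iff_tendsto_nhds)
  have lowT: "\<forall>\<^sub>F y in nhds z. c * norm (T y - T z) \<le> norm (Y (T y) - Y (T z))"
    using eventually_compose_filterlim[OF low Tlim] .
  have eqz: "Y (T z) = X z" using eventually_nhds_x_imp_x[OF eq] .
  have Tz: "(T has_derivative (G \<circ> A)) (at z)"
    unfolding has_derivative_iff_eventually
  proof (intro conjI allI impI)
    show "bounded_linear (G \<circ> A)"
      using linear_compose[OF linA linG] linear_conv_bounded_linear by blast
    fix e :: real assume e: "e > 0"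
    define C where "C = (KA + 1) / c"
    have C: "C > 0" using KA c by (simp add: C_def)
    \<comment> \<open>Both remainders enter with factor \<open>e'\<close>, that of \<open>Y\<close>
      multiplied by the Lipschitz constant \<open>C\<close> of \<open>T\<close>; the left inverse
      contributes \<open>KG\<close>.\<close>
    define e' where "e' = e / (KG * (C + 1))"
    have e': "e' > 0" using e KG C by (simp add: e'_def)
    have X1: "\<forall>\<^sub>F y in nhds z. norm (X y - X z - A (y - z)) \<le> 1 * norm (y - z)"
      and X2: "\<forall>\<^sub>F y in nhds z. norm (X y - X z - A (y - z)) \<le> e' * norm (y - z)"
      using X e' unfolding has_derivative_iff_eventually by (meson zero_less_one)+
    have "\<forall>\<^sub>F w in nhds (T z). norm (Y w - Y (T z) - B (w - T z)) \<le> e' * norm (w - T z)"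
      using Y e' unfolding has_derivative_iff_eventually by auto
    then have Y2: "\<forall>\<^sub>F y in nhds z. norm (Y (T y) - Y (T z) - B (T y - T z)) \<le> e' * norm (T y - T z)"
      using eventually_compose_filterlim[OF _ Tlim] by blast
    show "\<forall>\<^sub>F y in nhds z. norm (T y - T z - (G \<circ> A) (y - z)) \<le> e * norm (y - z)"
      using X1 X2 Y2 lowT eq
    proof eventually_elim
      case (elim y)
      let ?h = "y - z" and ?k = "T y - T z"
      have "norm (X y - X z) \<le> norm (A ?h) + norm (X y - X z - A ?h)"
        by (rule norm_triangle_sub)
      also have "\<dots> \<le> (KA + 1) * norm ?h" using elim(1) KA(2)[of ?h] by (simp add: algebra_simps)
      finally have "c * norm ?k \<le> (KA + 1) * norm ?h" using elim eqz by simp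
      then have k: "norm ?k \<le> C * norm ?h" using c by (simp add: C_def field_simps)
      have "?k - G (A ?h) = G ((X y - X z - A ?h) - (X y - X z - B ?k))"
        by (simp add: linear_diff[OF linG])
      also have "norm \<dots> \<le> KG * (norm (X y - X z - A ?h) + norm (X y - X z - B ?k))"
        using KG(2)[of "(X y - X z - A ?h) - (X y - X z - B ?k)"] KG(1)
          norm_triangle_ineq4[of "X y - X z - A ?h" "X y - X z - B ?k"]
        by (smt (verit, best) mult_left_mono)
      also have "\<dots> \<le> KG * (e' * norm ?h + e' * (C * norm ?h))"
        using elim eqz k e' KG(1) by (intro mult_left_mono add_mono) (auto intro: order_trans mult_left_mono)
      also have "\<dots> = e * norm ?h"
      proof -
        have "e' * (KG * (C + 1)) = e" using KG C by (simp add: e'_def)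
        then show ?thesis by (metis (no_types, opaque_lifting) distrib_left mult.assoc mult.commute mult.right_neutral add.commute)
      qed
      finally show ?case by simp
    qed
  qed
  have "((\<lambda>y. Y (T y)) has_derivative (B \<circ> (G \<circ> A))) (at z)"
    using diff_chain_at[OF Tz Y] by (simp add: o_def)
  moreover have "((\<lambda>y. Y (T y)) has_derivative A) (at z)"
    unfolding has_derivative_iff_eventually
  proof (intro conjI allI impI)
    show "bounded_linear A" using linA linear_conv_bounded_linear by blast
    fix e :: real assume "e > 0"
    then have "\<forall>\<^sub>F y in nhds z. norm (X y - X z - A (y - z)) \<le> e * norm (y - z)"
      using X unfolding has_derivative_iff_eventually by blast
    then show "\<forall>\<^sub>F y in nhds z. norm (Y (T y) - Y (T z) - A (y - z)) \<le> e * norm (y - z)"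
      using eq by eventually_elim (simp add: eqz)
  qed
  ultimately have "A = B \<circ> (G \<circ> A)" using has_derivative_unique by blast
  then show ?thesis using Tz by blast
qed

section \<open>Gram determinants and area densities\<close>

definition gram :: "(real^'n \<Rightarrow> real^'m) \<Rightarrow> real" where
  "gram A = det (\<chi> i j. A (axis i 1) \<bullet> A (axis j 1) :: real^'n^'n)"

lemma gram_matrix:
  "(\<chi> i j. A (axis i 1) \<bullet> A (axis j 1)) = transpose (matrix A) ** matrix A"
  by (simp add: matrix_def transpose_def matrix_matrix_mult_def inner_vec_def)

lemma gram_compose:
  fixes B :: "real^'n \<Rightarrow> real^'m"
  assumes "linear B" "linear C"
  shows "gram (B \<circ> C) = (det (matrix C))\<^sup>2 * gram B"
  unfolding gram_def gram_matrix matrix_compose[OF assms(2,1)]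
proof -
  let ?B = "matrix B" and ?C = "matrix C"
  have "transpose (?B ** ?C) ** (?B ** ?C) = transpose ?C ** (transpose ?B ** ?B) ** ?C"
    by (simp add: matrix_transpose_mul matrix_mul_assoc)
  then show "det (transpose (?B ** ?C) ** (?B ** ?C)) = (det ?C)\<^sup>2 * det (transpose ?B ** ?B)"
    by (simp add: det_mul power2_eq_square)
qed

text \<open>The segment from the identity to the Gram matrix consists of positive definite, hence
  invertible matrices. The determinant is 1 at its start and never vanishes, so by the intermediate
  value theorem it stays positive.\<close>

lemma gram_pos:
  fixes A :: "real^'n \<Rightarrow> real^'m"
  assumes lin: "linear A" and inj: "inj A"
  shows "gram A > 0"
proof (rule ccontr)
  assume neg: "\<not> gram A > 0"
  let ?G = "transpose (matrix A) ** matrix A"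
  let ?M = "\<lambda>s::real. (1 - s) *\<^sub>R mat 1 + s *\<^sub>R ?G"
  have nz: "det (?M s) \<noteq> 0" if s: "0 \<le> s" "s \<le> 1" for s
  proof -
    have "x = 0" if x: "?M s *v x = 0" for x
    proof (rule ccontr)
      assume "x \<noteq> 0"
      have "x \<bullet> (?G *v x) = (A x) \<bullet> (A x)"
        by (subst inner_commute) (simp add: matrix_vector_mul_assoc[symmetric] transpose_matrix_vector lin
            dot_lmul_matrix matrix_works[unfolded linear_matrix_vector_mul_eq])
      then have "x \<bullet> (?M s *v x) = (1 - s) * (x \<bullet> x) + s * (A x \<bullet> A x)"
        by (simp add: matrix_vector_mult_add_rdistrib scaleR_matrix_vector_assoc[symmetric] inner_add_right)
      moreover have "A x \<noteq> 0" using \<open>x \<noteq> 0\<close> inj linear_0[OF lin] by (metis injD)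
      then have "x \<bullet> x > 0" "A x \<bullet> A x > 0" using \<open>x \<noteq> 0\<close> by auto
      then have "(1 - s) * (x \<bullet> x) + s * (A x \<bullet> A x) > 0"
        using s by (cases "s = 1") (auto intro!: add_pos_nonneg mult_nonneg_nonneg)
      ultimately show False using x by simp
    qed
    then have "invertible (?M s)"
      using matrix_left_invertible_ker[of "?M s"] invertible_left_inverse by blast
    then show ?thesis by (simp add: invertible_det_nz)
  qed
  have "continuous_on {0..1} (\<lambda>s. det (?M s))"
    unfolding det_def by (intro continuous_intros)
  moreover have "det (?M 0) = 1" "det (?M 1) \<le> 0"
    using neg by (auto simp: gram_def gram_matrix)
  ultimately obtain s where "0 \<le> s" "s \<le> 1" "det (?M s) = 0"
    using IVT2'[of "\<lambda>s. det (?M s)" 1 0 0] by auto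
  with nz show False by blast
qed

lemma continuous_on_gram:
  assumes "\<And>v. continuous_on S (\<lambda>x. A x v)"
  shows "continuous_on S (\<lambda>x. gram (A x))"
  unfolding gram_def det_def using assms by (auto intro!: continuous_intros)

lemma area_density_gram: "area_density X z = sqrt (gram (frechet_derivative X (at z)))"
  by (simp add: area_density_def gram_def)

section \<open>The surface measure in charts\<close>

text \<open>Smoothness is relaxed to class C1, which is all that the area formula needs and what is
  shown for charts carried along by the flow (\<open>flow_chart\<close>).\<close>

definition c1_param ::
  "('n::finite) ambient set \<Rightarrow> (real ^ 'n) set \<Rightarrow> (real ^ 'n \<Rightarrow> 'n ambient) \<Rightarrow> bool" where
  "c1_param S U X \<longleftrightarrow> c1 U X \<and> (\<forall>z\<in>U. inj (frechet_derivative X (at z))) \<and>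
     (\<exists>Y. homeomorphism U (X ` U) X Y) \<and> openin (top_of_set S) (X ` U)"

lemma local_param_imp_c1_param: "local_param S U X \<Longrightarrow> c1_param S U X"
  by (auto simp: local_param_def c1_param_def smooth_on_open_c1)

lemma c1_param_subset:
  assumes "c1_param S U X" "open V" "V \<subseteq> U"
  shows "c1_param S V X"
proof -
  obtain Y where Y: "homeomorphism U (X ` U) X Y"
    using assms by (auto simp: c1_param_def)
  have "openin (top_of_set U) V" using assms(2,3) open_subset by blast
  then have "openin (top_of_set S) (X ` V)"
    using homeomorphism_imp_open_map[OF Y] assms(1) openin_trans unfolding c1_param_def by blast
  moreover have "homeomorphism V (X ` V) X Y"
    using homeomorphism_of_subsets[OF Y assms(3)] assms(3) by (metis image_mono order_refl)
  ultimately show ?thesis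
    using assms by (auto simp: c1_param_def c1_subset)
qed

lemma c1_param_open: "c1_param S U X \<Longrightarrow> open U"
  by (auto simp: c1_param_def c1_open)

lemma c1_param_image: "c1_param S U X \<Longrightarrow> X ` U \<subseteq> S"
  by (auto simp: c1_param_def dest: openin_imp_subset)

lemma c1_param_inj_on: "c1_param S U X \<Longrightarrow> inj_on X U"
  unfolding c1_param_def homeomorphism_def by (meson inj_on_inverseI)

lemma c1_param_continuous: "c1_param S U X \<Longrightarrow> continuous_on U X"
  by (auto simp: c1_param_def c1_continuous_on)

lemma c1_param_gram_pos:
  "c1_param S U X \<Longrightarrow> z \<in> U \<Longrightarrow> gram (frechet_derivative X (at z)) > 0"
  using gram_pos c1_linear unfolding c1_param_def by blast

lemma c1_param_density_pos: "c1_param S U X \<Longrightarrow> z \<in> U \<Longrightarrow> area_density X z > 0"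
  by (simp add: area_density_gram c1_param_gram_pos)

lemma c1_param_density_continuous: "c1_param S U X \<Longrightarrow> continuous_on U (area_density X)"
  unfolding c1_param_def area_density_gram[abs_def]
  by (intro continuous_intros continuous_on_gram c1_continuous_deriv) auto

text \<open>The area of one chart image, as a measure on the whole ambient space. The indicator
  makes the chart a global Borel map; the density vanishes wherever the chart was altered.\<close>

definition chart_measure :: "(real ^ 'n) set \<Rightarrow> (real ^ 'n \<Rightarrow> ('n::finite) ambient) \<Rightarrow> 'n ambient measure" where
  "chart_measure U X = distr (density lborel (\<lambda>z. ennreal (indicator U z * area_density X z))) borel
     (\<lambda>z. indicator U z *\<^sub>R X z)"

lemma sets_chart_measure [simp, measurable_cong]: "sets (chart_measure U X) = sets borel"
  by (simp add: chart_measure_def)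

lemma c1_param_borel:
  assumes "c1_param S U X"
  shows "(\<lambda>z. indicator U z *\<^sub>R X z) \<in> borel_measurable borel"
    "(\<lambda>z. indicator U z * area_density X z) \<in> borel_measurable borel"
proof -
  have U: "U \<in> sets borel" using c1_param_open[OF assms] by simp
  show "(\<lambda>z. indicator U z *\<^sub>R X z) \<in> borel_measurable borel"
    by (rule borel_measurable_continuous_on_indicator[OF U c1_param_continuous[OF assms]])
  show "(\<lambda>z. indicator U z * area_density X z) \<in> borel_measurable borel"
    using borel_measurable_continuous_on_indicator[OF U c1_param_density_continuous[OF assms]] by simp
qed

lemma c1_param_preimage_borel:
  assumes X: "c1_param S U X" and A: "A \<in> sets borel"
  shows "{z \<in> U. X z \<in> A} \<in> sets borel"
proof -
  have U: "U \<in> sets borel" using c1_param_open[OF X] by simp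
  have "U \<inter> (\<lambda>z. indicator U z *\<^sub>R X z) -` A \<in> sets borel"
    using measurable_sets_borel[OF c1_param_borel(1)[OF X] A] U by blast
  also have "U \<inter> (\<lambda>z. indicator U z *\<^sub>R X z) -` A = {z \<in> U. X z \<in> A}" by auto
  finally show ?thesis .
qed

lemma nn_integral_chart_measure:
  assumes X: "c1_param S U X" and h: "h \<in> borel_measurable borel"
  shows "(\<integral>\<^sup>+x. h x \<partial>chart_measure U X) = (\<integral>\<^sup>+z\<in>U. ennreal (area_density X z) * h (X z) \<partial>lborel)"
proof -
  note [measurable] = c1_param_borel[OF X] h
  have "(\<integral>\<^sup>+x. h x \<partial>chart_measure U X) =
    (\<integral>\<^sup>+z. ennreal (indicator U z * area_density X z) * h (indicator U z *\<^sub>R X z) \<partial>lborel)"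
    unfolding chart_measure_def
    by (subst nn_integral_distr, simp, simp, subst nn_integral_density) auto
  also have "\<dots> = (\<integral>\<^sup>+z\<in>U. ennreal (area_density X z) * h (X z) \<partial>lborel)"
    by (intro nn_integral_cong) (auto simp: indicator_def)
  finally show ?thesis .
qed

lemma emeasure_chart_measure:
  assumes X: "c1_param S U X" and A: "A \<in> sets borel"
  shows "emeasure (chart_measure U X) A = (\<integral>\<^sup>+z\<in>{z\<in>U. X z \<in> A}. ennreal (area_density X z) \<partial>lborel)"
proof -
  have "emeasure (chart_measure U X) A = (\<integral>\<^sup>+x. indicator A x \<partial>chart_measure U X)"
    using A by (simp add: nn_integral_indicator)
  also have "\<dots> = (\<integral>\<^sup>+z\<in>{z\<in>U. X z \<in> A}. ennreal (area_density X z) \<partial>lborel)"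
    using A by (subst nn_integral_chart_measure[OF X]) (auto intro!: nn_integral_cong simp: indicator_def)
  finally show ?thesis .
qed

lemma c1_param_transition:
  assumes X: "c1_param S U X" and Y: "c1_param S V Y"
    and z: "z \<in> U" and XY: "X z \<in> Y ` V" and T: "homeomorphism V (Y ` V) Y Yi"
  shows "\<exists>D. ((\<lambda>z. Yi (X z)) has_derivative D) (at z) \<and>
    frechet_derivative X (at z) = frechet_derivative Y (at (Yi (X z))) \<circ> D"
proof -
  let ?T = "\<lambda>z. Yi (X z)" and ?O = "U \<inter> X -` (Y ` V)"
  have opS: "openin (top_of_set S) (Y ` V)" and c1: "c1 U X" "c1 V Y"
    using X Y by (auto simp: c1_param_def)
  have "openin (top_of_set U) ?O"
    using c1_param_continuous[OF X] c1_param_image[OF X] opS by (intro continuous_openin_preimage) auto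
  then have O: "open ?O" using c1_param_open[OF X] openin_open_trans by blast
  have "continuous_on ?O ?T"
    using c1_param_continuous[OF X] T
    by (auto intro!: continuous_on_compose2[of "Y ` V" Yi] intro: continuous_on_subset simp: homeomorphism_def)
  then have contT: "isCont ?T z" using O z XY by (simp add: continuous_on_eq_continuous_at)
  have TzV: "?T z \<in> V" using T XY by (auto simp: homeomorphism_def)
  have inj: "inj (frechet_derivative Y (at (?T z)))" using Y TzV by (auto simp: c1_param_def)
  obtain \<eta> c where \<eta>: "\<eta> > 0" "c > 0"
    "\<And>x y. x \<in> ball (?T z) \<eta> \<Longrightarrow> y \<in> ball (?T z) \<eta> \<Longrightarrow> c * norm (x - y) \<le> norm (Y x - Y y)"
    using c1_locally_bilipschitz[OF c1(2) TzV inj] by metis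
  show ?thesis
  proof (rule transition_derivative[OF c1_has_derivative[OF c1(1) z] c1_has_derivative[OF c1(2) TzV] contT _ \<eta>(2)])
    have "\<forall>\<^sub>F y in nhds z. y \<in> ?O" using O z XY by (intro eventually_nhds_in_open) auto
    then show "\<forall>\<^sub>F y in nhds z. Y (Yi (X y)) = X y"
      by eventually_elim (use T in \<open>auto simp: homeomorphism_def\<close>)
    have "\<forall>\<^sub>F w in nhds (?T z). w \<in> ball (?T z) \<eta>"
      using \<eta> by (intro eventually_nhds_in_open) auto
    then show "\<forall>\<^sub>F w in nhds (?T z). c * norm (w - ?T z) \<le> norm (Y w - Y (?T z))"
      by eventually_elim (use \<eta> in auto)
  qed
qed

text \<open>Area does not depend on the chart: the change of variables by the transition map
  produces its Jacobian, and by \<open>gram_compose\<close> the quotient of the two area densities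
  is exactly this Jacobian.\<close>

lemma chart_measure_eq:
  assumes X: "c1_param S U X" and Y: "c1_param S V Y"
    and A: "A \<in> sets borel" "A \<subseteq> X ` U" "A \<subseteq> Y ` V"
  shows "emeasure (chart_measure U X) A = emeasure (chart_measure V Y) A"
proof -
  obtain Xi Yi where Xi: "homeomorphism U (X ` U) X Xi" and Yi: "homeomorphism V (Y ` V) Y Yi"
    using X Y by (auto simp: c1_param_def)
  have XXi: "\<And>z. z \<in> U \<Longrightarrow> Xi (X z) = z" "\<And>x. x \<in> X ` U \<Longrightarrow> X (Xi x) = x \<and> Xi x \<in> U"
    and YYi: "\<And>z. z \<in> V \<Longrightarrow> Yi (Y z) = z" "\<And>x. x \<in> Y ` V \<Longrightarrow> Y (Yi x) = x \<and> Yi x \<in> V"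
    using Xi Yi by (auto simp: homeomorphism_def)
  have c1: "c1 U X" "c1 V Y" using X Y by (auto simp: c1_param_def)
  define T where "T = (\<lambda>z. Yi (X z))"
  define W where "W = {z \<in> U. X z \<in> Y ` V}"
  have openpre: "open {z \<in> U. X z \<in> Y ` V}"
    if "c1_param S U X" "c1_param S V Y" for U V and X Y :: "real^'a \<Rightarrow> 'a ambient"
  proof -
    have op: "openin (top_of_set S) (Y ` V)" using that(2) by (simp add: c1_param_def)
    have "openin (top_of_set U) (U \<inter> X -` (Y ` V))"
      by (rule continuous_openin_preimage[OF c1_param_continuous[OF that(1)] _ op])
        (use c1_param_image[OF that(1)] in auto)
    then have "open (U \<inter> X -` (Y ` V))" using c1_param_open[OF that(1)] openin_open_trans by blast
    then show ?thesis by (simp add: Int_def vimage_def)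
  qed
  have W: "open W" unfolding W_def by (rule openpre[OF X Y])
  have W': "open {w \<in> V. Y w \<in> X ` U}" by (rule openpre[OF Y X])
  have contT: "continuous_on W T"
    unfolding T_def using c1_param_continuous[OF X] Yi
    by (auto intro!: continuous_on_compose2[of "Y ` V" Yi] intro: continuous_on_subset simp: homeomorphism_def W_def)
  have TV: "T z \<in> V" "Y (T z) = X z" if "z \<in> W" for z
    using that YYi by (auto simp: T_def W_def)
  have Timg: "T ` B = {w \<in> V. Y w \<in> X ` U \<and> Xi (Y w) \<in> B}" if "B \<subseteq> W" for B
  proof (intro equalityI subsetI)
    fix w assume "w \<in> T ` B"
    then obtain z where z: "z \<in> B" "w = T z" by blast
    then have "z \<in> W" "z \<in> U" using that by (auto simp: W_def)
    then show "w \<in> {w \<in> V. Y w \<in> X ` U \<and> Xi (Y w) \<in> B}"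
      using z TV[of z] XXi(1)[of z] by simp
  next
    fix w assume w: "w \<in> {w \<in> V. Y w \<in> X ` U \<and> Xi (Y w) \<in> B}"
    then have "X (Xi (Y w)) = Y w" using XXi(2) by blast
    then have "T (Xi (Y w)) = w" using w YYi(1)[of w] by (simp add: T_def)
    then show "w \<in> T ` B" using w by (metis (no_types, lifting) image_eqI mem_Collect_eq)
  qed
  have "\<forall>z\<in>W. \<exists>D. (T has_derivative D) (at z) \<and>
      frechet_derivative X (at z) = frechet_derivative Y (at (T z)) \<circ> D"
    using c1_param_transition[OF X Y _ _ Yi] unfolding T_def W_def by auto
  then obtain D where D: "\<And>z. z \<in> W \<Longrightarrow> (T has_derivative D z) (at z)"
    "\<And>z. z \<in> W \<Longrightarrow> frechet_derivative X (at z) = frechet_derivative Y (at (T z)) \<circ> D z"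
    by metis
  have dens: "area_density X z = \<bar>det (matrix (D z))\<bar> * area_density Y (T z)" if z: "z \<in> W" for z
    using gram_compose[OF c1_linear[OF c1(2) TV(1)[OF z]] has_derivative_linear[OF D(1)[OF z]]]
    by (simp add: area_density_gram D(2)[OF z] real_sqrt_mult)
  \<comment> \<open>The Jacobian of the transition map, written as a quotient of continuous
    densities; in this form it is visibly Borel.\<close>
  define d where "d = (\<lambda>z. indicator W z *\<^sub>R (area_density X z / area_density Y (T z)))"
  have d: "d z = \<bar>det (matrix (D z))\<bar>" if "z \<in> W" for z
    using dens[OF that] c1_param_density_pos[OF Y TV(1)[OF that]] that by (simp add: d_def)
  have dm: "d \<in> borel_measurable borel"
    unfolding d_def
  proof (rule borel_measurable_continuous_on_indicator)
    have "continuous_on W (area_density X)"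
      using c1_param_density_continuous[OF X] by (rule continuous_on_subset) (auto simp: W_def)
    moreover have "continuous_on W (\<lambda>z. area_density Y (T z))"
      by (rule continuous_on_compose2[OF c1_param_density_continuous[OF Y] contT]) (use TV in auto)
    ultimately show "continuous_on W (\<lambda>z. area_density X z / area_density Y (T z))"
      using c1_param_density_pos[OF Y TV(1)] by (intro continuous_intros) (auto, metis less_irrefl)
  qed (use W in simp)
  define B where "B = {z \<in> U. X z \<in> A}"
  have B: "B \<in> sets borel" "B \<subseteq> W"
    using c1_param_preimage_borel[OF X A(1)] A by (auto simp: B_def W_def)
  have "{w \<in> V. Y w \<in> A} = T ` B"
    using A XXi by (subst Timg[OF B(2)]) (auto simp: B_def)
  moreover have "(\<integral>\<^sup>+y\<in>T ` B. ennreal (indicator V y * area_density Y y) \<partial>lborel) =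
      (\<integral>\<^sup>+x\<in>B. ennreal (d x) * ennreal (indicator V (T x) * area_density Y (T x)) \<partial>lborel)"
  proof (rule nn_integral_image[where f' = D])
    fix E assume E: "E \<in> sets borel" "E \<subseteq> B"
    have cont: "continuous_on {w \<in> V. Y w \<in> X ` U} (\<lambda>w. Xi (Y w))"
      using c1_param_continuous[OF Y] Xi
      by (auto intro!: continuous_on_compose2[of "X ` U" Xi] intro: continuous_on_subset simp: homeomorphism_def)
    have "T ` E = {w \<in> V. Y w \<in> X ` U} \<inter> (\<lambda>w. indicator {w \<in> V. Y w \<in> X ` U} w *\<^sub>R Xi (Y w)) -` E"
      using E B(2) by (subst Timg) auto
    also have "\<dots> \<in> sets borel"
      by (intro sets.Int borel_open[OF W']
          measurable_sets_borel[OF borel_measurable_continuous_on_indicator[OF borel_open[OF W'] cont] E(1)])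
    finally show "T ` E \<in> sets borel" .
  next
    have "(\<lambda>x. indicator B x *\<^sub>R (indicator W x *\<^sub>R T x)) \<in> borel_measurable borel"
      using borel_measurable_continuous_on_indicator[OF _ contT] W B by measurable
    also have "(\<lambda>x. indicator B x *\<^sub>R (indicator W x *\<^sub>R T x)) = (\<lambda>x. indicator B x *\<^sub>R T x)"
      using B by (auto simp: fun_eq_iff indicator_def)
    finally show "(\<lambda>x. indicator B x *\<^sub>R T x) \<in> borel_measurable borel" .
  next
    show "inj_on T B"
      using B(2) XXi TV by (intro inj_onI) (metis (no_types, lifting) W_def in_mono mem_Collect_eq)
    show "(\<lambda>y. ennreal (indicator V y * area_density Y y)) \<in> borel_measurable borel"
      using c1_param_borel(2)[OF Y] by measurable
  qed (use B D d dm in auto)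
  moreover have "(\<integral>\<^sup>+y\<in>T ` B. ennreal (indicator V y * area_density Y y) \<partial>lborel) =
      (\<integral>\<^sup>+y\<in>T ` B. ennreal (area_density Y y) \<partial>lborel)"
    using B TV by (intro nn_integral_cong) (auto simp: indicator_def)
  moreover have "(\<integral>\<^sup>+x\<in>B. ennreal (d x) * ennreal (indicator V (T x) * area_density Y (T x)) \<partial>lborel) =
      (\<integral>\<^sup>+x\<in>B. ennreal (area_density X x) \<partial>lborel)"
  proof (intro nn_integral_cong)
    fix x
    have "x \<in> B \<Longrightarrow> ennreal (d x) * ennreal (indicator V (T x) * area_density Y (T x)) = ennreal (area_density X x)"
      using B TV[of x] d[of x] dens[of x]
      by (subst ennreal_mult[symmetric]) (auto simp: indicator_def area_density_gram c1_param_gram_pos[OF Y] less_imp_le)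
    then show "ennreal (d x) * ennreal (indicator V (T x) * area_density Y (T x)) * indicator B x
        = ennreal (area_density X x) * indicator B x"
      by (auto simp: indicator_def)
  qed
  ultimately show ?thesis
    by (simp add: emeasure_chart_measure[OF X A(1)] emeasure_chart_measure[OF Y A(1)] B_def)
qed

section \<open>Finite atlases and the gluing of the chart measures\<close>

locale atlas =
  fixes S :: "('n::finite) ambient set" and N :: nat
    and X :: "nat \<Rightarrow> real ^ 'n \<Rightarrow> 'n ambient" and c :: "nat \<Rightarrow> real ^ 'n" and r :: "nat \<Rightarrow> real"
  assumes compact: "compact S"
    and r_pos: "\<And>i. i < N \<Longrightarrow> r i > 0"
    and chart: "\<And>i. i < N \<Longrightarrow> \<exists>U. cball (c i) (r i) \<subseteq> U \<and> local_param S U (X i)"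
    and bilip: "\<And>i. i < N \<Longrightarrow> \<exists>k>0. \<exists>L. \<forall>a\<in>cball (c i) (r i). \<forall>b\<in>cball (c i) (r i).
        k * norm (a - b) \<le> norm (X i a - X i b) \<and> norm (X i a - X i b) \<le> L * norm (a - b)"
    and cover: "S \<subseteq> (\<Union>i<N. X i ` ball (c i) (r i / 2))"

text \<open>Already the balls of half radius have images covering \<open>S\<close>. So each point
  has a parameter around which a ball of radius \<open>r i / 2\<close> lies in the chart domain;
  this room gives the uniform lower bound for the area of small balls in
  \<open>surface_measure_ball\<close>.\<close>

lemma closed_hypersurface_atlas:
  fixes S :: "('n::finite) ambient set"
  assumes "closed_hypersurface S"
  obtains N X c r where "atlas S N X c r"
proof -
  have S: "compact S" using assms by (simp add: closed_hypersurface_def)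
  have "\<exists>X c r. p \<in> X ` ball c (r / 2) \<and> r > 0 \<and> (\<exists>U. cball c r \<subseteq> U \<and> local_param S U X) \<and>
      (\<exists>k>0. \<exists>L. \<forall>a\<in>cball c r. \<forall>b\<in>cball c r.
        k * norm (a - b) \<le> norm (X a - X b) \<and> norm (X a - X b) \<le> L * norm (a - b))" if p: "p \<in> S" for p
  proof -
    obtain U X where X: "local_param S U X" "p \<in> X ` U"
      using assms p by (auto simp: closed_hypersurface_def)
    then obtain c where c: "c \<in> U" "p = X c" by blast
    have cU: "c1 U X" "inj (frechet_derivative X (at c))"
      using local_param_imp_c1_param[OF X(1)] c by (auto simp: c1_param_def)
    obtain \<eta> k where 1: "\<eta> > 0" "k > 0" "ball c \<eta> \<subseteq> U"
      "\<And>x y. x \<in> ball c \<eta> \<Longrightarrow> y \<in> ball c \<eta> \<Longrightarrow> k * norm (x - y) \<le> norm (X x - X y)"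
      using c1_locally_bilipschitz[OF cU(1) c(1) cU(2)] by blast
    obtain \<eta>' L where 2: "\<eta>' > 0" "L > 0" "ball c \<eta>' \<subseteq> U"
      "\<And>x y. x \<in> ball c \<eta>' \<Longrightarrow> y \<in> ball c \<eta>' \<Longrightarrow> norm (X x - X y) \<le> L * norm (x - y)"
      using c1_locally_lipschitz[OF cU(1) c(1)] by blast
    define r where "r = min \<eta> \<eta>' / 2"
    have r: "r > 0" "cball c r \<subseteq> ball c \<eta>" "cball c r \<subseteq> ball c \<eta>'"
      using 1 2 by (auto simp: r_def min_def)
    have "p \<in> X ` ball c (r / 2)" using c r by auto
    moreover have "\<exists>U. cball c r \<subseteq> U \<and> local_param S U X" using r 1 X by blast
    moreover have "\<forall>a\<in>cball c r. \<forall>b\<in>cball c r.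
        k * norm (a - b) \<le> norm (X a - X b) \<and> norm (X a - X b) \<le> L * norm (a - b)"
      using r 1 2 by (meson subsetD)
    ultimately show ?thesis using r(1) 1(2) by blast
  qed
  then obtain X c r where *: "\<And>p. p \<in> S \<Longrightarrow> p \<in> X p ` ball (c p) (r p / 2) \<and> r p > 0 \<and>
      (\<exists>U. cball (c p) (r p) \<subseteq> U \<and> local_param S U (X p)) \<and>
      (\<exists>k>0. \<exists>L. \<forall>a\<in>cball (c p) (r p). \<forall>b\<in>cball (c p) (r p).
        k * norm (a - b) \<le> norm (X p a - X p b) \<and> norm (X p a - X p b) \<le> L * norm (a - b))"
    by metis
  have op: "openin (top_of_set S) (X p ` ball (c p) (r p / 2))" if p: "p \<in> S" for p
  proof -
    obtain U where U: "cball (c p) (r p) \<subseteq> U" "local_param S U (X p)" using *[OF p] by blast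
    have "ball (c p) (r p / 2) \<subseteq> U" using U(1) *[OF p] by (auto simp: subset_iff)
    then have "c1_param S (ball (c p) (r p / 2)) (X p)"
      using c1_param_subset[OF local_param_imp_c1_param[OF U(2)]] by blast
    then show ?thesis by (simp add: c1_param_def)
  qed
  then have "\<exists>O'. open O' \<and> X p ` ball (c p) (r p / 2) = S \<inter> O'" if "p \<in> S" for p
    using that by (auto simp: openin_open)
  then obtain O' where O': "\<And>p. p \<in> S \<Longrightarrow> open (O' p) \<and> X p ` ball (c p) (r p / 2) = S \<inter> O' p"
    by metis
  obtain F where F: "F \<subseteq> S" "finite F" "S \<subseteq> (\<Union>p\<in>F. O' p)"
    using compactE_image[OF S, of S O'] O' * by (metis IntE UN_I subsetI)
  obtain h where h: "bij_betw h {..<card F} F"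
    using ex_bij_betw_nat_finite[OF F(2)] by (metis atLeast0LessThan)
  have hS: "h i \<in> S" if "i < card F" for i using h F that by (auto simp: bij_betw_def)
  have "atlas S (card F) (X \<circ> h) (c \<circ> h) (r \<circ> h)"
  proof
    show "S \<subseteq> (\<Union>i<card F. (X \<circ> h) i ` ball ((c \<circ> h) i) ((r \<circ> h) i / 2))"
    proof
      fix x assume x: "x \<in> S"
      then obtain p where p: "p \<in> F" "x \<in> O' p" using F by blast
      then obtain i where i: "i < card F" "p = h i" using h by (auto simp: bij_betw_def)
      have "x \<in> X p ` ball (c p) (r p / 2)" using O'[of p] p F x by blast
      then show "x \<in> (\<Union>i<card F. (X \<circ> h) i ` ball ((c \<circ> h) i) ((r \<circ> h) i / 2))" using i by auto
    qed
    show "\<exists>U. cball ((c \<circ> h) i) ((r \<circ> h) i) \<subseteq> U \<and> local_param S U ((X \<circ> h) i)" if "i < card F" for i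
      using *[OF hS[OF that]] unfolding o_def by blast
    show "\<exists>k>0. \<exists>L. \<forall>a\<in>cball ((c \<circ> h) i) ((r \<circ> h) i). \<forall>b\<in>cball ((c \<circ> h) i) ((r \<circ> h) i).
        k * norm (a - b) \<le> norm ((X \<circ> h) i a - (X \<circ> h) i b) \<and>
        norm ((X \<circ> h) i a - (X \<circ> h) i b) \<le> L * norm (a - b)" if "i < card F" for i
      using *[OF hS[OF that]] unfolding o_def by blast
    show "(r \<circ> h) i > 0" if "i < card F" for i
      using *[OF hS[OF that]] by simp
  qed (rule S)
  then show thesis by (rule that)
qed

context atlas
begin

abbreviation "B i \<equiv> ball (c i) (r i)"

lemma c1_chart:
  assumes "i < N"
  shows "c1_param S (B i) (X i)"
proof -
  obtain U where U: "cball (c i) (r i) \<subseteq> U" "local_param S U (X i)" using chart[OF assms] by blast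
  then have "B i \<subseteq> U" by auto
  then show ?thesis using c1_param_subset[OF local_param_imp_c1_param[OF U(2)]] by blast
qed

text \<open>Chart images made disjoint: areas and Jacobians can then be defined piece by piece and
  added, without a partition of unity.\<close>

definition piece :: "nat \<Rightarrow> 'n ambient set" where
  "piece i = X i ` B i - (\<Union>j<i. X j ` B j)"

lemma S_borel: "S \<in> sets borel"
  by (intro borel_closed compact_imp_closed compact)

lemma image_borel:
  assumes "c1_param S U Y"
  shows "Y ` U \<in> sets borel"
proof -
  obtain O' where "open O'" "Y ` U = S \<inter> O'"
    using assms by (auto simp: c1_param_def openin_open)
  then show ?thesis using S_borel by auto
qed

lemma piece_borel: "i < N \<Longrightarrow> piece i \<in> sets borel"
  unfolding piece_def using image_borel[OF c1_chart] by (intro sets.Diff sets.finite_UN) auto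

lemma piece_image: "piece i \<subseteq> X i ` B i" by (auto simp: piece_def)

lemma piece_subset: "i < N \<Longrightarrow> piece i \<subseteq> S"
  using piece_image c1_param_image[OF c1_chart] by blast

lemma piece_disjoint: "disjoint_family_on piece {..<N}"
  unfolding disjoint_family_on_def piece_def
proof (intro ballI impI)
  fix m n :: nat assume "m \<noteq> n"
  then have "m < n \<or> n < m" by linarith
  then show "(X m ` B m - (\<Union>j<m. X j ` B j)) \<inter> (X n ` B n - (\<Union>j<n. X j ` B j)) = {}"
    by blast
qed

lemma piece_cover: "S = (\<Union>i<N. piece i)"
proof
  show "S \<subseteq> (\<Union>i<N. piece i)"
  proof
    fix x assume "x \<in> S"
    then obtain i where "i < N" "x \<in> X i ` ball (c i) (r i / 2)" using cover by blast
    then have i: "i < N \<and> x \<in> X i ` B i" using r_pos[of i] by auto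
    define k where "k = (LEAST i. i < N \<and> x \<in> X i ` B i)"
    have "k < N \<and> x \<in> X k ` B k" unfolding k_def by (rule LeastI, rule i)
    moreover have "\<not> (j < N \<and> x \<in> X j ` B j)" if "j < k" for j
      using not_less_Least that unfolding k_def by blast
    ultimately show "x \<in> (\<Union>i<N. piece i)" by (force simp: piece_def)
  qed
qed (use piece_subset in auto)

lemma emeasure_pieces:
  assumes "sets \<mu> = sets borel \<or> sets \<mu> = sets (restrict_space borel S)" "A \<in> sets borel" "A \<subseteq> S"
  shows "emeasure \<mu> A = (\<Sum>i<N. emeasure \<mu> (A \<inter> piece i))"
proof -
  have "A = (\<Union>i<N. A \<inter> piece i)" using piece_cover assms(3) by blast
  moreover have "A \<inter> piece i \<in> sets \<mu>" if "i < N" for i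
    using assms piece_borel[OF that] piece_subset[OF that] S_borel
    by (auto simp: sets_restrict_space_iff)
  then have "(\<Sum>i<N. emeasure \<mu> (A \<inter> piece i)) = emeasure \<mu> (\<Union>i<N. A \<inter> piece i)"
    using piece_disjoint by (intro sum_emeasure) (auto simp: disjoint_family_on_def)
  ultimately show ?thesis by simp
qed

definition area :: "'n ambient measure" where
  "area = measure_of UNIV (sets borel) (\<lambda>A. \<Sum>i<N. emeasure (chart_measure (B i) (X i)) (A \<inter> piece i))"

lemma sets_area: "sets area = sets borel"
  unfolding area_def using sets.sigma_sets_eq[of borel] by (simp add: sets_measure_of_conv)

lemma emeasure_area:
  assumes "A \<in> sets borel"
  shows "emeasure area A = (\<Sum>i<N. emeasure (chart_measure (B i) (X i)) (A \<inter> piece i))"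
proof (rule emeasure_measure_of[OF area_def])
  show "A \<in> sets area" using assms by (simp add: sets_area)
  show "countably_additive (sets area) (\<lambda>A. \<Sum>i<N. emeasure (chart_measure (B i) (X i)) (A \<inter> piece i))"
  proof (rule countably_additiveI)
    fix A :: "nat \<Rightarrow> 'n ambient set"
    assume A: "range A \<subseteq> sets area" "disjoint_family A"
    have "(\<Sum>n. \<Sum>i<N. emeasure (chart_measure (B i) (X i)) (A n \<inter> piece i)) =
      (\<Sum>i<N. \<Sum>n. emeasure (chart_measure (B i) (X i)) (A n \<inter> piece i))"
      by (rule suminf_sum) simp
    also have "\<dots> = (\<Sum>i<N. emeasure (chart_measure (B i) (X i)) (\<Union>(range A) \<inter> piece i))"
    proof (rule sum.cong[OF refl])
      fix i assume i: "i \<in> {..<N}"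
      have "(\<Sum>n. emeasure (chart_measure (B i) (X i)) (A n \<inter> piece i)) =
        emeasure (chart_measure (B i) (X i)) (\<Union>n. A n \<inter> piece i)"
        using A piece_borel i by (intro suminf_emeasure) (auto simp: sets_area disjoint_family_on_def)
      then show "(\<Sum>n. emeasure (chart_measure (B i) (X i)) (A n \<inter> piece i)) =
        emeasure (chart_measure (B i) (X i)) (\<Union>(range A) \<inter> piece i)" by simp
    qed
    finally show "(\<Sum>n. \<Sum>i<N. emeasure (chart_measure (B i) (X i)) (A n \<inter> piece i)) =
      (\<Sum>i<N. emeasure (chart_measure (B i) (X i)) (\<Union>(range A) \<inter> piece i))" .
  qed
qed (auto simp: positive_def)

text \<open>On each piece the chart of the atlas may be exchanged for \<open>Y\<close> by
  \<open>chart_measure_eq\<close>; hence the glued measure has the right value in every chart, not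
  only in those of the atlas.\<close>

lemma emeasure_area_chart:
  assumes Y: "c1_param S U Y" and A: "A \<in> sets borel" "A \<subseteq> Y ` U"
  shows "emeasure area A = emeasure (chart_measure U Y) A"
proof -
  have "emeasure area A = (\<Sum>i<N. emeasure (chart_measure (B i) (X i)) (A \<inter> piece i))"
    by (rule emeasure_area[OF A(1)])
  also have "\<dots> = (\<Sum>i<N. emeasure (chart_measure U Y) (A \<inter> piece i))"
  proof (rule sum.cong[OF refl])
    fix i assume "i \<in> {..<N}"
    then have i: "i < N" by simp
    show "emeasure (chart_measure (B i) (X i)) (A \<inter> piece i) = emeasure (chart_measure U Y) (A \<inter> piece i)"
      using piece_image[of i] A piece_borel[OF i] by (intro chart_measure_eq[OF c1_chart[OF i] Y]) auto
  qed
  also have "\<dots> = emeasure (chart_measure U Y) A"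
    using A c1_param_image[OF Y] by (intro emeasure_pieces[symmetric]) auto
  finally show ?thesis .
qed

text \<open>Resolves the definite description. \<open>area\<close> has the required values by
  \<open>emeasure_area_chart\<close>; any other candidate agrees with it because a Borel set splits
  into pieces that each lie in one chart.\<close>

lemma surface_measure_area: "surface_measure S = restrict_space area S"
  unfolding surface_measure_def
proof (rule the_equality)
  have sets: "sets (restrict_space area S) = sets (restrict_space borel S)"
    by (rule sets_restrict_space_cong[OF sets_area])
  have image: "X ` B \<in> sets borel" "{z \<in> U. X z \<in> X ` B} = B"
    if asm: "c1_param S U X" "B \<in> sets borel" "B \<subseteq> U" for U and X :: "real^'n \<Rightarrow> 'n ambient" and B
  proof -
    obtain Xi where Xi: "homeomorphism U (X ` U) X Xi" using asm(1) by (auto simp: c1_param_def)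
    then have c: "continuous_on (X ` U) Xi" and inv: "\<And>z. z \<in> U \<Longrightarrow> Xi (X z) = z"
      by (auto simp: homeomorphism_def)
    have XU: "X ` U \<in> sets borel" by (rule image_borel[OF asm(1)])
    have "X ` B = X ` U \<inter> (\<lambda>x. indicator (X ` U) x *\<^sub>R Xi x) -` B"
      using asm(3) by (auto simp: inv subset_iff)
    also have "\<dots> \<in> sets borel"
      by (intro sets.Int XU measurable_sets_borel[OF borel_measurable_continuous_on_indicator[OF XU c] asm(2)])
    finally show "X ` B \<in> sets borel" .
    show "{z \<in> U. X z \<in> X ` B} = B" 
      using inj_on_image_mem_iff[OF c1_param_inj_on[OF asm(1)] _ asm(3)] asm(3) by auto
  qed
  show "sets (restrict_space area S) = sets (restrict_space borel S) \<and>
    (\<forall>U X B. local_param S U X \<and> B \<in> sets borel \<and> B \<subseteq> U \<longrightarrow>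
      emeasure (restrict_space area S) (X ` B) = (\<integral>\<^sup>+z\<in>B. ennreal (area_density X z) \<partial>lborel))"
  proof (intro conjI allI impI sets, elim conjE)
    fix U X B assume X: "local_param S U X" and B: "B \<in> sets borel" "B \<subseteq> U"
    note X' = local_param_imp_c1_param[OF X]
    have "emeasure (restrict_space area S) (X ` B) = emeasure area (X ` B)"
      using S_borel c1_param_image[OF X'] B by (intro emeasure_restrict_space) (auto simp: sets_area)
    also have "\<dots> = emeasure (chart_measure U X) (X ` B)"
      using image[OF X' B] B by (intro emeasure_area_chart[OF X']) auto
    also have "\<dots> = (\<integral>\<^sup>+z\<in>B. ennreal (area_density X z) \<partial>lborel)"
      using image[OF X' B] by (simp add: emeasure_chart_measure[OF X'])
    finally show "emeasure (restrict_space area S) (X ` B) = (\<integral>\<^sup>+z\<in>B. ennreal (area_density X z) \<partial>lborel)" .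
  qed
  fix \<mu> assume \<mu>: "sets \<mu> = sets (restrict_space borel S) \<and>
    (\<forall>U X B. local_param S U X \<and> B \<in> sets borel \<and> B \<subseteq> U \<longrightarrow>
      emeasure \<mu> (X ` B) = (\<integral>\<^sup>+z\<in>B. ennreal (area_density X z) \<partial>lborel))"
  show "\<mu> = restrict_space area S"
  proof (rule measure_eqI)
    show "sets \<mu> = sets (restrict_space area S)" using \<mu> sets by simp
    fix A assume "A \<in> sets \<mu>"
    then have A: "A \<in> sets borel" "A \<subseteq> S" using \<mu> S_borel by (auto simp: sets_restrict_space_iff)
    have "emeasure \<mu> A = (\<Sum>i<N. emeasure \<mu> (A \<inter> piece i))"
      using \<mu> A by (intro emeasure_pieces) auto
    also have "\<dots> = (\<Sum>i<N. emeasure (chart_measure (B i) (X i)) (A \<inter> piece i))"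
    proof (rule sum.cong[OF refl])
      fix i assume "i \<in> {..<N}"
      then have i: "i < N" by simp
      obtain U where U: "cball (c i) (r i) \<subseteq> U" "local_param S U (X i)" using chart[OF i] by blast
      let ?D = "{z \<in> B i. X i z \<in> A \<inter> piece i}"
      have AD: "A \<inter> piece i = X i ` ?D" using piece_image[of i] by auto
      have Db: "?D \<in> sets borel"
        by (rule c1_param_preimage_borel[OF c1_chart[OF i]]) (use A piece_borel[OF i] in auto)
      have DU: "?D \<subseteq> U" using U(1) by auto
      have "emeasure \<mu> (X i ` ?D) = (\<integral>\<^sup>+z\<in>?D. ennreal (area_density (X i) z) \<partial>lborel)"
        using \<mu> U(2) Db DU by blast
      then show "emeasure \<mu> (A \<inter> piece i) = emeasure (chart_measure (B i) (X i)) (A \<inter> piece i)"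
        using A piece_borel[OF i] unfolding AD[symmetric]
        by (subst emeasure_chart_measure[OF c1_chart[OF i]]) auto
    qed
    also have "\<dots> = emeasure area A" by (rule emeasure_area[OF A(1), symmetric])
    also have "\<dots> = emeasure (restrict_space area S) A"
      using S_borel A by (intro emeasure_restrict_space[symmetric]) (auto simp: sets_area)
    finally show "emeasure \<mu> A = emeasure (restrict_space area S) A" .
  qed
qed

end

lemma sets_surface_measure:
  assumes "closed_hypersurface S"
  shows "sets (surface_measure S) = sets (restrict_space borel S)"
proof -
  obtain N X c r where "atlas S N X c r" using closed_hypersurface_atlas[OF assms] .
  then interpret atlas S N X c r .
  show ?thesis unfolding surface_measure_area by (rule sets_restrict_space_cong[OF sets_area])
qed

lemma space_surface_measure:
  "closed_hypersurface S \<Longrightarrow> space (surface_measure S) = S"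
  using sets_eq_imp_space_eq[OF sets_surface_measure] by (simp add: space_restrict_space)

lemma emeasure_surface_measure:
  assumes S: "closed_hypersurface S" and Y: "c1_param S U Y" and A: "A \<in> sets borel" "A \<subseteq> Y ` U"
  shows "emeasure (surface_measure S) A = emeasure (chart_measure U Y) A"
proof -
  obtain N X c r where "atlas S N X c r" using closed_hypersurface_atlas[OF S] .
  then interpret atlas S N X c r .
  have "emeasure (surface_measure S) A = emeasure area A"
    unfolding surface_measure_area using S_borel A c1_param_image[OF Y]
    by (intro emeasure_restrict_space) (auto simp: sets_area)
  then show ?thesis using emeasure_area_chart[OF Y A] by simp
qed

section \<open>Small balls and the tangential gradient\<close>

lemma finite_uniform_lower:
  fixes P :: "nat \<Rightarrow> real \<Rightarrow> bool"
  assumes "\<And>i. i < N \<Longrightarrow> \<exists>k>0. P i k" "\<And>i k k'. P i k \<Longrightarrow> 0 < k' \<Longrightarrow> k' \<le> k \<Longrightarrow> P i k'"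
  shows "\<exists>k>0. \<forall>i<N. P i k"
proof -
  obtain f where f: "\<And>i. i < N \<Longrightarrow> f i > 0 \<and> P i (f i)" using assms(1) by metis
  \<comment> \<open>The additional 1 keeps the minimum defined and positive when
    \<open>N = 0\<close>.\<close>
  let ?k = "Min (insert 1 (f ` {..<N}))"
  have pos: "?k > 0" using f by simp
  have "P i ?k" if i: "i < N" for i
  proof -
    have "?k \<le> f i" using i by (intro Min_le) auto
    then show ?thesis using assms(2) f[OF i] pos by blast
  qed
  then show ?thesis using pos by blast
qed

lemma finite_uniform_upper:
  fixes P :: "nat \<Rightarrow> real \<Rightarrow> bool"
  assumes "\<And>i. i < N \<Longrightarrow> \<exists>k. P i k" "\<And>i k k'. P i k \<Longrightarrow> k \<le> k' \<Longrightarrow> P i k'"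
  shows "\<exists>k>0. \<forall>i<N. P i k"
proof -
  obtain f where f: "\<And>i. i < N \<Longrightarrow> P i (f i)" using assms(1) by metis
  let ?k = "Max (insert 1 (f ` {..<N}))"
  have pos: "?k > 0" by (rule less_le_trans[OF zero_less_one]) (auto intro: Max_ge)
  have "P i ?k" if i: "i < N" for i
  proof -
    have "f i \<le> ?k" using i by (intro Max_ge) auto
    then show ?thesis using assms(2) f[OF i] by blast
  qed
  then show ?thesis using pos by blast
qed

lemma continuous_compact_bounds:
  fixes f :: "'a::topological_space \<Rightarrow> real"
  assumes "compact K" "continuous_on K f" "\<And>x. x \<in> K \<Longrightarrow> f x > 0"
  shows "\<exists>m>0. \<forall>x\<in>K. m \<le> f x" "\<exists>M. \<forall>x\<in>K. f x \<le> M"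
proof -
  show "\<exists>m>0. \<forall>x\<in>K. m \<le> f x"
    using continuous_attains_inf[of K f] assms by (cases "K = {}") (auto intro: exI[of _ 1])
  show "\<exists>M. \<forall>x\<in>K. f x \<le> M"
    using continuous_attains_sup[of K f] assms by (cases "K = {}") auto
qed

context atlas
begin

lemma bilip_uniform:
  obtains k L where "k > 0" "L > 0"
    "\<And>i a b. i < N \<Longrightarrow> a \<in> cball (c i) (r i) \<Longrightarrow> b \<in> cball (c i) (r i) \<Longrightarrow> k * norm (a - b) \<le> norm (X i a - X i b)"
    "\<And>i a b. i < N \<Longrightarrow> a \<in> cball (c i) (r i) \<Longrightarrow> b \<in> cball (c i) (r i) \<Longrightarrow> norm (X i a - X i b) \<le> L * norm (a - b)"
proof -
  have "\<exists>k>0. \<forall>i<N. \<forall>a\<in>cball (c i) (r i). \<forall>b\<in>cball (c i) (r i). k * norm (a - b) \<le> norm (X i a - X i b)"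
  proof (rule finite_uniform_lower[of N "\<lambda>i k. \<forall>a\<in>cball (c i) (r i). \<forall>b\<in>cball (c i) (r i). k * norm (a - b) \<le> norm (X i a - X i b)"])
    show "\<exists>k>0. \<forall>a\<in>cball (c i) (r i). \<forall>b\<in>cball (c i) (r i). k * norm (a - b) \<le> norm (X i a - X i b)" if "i < N" for i
      using bilip[OF that] by metis
  qed (meson mult_right_mono norm_ge_zero order_trans)
  then obtain k where k: "k > 0" "\<And>i. i < N \<Longrightarrow> \<forall>a\<in>cball (c i) (r i). \<forall>b\<in>cball (c i) (r i). k * norm (a - b) \<le> norm (X i a - X i b)"
    by blast
  have "\<exists>L>0. \<forall>i<N. \<forall>a\<in>cball (c i) (r i). \<forall>b\<in>cball (c i) (r i). norm (X i a - X i b) \<le> L * norm (a - b)"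
  proof (rule finite_uniform_upper[of N "\<lambda>i L. \<forall>a\<in>cball (c i) (r i). \<forall>b\<in>cball (c i) (r i). norm (X i a - X i b) \<le> L * norm (a - b)"])
    show "\<exists>L. \<forall>a\<in>cball (c i) (r i). \<forall>b\<in>cball (c i) (r i). norm (X i a - X i b) \<le> L * norm (a - b)" if "i < N" for i
      using bilip[OF that] by metis
  qed (meson mult_right_mono norm_ge_zero order_trans)
  then obtain L where L: "L > 0" "\<And>i. i < N \<Longrightarrow> \<forall>a\<in>cball (c i) (r i). \<forall>b\<in>cball (c i) (r i). norm (X i a - X i b) \<le> L * norm (a - b)"
    by blast
  show thesis using that[of k L] k L by blast
qed

lemma density_uniform:
  obtains m M where "m > 0" "M > 0"
    "\<And>i z. i < N \<Longrightarrow> z \<in> cball (c i) (r i) \<Longrightarrow> m \<le> area_density (X i) z"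
    "\<And>i z. i < N \<Longrightarrow> z \<in> cball (c i) (r i) \<Longrightarrow> area_density (X i) z \<le> M"
proof -
  have *: "continuous_on (cball (c i) (r i)) (area_density (X i))"
    "\<And>z. z \<in> cball (c i) (r i) \<Longrightarrow> area_density (X i) z > 0" if "i < N" for i
  proof -
    obtain U where U: "cball (c i) (r i) \<subseteq> U" "c1_param S U (X i)"
      using chart[OF \<open>i < N\<close>] local_param_imp_c1_param by blast
    show "continuous_on (cball (c i) (r i)) (area_density (X i))"
      using c1_param_density_continuous[OF U(2)] U(1) continuous_on_subset by blast
    show "\<And>z. z \<in> cball (c i) (r i) \<Longrightarrow> area_density (X i) z > 0"
      using c1_param_density_pos[OF U(2)] U(1) by blast
  qed
  have "\<exists>m>0. \<forall>i<N. \<forall>z\<in>cball (c i) (r i). m \<le> area_density (X i) z"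
  proof (rule finite_uniform_lower[of N "\<lambda>i m. \<forall>z\<in>cball (c i) (r i). m \<le> area_density (X i) z"])
    show "\<exists>m>0. \<forall>z\<in>cball (c i) (r i). m \<le> area_density (X i) z" if "i < N" for i
      by (rule continuous_compact_bounds) (use *[OF that] in auto)
  qed (meson order_trans)
  then obtain m where m: "m > 0" "\<And>i. i < N \<Longrightarrow> \<forall>z\<in>cball (c i) (r i). m \<le> area_density (X i) z"
    by blast
  have "\<exists>M>0. \<forall>i<N. \<forall>z\<in>cball (c i) (r i). area_density (X i) z \<le> M"
  proof (rule finite_uniform_upper[of N "\<lambda>i M. \<forall>z\<in>cball (c i) (r i). area_density (X i) z \<le> M"])
    show "\<exists>M. \<forall>z\<in>cball (c i) (r i). area_density (X i) z \<le> M" if "i < N" for i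
      by (rule continuous_compact_bounds) (use *[OF that] in auto)
  qed (meson order_trans)
  then obtain M where M: "M > 0" "\<And>i. i < N \<Longrightarrow> \<forall>z\<in>cball (c i) (r i). area_density (X i) z \<le> M"
    by blast
  show thesis using that[of m M] m M by blast
qed

end

lemma emeasure_chart_measure_bounds:
  assumes X: "c1_param S U X" and A: "A \<in> sets borel"
  shows "(\<And>z. z \<in> U \<Longrightarrow> X z \<in> A \<Longrightarrow> area_density X z \<le> M) \<Longrightarrow>
      emeasure (chart_measure U X) A \<le> ennreal M * emeasure lborel {z \<in> U. X z \<in> A}"
    "(\<And>z. z \<in> U \<Longrightarrow> X z \<in> A \<Longrightarrow> m \<le> area_density X z) \<Longrightarrow>
      ennreal m * emeasure lborel {z \<in> U. X z \<in> A} \<le> emeasure (chart_measure U X) A"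
proof -
  let ?D = "{z \<in> U. X z \<in> A}"
  have D: "?D \<in> sets lborel" using c1_param_preimage_borel[OF X A] by simp
  have eq: "ennreal k * emeasure lborel ?D = (\<integral>\<^sup>+z\<in>?D. ennreal k \<partial>lborel)" for k
    using D by (rule nn_integral_cmult_indicator[symmetric])
  show "emeasure (chart_measure U X) A \<le> ennreal M * emeasure lborel ?D"
    if "\<And>z. z \<in> U \<Longrightarrow> X z \<in> A \<Longrightarrow> area_density X z \<le> M"
    unfolding eq emeasure_chart_measure[OF X A]
    using that by (intro nn_integral_mono) (auto simp: indicator_def intro: ennreal_leI)
  show "ennreal m * emeasure lborel ?D \<le> emeasure (chart_measure U X) A"
    if "\<And>z. z \<in> U \<Longrightarrow> X z \<in> A \<Longrightarrow> m \<le> area_density X z"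
    unfolding eq emeasure_chart_measure[OF X A]
    using that by (intro nn_integral_mono) (auto simp: indicator_def intro: ennreal_leI)
qed

text \<open>From below: the chart image of a parameter ball of radius \<open>\<rho> / L\<close> lies
  in \<open>ball x \<rho>\<close>. From above: in each of the \<open>N\<close> charts the preimage
  of \<open>ball x \<rho>\<close> lies in a parameter ball of radius \<open>2 * \<rho> / k\<close>.
  The exponent is the dimension of the hypersurface, not that of the ambient space.\<close>

lemma surface_measure_ball:
  fixes S :: "('n::finite) ambient set"
  assumes S: "closed_hypersurface S"
  obtains a A r0 where "a > 0" "A > 0" "r0 > 0"
    "\<And>x \<rho>. x \<in> S \<Longrightarrow> 0 < \<rho> \<Longrightarrow> \<rho> \<le> r0 \<Longrightarrow> ennreal (a * \<rho> ^ CARD('n)) \<le> emeasure (surface_measure S) (S \<inter> ball x \<rho>)"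
    "\<And>x \<rho>. 0 < \<rho> \<Longrightarrow> emeasure (surface_measure S) (S \<inter> ball x \<rho>) \<le> ennreal (A * \<rho> ^ CARD('n))"
proof -
  obtain N X c r where "atlas S N X c r" using closed_hypersurface_atlas[OF S] .
  then interpret atlas S N X c r .
  obtain k L where kL: "k > 0" "L > 0"
    "\<And>i a b. i < N \<Longrightarrow> a \<in> cball (c i) (r i) \<Longrightarrow> b \<in> cball (c i) (r i) \<Longrightarrow> k * norm (a - b) \<le> norm (X i a - X i b)"
    "\<And>i a b. i < N \<Longrightarrow> a \<in> cball (c i) (r i) \<Longrightarrow> b \<in> cball (c i) (r i) \<Longrightarrow> norm (X i a - X i b) \<le> L * norm (a - b)"
    using bilip_uniform by metis
  obtain m M where mM: "m > 0" "M > 0"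
    "\<And>i z. i < N \<Longrightarrow> z \<in> cball (c i) (r i) \<Longrightarrow> m \<le> area_density (X i) z"
    "\<And>i z. i < N \<Longrightarrow> z \<in> cball (c i) (r i) \<Longrightarrow> area_density (X i) z \<le> M"
    using density_uniform by metis
  have "\<exists>\<eta>>0. \<forall>i<N. \<eta> \<le> r i"
    by (rule finite_uniform_lower) (use r_pos in auto)
  then obtain \<eta> where \<eta>: "\<eta> > 0" "\<And>i. i < N \<Longrightarrow> \<eta> \<le> r i" by blast
  let ?n = "CARD('n)" and ?\<sigma> = "surface_measure S"
  define \<omega> where "\<omega> = unit_ball_vol (real ?n)"
  have \<omega>: "\<omega> > 0" by (simp add: \<omega>_def unit_ball_vol_pos)
  have vol: "emeasure lborel (ball z \<rho> :: (real^'n) set) = ennreal (\<omega> * \<rho> ^ ?n)" if "\<rho> \<ge> 0" for z \<rho>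
    using emeasure_ball[of \<rho> z] that by (simp add: \<omega>_def)
  have setsS: "A \<inter> S \<in> sets ?\<sigma>" if "A \<in> sets borel" for A
    using that S_borel by (auto simp: sets_surface_measure[OF S] sets_restrict_space_iff)
  define a where "a = m * (\<omega> * (1 / L) ^ ?n)"
  \<comment> \<open>The summand 1 makes \<open>A\<close> positive even for an empty
    hypersurface.\<close>
  define A where "A = real N * (M * (\<omega> * (2 / k) ^ ?n)) + 1"
  \<comment> \<open>For \<open>\<rho> \<le> r0\<close> the parameter radius
    \<open>\<rho> / L\<close> is at most half of every \<open>r i\<close>.\<close>
  define r0 where "r0 = L * \<eta> / 2"
  have "ennreal (a * \<rho> ^ ?n) \<le> emeasure ?\<sigma> (S \<inter> ball x \<rho>)" if x: "x \<in> S" and \<rho>: "0 < \<rho>" "\<rho> \<le> r0" for x \<rho>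
  proof -
    obtain i z where i: "i < N" "z \<in> ball (c i) (r i / 2)" "x = X i z" using cover x by blast
    have sub: "ball z (\<rho> / L) \<subseteq> B i"
    proof
      fix w assume "w \<in> ball z (\<rho> / L)"
      moreover have "\<rho> / L \<le> r i / 2" using \<rho> \<eta>(2)[OF i(1)] kL by (simp add: r0_def field_simps) (smt (verit, best) mult_left_mono)
      ultimately show "w \<in> B i" using i dist_triangle[of "c i" w z] unfolding mem_ball by linarith
    qed
    have cp: "c1_param S (ball z (\<rho> / L)) (X i)" by (rule c1_param_subset[OF c1_chart[OF i(1)] _ sub]) simp
    let ?I = "X i ` ball z (\<rho> / L)"
    have Ib: "?I \<in> sets borel" by (rule image_borel[OF cp])
    have zi: "z \<in> cball (c i) (r i)" using i r_pos[of i] by auto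
    have "?I \<subseteq> ball x \<rho>"
    proof safe
      fix w assume w: "w \<in> ball z (\<rho> / L)"
      then have "w \<in> cball (c i) (r i)" using sub by (auto simp: subset_iff less_imp_le)
      then have "norm (X i z - X i w) \<le> L * norm (z - w)" using kL(4)[OF i(1) zi] by blast
      also have "\<dots> < \<rho>" using w kL by (simp add: dist_norm field_simps)
      finally show "X i w \<in> ball x \<rho>" using i by (simp add: dist_norm)
    qed
    then have "emeasure ?\<sigma> ?I \<le> emeasure ?\<sigma> (S \<inter> ball x \<rho>)"
      using c1_param_image[OF cp] setsS[of "ball x \<rho>"] by (intro emeasure_mono) (auto simp: Int_commute)
    moreover have "emeasure ?\<sigma> ?I = emeasure (chart_measure (ball z (\<rho> / L)) (X i)) ?I"
      by (rule emeasure_surface_measure[OF S cp Ib]) simp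
    moreover have "{w \<in> ball z (\<rho> / L). X i w \<in> ?I} = ball z (\<rho> / L)" by auto
    then have "ennreal m * emeasure lborel (ball z (\<rho> / L)) \<le> emeasure (chart_measure (ball z (\<rho> / L)) (X i)) ?I"
      using emeasure_chart_measure_bounds(2)[OF cp Ib, of m] mM(3)[OF i(1)] sub
      by (metis (no_types, lifting) ball_subset_cball subset_iff)
    moreover have "ennreal m * emeasure lborel (ball z (\<rho> / L)) = ennreal (a * \<rho> ^ ?n)"
      using \<rho> kL mM \<omega> by (subst vol) (auto simp: a_def ennreal_mult'[symmetric] power_divide field_simps)
    ultimately show ?thesis by simp
  qed
  moreover have "emeasure ?\<sigma> (S \<inter> ball x \<rho>) \<le> ennreal (A * \<rho> ^ ?n)" if \<rho>: "0 < \<rho>" for x \<rho>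
  proof -
    let ?P = "\<lambda>i. X i ` B i \<inter> ball x \<rho>"
    have Pb: "?P i \<in> sets borel" if "i < N" for i using image_borel[OF c1_chart[OF that]] by simp
    have PS: "?P i \<subseteq> S" if "i < N" for i using c1_param_image[OF c1_chart[OF that]] by auto
    have Ps: "?P i \<in> sets ?\<sigma>" if "i < N" for i
      using setsS[OF Pb[OF that]] PS[OF that] by (simp add: Int_absorb2)
    have "S \<inter> ball x \<rho> \<subseteq> (\<Union>i<N. ?P i)"
    proof
      fix y assume y: "y \<in> S \<inter> ball x \<rho>"
      then have "y \<in> (\<Union>i<N. piece i)" using piece_cover by simp
      then obtain i where "i < N" "y \<in> piece i" by blast
      then show "y \<in> (\<Union>i<N. ?P i)" using piece_image[of i] y by blast
    qed
    then have "emeasure ?\<sigma> (S \<inter> ball x \<rho>) \<le> emeasure ?\<sigma> (\<Union>i<N. ?P i)"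
      using Ps by (intro emeasure_mono sets.finite_UN) auto
    also have "\<dots> \<le> (\<Sum>i<N. emeasure ?\<sigma> (?P i))"
      using Ps by (intro emeasure_subadditive_finite) auto
    also have "\<dots> \<le> (\<Sum>i<N. ennreal (M * (\<omega> * (2 * \<rho> / k) ^ ?n)))"
    proof (rule sum_mono)
      fix i assume "i \<in> {..<N}"
      then have i: "i < N" by simp
      have "emeasure ?\<sigma> (?P i) = emeasure (chart_measure (B i) (X i)) (?P i)"
        by (rule emeasure_surface_measure[OF S c1_chart[OF i] Pb[OF i]]) simp
      also have "\<dots> \<le> ennreal M * emeasure lborel {z \<in> B i. X i z \<in> ?P i}"
        by (rule emeasure_chart_measure_bounds(1)[OF c1_chart[OF i] Pb[OF i]]) (use mM(4)[OF i] in auto)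
      also have "emeasure lborel {z \<in> B i. X i z \<in> ?P i} \<le> ennreal (\<omega> * (2 * \<rho> / k) ^ ?n)"
      proof (cases "{z \<in> B i. X i z \<in> ?P i} = {}")
        case False
        then obtain z0 where z0: "z0 \<in> B i" "X i z0 \<in> ball x \<rho>" by auto
        have "{z \<in> B i. X i z \<in> ?P i} \<subseteq> ball z0 (2 * \<rho> / k)"
        proof safe
          fix z assume z: "z \<in> B i" "X i z \<in> ball x \<rho>"
          have "k * norm (z0 - z) \<le> norm (X i z0 - X i z)"
            using kL(3)[OF i, of z0 z] z0 z by simp
          also have "\<dots> < 2 * \<rho>"
            using z z0 dist_triangle[of "X i z0" "X i z" x] by (simp add: dist_norm norm_minus_commute)
          finally show "z \<in> ball z0 (2 * \<rho> / k)" using kL by (simp add: dist_norm field_simps)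
        qed
        then have "emeasure lborel {z \<in> B i. X i z \<in> ?P i} \<le> emeasure lborel (ball z0 (2 * \<rho> / k))"
          by (intro emeasure_mono) auto
        also have "\<dots> = ennreal (\<omega> * (2 * \<rho> / k) ^ ?n)" using \<rho> kL by (intro vol) auto
        finally show ?thesis .
      qed (metis emeasure_empty zero_le)
      finally show "emeasure ?\<sigma> (?P i) \<le> ennreal (M * (\<omega> * (2 * \<rho> / k) ^ ?n))"
        using mM by (simp add: ennreal_mult' mult_left_mono)
    qed
    also have "\<dots> = ennreal (real N * (M * (\<omega> * (2 / k) ^ ?n)) * \<rho> ^ ?n)"
      using mM \<omega> kL \<rho> by (simp add: ennreal_of_nat_eq_real_of_nat ennreal_mult'[symmetric] power_divide power_mult_distrib mult_ac)
    also have "\<dots> \<le> ennreal (A * \<rho> ^ ?n)"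
      using \<rho> by (intro ennreal_leI) (simp add: A_def algebra_simps)
    finally show ?thesis .
  qed
  moreover have "a > 0" "r0 > 0" using mM(1) kL(2) \<omega> \<eta>(1) by (simp_all add: a_def r0_def)
  moreover have "A > 0"
    unfolding A_def using mM(2) kL(1) \<omega> by (intro add_nonneg_pos mult_nonneg_nonneg) simp_all
  ultimately show thesis by (intro that[of a A r0])
qed

lemma finite_measure_surface_measure:
  fixes S :: "('n::finite) ambient set"
  assumes S: "closed_hypersurface S"
  shows "finite_measure (surface_measure S)"
proof (rule finite_measureI)
  obtain R where R: "R > 0" "S \<subseteq> ball 0 R"
    using S bounded_subset_ballD[of S 0] by (auto simp: closed_hypersurface_def compact_imp_bounded)
  obtain a A r0 where "\<And>x \<rho>. 0 < \<rho> \<Longrightarrow> emeasure (surface_measure S) (S \<inter> ball x \<rho>) \<le> ennreal (A * \<rho> ^ CARD('n))"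
    using surface_measure_ball[OF S] by metis
  from this[OF R(1), of 0] have "emeasure (surface_measure S) S \<le> ennreal (A * R ^ CARD('n))"
    using R(2) by (simp add: Int_absorb2)
  then show "emeasure (surface_measure S) (space (surface_measure S)) \<noteq> \<infinity>"
    by (auto simp: space_surface_measure[OF S] top_unique)
qed

section \<open>Tangent spaces and the tangential gradient\<close>

lemma tangent_space_chart:
  assumes X: "local_param S U X" and z: "z \<in> U"
  shows "tangent_space S (X z) = range (frechet_derivative X (at z))"
proof
  show "range (frechet_derivative X (at z)) \<subseteq> tangent_space S (X z)"
    using assms by (auto simp: tangent_space_def)
  show "tangent_space S (X z) \<subseteq> range (frechet_derivative X (at z))"
  proof
    fix w assume "w \<in> tangent_space S (X z)"
    then obtain X' U' z' h where X': "local_param S U' X'" "z' \<in> U'" "X' z' = X z"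
      and w: "w = frechet_derivative X' (at z') h" by (auto simp: tangent_space_def)
    obtain Xi where Xi: "homeomorphism U (X ` U) X Xi" using X by (auto simp: local_param_def)
    \<comment> \<open>By the chain rule for the transition map the derivative of any other chart has
      its range inside that of \<open>X\<close>; so the union over all charts collapses to one
      range.\<close>
    have "\<exists>D. ((\<lambda>z. Xi (X' z)) has_derivative D) (at z') \<and>
        frechet_derivative X' (at z') = frechet_derivative X (at (Xi (X' z'))) \<circ> D"
      by (rule c1_param_transition[OF local_param_imp_c1_param[OF X'(1)] local_param_imp_c1_param[OF X] X'(2) _ Xi])
        (use X' z in auto)
    moreover have "Xi (X' z') = z" using Xi z X'(3) by (auto simp: homeomorphism_def)
    ultimately show "w \<in> range (frechet_derivative X (at z))" using w by auto
  qed
qed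

text \<open>The tangent space has codimension one, so the unit normal is unique up to its sign,
  which the projection does not see. Two extensions have equal derivatives along the surface, so
  their gradients differ by a normal vector, which the projection removes. Thus the description in
  \<open>tgrad\<close> is unique, and against tangent vectors the ambient gradient may replace
  it.\<close>

lemma inner_tgrad:
  fixes S :: "('n::finite) ambient set"
  assumes S: "closed_hypersurface S" and x: "x \<in> S" and w: "w \<in> tangent_space S x"
    and d: "GDERIV \<phi> x :> d"
  shows "w \<bullet> tgrad S \<phi> x = w \<bullet> d"
proof -
  obtain U X z where X: "local_param S U X" "z \<in> U" "x = X z"
    using S x by (auto simp: closed_hypersurface_def)
  let ?D = "frechet_derivative X (at z)"
  note cp = local_param_imp_c1_param[OF X(1)]
  have c1: "c1 U X" and inj: "inj ?D" using cp X(2) by (auto simp: c1_param_def)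
  have DX: "(X has_derivative ?D) (at z)" by (rule c1_has_derivative[OF c1 X(2)])
  have lin: "linear ?D" by (rule c1_linear[OF c1 X(2)])
  have ts: "tangent_space S x = range ?D" using tangent_space_chart[OF X(1,2)] X(3) by simp
  have sub: "subspace (range ?D)" using lin by (simp add: linear_subspace_image)
  let ?V = "{y \<in> UNIV. \<forall>x\<in>range ?D. orthogonal x y}"
  have "dim ?V + dim (range ?D) = dim (UNIV :: 'n ambient set)"
    by (rule dim_subspace_orthogonal_to_vectors[OF sub]) auto
  moreover have "dim (range ?D) = CARD('n)"
    using dim_image_eq[OF lin, of UNIV] inj by simp
  ultimately have dimV: "dim ?V = 1" by simp
  have subV: "subspace ?V" by (auto simp: subspace_def orthogonal_def inner_add_right)
  obtain e where e: "e \<in> ?V" "e \<noteq> 0"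
    using dimV dim_eq_0[of ?V] by (metis (no_types, lifting) singletonI subsetI one_neq_zero)
  define \<nu> where "\<nu> = e /\<^sub>R norm e"
  have \<nu>: "\<nu> \<in> ?V" "norm \<nu> = 1" using e by (auto simp: \<nu>_def orthogonal_def)
  have "span {\<nu>} = ?V"
  proof (rule subspace_dim_equal)
    have "\<nu> \<noteq> 0" using \<nu>(2) by auto
    then show "dim ?V \<le> dim (span {\<nu>})" using dimV by (simp add: dim_span dim_singleton)
    show "span {\<nu>} \<subseteq> ?V" using \<nu> subV by (intro span_minimal) auto
  qed (rule subspace_span, rule subV)
  then have Vspan: "\<exists>s. y = s *\<^sub>R \<nu>" if "y \<in> ?V" for y using that by (auto simp: span_singleton)
  have un: "unit_normal S x \<nu>" using \<nu> by (auto simp: unit_normal_def ts orthogonal_def inner_commute)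
  let ?w = "d - (d \<bullet> \<nu>) *\<^sub>R \<nu>"
  have "tgrad S \<phi> x = ?w"
    unfolding tgrad_def
  proof (rule the_equality)
    show "\<exists>\<nu> h d. unit_normal S x \<nu> \<and> (\<forall>y\<in>S. h y = \<phi> y) \<and> (GDERIV h x :> d) \<and> ?w = d - (d \<bullet> \<nu>) *\<^sub>R \<nu>"
      using un d by blast
    fix w' assume "\<exists>\<nu> h d. unit_normal S x \<nu> \<and> (\<forall>y\<in>S. h y = \<phi> y) \<and> (GDERIV h x :> d) \<and> w' = d - (d \<bullet> \<nu>) *\<^sub>R \<nu>"
    then obtain \<nu>' h d' where *: "unit_normal S x \<nu>'" "\<forall>y\<in>S. h y = \<phi> y" "GDERIV h x :> d'"
      and w': "w' = d' - (d' \<bullet> \<nu>') *\<^sub>R \<nu>'" by blast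
    have "\<nu>' \<in> ?V" using *(1) by (auto simp: unit_normal_def ts orthogonal_def inner_commute)
    then obtain s where s: "\<nu>' = s *\<^sub>R \<nu>" using Vspan by blast
    have "s * s = 1" using *(1) \<nu>(2) s by (auto simp: unit_normal_def abs_if split: if_splits)
    then have 1: "(d' \<bullet> \<nu>') *\<^sub>R \<nu>' = (d' \<bullet> \<nu>) *\<^sub>R \<nu>" by (simp add: s algebra_simps)
    have der: "((\<lambda>y. \<phi> (X y)) has_derivative (\<lambda>k. ?D k \<bullet> d)) (at z)"
      "((\<lambda>y. h (X y)) has_derivative (\<lambda>k. ?D k \<bullet> d')) (at z)"
      using d *(3) diff_chain_at[OF DX] by (auto simp: gderiv_def X(3) o_def)
    have "((\<lambda>y. \<phi> (X y)) has_derivative (\<lambda>k. ?D k \<bullet> d')) (at z)"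
    proof (rule has_derivative_transform_within_open[OF der(2) c1_param_open[OF cp] X(2)])
      show "\<And>y. y \<in> U \<Longrightarrow> h (X y) = \<phi> (X y)" using *(2) c1_param_image[OF cp] by blast
    qed
    then have "(\<lambda>k. ?D k \<bullet> d') = (\<lambda>k. ?D k \<bullet> d)" using has_derivative_unique der(1) by blast
    then have "?D k \<bullet> d' = ?D k \<bullet> d" for k by (rule fun_cong)
    then have "d' - d \<in> ?V" by (auto simp: orthogonal_def inner_diff_right)
    then obtain b where b: "d' = d + b *\<^sub>R \<nu>" 
      using Vspan[of "d' - d"] by (metis diff_add_cancel add.commute)
    have "\<nu> \<bullet> \<nu> = 1" using \<nu>(2) by (simp add: norm_eq_1)
    then show "w' = ?w" unfolding w' 1 by (simp add: b inner_add_left algebra_simps)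
  qed
  moreover have "w \<bullet> \<nu> = 0" using w un by (auto simp: unit_normal_def inner_commute)
  ultimately show ?thesis by (simp add: inner_diff_right)
qed

section \<open>Averages over concentrating kernels\<close>

text \<open>An approximate identity without normalisation: bounded mass in each variable and
  concentration on the diagonal. This is enough because \<open>g\<close> is only ever compared with
  its own values nearby.\<close>

locale mollifier = finite_measure \<pi>
  for \<pi> :: "'a::{euclidean_space} measure" +
  fixes \<Omega> :: "'a set" and F :: "'f filter" and K :: "'f \<Rightarrow> 'a \<Rightarrow> 'a \<Rightarrow> ennreal" and C :: real
  assumes sets_eq: "sets \<pi> = sets (restrict_space borel \<Omega>)"
    and K_meas: "\<And>\<epsilon>. (\<lambda>z. K \<epsilon> (fst z) (snd z)) \<in> borel_measurable (\<pi> \<Otimes>\<^sub>M \<pi>)"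
    and K_fst: "\<forall>\<^sub>F \<epsilon> in F. \<forall>x\<in>\<Omega>. (\<integral>\<^sup>+y. K \<epsilon> x y \<partial>\<pi>) \<le> ennreal C"
    and K_snd: "\<forall>\<^sub>F \<epsilon> in F. \<forall>y\<in>\<Omega>. (\<integral>\<^sup>+x. K \<epsilon> x y \<partial>\<pi>) \<le> ennreal C"
    and K_near: "\<And>\<rho>. \<rho> > 0 \<Longrightarrow> \<forall>\<^sub>F \<epsilon> in F. \<forall>x\<in>\<Omega>. \<forall>y\<in>\<Omega>. K \<epsilon> x y \<noteq> 0 \<longrightarrow> dist x y < \<rho>"
    and C_pos: "C > 0"
begin

lemma space_eq: "space \<pi> = \<Omega>"
  using sets_eq_imp_space_eq[OF sets_eq] by (simp add: space_restrict_space)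

lemma K_meas' [measurable (raw)]:
  "f \<in> M \<rightarrow>\<^sub>M \<pi> \<Longrightarrow> g \<in> M \<rightarrow>\<^sub>M \<pi> \<Longrightarrow> (\<lambda>x. K \<epsilon> (f x) (g x)) \<in> borel_measurable M"
  using measurable_compose[OF _ K_meas, of "\<lambda>x. (f x, g x)" M] by simp

sublocale pair_sigma_finite \<pi> \<pi> ..

text \<open>An L1 modulus of continuity of \<open>g\<close> at the scale of the kernel.\<close>

definition avg :: "'f \<Rightarrow> ('a \<Rightarrow> real) \<Rightarrow> ennreal" where
  "avg \<epsilon> g = (\<integral>\<^sup>+x. \<integral>\<^sup>+y. ennreal \<bar>g x - g y\<bar> * K \<epsilon> x y \<partial>\<pi> \<partial>\<pi>)"

text \<open>A Schur test: after splitting the majorant, one variable of the kernel is integrated out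
  in each summand, which uses one mass bound each.\<close>

lemma avg_majorant:
  assumes h[measurable]: "h \<in> borel_measurable \<pi>"
    and le: "\<And>x y. x \<in> \<Omega> \<Longrightarrow> y \<in> \<Omega> \<Longrightarrow> K \<epsilon> x y \<noteq> 0 \<Longrightarrow> ennreal \<bar>g x - g y\<bar> \<le> h x + h y"
    and 1: "\<forall>x\<in>\<Omega>. (\<integral>\<^sup>+y. K \<epsilon> x y \<partial>\<pi>) \<le> ennreal C"
    and 2: "\<forall>y\<in>\<Omega>. (\<integral>\<^sup>+x. K \<epsilon> x y \<partial>\<pi>) \<le> ennreal C"
  shows "avg \<epsilon> g \<le> 2 * ennreal C * (\<integral>\<^sup>+x. h x \<partial>\<pi>)"
proof -
  have "avg \<epsilon> g \<le> (\<integral>\<^sup>+x. \<integral>\<^sup>+y. (h x + h y) * K \<epsilon> x y \<partial>\<pi> \<partial>\<pi>)"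
    unfolding avg_def
  proof (intro nn_integral_mono)
    fix x y assume "x \<in> space \<pi>" "y \<in> space \<pi>"
    then show "ennreal \<bar>g x - g y\<bar> * K \<epsilon> x y \<le> (h x + h y) * K \<epsilon> x y"
      using le[of x y] by (cases "K \<epsilon> x y = 0") (auto simp: space_eq intro: mult_right_mono)
  qed
  also have "\<dots> = (\<integral>\<^sup>+x. (\<integral>\<^sup>+y. h x * K \<epsilon> x y \<partial>\<pi>) + (\<integral>\<^sup>+y. h y * K \<epsilon> x y \<partial>\<pi>) \<partial>\<pi>)"
    by (intro nn_integral_cong) (simp add: distrib_right nn_integral_add)
  also have "\<dots> = (\<integral>\<^sup>+x. \<integral>\<^sup>+y. h x * K \<epsilon> x y \<partial>\<pi> \<partial>\<pi>) + (\<integral>\<^sup>+x. \<integral>\<^sup>+y. h y * K \<epsilon> x y \<partial>\<pi> \<partial>\<pi>)"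
    by (intro nn_integral_add) measurable
  also have "(\<integral>\<^sup>+x. \<integral>\<^sup>+y. h y * K \<epsilon> x y \<partial>\<pi> \<partial>\<pi>) = (\<integral>\<^sup>+y. \<integral>\<^sup>+x. h y * K \<epsilon> x y \<partial>\<pi> \<partial>\<pi>)"
    using Fubini[of "\<lambda>z. h (snd z) * K \<epsilon> (fst z) (snd z)"] by simp
  also have "(\<integral>\<^sup>+x. \<integral>\<^sup>+y. h x * K \<epsilon> x y \<partial>\<pi> \<partial>\<pi>) \<le> (\<integral>\<^sup>+x. h x * ennreal C \<partial>\<pi>)"
    using 1 by (intro nn_integral_mono) (simp add: nn_integral_cmult space_eq mult_left_mono)
  also have "(\<integral>\<^sup>+y. \<integral>\<^sup>+x. h y * K \<epsilon> x y \<partial>\<pi> \<partial>\<pi>) \<le> (\<integral>\<^sup>+x. h x * ennreal C \<partial>\<pi>)"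
    using 2 by (intro nn_integral_mono) (simp add: nn_integral_cmult space_eq mult_left_mono)
  also have "(\<integral>\<^sup>+x. h x * ennreal C \<partial>\<pi>) + (\<integral>\<^sup>+x. h x * ennreal C \<partial>\<pi>) = 2 * ennreal C * (\<integral>\<^sup>+x. h x \<partial>\<pi>)"
    by (subst (1 2) nn_integral_multc) (auto simp: mult_2[symmetric] mult_ac)
  finally show ?thesis by (simp add: add_right_mono)
qed

lemma avg_add:
  assumes [measurable]: "g \<in> borel_measurable \<pi>" "h \<in> borel_measurable \<pi>"
  shows "avg \<epsilon> (\<lambda>x. g x + h x) \<le> avg \<epsilon> g + avg \<epsilon> h"
proof -
  have "avg \<epsilon> (\<lambda>x. g x + h x) \<le>
    (\<integral>\<^sup>+x. \<integral>\<^sup>+y. ennreal \<bar>g x - g y\<bar> * K \<epsilon> x y + ennreal \<bar>h x - h y\<bar> * K \<epsilon> x y \<partial>\<pi> \<partial>\<pi>)"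
    unfolding avg_def distrib_right[symmetric] ennreal_plus[OF abs_ge_zero abs_ge_zero, symmetric]
    by (intro nn_integral_mono mult_right_mono ennreal_leI) auto
  also have "\<dots> = (\<integral>\<^sup>+x. (\<integral>\<^sup>+y. ennreal \<bar>g x - g y\<bar> * K \<epsilon> x y \<partial>\<pi>) + (\<integral>\<^sup>+y. ennreal \<bar>h x - h y\<bar> * K \<epsilon> x y \<partial>\<pi>) \<partial>\<pi>)"
    by (intro nn_integral_cong nn_integral_add) auto
  also have "\<dots> = avg \<epsilon> g + avg \<epsilon> h"
    unfolding avg_def by (intro nn_integral_add) measurable
  finally show ?thesis .
qed

text \<open>Regularity encloses the set between a compact \<open>k\<close> and an open
  \<open>O'\<close> of nearly the same measure. Once the range of the kernel is below the distance
  from \<open>k\<close> to the complement of \<open>O'\<close>, a pair with different indicator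
  values has a point in the small set \<open>O' - k\<close>.\<close>

lemma avg_indicator:
  assumes A: "A \<in> sets \<pi>" and \<eta>: "\<eta> > (0::real)"
  shows "\<forall>\<^sub>F \<epsilon> in F. avg \<epsilon> (indicator A) \<le> ennreal \<eta>"
proof -
  obtain B where B: "B \<in> sets borel" "A = \<Omega> \<inter> B"
    using A by (auto simp: sets_eq sets_restrict_space)
  have id[measurable]: "(\<lambda>x. x) \<in> \<pi> \<rightarrow>\<^sub>M borel"
    by (subst measurable_cong_sets[OF sets_eq refl]) (rule measurable_restrict_space1, simp)
  define N where "N = distr \<pi> borel (\<lambda>x. x)"
  have setsN: "sets N = sets borel" by (simp add: N_def)
  have "emeasure N (space N) = emeasure \<pi> ((\<lambda>x. x) -` UNIV \<inter> space \<pi>)"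
    unfolding N_def space_distr space_borel using id by (rule emeasure_distr) simp
  then have "emeasure N (space N) \<noteq> \<infinity>" 
    using emeasure_finite[of "(\<lambda>x. x) -` UNIV \<inter> space \<pi>"] unfolding infinity_ennreal_def by (rule ssubst)
  note N = setsN this
  interpret N: finite_measure N by (rule finite_measureI, rule N(2))
  \<comment> \<open>Inner and outer approximation lose \<open>e\<close> each, and
    \<open>avg_majorant\<close> multiplies by \<open>2 * C\<close>.\<close>
  define e where "e = \<eta> / (4 * C)"
  have e: "e > 0" using \<eta> C_pos by (simp add: e_def)
  have "emeasure N B \<noteq> \<infinity>" using N.emeasure_finite[of B] by simp
  have "{k. k \<subseteq> B \<and> compact k} \<noteq> {}" using compact_empty by blast
  from SUP_approx_ennreal[OF e this inner_regular[OF N B(1)] \<open>emeasure N B \<noteq> \<infinity>\<close>]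
  obtain k where k: "k \<subseteq> B" "compact k" "emeasure N B < emeasure N k + ennreal e" by auto
  from INF_approx_ennreal[OF e outer_regular[OF N B(1)] \<open>emeasure N B \<noteq> \<infinity>\<close>]
  obtain O' where O': "B \<subseteq> O'" "open O'" "emeasure N O' < emeasure N B + ennreal e" by auto
  have kb: "k \<in> sets borel" "O' \<in> sets borel" using k O' by (auto intro: borel_compact)
  have "measure N (O' - k) = measure N O' - measure N k"
    using k O' kb N by (intro N.finite_measure_Diff) auto
  also have "\<dots> \<le> 2 * e"
    using k(3) O'(3) e by (simp add: N.emeasure_eq_measure ennreal_plus[symmetric] ennreal_less_iff del: ennreal_plus)
  finally have small: "measure N (O' - k) \<le> 2 * e" .
  obtain d where d: "d > 0" "\<forall>x\<in>k. \<forall>y\<in>- O'. d \<le> dist x y"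
    using separate_compact_closed[of k "- O'"] O' k by auto
  show ?thesis
    using K_fst K_snd K_near[OF d(1)]
  proof eventually_elim
    case (elim \<epsilon>)
    have "avg \<epsilon> (indicator A) \<le> 2 * ennreal C * (\<integral>\<^sup>+x. indicator (O' - k) x \<partial>\<pi>)"
    proof (rule avg_majorant)
      show "(indicator (O' - k) :: 'a \<Rightarrow> ennreal) \<in> borel_measurable \<pi>"
        using kb by (intro measurable_compose[OF id]) auto
      fix x y assume xy: "x \<in> \<Omega>" "y \<in> \<Omega>" "K \<epsilon> x y \<noteq> 0"
      then have "dist x y < d" using elim by blast
      moreover then have "dist y x < d" by (simp add: dist_commute)
      ultimately
      have "\<not> (x \<in> k \<and> y \<notin> O')" "\<not> (y \<in> k \<and> x \<notin> O')"
        using d(2) by (auto simp: not_le[symmetric])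
      then show "ennreal \<bar>indicator A x - indicator A y\<bar> \<le> indicator (O' - k) x + indicator (O' - k) y"
        using xy B(2) k(1) O'(1) by (auto simp: indicator_def)
    qed (rule elim(1), rule elim(2))
    also have "(\<integral>\<^sup>+x. indicator (O' - k) x \<partial>\<pi>) = (\<integral>\<^sup>+x. indicator (O' - k) x \<partial>N)"
      unfolding N_def using kb by (subst nn_integral_distr) auto
    also have "\<dots> = emeasure N (O' - k)"
      using kb N by (intro nn_integral_indicator) auto
    also have "\<dots> \<le> ennreal (2 * e)"
      using small by (simp add: N.emeasure_eq_measure ennreal_leI)
    also have "2 * ennreal C * ennreal (2 * e) = ennreal \<eta>"
      using C_pos \<eta> by (simp add: e_def ennreal_mult'[symmetric] flip: ennreal_numeral)
    finally show ?case by (simp add: mult_left_mono)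
  qed
qed

text \<open>The analogue of the continuity of translations in L1: indicators by regularity, simple
  functions by subadditivity, limits because \<open>avg\<close> is dominated by the L1 norm
  uniformly in the kernel.\<close>

theorem avg_tendsto_zero:
  assumes g: "integrable \<pi> g" and \<eta>: "\<eta> > (0::real)"
  shows "\<forall>\<^sub>F \<epsilon> in F. avg \<epsilon> g \<le> ennreal \<eta>"
  using g \<eta>
proof (induction arbitrary: \<eta> rule: integrable_induct)
  case (base A c)
  define k where "k = \<bar>c\<bar> + 1"
  have k: "k > 0" "\<bar>c\<bar> \<le> k" by (auto simp: k_def)
  have le: "avg \<epsilon> (\<lambda>x. indicator A x *\<^sub>R c) \<le> ennreal k * avg \<epsilon> (indicator A)" for \<epsilon>
  proof -
    have [measurable]: "A \<in> sets \<pi>" by fact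
    have "avg \<epsilon> (\<lambda>x. indicator A x *\<^sub>R c) \<le>
      (\<integral>\<^sup>+x. \<integral>\<^sup>+y. ennreal k * (ennreal \<bar>indicator A x - indicator A y\<bar> * K \<epsilon> x y) \<partial>\<pi> \<partial>\<pi>)"
      unfolding avg_def mult.assoc[symmetric]
    proof (intro nn_integral_mono mult_right_mono)
      fix x y
      have "\<bar>indicator A x *\<^sub>R c - indicator A y *\<^sub>R c\<bar> \<le> k * \<bar>indicator A x - indicator A y\<bar>"
        using k by (auto simp: indicator_def)
      then show "ennreal \<bar>indicator A x *\<^sub>R c - indicator A y *\<^sub>R c\<bar> \<le> ennreal k * ennreal \<bar>indicator A x - indicator A y\<bar>"
        using k by (simp add: ennreal_mult'[symmetric] ennreal_leI)
    qed auto
    also have "\<dots> = ennreal k * avg \<epsilon> (indicator A)"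
      unfolding avg_def by (subst nn_integral_cmult[symmetric]) (auto intro!: nn_integral_cong nn_integral_cmult)
    finally show ?thesis .
  qed
  have "\<forall>\<^sub>F \<epsilon> in F. avg \<epsilon> (indicator A) \<le> ennreal (\<eta> / k)"
    using base k by (intro avg_indicator) auto
  then show ?case
  proof eventually_elim
    case (elim \<epsilon>)
    have "ennreal k * avg \<epsilon> (indicator A) \<le> ennreal k * ennreal (\<eta> / k)"
      using elim by (intro mult_left_mono) auto
    also have "\<dots> = ennreal \<eta>" using k by (simp add: ennreal_mult'[symmetric])
    finally show ?case using le by (rule order_trans[rotated])
  qed
next
  case (add f g)
  have "\<forall>\<^sub>F \<epsilon> in F. avg \<epsilon> f \<le> ennreal (\<eta> / 2)" "\<forall>\<^sub>F \<epsilon> in F. avg \<epsilon> g \<le> ennreal (\<eta> / 2)"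
    using add by auto
  then show ?case
  proof eventually_elim
    case (elim \<epsilon>)
    have "avg \<epsilon> (\<lambda>x. f x + g x) \<le> avg \<epsilon> f + avg \<epsilon> g" using add by (intro avg_add) auto
    also have "\<dots> \<le> ennreal (\<eta> / 2) + ennreal (\<eta> / 2)" using elim by (intro add_mono) auto
    also have "\<dots> = ennreal \<eta>" using \<open>\<eta> > 0\<close> by (simp add: ennreal_plus[symmetric] del: ennreal_plus)
    finally show ?case .
  qed
next
  case (lim f s)
  have [measurable]: "f \<in> borel_measurable \<pi>" "s i \<in> borel_measurable \<pi>" for i using lim by auto
  have "(\<lambda>i. \<integral>\<^sup>+x. norm (f x - s i x) \<partial>\<pi>) \<longlonglongrightarrow> 0"
  proof (rule nn_integral_dominated_convergence_norm[where w = "\<lambda>x. 2 * norm (f x)"])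
    show "(\<integral>\<^sup>+x. ennreal (2 * norm (f x)) \<partial>\<pi>) < \<infinity>"
      using lim(4) by (simp add: integrable_iff_bounded ennreal_mult' nn_integral_cmult ennreal_mult_less_top)
    show "AE x in \<pi>. norm (s j x) \<le> 2 * norm (f x)" for j
      by (rule AE_I2) (rule lim.hyps)
    show "AE x in \<pi>. (\<lambda>i. s i x) \<longlonglongrightarrow> f x"
      by (rule AE_I2) (rule lim.hyps)
  qed measurable
  then have "\<forall>\<^sub>F i in sequentially. (\<integral>\<^sup>+x. norm (f x - s i x) \<partial>\<pi>) < ennreal (\<eta> / (4 * C))"
    using \<open>\<eta> > 0\<close> C_pos by (intro order_tendstoD) auto
  then obtain i where i: "(\<integral>\<^sup>+x. norm (f x - s i x) \<partial>\<pi>) < ennreal (\<eta> / (4 * C))"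
    by (auto dest: eventually_happens)
  have "\<forall>\<^sub>F \<epsilon> in F. avg \<epsilon> (s i) \<le> ennreal (\<eta> / 2)" using lim by auto
  with K_fst K_snd show ?case
  proof eventually_elim
    case (elim \<epsilon>)
    have "avg \<epsilon> (\<lambda>x. f x - s i x) \<le> 2 * ennreal C * (\<integral>\<^sup>+x. norm (f x - s i x) \<partial>\<pi>)"
      using elim by (intro avg_majorant)
        (auto simp: ennreal_plus[symmetric] simp del: ennreal_plus intro!: ennreal_leI)
    also have "\<dots> \<le> 2 * ennreal C * ennreal (\<eta> / (4 * C))" using i by (intro mult_left_mono) auto
    also have "\<dots> = ennreal (\<eta> / 2)"
      using C_pos \<open>\<eta> > 0\<close> by (simp add: ennreal_mult'[symmetric] flip: ennreal_numeral)
    finally have 1: "avg \<epsilon> (\<lambda>x. f x - s i x) \<le> ennreal (\<eta> / 2)" .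
    have "avg \<epsilon> f = avg \<epsilon> (\<lambda>x. s i x + (f x - s i x))" by simp
    also have "\<dots> \<le> avg \<epsilon> (s i) + avg \<epsilon> (\<lambda>x. f x - s i x)" by (rule avg_add) auto
    also have "\<dots> \<le> ennreal (\<eta> / 2) + ennreal (\<eta> / 2)" using elim 1 by (intro add_mono) auto
    also have "\<dots> = ennreal \<eta>" using \<open>\<eta> > 0\<close> by (simp add: ennreal_plus[symmetric] del: ennreal_plus)
    finally show ?case .
  qed
qed

end

section \<open>Cutoff functions in time and space\<close>

lemma DERIV_max_square: "((\<lambda>x::real. (max 0 x)\<^sup>2) has_field_derivative 2 * max 0 x) (at x)"
proof -
  consider "x < 0" | "x = 0" | "x > 0" by linarith
  then show ?thesis
  proof cases
    case 1
    have "((\<lambda>x::real. 0) has_field_derivative 2 * max 0 x) (at x)" using 1 by simp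
    then show ?thesis
      by (rule has_field_derivative_transform_within_open[of _ _ _ "{..<0}"]) (use 1 in auto)
  next
    case 2
    have "((\<lambda>h::real. max 0 h) \<longlongrightarrow> max 0 0) (at 0)" by (intro tendsto_intros)
    moreover have "\<forall>\<^sub>F h in at 0. max 0 h = (max 0 h)\<^sup>2 / (h::real)"
      by (auto simp: eventually_at_filter max_def power2_eq_square)
    ultimately have "((\<lambda>h::real. (max 0 h)\<^sup>2 / h) \<longlongrightarrow> max 0 0) (at 0)"
      by (rule Lim_transform_eventually)
    then show ?thesis using 2 by (simp add: DERIV_def)
  next
    case 3
    have "((\<lambda>x::real. x\<^sup>2) has_field_derivative 2 * max 0 x) (at x)"
      using 3 by (auto intro!: derivative_eq_intros)
    then show ?thesis
      by (rule has_field_derivative_transform_within_open[of _ _ _ "{0<..}"]) (use 3 in auto)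
  qed
qed

definition clamp01 :: "real \<Rightarrow> real" where
  "clamp01 s = max 0 (min 1 s)"

lemma clamp01_bounds: "0 \<le> clamp01 s" "clamp01 s \<le> 1"
  by (auto simp: clamp01_def)

lemma continuous_on_clamp01: "continuous_on A clamp01"
  unfolding clamp01_def[abs_def] by (intro continuous_intros)

text \<open>A function whose derivative vanishes at 0 and 1 remains differentiable when it is frozen
  outside the unit interval.\<close>

lemma DERIV_clamp01:
  assumes q: "\<And>x. (q has_field_derivative q' x) (at x)" and 0: "q' 0 = 0" "q' 1 = 0"
  shows "((\<lambda>s. q (clamp01 s)) has_field_derivative q' (clamp01 s)) (at s)"
proof -
  \<comment> \<open>At an end point the difference quotient of the clamped function is either 0 or
    that of \<open>q\<close>, so it is dominated by the latter, which tends to 0.\<close>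
  have edge: "((\<lambda>s. q (clamp01 s)) has_field_derivative 0) (at a)"
    if "q' a = 0" "clamp01 a = a" "\<And>h. \<bar>clamp01 (a + h) - a\<bar> \<le> \<bar>h\<bar>"
      "\<And>h. clamp01 (a + h) = a \<or> clamp01 (a + h) = a + h \<or> \<bar>h\<bar> \<ge> 1" for a
  proof -
    have "((\<lambda>h. \<bar>(q (a + h) - q a) / h\<bar>) \<longlongrightarrow> 0) (at 0)"
      using q[of a] that(1) by (intro tendsto_rabs_zero) (simp add: DERIV_def)
    moreover have "\<forall>\<^sub>F h in at 0. \<bar>(q (clamp01 (a + h)) - q (clamp01 a)) / h\<bar> \<le> \<bar>(q (a + h) - q a) / h\<bar>"
      unfolding eventually_at
    proof (intro exI[of _ 1] conjI ballI impI)
      fix h :: real assume "h \<noteq> 0 \<and> dist h 0 < 1"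
      then have "clamp01 (a + h) = a \<or> clamp01 (a + h) = a + h" using that(4)[of h] by auto
      then show "\<bar>(q (clamp01 (a + h)) - q (clamp01 a)) / h\<bar> \<le> \<bar>(q (a + h) - q a) / h\<bar>"
        using that(2) by auto
    qed auto
    ultimately have "((\<lambda>h. \<bar>(q (clamp01 (a + h)) - q (clamp01 a)) / h\<bar>) \<longlongrightarrow> 0) (at 0)"
      using tendsto_sandwich[of "\<lambda>_. 0" "\<lambda>h. \<bar>(q (clamp01 (a + h)) - q (clamp01 a)) / h\<bar>" "at 0"
          "\<lambda>h. \<bar>(q (a + h) - q a) / h\<bar>" 0] by fastforce
    then show ?thesis unfolding DERIV_def by (rule tendsto_rabs_zero_cancel)
  qed
  consider "s < 0" | "s = 0" | "0 < s" "s < 1" | "s = 1" | "s > 1" by linarith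
  then show ?thesis
  proof cases
    case 1
    have "((\<lambda>s. q 0) has_field_derivative q' (clamp01 s)) (at s)" using 1 0 by (simp add: clamp01_def)
    then show ?thesis
      by (rule has_field_derivative_transform_within_open[of _ _ _ "{..<0}"]) (use 1 in \<open>auto simp: clamp01_def\<close>)
  next
    case 2
    have "((\<lambda>s. q (clamp01 s)) has_field_derivative 0) (at 0)"
      by (rule edge) (auto simp: clamp01_def min_def max_def 0)
    then show ?thesis using 2 0 by (simp add: clamp01_def)
  next
    case 3
    have "(q has_field_derivative q' (clamp01 s)) (at s)" using 3 q[of s] by (simp add: clamp01_def)
    then show ?thesis
      by (rule has_field_derivative_transform_within_open[of _ _ _ "{0<..<1}"]) (use 3 in \<open>auto simp: clamp01_def\<close>)
  next
    case 4
    have "((\<lambda>s. q (clamp01 s)) has_field_derivative 0) (at 1)"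
      by (rule edge) (auto simp: clamp01_def min_def max_def 0)
    then show ?thesis using 4 0 by (simp add: clamp01_def)
  next
    case 5
    have "((\<lambda>s. q 1) has_field_derivative q' (clamp01 s)) (at s)" using 5 0 by (simp add: clamp01_def)
    then show ?thesis
      by (rule has_field_derivative_transform_within_open[of _ _ _ "{1<..}"]) (use 5 in \<open>auto simp: clamp01_def\<close>)
  qed
qed

text \<open>The quintic with derivative \<open>30 * c ^ 2 * (1 - c) ^ 2\<close>, rising from 0 to 1.
  It is of class C2, so that its derivative, the time mollifier, is an admissible factor of a C1
  test function.\<close>

definition step :: "real \<Rightarrow> real" where
  "step s = (let c = clamp01 s in 10 * c ^ 3 - 15 * c ^ 4 + 6 * c ^ 5)"

definition step' :: "real \<Rightarrow> real" where
  "step' s = (let c = clamp01 s in 30 * c ^ 2 * (1 - c) ^ 2)"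

definition step'' :: "real \<Rightarrow> real" where
  "step'' s = (let c = clamp01 s in 60 * c * (1 - c) * (1 - 2 * c))"

lemma DERIV_step: "(step has_field_derivative step' s) (at s)"
  unfolding step_def[abs_def] step'_def Let_def
proof (rule DERIV_clamp01[where q' = "\<lambda>c. 30 * c ^ 2 * (1 - c) ^ 2"])
  fix x :: real
  have "((\<lambda>c. 10 * c ^ 3 - 15 * c ^ 4 + 6 * c ^ 5) has_field_derivative
      10 * (3 * x ^ 2) - 15 * (4 * x ^ 3) + 6 * (5 * x ^ 4)) (at x)"
    by (auto intro!: derivative_eq_intros)
  moreover have "10 * (3 * x ^ 2) - 15 * (4 * x ^ 3) + 6 * (5 * x ^ 4) = 30 * x ^ 2 * (1 - x) ^ 2"
    by algebra
  ultimately show "((\<lambda>c. 10 * c ^ 3 - 15 * c ^ 4 + 6 * c ^ 5) has_field_derivative 30 * x ^ 2 * (1 - x) ^ 2) (at x)"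
    by simp
qed auto

lemma DERIV_step': "(step' has_field_derivative step'' s) (at s)"
  unfolding step'_def[abs_def] step''_def Let_def
proof (rule DERIV_clamp01[where q' = "\<lambda>c. 60 * c * (1 - c) * (1 - 2 * c)"])
  fix x :: real
  have "((\<lambda>c. 30 * c ^ 2 - 60 * c ^ 3 + 30 * c ^ 4) has_field_derivative
      30 * (2 * x) - 60 * (3 * x ^ 2) + 30 * (4 * x ^ 3)) (at x)"
    by (auto intro!: derivative_eq_intros)
  moreover have "30 * (2 * x) - 60 * (3 * x ^ 2) + 30 * (4 * x ^ 3) = 60 * x * (1 - x) * (1 - 2 * x)"
    by algebra
  moreover have "(\<lambda>c::real. 30 * c ^ 2 - 60 * c ^ 3 + 30 * c ^ 4) = (\<lambda>c. 30 * c ^ 2 * (1 - c) ^ 2)"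
    by (rule ext) algebra
  ultimately show "((\<lambda>c. 30 * c ^ 2 * (1 - c) ^ 2) has_field_derivative 60 * x * (1 - x) * (1 - 2 * x)) (at x)"
    by simp
qed auto

lemma continuous_on_step'': "continuous_on A step''"
  unfolding step''_def[abs_def] Let_def
  by (intro continuous_on_mult continuous_on_diff continuous_on_const continuous_on_clamp01)

lemma step'_nonneg: "0 \<le> step' s"
  by (simp add: step'_def Let_def)

lemma step'_zero: "s \<le> 0 \<Longrightarrow> step' s = 0" "s \<ge> 1 \<Longrightarrow> step' s = 0"
  by (simp_all add: step'_def clamp01_def)

lemma step'_bound: "step' s \<le> 30"
proof -
  let ?c = "clamp01 s"
  have "?c ^ 2 \<le> 1" "(1 - ?c) ^ 2 \<le> 1" using clamp01_bounds[of s] by (auto simp: power_le_one)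
  then have "?c ^ 2 * (1 - ?c) ^ 2 \<le> 1 * 1" by (intro mult_mono) auto
  then show ?thesis by (simp add: step'_def Let_def)
qed

lemma step_values: "s \<le> 0 \<Longrightarrow> step s = 0" "s \<ge> 1 \<Longrightarrow> step s = 1"
  by (simp_all add: step_def clamp01_def)

lemma step_mono: "s \<le> t \<Longrightarrow> step s \<le> step t"
  by (rule DERIV_nonneg_imp_nondecreasing) (use DERIV_step step'_nonneg in blast)+

lemma step_bounds: "0 \<le> step s" "step s \<le> 1"
proof -
  have "step (min 0 s) \<le> step s" "step s \<le> step (max 1 s)" by (intro step_mono; simp)+
  then show "0 \<le> step s" "step s \<le> 1" by (simp_all add: step_values)
qed

text \<open>A truncated paraboloid; squaring it makes it C1 across the sphere of radius
  \<epsilon>.\<close>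

definition bump :: "real \<Rightarrow> 'a::euclidean_space \<Rightarrow> real" where
  "bump \<epsilon> z = (max 0 (1 - (z \<bullet> z) / \<epsilon>\<^sup>2))\<^sup>2"

definition bump_grad :: "real \<Rightarrow> 'a::euclidean_space \<Rightarrow> 'a" where
  "bump_grad \<epsilon> z = (- 4 / \<epsilon>\<^sup>2 * max 0 (1 - (z \<bullet> z) / \<epsilon>\<^sup>2)) *\<^sub>R z"

lemma bump_has_derivative: "(bump \<epsilon> has_derivative (\<lambda>h. h \<bullet> bump_grad \<epsilon> z)) (at z)"
proof -
  have "((\<lambda>z. 1 - inverse (\<epsilon>\<^sup>2) * (z \<bullet> z)) has_derivative (\<lambda>h. - (inverse (\<epsilon>\<^sup>2) * (2 * (h \<bullet> z))))) (at z)"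
    by (auto intro!: derivative_eq_intros simp: inner_commute)
  from has_derivative_compose[OF this DERIV_max_square[unfolded has_field_derivative_def]]
  show ?thesis
    unfolding bump_def[abs_def] bump_grad_def divide_inverse by (simp add: o_def algebra_simps)
qed

lemma continuous_on_bump_grad: "continuous_on A (bump_grad \<epsilon>)"
  unfolding bump_grad_def[abs_def] divide_inverse by (intro continuous_intros)

lemma continuous_on_bump: "continuous_on A (bump \<epsilon>)"
  unfolding bump_def[abs_def] divide_inverse by (intro continuous_intros)

lemma bump_bounds: "0 \<le> bump \<epsilon> z" "bump \<epsilon> z \<le> 1"
proof -
  have "max 0 (1 - (z \<bullet> z) / \<epsilon>\<^sup>2) \<le> 1" by simp
  then show "0 \<le> bump \<epsilon> z" "bump \<epsilon> z \<le> 1" unfolding bump_def by (auto intro: power_le_one)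
qed

lemma bump_zero: "\<epsilon> > 0 \<Longrightarrow> norm z \<ge> \<epsilon> \<Longrightarrow> bump \<epsilon> z = 0" "\<epsilon> > 0 \<Longrightarrow> norm z \<ge> \<epsilon> \<Longrightarrow> bump_grad \<epsilon> z = 0"
proof -
  assume "\<epsilon> > 0" "norm z \<ge> \<epsilon>"
  then have "\<epsilon>\<^sup>2 \<le> z \<bullet> z" by (simp add: power_mono flip: power2_norm_eq_inner)
  then have "max 0 (1 - (z \<bullet> z) / \<epsilon>\<^sup>2) = 0" using \<open>\<epsilon> > 0\<close> by (simp add: field_simps)
  then show "bump \<epsilon> z = 0" "bump_grad \<epsilon> z = 0" by (simp_all add: bump_def bump_grad_def)
qed

lemma bump_grad_bound:
  assumes "\<epsilon> > 0"
  shows "norm (bump_grad \<epsilon> z) \<le> 4 / \<epsilon>"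
proof (cases "norm z \<ge> \<epsilon>")
  case False
  have "norm (bump_grad \<epsilon> z) = 4 / \<epsilon>\<^sup>2 * max 0 (1 - (z \<bullet> z) / \<epsilon>\<^sup>2) * norm z"
    by (simp add: bump_grad_def abs_mult)
  also have "\<dots> \<le> 4 / \<epsilon>\<^sup>2 * 1 * \<epsilon>"
    using False assms by (intro mult_mono) auto
  finally show ?thesis using assms by (simp add: power2_eq_square)
next
  case True
  then show ?thesis using assms bump_zero(2)[OF assms True] by simp
qed

text \<open>The value \<open>(1 - 1 / 4)\<^sup>2\<close> at half the radius; it is the factor
  \<open>9 / 16\<close> in the constants below.\<close>

lemma bump_lower:
  assumes "\<epsilon> > 0" "norm z \<le> \<epsilon> / 2"
  shows "9 / 16 \<le> bump \<epsilon> z"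
proof -
  have "z \<bullet> z \<le> (\<epsilon> / 2)\<^sup>2" using assms by (simp add: power_mono flip: power2_norm_eq_inner)
  then have "3 / 4 \<le> 1 - (z \<bullet> z) / \<epsilon>\<^sup>2" using assms by (simp add: field_simps power2_eq_square)
  then have "3 / 4 \<le> max 0 (1 - (z \<bullet> z) / \<epsilon>\<^sup>2)" by (rule max.coboundedI2)
  then have "(3 / 4)\<^sup>2 \<le> bump \<epsilon> z" unfolding bump_def by (rule power_mono) simp
  then show ?thesis by (simp add: power2_eq_square)
qed

lemma bump_minus: "bump \<epsilon> (- z) = bump \<epsilon> z" "bump_grad \<epsilon> (- z) = - bump_grad \<epsilon> z"
  by (simp_all add: bump_def bump_grad_def)

section \<open>Doubling of variables\<close>

lemma sets_pair_restrict_borel: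
  fixes M :: "'a::second_countable_topology set" and I :: "'b::second_countable_topology set"
  shows "sets (restrict_space borel M \<Otimes>\<^sub>M restrict_space borel I) = sets (restrict_space borel (M \<times> I))"
proof
  show "sets (restrict_space borel M \<Otimes>\<^sub>M restrict_space borel I) \<subseteq> sets (restrict_space borel (M \<times> I))"
    unfolding sets_pair_measure
  proof (rule sets.sigma_sets_subset')
    show "{a \<times> b |a b. a \<in> sets (restrict_space borel M) \<and> b \<in> sets (restrict_space borel I)}
      \<subseteq> sets (restrict_space borel (M \<times> I))"
    proof safe
      fix a b assume "a \<in> sets (restrict_space borel M)" "b \<in> sets (restrict_space borel I)"
      then obtain a' b' where "a = M \<inter> a'" "a' \<in> sets borel" "b = I \<inter> b'" "b' \<in> sets borel"
        by (auto simp: sets_restrict_space)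
      moreover from this have "a' \<times> b' \<in> sets (borel :: ('a \<times> 'b) measure)"
        unfolding borel_prod[symmetric] by blast
      ultimately show "a \<times> b \<in> sets (restrict_space borel (M \<times> I))"
        unfolding sets_restrict_space by (intro image_eqI[of _ _ "a' \<times> b'"]) auto
    qed
    show "space (restrict_space borel M) \<times> space (restrict_space borel I) \<in> sets (restrict_space borel (M \<times> I))"
      using sets.top[of "restrict_space borel (M \<times> I)"] by (simp add: space_restrict_space)
  qed
  show "sets (restrict_space borel (M \<times> I)) \<subseteq> sets (restrict_space borel M \<Otimes>\<^sub>M restrict_space borel I)"
  proof
    fix A assume "A \<in> sets (restrict_space borel (M \<times> I))"
    then obtain B where B: "B \<in> sets borel" "A = (M \<times> I) \<inter> B" by (auto simp: sets_restrict_space)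
    have "(\<lambda>x. x) \<in> restrict_space borel M \<rightarrow>\<^sub>M borel" "(\<lambda>x. x) \<in> restrict_space borel I \<rightarrow>\<^sub>M borel"
      by (rule measurable_restrict_space1, simp)+
    then have "(\<lambda>z. (fst z, snd z)) \<in> restrict_space borel M \<Otimes>\<^sub>M restrict_space borel I \<rightarrow>\<^sub>M borel \<Otimes>\<^sub>M borel"
      by (intro measurable_Pair) (auto intro: measurable_compose[OF measurable_fst] measurable_compose[OF measurable_snd])
    then have "(\<lambda>z. z) \<in> restrict_space borel M \<Otimes>\<^sub>M restrict_space borel I \<rightarrow>\<^sub>M borel"
      by (simp add: borel_prod)
    from measurable_sets[OF this B(1)]
    show "A \<in> sets (restrict_space borel M \<Otimes>\<^sub>M restrict_space borel I)"
      using B(2) by (simp add: space_pair_measure space_restrict_space Int_commute)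
  qed
qed

section \<open>Mollifiers in time\<close>

definition mol :: "real \<Rightarrow> real \<Rightarrow> real" where
  "mol \<delta> s = step' (s / \<delta>) / \<delta>"

definition mol' :: "real \<Rightarrow> real \<Rightarrow> real" where
  "mol' \<delta> s = step'' (s / \<delta>) / \<delta>\<^sup>2"

lemma DERIV_step_scaled:
  assumes "\<delta> > 0"
  shows "((\<lambda>s. step (s / \<delta>)) has_field_derivative mol \<delta> s) (at s)"
proof -
  have "((\<lambda>s. step (s / \<delta>)) has_field_derivative step' (s / \<delta>) * (1 / \<delta>)) (at s)"
    by (rule DERIV_chain2[where f = step, OF DERIV_step]) (use assms in \<open>auto intro!: derivative_eq_intros\<close>)
  then show ?thesis by (simp add: mol_def)
qed

lemma DERIV_mol:
  assumes "\<delta> > 0"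
  shows "(mol \<delta> has_field_derivative mol' \<delta> s) (at s)"
proof -
  have "((\<lambda>s. step' (s / \<delta>)) has_field_derivative step'' (s / \<delta>) * (1 / \<delta>)) (at s)"
    by (rule DERIV_chain2[where f = step', OF DERIV_step']) (use assms in \<open>auto intro!: derivative_eq_intros\<close>)
  from DERIV_cdivide[OF this, of \<delta>] show ?thesis
    unfolding mol_def[abs_def] mol'_def by (simp add: power2_eq_square)
qed

lemma continuous_on_mol': "continuous_on A (mol' \<delta>)"
  unfolding mol'_def[abs_def] divide_inverse
  by (intro continuous_on_mult continuous_on_const continuous_on_compose2[OF continuous_on_step''[of UNIV]] continuous_on_id) auto

lemma mol_nonneg: "\<delta> > 0 \<Longrightarrow> 0 \<le> mol \<delta> s"
  by (simp add: mol_def step'_nonneg)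

lemma mol_zero:
  assumes "\<delta> > 0" "s \<le> 0 \<or> s \<ge> \<delta>"
  shows "mol \<delta> s = 0"
proof -
  have "s / \<delta> \<le> 0 \<or> s / \<delta> \<ge> 1" using assms by (auto simp: divide_nonpos_pos)
  then show ?thesis by (auto simp: mol_def step'_zero)
qed

lemma mol_bound: "\<delta> > 0 \<Longrightarrow> \<bar>mol \<delta> s\<bar> \<le> 30 / \<delta>"
  using step'_bound[of "s / \<delta>"] step'_nonneg[of "s / \<delta>"] by (simp add: mol_def divide_right_mono)

lemma step''_bound: "\<bar>step'' s\<bar> \<le> 60"
proof -
  let ?c = "clamp01 s"
  have "\<bar>?c\<bar> \<le> 1" "\<bar>1 - ?c\<bar> \<le> 1" "\<bar>1 - 2 * ?c\<bar> \<le> 1" using clamp01_bounds[of s] by auto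
  then have "\<bar>?c\<bar> * \<bar>1 - ?c\<bar> * \<bar>1 - 2 * ?c\<bar> \<le> 1 * 1 * 1" by (intro mult_mono) auto
  then show ?thesis by (simp add: step''_def Let_def abs_mult)
qed

lemma mol'_bound: "\<delta> > 0 \<Longrightarrow> \<bar>mol' \<delta> s\<bar> \<le> 60 / \<delta>\<^sup>2"
  using step''_bound[of "s / \<delta>"] by (simp add: mol'_def divide_right_mono)

lemma mol_bump_measurable [measurable]:
  "mol \<delta> \<in> borel_measurable borel" "mol' \<delta> \<in> borel_measurable borel" "step \<in> borel_measurable borel"
  "bump \<epsilon> \<in> borel_measurable borel" "bump_grad \<epsilon> \<in> borel_measurable borel"
proof -
  have c: "continuous_on UNIV f" if "\<And>s. (f has_field_derivative f' s) (at s)" for f f' :: "real \<Rightarrow> real"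
    using that by (meson DERIV_isCont continuous_at_imp_continuous_on)
  have "continuous_on UNIV step'" by (rule c[OF DERIV_step'])
  then have [measurable]: "step' \<in> borel_measurable borel" by (rule borel_measurable_continuous_onI)
  show "mol \<delta> \<in> borel_measurable borel" unfolding mol_def[abs_def] by measurable
  have "continuous_on UNIV step" by (rule c[OF DERIV_step])
  then show "step \<in> borel_measurable borel" by (rule borel_measurable_continuous_onI)
qed (rule borel_measurable_continuous_onI, rule continuous_on_mol' continuous_on_bump continuous_on_bump_grad)+

text \<open>The primitive of the mollifier is \<open>step\<close>, so the mass that falls outside
  the time interval is known exactly.\<close>

lemma nn_integral_mol:
  assumes \<delta>: "\<delta> > 0" and T: "T > 0"
  shows "(\<integral>\<^sup>+s\<in>{0<..<T}. ennreal (mol \<delta> (t - s)) \<partial>lborel) = ennreal (step (t / \<delta>) - step ((t - T) / \<delta>))" (is ?A)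
    and "(\<integral>\<^sup>+s\<in>{0<..<T}. ennreal (mol \<delta> (s - t)) \<partial>lborel) = ennreal (step ((T - t) / \<delta>) - step (- t / \<delta>))" (is ?B)
proof -
  have ae: "(\<integral>\<^sup>+s\<in>{0<..<T}. f s \<partial>lborel) = (\<integral>\<^sup>+s\<in>{0..T}. f s \<partial>lborel)" for f :: "real \<Rightarrow> ennreal"
  proof (rule nn_integral_cong_AE)
    have "AE s in lborel. s \<noteq> 0 \<and> s \<noteq> T" using AE_lborel_singleton[of 0] AE_lborel_singleton[of T] by auto
    then show "AE s in lborel. f s * indicator {0<..<T} s = f s * indicator {0..T} s"
      by eventually_elim (auto simp: indicator_def)
  qed
  have "(\<integral>\<^sup>+s. ennreal (mol \<delta> (t - s)) * indicator {0..T} s \<partial>lborel) =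
      ennreal ((- step ((t - T) / \<delta>)) - (- step ((t - 0) / \<delta>)))"
  proof (rule nn_integral_FTC_Icc[where F = "\<lambda>s. - step ((t - s) / \<delta>)"])
    fix s
    have "((\<lambda>s. step ((t - s) / \<delta>)) has_field_derivative mol \<delta> (t - s) * (- 1)) (at s)"
      by (rule DERIV_chain2[OF DERIV_step_scaled[OF \<delta>]]) (auto intro!: derivative_eq_intros)
    from DERIV_minus[OF this]
    show "((\<lambda>s. - step ((t - s) / \<delta>)) has_field_derivative mol \<delta> (t - s)) (at s)"
      by simp
  qed (use T \<delta> in \<open>auto simp: mol_nonneg\<close>)
  then show ?A unfolding ae by (simp add: algebra_simps)
  have "(\<integral>\<^sup>+s. ennreal (mol \<delta> (s - t)) * indicator {0..T} s \<partial>lborel) =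
      ennreal (step ((T - t) / \<delta>) - step ((0 - t) / \<delta>))"
  proof (rule nn_integral_FTC_Icc[where F = "\<lambda>s. step ((s - t) / \<delta>)"])
    fix s
    have "((\<lambda>s. step ((s - t) / \<delta>)) has_field_derivative mol \<delta> (s - t) * 1) (at s)"
      by (rule DERIV_chain2[OF DERIV_step_scaled[OF \<delta>]]) (auto intro!: derivative_eq_intros)
    then show "((\<lambda>s. step ((s - t) / \<delta>)) has_field_derivative mol \<delta> (s - t)) (at s)"
      by simp
  qed (use T \<delta> in \<open>auto simp: mol_nonneg\<close>)
  then show ?B unfolding ae by simp
qed

text \<open>The situation after the pull-back. A point of \<open>M \<times> {0<..<T}\<close> is a
  label with a time; \<open>P\<close> is its position, \<open>V\<close> the velocity and
  \<open>F\<close> the flux there, \<open>b\<close> the divergence of the velocity, \<open>J\<close>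
  the Jacobian, \<open>w\<close> and \<open>w'\<close> are the two solutions. Of the geometry only
  Lipschitz bounds and the growth of balls remain. \<open>F_lip\<close> bounds a mixed second
  difference: the flux difference between two points is Lipschitz in the state, with a constant
  proportional to the distance of the points.\<close>

locale doubling =
  fixes \<mu> :: "'a::euclidean_space measure" and M :: "'a set" and T :: real and n :: nat
    and P V :: "'a \<times> real \<Rightarrow> 'a" and F :: "'a \<times> real \<Rightarrow> real \<Rightarrow> 'a" and J b w w' :: "'a \<times> real \<Rightarrow> real"
    and u0 :: "'a \<Rightarrow> real"
    and aL aU r0 j0 j1 B Kw KV KF LP \<kappa> LV LF :: real
  assumes T: "T > 0" and fin: "finite_measure \<mu>" and sets_\<mu>: "sets \<mu> = sets (restrict_space borel M)"
    and pos: "aL > 0" "aU > 0" "r0 > 0" "j0 > 0" "j1 > 0" "B > 0" "Kw > 0" "KV > 0" "KF > 0" "LP > 0" "\<kappa> > 0" "LV > 0" "LF > 0"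
    and ball_lower: "\<And>y r. y \<in> M \<Longrightarrow> 0 < r \<Longrightarrow> r \<le> r0 \<Longrightarrow> ennreal (aL * r ^ n) \<le> emeasure \<mu> (M \<inter> ball y r)"
    and ball_upper: "\<And>y r. 0 < r \<Longrightarrow> emeasure \<mu> (M \<inter> ball y r) \<le> ennreal (aU * r ^ n)"
    and meas: "J \<in> borel_measurable (\<mu> \<Otimes>\<^sub>M restrict_space lborel {0<..<T})"
      "b \<in> borel_measurable (\<mu> \<Otimes>\<^sub>M restrict_space lborel {0<..<T})"
      "w \<in> borel_measurable (\<mu> \<Otimes>\<^sub>M restrict_space lborel {0<..<T})"
      "w' \<in> borel_measurable (\<mu> \<Otimes>\<^sub>M restrict_space lborel {0<..<T})"
      "P \<in> borel_measurable (\<mu> \<Otimes>\<^sub>M restrict_space lborel {0<..<T})"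
      "V \<in> borel_measurable (\<mu> \<Otimes>\<^sub>M restrict_space lborel {0<..<T})"
      "(\<lambda>z. F (fst z) (snd z)) \<in> borel_measurable ((\<mu> \<Otimes>\<^sub>M restrict_space lborel {0<..<T}) \<Otimes>\<^sub>M borel)"
      "u0 \<in> borel_measurable \<mu>"
    and J_bounds: "\<And>X. X \<in> M \<times> {0<..<T} \<Longrightarrow> j0 \<le> J X" "\<And>X. X \<in> M \<times> {0<..<T} \<Longrightarrow> J X \<le> j1"
    and b_bound: "\<And>X. X \<in> M \<times> {0<..<T} \<Longrightarrow> \<bar>b X\<bar> \<le> B"
    and w_bound: "\<And>X. X \<in> M \<times> {0<..<T} \<Longrightarrow> \<bar>w X\<bar> \<le> Kw" "\<And>X. X \<in> M \<times> {0<..<T} \<Longrightarrow> \<bar>w' X\<bar> \<le> Kw"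
    and u0_bound: "\<And>y. y \<in> M \<Longrightarrow> \<bar>u0 y\<bar> \<le> Kw"
    and P_lip: "\<And>y y' t t'. y \<in> M \<Longrightarrow> y' \<in> M \<Longrightarrow> t \<in> {0..T} \<Longrightarrow> t' \<in> {0..T} \<Longrightarrow>
        norm (P (y, t) - P (y', t')) \<le> LP * (norm (y - y') + \<bar>t - t'\<bar>)"
    and P_low: "\<And>y y' t. y \<in> M \<Longrightarrow> y' \<in> M \<Longrightarrow> t \<in> {0..T} \<Longrightarrow> norm (y - y') \<le> \<kappa> * norm (P (y, t) - P (y', t))"
    and P_0: "\<And>y. y \<in> M \<Longrightarrow> P (y, 0) = y"
    and V_bound: "\<And>X. X \<in> M \<times> {0<..<T} \<Longrightarrow> norm (V X) \<le> KV"
    and V_lip: "\<And>X X'. X \<in> M \<times> {0<..<T} \<Longrightarrow> X' \<in> M \<times> {0<..<T} \<Longrightarrow>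
        norm (V X - V X') \<le> LV * (norm (fst X - fst X') + \<bar>snd X - snd X'\<bar>)"
    and F_bound: "\<And>X s. X \<in> M \<times> {0<..<T} \<Longrightarrow> \<bar>s\<bar> \<le> Kw \<Longrightarrow> norm (F X s) \<le> KF"
    and F_lip: "\<And>X X' s s'. X \<in> M \<times> {0<..<T} \<Longrightarrow> X' \<in> M \<times> {0<..<T} \<Longrightarrow> \<bar>s\<bar> \<le> Kw \<Longrightarrow> \<bar>s'\<bar> \<le> Kw \<Longrightarrow>
        norm ((F X s - F X' s) - (F X s' - F X' s')) \<le> LF * (norm (fst X - fst X') + \<bar>snd X - snd X'\<bar>) * \<bar>s - s'\<bar>"
begin

definition "stm = \<mu> \<Otimes>\<^sub>M restrict_space lborel {0<..<T}"
abbreviation "\<Omega> \<equiv> M \<times> {0<..<T}"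

text \<open>The entropy integrand of \<open>v\<close> for the test function
  \<open>\<tau> t * bump \<epsilon> (x - q)\<close>. The bracket in the first line is its material
  derivative: the label is fixed, so the position moves with velocity \<open>V\<close>.\<close>

definition S :: "('a \<times> real \<Rightarrow> real) \<Rightarrow> real \<Rightarrow> 'a \<Rightarrow> real \<Rightarrow> (real \<Rightarrow> real) \<Rightarrow> (real \<Rightarrow> real) \<Rightarrow> 'a \<times> real \<Rightarrow> real" where
  "S v k q \<epsilon> \<tau> \<tau>' X =
     \<bar>v X - k\<bar> * (\<tau>' (snd X) * bump \<epsilon> (P X - q) + \<tau> (snd X) * (V X \<bullet> bump_grad \<epsilon> (P X - q)))
     - sgn (v X - k) * k * b X * (\<tau> (snd X) * bump \<epsilon> (P X - q))
     + sgn (v X - k) * \<tau> (snd X) * ((F X (v X) - F X k) \<bullet> bump_grad \<epsilon> (P X - q))"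

definition entropy :: "('a \<times> real \<Rightarrow> real) \<Rightarrow> bool" where
  "entropy v \<longleftrightarrow> (\<forall>k q \<epsilon> \<tau> \<tau>'. \<epsilon> > 0 \<longrightarrow> (\<forall>t. (\<tau> has_field_derivative \<tau>' t) (at t)) \<longrightarrow>
     continuous_on UNIV \<tau>' \<longrightarrow> (\<forall>t\<in>{0..T}. 0 \<le> \<tau> t) \<longrightarrow> \<tau> T = 0 \<longrightarrow>
     0 \<le> (\<integral>X. J X * S v k q \<epsilon> \<tau> \<tau>' X \<partial>stm) + (\<integral>y. \<bar>u0 y - k\<bar> * (\<tau> 0 * bump \<epsilon> (y - q)) \<partial>\<mu>))"

lemma space_\<mu>: "space \<mu> = M"
  using sets_eq_imp_space_eq[OF sets_\<mu>] by (simp add: space_restrict_space)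

lemma space_stm: "space stm = \<Omega>"
  by (simp add: stm_def space_pair_measure space_\<mu> space_restrict_space)

lemma sets_stm: "sets stm = sets (restrict_space borel \<Omega>)"
proof -
  have "sets stm = sets (restrict_space borel M \<Otimes>\<^sub>M restrict_space borel {0<..<T})"
    unfolding stm_def by (intro sets_pair_measure_cong sets_\<mu> sets_restrict_space_cong) simp
  then show ?thesis by (simp only: sets_pair_restrict_borel)
qed

lemma finite_lam: "finite_measure (restrict_space lborel {0<..<T})"
  by (rule finite_measureI) (use T in \<open>simp add: emeasure_restrict_space space_restrict_space\<close>)

lemma finite_stm: "finite_measure stm"
  unfolding stm_def by (rule finite_measure_pair_measure[OF finite_lam fin])

lemma meas_stm [measurable]:
  "J \<in> borel_measurable stm" "b \<in> borel_measurable stm" "w \<in> borel_measurable stm" "w' \<in> borel_measurable stm"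
  "P \<in> borel_measurable stm" "V \<in> borel_measurable stm" "u0 \<in> borel_measurable \<mu>"
  using meas by (auto simp: stm_def)

lemma F_meas [measurable (raw)]:
  "f \<in> N \<rightarrow>\<^sub>M stm \<Longrightarrow> g \<in> borel_measurable N \<Longrightarrow> (\<lambda>x. F (f x) (g x)) \<in> borel_measurable N"
  using measurable_compose[OF measurable_Pair meas(7), of f N g] by (simp add: stm_def)

lemma id_\<mu> [measurable]: "(\<lambda>x. x) \<in> \<mu> \<rightarrow>\<^sub>M borel"
  by (subst measurable_cong_sets[OF sets_\<mu> refl]) (rule measurable_restrict_space1, simp)

lemma fst_snd_stm [measurable]: "fst \<in> stm \<rightarrow>\<^sub>M \<mu>" "fst \<in> stm \<rightarrow>\<^sub>M borel" "snd \<in> stm \<rightarrow>\<^sub>M borel"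
proof -
  show fst: "fst \<in> stm \<rightarrow>\<^sub>M \<mu>" unfolding stm_def by measurable
  show "fst \<in> stm \<rightarrow>\<^sub>M borel" using measurable_compose[OF fst id_\<mu>] by simp
  have "(\<lambda>x. x) \<in> restrict_space lborel {0<..<T} \<rightarrow>\<^sub>M borel" by (rule measurable_restrict_space1) simp
  then show "snd \<in> stm \<rightarrow>\<^sub>M borel" using measurable_compose[OF measurable_snd] unfolding stm_def by fastforce
qed

text \<open>The comparison kernel. The bump depends on positions, which mix label and time; this
  product of a time factor and a label factor can be integrated directly.\<close>

definition "kern \<delta> r X X' = mol \<delta> (snd X - snd X') * indicator {z. norm z < r} (fst X - fst X')"

lemma indicator_borel [measurable]: "(indicator {z::'a. norm z < r} :: 'a \<Rightarrow> real) \<in> borel_measurable borel"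
  by measurable

lemma kern_meas [measurable (raw)]:
  "f \<in> N \<rightarrow>\<^sub>M stm \<Longrightarrow> g \<in> N \<rightarrow>\<^sub>M stm \<Longrightarrow> (\<lambda>x. kern \<delta> r (f x) (g x)) \<in> borel_measurable N"
proof -
  assume f: "f \<in> N \<rightarrow>\<^sub>M stm" and g: "g \<in> N \<rightarrow>\<^sub>M stm"
  note [measurable] = measurable_compose[OF f fst_snd_stm(2)] measurable_compose[OF g fst_snd_stm(2)]
    measurable_compose[OF f fst_snd_stm(3)] measurable_compose[OF g fst_snd_stm(3)]
  show ?thesis unfolding kern_def by measurable
qed

lemma kern_nonneg: "\<delta> > 0 \<Longrightarrow> 0 \<le> kern \<delta> r X X'"
  by (simp add: kern_def mol_nonneg)

lemma nn_integral_stm: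
  assumes "f \<in> borel_measurable stm"
  shows "(\<integral>\<^sup>+X. f X \<partial>stm) = (\<integral>\<^sup>+y. (\<integral>\<^sup>+t\<in>{0<..<T}. f (y, t) \<partial>lborel) \<partial>\<mu>)"
proof -
  interpret lam: finite_measure "restrict_space lborel {0<..<T}" by (rule finite_lam)
  have "(\<integral>\<^sup>+X. f X \<partial>stm) = (\<integral>\<^sup>+y. \<integral>\<^sup>+t. f (y, t) \<partial>restrict_space lborel {0<..<T} \<partial>\<mu>)"
    using lam.nn_integral_fst[of f \<mu>] assms by (simp add: stm_def)
  then show ?thesis by (simp add: nn_integral_restrict_space)
qed

lemma ball_meas: "(\<integral>\<^sup>+y'. ennreal (indicator {z. norm z < r} (y - y')) \<partial>\<mu>) = emeasure \<mu> (M \<inter> ball y r)"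
  "(\<integral>\<^sup>+y'. ennreal (indicator {z. norm z < r} (y' - y)) \<partial>\<mu>) = emeasure \<mu> (M \<inter> ball y r)"
proof -
  have "M \<inter> ball y r \<in> sets \<mu>" by (auto simp: sets_\<mu> sets_restrict_space)
  then have "emeasure \<mu> (M \<inter> ball y r) = (\<integral>\<^sup>+y'. indicator (M \<inter> ball y r) y' \<partial>\<mu>)" by simp
  also have "\<dots> = (\<integral>\<^sup>+y'. ennreal (indicator {z. norm z < r} (y - y')) \<partial>\<mu>)"
    by (intro nn_integral_cong) (auto simp: space_\<mu> indicator_def dist_norm)
  finally show "(\<integral>\<^sup>+y'. ennreal (indicator {z. norm z < r} (y - y')) \<partial>\<mu>) = emeasure \<mu> (M \<inter> ball y r)" ..
  then show "(\<integral>\<^sup>+y'. ennreal (indicator {z. norm z < r} (y' - y)) \<partial>\<mu>) = emeasure \<mu> (M \<inter> ball y r)"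
    by (subst (asm) norm_minus_commute[abs_def, symmetric] | simp add: indicator_def norm_minus_commute)+
qed

text \<open>The mollifier looks backwards from \<open>X\<close>, so integrating out the earlier
  point loses mass only near time 0. There the exact factor is kept because it is needed for a lower
  bound; in the other order an upper bound suffices.\<close>

lemma kern_integral:
  assumes \<delta>: "\<delta> > 0" and X: "X \<in> \<Omega>"
  shows "(\<integral>\<^sup>+X'. ennreal (kern \<delta> r X X') \<partial>stm) = emeasure \<mu> (M \<inter> ball (fst X) r) * ennreal (step (snd X / \<delta>))"
    and "(\<integral>\<^sup>+X'. ennreal (kern \<delta> r X' X) \<partial>stm) \<le> emeasure \<mu> (M \<inter> ball (fst X) r)"
proof -
  obtain y t where [simp]: "X = (y, t)" by (cases X)
  have y: "y \<in> M" "0 < t" "t < T" using X by auto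
  have Xs: "X \<in> space stm" using X space_stm by simp
  have [measurable]: "(\<lambda>X'. kern \<delta> r X X') \<in> borel_measurable stm" "(\<lambda>X'. kern \<delta> r X' X) \<in> borel_measurable stm"
    using Xs by measurable
  have "(t - T) / \<delta> \<le> 0" using y \<delta> by (simp add: divide_nonpos_pos)
  then have 0: "step ((t - T) / \<delta>) = 0" by (rule step_values)
  have "(\<integral>\<^sup>+X'. ennreal (kern \<delta> r X X') \<partial>stm) =
    (\<integral>\<^sup>+y'. ennreal (indicator {z. norm z < r} (y - y')) * (\<integral>\<^sup>+t'\<in>{0<..<T}. ennreal (mol \<delta> (t - t')) \<partial>lborel) \<partial>\<mu>)"
    by (subst nn_integral_stm) (auto simp: kern_def ennreal_mult' mol_nonneg[OF \<delta>] nn_integral_cmult[symmetric] mult_ac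
        intro!: nn_integral_cong)
  also have "\<dots> = emeasure \<mu> (M \<inter> ball y r) * ennreal (step (t / \<delta>))"
    by (subst nn_integral_mol[OF \<delta> T], subst nn_integral_multc) (auto simp: ball_meas 0)
  finally show "(\<integral>\<^sup>+X'. ennreal (kern \<delta> r X X') \<partial>stm) = emeasure \<mu> (M \<inter> ball (fst X) r) * ennreal (step (snd X / \<delta>))"
    by simp
  have "(\<integral>\<^sup>+X'. ennreal (kern \<delta> r X' X) \<partial>stm) =
    (\<integral>\<^sup>+y'. ennreal (indicator {z. norm z < r} (y' - y)) * (\<integral>\<^sup>+t'\<in>{0<..<T}. ennreal (mol \<delta> (t' - t)) \<partial>lborel) \<partial>\<mu>)"
    by (subst nn_integral_stm) (auto simp: kern_def ennreal_mult' mol_nonneg[OF \<delta>] nn_integral_cmult[symmetric] mult_ac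
        intro!: nn_integral_cong)
  also have "\<dots> = emeasure \<mu> (M \<inter> ball y r) * ennreal (step ((T - t) / \<delta>) - step (- t / \<delta>))"
    by (subst nn_integral_mol[OF \<delta> T], subst nn_integral_multc) (auto simp: ball_meas)
  also have "\<dots> \<le> emeasure \<mu> (M \<inter> ball y r) * 1"
    using step_bounds[of "(T - t) / \<delta>"] step_bounds[of "- t / \<delta>"]
    by (intro mult_left_mono) (auto simp: ennreal_le_1)
  finally show "(\<integral>\<^sup>+X'. ennreal (kern \<delta> r X' X) \<partial>stm) \<le> emeasure \<mu> (M \<inter> ball (fst X) r)" by simp
qed

end

locale doubling_entropy = doubling +
  assumes ent: "entropy w" "entropy w'"
begin

sublocale \<mu>: finite_measure \<mu> by (rule fin)
sublocale stm: finite_measure stm by (rule finite_stm)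
sublocale PP: pair_sigma_finite stm stm ..
sublocale PM: pair_sigma_finite stm \<mu> ..

text \<open>By \<open>near\<close>, positions closer than \<epsilon> have labels closer than
  \<open>\<kappa>1 * \<epsilon>\<close>, and labels closer than
  \<open>\<kappa>2 * \<epsilon>\<close> have positions within \<open>\<epsilon> / 2\<close>.
  \<open>C1\<close> collects the rates of the velocity, flux and divergence terms; in the first two,
  4 comes from the bound \<open>4 / \<epsilon>\<close> of the bump gradient and
  \<open>\<kappa>1 + 1\<close> from the distance in label and time.\<close>

definition "\<kappa>1 = \<kappa> * (1 + LP)"
definition "\<kappa>2 = 1 / (4 * LP)"
definition "C1 = 4 * LV * (\<kappa>1 + 1) + 4 * LF * (\<kappa>1 + 1) + B"
definition "cL = 9 / 16 * j0\<^sup>2 * aL * \<kappa>2 ^ n"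
definition "cU = j1\<^sup>2 * C1 * aU * \<kappa>1 ^ n"
definition "\<Lambda> = cU / cL"
text \<open>In the limit \<open>\<epsilon> \<rightarrow> 0\<close> doubling yields \<open>cL * (\<integral> - \<psi>' * d) \<le> cU * (\<integral> \<psi> * d)\<close>; the weight \<open>\<psi>\<close> is chosen
  such that \<open>- \<psi>' - \<Lambda> * \<psi>\<close> is strictly positive.\<close>

definition "\<psi> t = exp (- \<Lambda> * t) * (T - t)"
definition "\<psi>' t = - \<Lambda> * \<psi> t - exp (- \<Lambda> * t)"
text \<open>\<open>C2\<close> multiplies the oscillations of \<open>w'\<close> and \<open>b\<close>,
  which vanish in the limit. \<open>C3 / \<epsilon>\<close> bounds the entropy integrand without its
  time derivative in the initial layer; it is \<open>S_bound\<close> for \<open>A = 1\<close>,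
  \<open>A' = 0\<close>.\<close>

definition "C2 = \<Lambda> * T + 1 + C1 * T + Kw * T"
definition "C3 = 8 * Kw * KV + Kw * B + 8 * KF"
text \<open>The conditions give in turn \<open>\<epsilon>\<^sup>2 \<le> \<epsilon>\<close>, the
  displacement bound in \<open>near\<close>, the range of \<open>ball_lower\<close>, and room for
  the initial layer before time \<open>T\<close>.\<close>

definition "adm \<epsilon> \<longleftrightarrow> 0 < \<epsilon> \<and> \<epsilon> \<le> 1 \<and> LP * \<epsilon> \<le> 1 / 4 \<and> \<kappa>2 * \<epsilon> \<le> r0 \<and> \<epsilon>\<^sup>2 < T"
definition "d X = \<bar>w X - w' X\<bar>"

lemma const_pos: "\<kappa>1 > 0" "\<kappa>2 > 0" "C1 > 0" "cL > 0" "cU > 0" "\<Lambda> > 0" "C2 > 0" "C3 > 0"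
proof -
  show k: "\<kappa>1 > 0" "\<kappa>2 > 0" using pos by (simp_all add: \<kappa>1_def \<kappa>2_def)
  show C: "C1 > 0" unfolding C1_def using pos k by (intro add_pos_pos mult_pos_pos) simp_all
  show c: "cL > 0" "cU > 0" using pos k C by (simp_all add: cL_def cU_def)
  show L: "\<Lambda> > 0" using c by (simp add: \<Lambda>_def)
  show "C2 > 0" unfolding C2_def using pos C T L by (intro add_pos_pos mult_pos_pos) simp_all
  show "C3 > 0" unfolding C3_def using pos by (intro add_pos_pos mult_pos_pos) simp_all
qed

lemma DERIV_\<psi>: "(\<psi> has_field_derivative \<psi>' t) (at t)"
  unfolding \<psi>_def[abs_def] \<psi>'_def by (auto intro!: derivative_eq_intros simp: \<psi>_def algebra_simps)

lemma \<psi>_bounds: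
  assumes "t \<in> {0..T}"
  shows "0 \<le> \<psi> t" "\<psi> t \<le> T" "\<psi>' t \<le> 0" "\<bar>\<psi>' t\<bar> \<le> \<Lambda> * T + 1"
proof -
  have e: "exp (- \<Lambda> * t) \<le> 1" using assms const_pos(6) by simp
  show p: "0 \<le> \<psi> t" using assms by (simp add: \<psi>_def)
  have "exp (- \<Lambda> * t) * (T - t) \<le> 1 * T" using assms e by (intro mult_mono) auto
  then show p2: "\<psi> t \<le> T" by (simp add: \<psi>_def)
  have 1: "0 \<le> \<Lambda> * \<psi> t" "\<Lambda> * \<psi> t \<le> \<Lambda> * T" using p p2 const_pos(6) by (simp_all add: mult_left_mono)
  have "- \<psi>' t = \<Lambda> * \<psi> t + exp (- \<Lambda> * t)" by (simp add: \<psi>'_def)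
  moreover have "0 < exp (- \<Lambda> * t)" by simp
  ultimately show "\<psi>' t \<le> 0" "\<bar>\<psi>' t\<bar> \<le> \<Lambda> * T + 1" using 1 e by linarith+
qed

lemma \<psi>_measurable [measurable]: "\<psi> \<in> borel_measurable borel" "\<psi>' \<in> borel_measurable borel"
  unfolding \<psi>_def[abs_def] \<psi>'_def[abs_def] by measurable

lemma \<Omega>_iff: "X \<in> \<Omega> \<longleftrightarrow> fst X \<in> M \<and> 0 < snd X \<and> snd X < T"
  by (cases X) auto

lemma integrable_bounded:
  assumes "finite_measure N" "f \<in> borel_measurable N" "\<And>x. x \<in> space N \<Longrightarrow> \<bar>f x\<bar> \<le> (C::real)"
  shows "integrable N f"
proof -
  interpret finite_measure N by fact
  show ?thesis by (rule integrable_const_bound[of _ C]) (use assms in auto)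
qed

lemma S_measurable [measurable (raw)]:
  assumes [measurable]: "v \<in> borel_measurable stm" "k \<in> borel_measurable N" "q \<in> borel_measurable N"
    "f \<in> N \<rightarrow>\<^sub>M stm" "(\<lambda>x. \<tau> x (snd (f x))) \<in> borel_measurable N" "(\<lambda>x. \<tau>' x (snd (f x))) \<in> borel_measurable N"
  shows "(\<lambda>x. S v (k x) (q x) \<epsilon> (\<tau> x) (\<tau>' x) (f x)) \<in> borel_measurable N"
  unfolding S_def by measurable

text \<open>Mostly a tool for integrability, where growth as \<epsilon> tends to 0 does no harm; in
  the initial layer, however, its order \<open>1 / \<epsilon>\<close> without a time derivative is
  essential.\<close>

lemma S_bound:
  assumes X: "X \<in> \<Omega>" and v: "\<bar>v X\<bar> \<le> Kw" and k: "\<bar>k\<bar> \<le> Kw" and \<epsilon>: "\<epsilon> > 0"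
    and A: "\<bar>\<tau> (snd X)\<bar> \<le> A" "\<bar>\<tau>' (snd X)\<bar> \<le> A'"
  shows "\<bar>S v k q \<epsilon> \<tau> \<tau>' X\<bar> \<le> 2 * Kw * (A' + A * (KV * (4 / \<epsilon>))) + Kw * B * A + A * (2 * KF * (4 / \<epsilon>))"
proof -
  let ?t = "snd X" and ?\<rho> = "bump \<epsilon> (P X - q)" and ?g = "bump_grad \<epsilon> (P X - q)"
  have \<rho>: "\<bar>?\<rho>\<bar> \<le> 1" using bump_bounds[of \<epsilon> "P X - q"] by simp
  have g: "norm ?g \<le> 4 / \<epsilon>" by (rule bump_grad_bound[OF \<epsilon>])
  have A0: "0 \<le> A" "0 \<le> A'" using A by auto
  have "\<bar>V X \<bullet> ?g\<bar> \<le> norm (V X) * norm ?g" by (rule Cauchy_Schwarz_ineq2)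
  also have "\<dots> \<le> KV * (4 / \<epsilon>)" using V_bound[OF X] g pos by (intro mult_mono) auto
  finally have Vg: "\<bar>V X \<bullet> ?g\<bar> \<le> KV * (4 / \<epsilon>)" .
  have "\<bar>(F X (v X) - F X k) \<bullet> ?g\<bar> \<le> norm (F X (v X) - F X k) * norm ?g" by (rule Cauchy_Schwarz_ineq2)
  also have "norm (F X (v X) - F X k) \<le> norm (F X (v X)) + norm (F X k)" by (rule norm_triangle_ineq4)
  also have "\<dots> \<le> 2 * KF" using F_bound[OF X v] F_bound[OF X k] by simp
  also have "2 * KF * norm ?g \<le> 2 * KF * (4 / \<epsilon>)" using g pos by (intro mult_left_mono) auto
  finally have Fg: "\<bar>(F X (v X) - F X k) \<bullet> ?g\<bar> \<le> 2 * KF * (4 / \<epsilon>)" by (simp add: mult_right_mono)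
  have "\<bar>\<tau>' ?t * ?\<rho> + \<tau> ?t * (V X \<bullet> ?g)\<bar> \<le> \<bar>\<tau>' ?t\<bar> * \<bar>?\<rho>\<bar> + \<bar>\<tau> ?t\<bar> * \<bar>V X \<bullet> ?g\<bar>"
    by (metis abs_mult abs_triangle_ineq)
  also have "\<dots> \<le> A' * 1 + A * (KV * (4 / \<epsilon>))" using A A0 \<rho> Vg by (intro add_mono mult_mono) auto
  finally have 1: "\<bar>\<bar>v X - k\<bar> * (\<tau>' ?t * ?\<rho> + \<tau> ?t * (V X \<bullet> ?g))\<bar> \<le> 2 * Kw * (A' + A * (KV * (4 / \<epsilon>)))"
    unfolding abs_mult using v k pos by (intro mult_mono) auto
  have sg: "\<bar>sgn (v X - k)\<bar> \<le> 1" by (simp add: sgn_real_def)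
  have 2: "\<bar>sgn (v X - k) * k * b X * (\<tau> ?t * ?\<rho>)\<bar> \<le> 1 * Kw * B * (A * 1)"
    unfolding abs_mult using sg k b_bound[OF X] A \<rho> A0 pos by (intro mult_mono) auto
  have 3: "\<bar>sgn (v X - k) * \<tau> ?t * ((F X (v X) - F X k) \<bullet> ?g)\<bar> \<le> 1 * A * (2 * KF * (4 / \<epsilon>))"
    unfolding abs_mult using sg A Fg A0 by (intro mult_mono) auto
  show ?thesis using 1 2 3 unfolding S_def by linarith
qed

text \<open>The time mollifier \<open>mol\<close> is one-sided: as a function of \<open>X\<close> the test function of \<open>Z\<close> vanishes at
  time 0, so that only \<open>Z'\<close> comes with an initial term.\<close>

definition "Z \<epsilon> X X' = S w (w' X') (P X') \<epsilon> (\<lambda>s. mol (\<epsilon>\<^sup>2) (s - snd X') * \<psi> s)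
    (\<lambda>s. mol' (\<epsilon>\<^sup>2) (s - snd X') * \<psi> s + mol (\<epsilon>\<^sup>2) (s - snd X') * \<psi>' s) X"

definition "Z' \<epsilon> X X' = S w' (w X) (P X) \<epsilon> (\<lambda>s. mol (\<epsilon>\<^sup>2) (snd X - s) * \<psi> (snd X))
    (\<lambda>s. - mol' (\<epsilon>\<^sup>2) (snd X - s) * \<psi> (snd X)) X'"

text \<open>The derivatives of the mollifiers, singular as \<open>\<epsilon> \<rightarrow> 0\<close>, cancel in the sum.\<close>

lemma Z_sum:
  fixes X X' \<epsilon>
  defines "a \<equiv> \<bar>w X - w' X'\<bar>" and "sg \<equiv> sgn (w X - w' X')" and "\<theta> \<equiv> mol (\<epsilon>\<^sup>2) (snd X - snd X')"
    and "\<rho> \<equiv> bump \<epsilon> (P X - P X')" and "g \<equiv> bump_grad \<epsilon> (P X - P X')" and "p \<equiv> \<psi> (snd X)" and "p' \<equiv> \<psi>' (snd X)"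
  shows "Z \<epsilon> X X' + Z' \<epsilon> X X' = \<theta> * (a * (p' * \<rho> + p * ((V X - V X') \<bullet> g))
      + p * (sg * (w X * b X' - w' X' * b X) * \<rho>)
      + p * (sg * (((F X (w X) - F X' (w X)) - (F X (w' X') - F X' (w' X'))) \<bullet> g)))"
proof -
  \<comment> \<open>Exchanging the points reverses both the sign function and the bump gradient.
    Hence the flux terms combine into a mixed second difference, while the velocity terms, without a
    sign function, combine into \<open>V X - V X'\<close>.\<close>
  have 1: "\<bar>w' X' - w X\<bar> = a" "sgn (w' X' - w X) = - sg"
    by (auto simp: a_def sg_def sgn_real_def)
  have 2: "bump \<epsilon> (P X' - P X) = \<rho>" "bump_grad \<epsilon> (P X' - P X) = - g"
    using bump_minus[of \<epsilon> "P X - P X'"] by (simp_all add: \<rho>_def g_def)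
  show ?thesis
    unfolding Z_def Z'_def S_def 1 2
    unfolding a_def[symmetric] sg_def[symmetric] \<rho>_def[symmetric] g_def[symmetric] \<theta>_def[symmetric] p_def[symmetric] p'_def[symmetric]
    by (simp add: inner_diff_left inner_minus_right algebra_simps)
qed

text \<open>A time lag of \<open>\<epsilon>\<^sup>2\<close> displaces a point by at most
  \<open>LP * \<epsilon>\<^sup>2\<close>, so at scale \<epsilon> the distance of positions at
  slightly different times is comparable to the distance of labels. Time 0 is allowed for
  \<open>X'\<close> so that a point can be compared with an initial label.\<close>

lemma near:
  assumes X: "X \<in> \<Omega>" "X' \<in> M \<times> {0..<T}" and \<epsilon>: "adm \<epsilon>"
    and t: "\<bar>snd X - snd X'\<bar> \<le> \<epsilon>\<^sup>2"
  shows "norm (P X - P X') < \<epsilon> \<Longrightarrow> norm (fst X - fst X') < \<kappa>1 * \<epsilon>"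
    and "norm (fst X - fst X') < \<kappa>2 * \<epsilon> \<Longrightarrow> norm (P X - P X') \<le> \<epsilon> / 2"
proof -
  obtain y t y' t' where [simp]: "X = (y, t)" "X' = (y', t')" by (cases X, cases X')
  have in_M: "y \<in> M" "y' \<in> M" "t \<in> {0..T}" "t' \<in> {0..T}" using X by auto
  have e: "0 < \<epsilon>" "\<epsilon> \<le> 1" "LP * \<epsilon> \<le> 1 / 4" using \<epsilon> by (auto simp: adm_def)
  have e2: "\<epsilon>\<^sup>2 \<le> \<epsilon>" using e by (simp add: power2_eq_square mult_left_le)
  have tt: "\<bar>t - t'\<bar> \<le> \<epsilon>\<^sup>2" using t by simp
  show "norm (fst X - fst X') < \<kappa>1 * \<epsilon>" if "norm (P X - P X') < \<epsilon>"
  proof -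
    have "norm (y - y') \<le> \<kappa> * norm (P (y, t) - P (y', t))" by (rule P_low[OF in_M(1,2,3)])
    also have "norm (P (y, t) - P (y', t)) \<le> norm (P (y, t) - P (y', t')) + norm (P (y', t') - P (y', t))"
      using norm_triangle_ineq[of "P (y, t) - P (y', t')" "P (y', t') - P (y', t)"] by simp
    also have "norm (P (y', t') - P (y', t)) \<le> LP * \<bar>t - t'\<bar>"
      using P_lip[OF in_M(2,2,4,3)] by (simp add: abs_minus_commute)
    also have "LP * \<bar>t - t'\<bar> \<le> LP * \<epsilon>" using tt e2 pos by (intro mult_left_mono) auto
    also have "norm (P (y, t) - P (y', t')) < \<epsilon>" using that by simp
    finally have "norm (y - y') < \<kappa> * (\<epsilon> + LP * \<epsilon>)" using pos by simp
    then show ?thesis by (simp add: \<kappa>1_def algebra_simps)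
  qed
  show "norm (P X - P X') \<le> \<epsilon> / 2" if "norm (fst X - fst X') < \<kappa>2 * \<epsilon>"
  proof -
    have "norm (P X - P X') \<le> LP * (norm (y - y') + \<bar>t - t'\<bar>)" using P_lip[OF in_M] by simp
    also have "\<dots> \<le> LP * (\<kappa>2 * \<epsilon> + \<epsilon>\<^sup>2)" using that tt pos by (intro mult_left_mono add_mono) auto
    also have "\<dots> = \<epsilon> / 4 + LP * \<epsilon> * \<epsilon>" using pos by (simp add: \<kappa>2_def field_simps power2_eq_square)
    also have "LP * \<epsilon> * \<epsilon> \<le> 1 / 4 * \<epsilon>" using e by (intro mult_right_mono) auto
    finally show ?thesis by simp
  qed
qed

text \<open>\<open>G1\<close> is a minorant of the favourable term with \<open>\<psi>'\<close>,
  restricted to labels where the bump is at least \<open>9 / 16\<close>; \<open>G2\<close> is a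
  majorant of everything else on the larger ball. In both the difference of \<open>w\<close> and
  \<open>w'\<close> at two points is replaced by \<open>d X\<close> at one point; the price is the
  oscillation of \<open>w'\<close> in \<open>G2\<close>.\<close>

definition "G1 \<epsilon> X X' = 9 / 16 * j0\<^sup>2 * (- \<psi>' (snd X)) * d X * kern (\<epsilon>\<^sup>2) (\<kappa>2 * \<epsilon>) X X'"
definition "G2 \<epsilon> X X' = (j1\<^sup>2 * C1 * \<psi> (snd X) * d X + j1\<^sup>2 * C2 * (\<bar>w' X - w' X'\<bar> + \<bar>b X - b X'\<bar>))
    * kern (\<epsilon>\<^sup>2) (\<kappa>1 * \<epsilon>) X X'"

lemma G_nonneg:
  assumes "X \<in> \<Omega>" "\<epsilon> > 0"
  shows "0 \<le> G1 \<epsilon> X X'" "0 \<le> G2 \<epsilon> X X'"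
proof -
  have t: "snd X \<in> {0..T}" using assms by (auto simp: \<Omega>_iff)
  have k: "0 \<le> kern (\<epsilon>\<^sup>2) r X X'" for r using assms by (intro kern_nonneg) simp
  show "0 \<le> G1 \<epsilon> X X'" unfolding G1_def using \<psi>_bounds[OF t] k
    by (intro mult_nonneg_nonneg) (simp_all add: d_def)
  show "0 \<le> G2 \<epsilon> X X'" unfolding G2_def using \<psi>_bounds[OF t] k const_pos
    by (intro mult_nonneg_nonneg add_nonneg_nonneg) (simp_all add: d_def)
qed

lemma Z_pointwise:
  assumes X: "X \<in> \<Omega>" "X' \<in> \<Omega>" and \<epsilon>: "adm \<epsilon>"
  shows "J X * J X' * (Z \<epsilon> X X' + Z' \<epsilon> X X') \<le> G2 \<epsilon> X X' - G1 \<epsilon> X X'"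
proof -
  define a sg \<theta> \<rho> g p p' where defs: "a = \<bar>w X - w' X'\<bar>" "sg = sgn (w X - w' X')"
    "\<theta> = mol (\<epsilon>\<^sup>2) (snd X - snd X')" "\<rho> = bump \<epsilon> (P X - P X')" "g = bump_grad \<epsilon> (P X - P X')"
    "p = \<psi> (snd X)" "p' = \<psi>' (snd X)"
  define e where "e = \<bar>w' X - w' X'\<bar>"
  define \<beta> where "\<beta> = \<bar>b X - b X'\<bar>"
  define \<chi>1 \<chi>2 :: real where \<chi>: "\<chi>1 = indicator {z. norm z < \<kappa>1 * \<epsilon>} (fst X - fst X')"
    "\<chi>2 = indicator {z. norm z < \<kappa>2 * \<epsilon>} (fst X - fst X')"
  have ep: "0 < \<epsilon>" "\<epsilon> \<le> 1" "0 < \<epsilon>\<^sup>2" using \<epsilon> by (auto simp: adm_def)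
  have t: "snd X \<in> {0..T}" using X by (auto simp: \<Omega>_iff)
  note p = \<psi>_bounds[OF t, folded defs]
  have \<theta>0: "0 \<le> \<theta>" using ep by (simp add: defs mol_nonneg)
  have \<rho>: "0 \<le> \<rho>" "\<rho> \<le> 1" by (simp_all add: defs bump_bounds)
  have nn: "0 \<le> d X" "0 \<le> e" "0 \<le> \<beta>" "0 \<le> a" by (simp_all add: d_def e_def \<beta>_def defs)
  have ade: "d X - e \<le> a" "a \<le> d X + e" by (auto simp: defs d_def e_def)
  have \<chi>b: "0 \<le> \<chi>1" "\<chi>1 \<le> 1" "0 \<le> \<chi>2" "\<chi>2 \<le> 1" by (auto simp: \<chi> indicator_def)
  let ?br = "a * (p' * \<rho> + p * ((V X - V X') \<bullet> g)) + p * (sg * (w X * b X' - w' X' * b X) * \<rho>)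
      + p * (sg * (((F X (w X) - F X' (w X)) - (F X (w' X') - F X' (w' X'))) \<bullet> g))"
  let ?E = "C1 * p * d X + C2 * (e + \<beta>)"
  have E0: "0 \<le> ?E" using p nn const_pos by (intro add_nonneg_nonneg mult_nonneg_nonneg) simp_all
  \<comment> \<open>A nonzero time factor forces a positive time lag below
    \<open>\<epsilon>\<^sup>2\<close>, as \<open>near\<close> requires.\<close>
  have key: "?br \<le> \<chi>1 * ?E - 9 / 16 * (- p') * d X * \<chi>2" if th: "\<theta> \<noteq> 0"
  proof -
    have "\<not> (snd X - snd X' \<le> 0 \<or> snd X - snd X' \<ge> \<epsilon>\<^sup>2)"
      using th mol_zero[OF ep(3)] by (auto simp: defs)
    then have tt: "\<bar>snd X - snd X'\<bar> \<le> \<epsilon>\<^sup>2" by auto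
    have X'2: "X' \<in> M \<times> {0..<T}" using X(2) by (auto simp: \<Omega>_iff mem_Times_iff)
    note near = near[OF X(1) X'2 \<epsilon> tt]
    show ?thesis
    proof (cases "norm (P X - P X') < \<epsilon>")
      case False
      then have z: "\<rho> = 0" "g = 0" using bump_zero[OF ep(1), of "P X - P X'"] by (simp_all add: defs not_less)
      \<comment> \<open>Off the support of the bump the left side is 0, so the negative term on the
        right has to vanish too: labels closer than \<open>\<kappa>2 * \<epsilon>\<close> would put
        the positions within \<open>\<epsilon> / 2\<close>.\<close>
      have "\<not> norm (fst X - fst X') < \<kappa>2 * \<epsilon>" using near(2) False ep by auto
      then have "\<chi>2 = 0" by (simp add: \<chi>)
      then show ?thesis using z E0 \<chi>b by simp
    next
      case True
      then have \<chi>1: "\<chi>1 = 1" using near(1) by (simp add: \<chi>)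
      let ?D = "norm (fst X - fst X') + \<bar>snd X - snd X'\<bar>"
      have "\<epsilon>\<^sup>2 \<le> \<epsilon>" using ep by (simp add: power2_eq_square mult_left_le)
      then have D: "?D \<le> (\<kappa>1 + 1) * \<epsilon>" using near(1)[OF True] tt by (simp add: algebra_simps)
      have gb: "norm g \<le> 4 / \<epsilon>" unfolding defs by (rule bump_grad_bound[OF ep(1)])
      have D0: "0 \<le> ?D" by simp
      \<comment> \<open>The distance, at most \<open>(\<kappa>1 + 1) * \<epsilon>\<close>, cancels
        against the gradient bound \<open>4 / \<epsilon>\<close>.\<close>
      have lip: "\<bar>v \<bullet> g\<bar> \<le> 4 * L * (\<kappa>1 + 1)" if "norm v \<le> L * ?D" "L \<ge> 0" for v L
      proof -
        have "\<bar>v \<bullet> g\<bar> \<le> norm v * norm g" by (rule Cauchy_Schwarz_ineq2)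
        also have "\<dots> \<le> (L * ((\<kappa>1 + 1) * \<epsilon>)) * (4 / \<epsilon>)"
          using that D gb const_pos ep by (intro mult_mono order_trans[OF that(1)]) auto
        also have "\<dots> = 4 * L * (\<kappa>1 + 1)" using ep by simp
        finally show ?thesis .
      qed
      have V1: "(V X - V X') \<bullet> g \<le> 4 * LV * (\<kappa>1 + 1)"
        using lip[OF V_lip[OF X]] pos by fastforce
      note wb = w_bound(1)[OF X(1)] w_bound(2)[OF X(2)]
      let ?F = "(F X (w X) - F X' (w X)) - (F X (w' X') - F X' (w' X'))"
      have "norm ?F \<le> (LF * a) * ?D"
        using F_lip[OF X wb] by (simp add: defs mult_ac)
      then have F1: "\<bar>?F \<bullet> g\<bar> \<le> 4 * (LF * a) * (\<kappa>1 + 1)" using pos nn by (intro lip) auto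
      have sgb: "\<bar>sg\<bar> \<le> 1" by (simp add: defs sgn_real_def)
      have F2: "sg * (?F \<bullet> g) \<le> 4 * LF * (\<kappa>1 + 1) * a"
      proof -
        have "sg * (?F \<bullet> g) \<le> \<bar>sg\<bar> * \<bar>?F \<bullet> g\<bar>" by (metis abs_ge_self abs_mult)
        also have "\<dots> \<le> 1 * (4 * (LF * a) * (\<kappa>1 + 1))" using sgb F1 by (intro mult_mono) auto
        finally show ?thesis by (simp add: mult_ac)
      qed
      \<comment> \<open>The first part of the splitting
        \<open>(w X - w' X') * b X' + w' X' * (b X' - b X)\<close> is controlled by the difference
        of the solutions, the second by the oscillation of \<open>b\<close>.\<close>
      have B2: "sg * (w X * b X' - w' X' * b X) * \<rho> \<le> B * a + Kw * \<beta>"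
      proof -
        have sa: "sg * (w X - w' X') = a" by (simp add: defs sgn_real_def abs_if)
        have "sg * (w X * b X' - w' X' * b X) = sg * (w X - w' X') * b X' + sg * w' X' * (b X' - b X)"
          by (simp add: algebra_simps)
        also have "\<dots> \<le> \<bar>sg * (w X - w' X') * b X'\<bar> + \<bar>sg * w' X' * (b X' - b X)\<bar>" by linarith
        also have "\<bar>sg * (w X - w' X') * b X'\<bar> \<le> a * B"
          unfolding sa abs_mult using b_bound[OF X(2)] nn by (intro mult_mono) auto
        also have "\<bar>sg * w' X' * (b X' - b X)\<bar> \<le> 1 * Kw * \<beta>"
          unfolding abs_mult using sgb wb by (intro mult_mono) (auto simp: \<beta>_def)
        finally have le: "sg * (w X * b X' - w' X' * b X) \<le> B * a + Kw * \<beta>" by (simp add: mult_ac)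
        have nn2: "0 \<le> B * a + Kw * \<beta>" using pos nn by simp
        have "sg * (w X * b X' - w' X' * b X) * \<rho> \<le> (B * a + Kw * \<beta>) * \<rho>" using le \<rho> by (intro mult_right_mono) auto
        also have "\<dots> \<le> (B * a + Kw * \<beta>) * 1" using \<rho> nn2 by (intro mult_left_mono) auto
        finally show ?thesis by simp
      qed
      have "?br \<le> a * (p' * \<rho>) + p * (C1 * a + Kw * \<beta>)"
      proof -
        have "a * ((V X - V X') \<bullet> g) \<le> a * (4 * LV * (\<kappa>1 + 1))" using V1 nn by (intro mult_left_mono) auto
        then have "a * ((V X - V X') \<bullet> g) + sg * (w X * b X' - w' X' * b X) * \<rho> + sg * (?F \<bullet> g) \<le> C1 * a + Kw * \<beta>"
          using B2 F2 unfolding C1_def by (simp add: algebra_simps)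
        then have "p * (a * ((V X - V X') \<bullet> g) + sg * (w X * b X' - w' X' * b X) * \<rho> + sg * (?F \<bullet> g)) \<le> p * (C1 * a + Kw * \<beta>)"
          using p by (intro mult_left_mono) auto
        then show ?thesis by (simp add: algebra_simps)
      qed
      \<comment> \<open>Since \<open>p' \<le> 0\<close>, an upper bound needs lower bounds of the
        bump and of \<open>a\<close>, namely \<open>9 / 16 * \<chi>2\<close> and
        \<open>d X - e\<close>.\<close>
      also have "a * (p' * \<rho>) \<le> 9 / 16 * p' * d X * \<chi>2 + (\<Lambda> * T + 1) * e"
      proof -
        have "9 / 16 * \<chi>2 \<le> \<rho>"
        proof (cases "norm (fst X - fst X') < \<kappa>2 * \<epsilon>")
          case True
          then show ?thesis using bump_lower[OF ep(1) near(2)[OF True]] by (simp add: \<chi> defs)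
        qed (use \<rho> in \<open>simp add: \<chi>\<close>)
        then have "(- p') * a * (9 / 16 * \<chi>2) \<le> (- p') * a * \<rho>"
          using p nn by (intro mult_left_mono mult_nonneg_nonneg) auto
        moreover have "(- p') * (d X - e) * (9 / 16 * \<chi>2) \<le> (- p') * a * (9 / 16 * \<chi>2)"
          by (rule mult_right_mono, rule mult_left_mono) (use p(3) ade(1) \<chi>b(3) in linarith)+
        moreover have "(- p') * e * (9 / 16 * \<chi>2) \<le> (\<Lambda> * T + 1) * e * 1"
        proof (rule mult_mono)
          show "(- p') * e \<le> (\<Lambda> * T + 1) * e" using p(4) nn(2) by (intro mult_right_mono) auto
          show "0 \<le> (\<Lambda> * T + 1) * e" using nn(2) const_pos(6) T by (intro mult_nonneg_nonneg) auto
        qed (use \<chi>b in auto)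
        ultimately show ?thesis by (simp add: algebra_simps)
      qed
      also have "p * (C1 * a + Kw * \<beta>) \<le> C1 * p * d X + C1 * T * e + Kw * T * \<beta>"
      proof -
        have "p * (C1 * a) \<le> p * (C1 * (d X + e))" using p ade const_pos by (intro mult_left_mono) auto
        moreover have "p * (C1 * e) \<le> T * (C1 * e)" "p * (Kw * \<beta>) \<le> T * (Kw * \<beta>)"
          using p nn const_pos pos by (auto intro!: mult_right_mono)
        ultimately show ?thesis by (simp add: algebra_simps)
      qed
      also have "9 / 16 * p' * d X * \<chi>2 + (\<Lambda> * T + 1) * e + (C1 * p * d X + C1 * T * e + Kw * T * \<beta>)
          \<le> \<chi>1 * ?E - 9 / 16 * (- p') * d X * \<chi>2"
      proof -
        have "0 \<le> (\<Lambda> * T + 1 + C1 * T) * \<beta>" "0 \<le> Kw * T * e"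
          using nn const_pos pos T by (auto intro!: mult_nonneg_nonneg add_nonneg_nonneg)
        then show ?thesis unfolding \<chi>1 C2_def by (simp add: algebra_simps)
      qed
      finally show ?thesis by simp
    qed
  qed
  have zz: "Z \<epsilon> X X' + Z' \<epsilon> X X' = \<theta> * ?br" using Z_sum[of \<epsilon> X X'] unfolding defs .
  have "\<theta> * ?br \<le> \<theta> * (\<chi>1 * ?E - 9 / 16 * (- p') * d X * \<chi>2)"
    using key \<theta>0 by (cases "\<theta> = 0") (auto intro: mult_left_mono)
  then have "J X * J X' * (Z \<epsilon> X X' + Z' \<epsilon> X X') \<le> J X * J X' * (\<theta> * (\<chi>1 * ?E) - \<theta> * (9 / 16 * (- p') * d X * \<chi>2))"
    unfolding zz using J_bounds[OF X(1)] J_bounds[OF X(2)] pos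
    by (intro mult_left_mono mult_nonneg_nonneg) (auto simp: algebra_simps)
  also have "\<dots> = (J X * J X') * (\<theta> * (\<chi>1 * ?E)) - (J X * J X') * (\<theta> * (9 / 16 * (- p') * d X * \<chi>2))"
    by (simp add: algebra_simps)
  \<comment> \<open>The Jacobians are estimated separately in the positive and the negative part, by
    their upper and lower bound.\<close>
  also have "\<dots> \<le> j1\<^sup>2 * (\<theta> * (\<chi>1 * ?E)) - j0\<^sup>2 * (\<theta> * (9 / 16 * (- p') * d X * \<chi>2))"
  proof (rule diff_mono)
    have "J X * J X' \<le> j1 * j1" "j0 * j0 \<le> J X * J X'"
      using J_bounds[OF X(1)] J_bounds[OF X(2)] pos by (auto intro!: mult_mono)
    then have JJ: "J X * J X' \<le> j1\<^sup>2" "j0\<^sup>2 \<le> J X * J X'" by (simp_all add: power2_eq_square)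
    show "J X * J X' * (\<theta> * (\<chi>1 * ?E)) \<le> j1\<^sup>2 * (\<theta> * (\<chi>1 * ?E))"
      using JJ \<theta>0 E0 \<chi>b by (intro mult_right_mono mult_nonneg_nonneg) auto
    show "j0\<^sup>2 * (\<theta> * (9 / 16 * (- p') * d X * \<chi>2)) \<le> J X * J X' * (\<theta> * (9 / 16 * (- p') * d X * \<chi>2))"
      using JJ \<theta>0 p nn \<chi>b by (intro mult_right_mono mult_nonneg_nonneg) auto
  qed
  also have "\<dots> = G2 \<epsilon> X X' - G1 \<epsilon> X X'"
    unfolding G1_def G2_def kern_def \<chi>[symmetric] defs(3)[symmetric] defs(6)[symmetric] defs(7)[symmetric] e_def[symmetric] \<beta>_def[symmetric]
    by (simp add: algebra_simps)
  finally show ?thesis .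
qed

end

section \<open>The initial layer\<close>

context doubling_entropy
begin

lemma mol_continuous: "\<delta> > 0 \<Longrightarrow> continuous_on A (mol \<delta>)"
  by (meson DERIV_isCont DERIV_mol continuous_at_imp_continuous_on)

lemma mol_continuous_compose:
  "\<delta> > 0 \<Longrightarrow> continuous_on UNIV f \<Longrightarrow> continuous_on UNIV (\<lambda>s. mol \<delta> (f s))"
  "continuous_on UNIV f \<Longrightarrow> continuous_on UNIV (\<lambda>s. mol' \<delta> (f s))"
  by (rule continuous_on_compose2[OF mol_continuous[of \<delta> UNIV]], simp_all)
     (rule continuous_on_compose2[OF continuous_on_mol'[of UNIV]], simp_all)

text \<open>A test function supported in the layer \<open>t < \<epsilon>\<^sup>2\<close> shows that \<open>w\<close> attains the initial datum in the
  mean. The time scale \<open>\<epsilon>\<^sup>2\<close> makes the flux contribution of this layer, of order \<open>\<epsilon>\<^sup>2 / \<epsilon>\<close>, negligible.\<close>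

lemma init_pointwise:
  assumes y': "y' \<in> M" and \<epsilon>: "adm \<epsilon>" and X: "X \<in> \<Omega>"
  shows "J X * S w (u0 y') y' \<epsilon> (\<lambda>s. 1 - step (s / \<epsilon>\<^sup>2)) (\<lambda>s. - mol (\<epsilon>\<^sup>2) s) X \<le>
    j1 * (C3 / \<epsilon>) * (indicator {z. norm z < \<kappa>1 * \<epsilon>} (fst X - y') * indicator {..<\<epsilon>\<^sup>2} (snd X))
    - J X * \<bar>w X - u0 y'\<bar> * mol (\<epsilon>\<^sup>2) (snd X) * bump \<epsilon> (P X - y')"
proof -
  define \<tau> where "\<tau> = (\<lambda>s. 1 - step (s / \<epsilon>\<^sup>2))"
  \<comment> \<open>The integrand without the time derivative of the test function. The part with
    the time derivative has a negative sign and is the quantity to be bounded; only \<open>r\<close>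
    has to be shown small.\<close>
  define r where "r = S w (u0 y') y' \<epsilon> \<tau> (\<lambda>_. 0) X"
  define I :: real where "I = indicator {z. norm z < \<kappa>1 * \<epsilon>} (fst X - y') * indicator {..<\<epsilon>\<^sup>2} (snd X)"
  have ep: "0 < \<epsilon>" "\<epsilon> \<le> 1" "0 < \<epsilon>\<^sup>2" using \<epsilon> by (auto simp: adm_def)
  have S: "S w (u0 y') y' \<epsilon> \<tau> (\<lambda>s. - mol (\<epsilon>\<^sup>2) s) X = r - \<bar>w X - u0 y'\<bar> * mol (\<epsilon>\<^sup>2) (snd X) * bump \<epsilon> (P X - y')"
    by (simp add: r_def S_def algebra_simps)
  have I0: "0 \<le> I" by (simp add: I_def)
  have "r \<le> C3 / \<epsilon> * I"
  proof (cases "snd X < \<epsilon>\<^sup>2 \<and> norm (P X - y') < \<epsilon>")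
    case True
    have "fst X \<in> M" "0 < snd X" using X by (auto simp: \<Omega>_iff)
    \<comment> \<open>The initial label is treated as a point at time 0, whose position is the label
      itself.\<close>
    then have "norm (fst X - fst (y', 0::real)) < \<kappa>1 * \<epsilon>"
      using True y' T P_0[OF y'] by (intro near(1)[OF X _ \<epsilon>]) auto
    then have I1: "I = 1" using True by (simp add: I_def)
    have "\<bar>\<tau> (snd X)\<bar> \<le> 1" using step_bounds[of "snd X / \<epsilon>\<^sup>2"] by (simp add: \<tau>_def)
    then have "\<bar>r\<bar> \<le> 2 * Kw * (0 + 1 * (KV * (4 / \<epsilon>))) + Kw * B * 1 + 1 * (2 * KF * (4 / \<epsilon>))"
      unfolding r_def using w_bound(1)[OF X] u0_bound[OF y'] ep by (intro S_bound[OF X]) auto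
    also have "Kw * B * 1 \<le> Kw * B / \<epsilon>" using ep pos by (simp add: field_simps)
    also have "2 * Kw * (0 + 1 * (KV * (4 / \<epsilon>))) + Kw * B / \<epsilon> + 1 * (2 * KF * (4 / \<epsilon>)) = C3 / \<epsilon>"
      by (simp add: C3_def add_divide_distrib)
    finally show ?thesis using I1 by simp
  next
    case False
    have "r = 0"
    proof (cases "snd X < \<epsilon>\<^sup>2")
      case True
      with False have far: "\<epsilon> \<le> norm (P X - y')" by auto
      show ?thesis by (simp add: r_def S_def bump_zero[OF ep(1) far])
    next
      case False
      then have "1 \<le> snd X / \<epsilon>\<^sup>2" using ep by simp
      then have "\<tau> (snd X) = 0" by (simp add: \<tau>_def step_values)
      then show ?thesis by (simp add: r_def S_def)
    qed
    then show ?thesis using I0 const_pos ep by simp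
  qed
  moreover have "0 \<le> C3 / \<epsilon> * I" using I0 const_pos ep by simp
  ultimately have "J X * r \<le> j1 * (C3 / \<epsilon> * I)"
    using J_bounds[OF X] pos by (meson less_imp_le mult_left_mono mult_right_mono order_trans)
  then show ?thesis
    unfolding \<tau>_def[symmetric] I_def[symmetric] S by (simp add: algebra_simps)
qed

text \<open>The entropy inequality of \<open>w\<close> with constant \<open>u0 y'\<close> and centre
  \<open>y'\<close>. Its error is at most of order \<open>1 / \<epsilon>\<close> on a set of
  duration \<open>\<epsilon>\<^sup>2\<close> and area of order \<open>\<epsilon> ^ n\<close>, hence
  of order \<open>\<epsilon> * \<epsilon> ^ n\<close>; what remains is the oscillation of
  \<open>u0\<close> near \<open>y'\<close>, since the test function has time factor 1 at time
  0.\<close>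

lemma init_bound:
  assumes y': "y' \<in> M" and \<epsilon>: "adm \<epsilon>"
  shows "(\<integral>\<^sup>+X. ennreal (J X * \<bar>w X - u0 y'\<bar> * mol (\<epsilon>\<^sup>2) (snd X) * bump \<epsilon> (P X - y')) \<partial>stm) \<le>
    ennreal (j1 * C3 * aU * \<kappa>1 ^ n * \<epsilon> * \<epsilon> ^ n) + (\<integral>\<^sup>+y. ennreal (\<bar>u0 y - u0 y'\<bar> * indicator {z. norm z < \<epsilon>} (y - y')) \<partial>\<mu>)"
proof -
  define \<tau> where "\<tau> = (\<lambda>s. 1 - step (s / \<epsilon>\<^sup>2))"
  define \<tau>' where "\<tau>' = (\<lambda>s. - mol (\<epsilon>\<^sup>2) s)"
  have ep: "0 < \<epsilon>" "\<epsilon> \<le> 1" "0 < \<epsilon>\<^sup>2" "\<epsilon>\<^sup>2 < T" using \<epsilon> by (auto simp: adm_def)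
  have Y: "y' \<in> space \<mu>" using y' space_\<mu> by simp
  define f1 where "f1 = (\<lambda>X. J X * \<bar>w X - u0 y'\<bar> * mol (\<epsilon>\<^sup>2) (snd X) * bump \<epsilon> (P X - y'))"
  define f2 where "f2 = (\<lambda>X::'a \<times> real. j1 * (C3 / \<epsilon>) * (indicator {z. norm z < \<kappa>1 * \<epsilon>} (fst X - y') * indicator {..<\<epsilon>\<^sup>2} (snd X)))"
  define f3 where "f3 = (\<lambda>y. \<bar>u0 y - u0 y'\<bar> * (\<tau> 0 * bump \<epsilon> (y - y')))"
  have m: "f1 \<in> borel_measurable stm" "f2 \<in> borel_measurable stm" "f3 \<in> borel_measurable \<mu>"
    "(\<lambda>X. J X * S w (u0 y') y' \<epsilon> \<tau> \<tau>' X) \<in> borel_measurable stm"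
    unfolding f1_def f2_def f3_def S_def \<tau>_def \<tau>'_def by measurable
  have f1_0: "0 \<le> f1 X" if "X \<in> \<Omega>" for X
    unfolding f1_def using J_bounds[OF that] pos mol_nonneg[OF ep(3)] bump_bounds
    by (intro mult_nonneg_nonneg) auto
  have f2_0: "0 \<le> f2 X" for X unfolding f2_def using const_pos pos ep by (intro mult_nonneg_nonneg) auto
  have f3_0: "0 \<le> f3 y" for y
    unfolding f3_def \<tau>_def using bump_bounds step_bounds by (intro mult_nonneg_nonneg) auto
  have le: "J X * S w (u0 y') y' \<epsilon> \<tau> \<tau>' X \<le> f2 X - f1 X" if "X \<in> \<Omega>" for X
    using init_pointwise[OF y' \<epsilon> that] by (simp add: f1_def f2_def \<tau>_def \<tau>'_def)
  have i1: "integrable stm f1"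
  proof (rule integrable_bounded[OF finite_stm m(1)])
    fix X assume "X \<in> space stm"
    then have X: "X \<in> \<Omega>" by (simp add: space_stm)
    have "f1 X \<le> j1 * (2 * Kw) * (30 / \<epsilon>\<^sup>2) * 1"
      unfolding f1_def using J_bounds[OF X] pos w_bound(1)[OF X] u0_bound[OF y'] mol_bound[OF ep(3), of "snd X"]
        mol_nonneg[OF ep(3), of "snd X"] bump_bounds[of \<epsilon> "P X - y'"]
      by (intro mult_mono mult_nonneg_nonneg) auto
    then show "\<bar>f1 X\<bar> \<le> j1 * (2 * Kw) * (30 / \<epsilon>\<^sup>2) * 1" using f1_0[OF X] by simp
  qed
  have i2: "integrable stm f2"
  proof (rule integrable_bounded[OF finite_stm m(2)])
    fix X :: "'a \<times> real"
    have "f2 X \<le> j1 * (C3 / \<epsilon>) * 1" unfolding f2_def using const_pos pos ep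
      by (intro mult_left_mono) (auto simp: indicator_def)
    then show "\<bar>f2 X\<bar> \<le> j1 * (C3 / \<epsilon>) * 1" using f2_0[of X] by simp
  qed
  have i3: "integrable \<mu> f3"
  proof (rule integrable_bounded[OF fin m(3)])
    fix y assume "y \<in> space \<mu>"
    then have y: "y \<in> M" by (simp add: space_\<mu>)
    have "f3 y \<le> 2 * Kw * (1 * 1)"
      unfolding f3_def \<tau>_def using u0_bound[OF y] u0_bound[OF y'] step_bounds bump_bounds
      by (intro mult_mono) auto
    then show "\<bar>f3 y\<bar> \<le> 2 * Kw * (1 * 1)" using f3_0[of y] by simp
  qed
  have iS: "integrable stm (\<lambda>X. J X * S w (u0 y') y' \<epsilon> \<tau> \<tau>' X)"
  proof (rule integrable_bounded[OF finite_stm m(4)])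
    fix X assume "X \<in> space stm"
    then have X: "X \<in> \<Omega>" by (simp add: space_stm)
    have "\<bar>S w (u0 y') y' \<epsilon> \<tau> \<tau>' X\<bar> \<le>
        2 * Kw * (30 / \<epsilon>\<^sup>2 + 1 * (KV * (4 / \<epsilon>))) + Kw * B * 1 + 1 * (2 * KF * (4 / \<epsilon>))"
      using w_bound(1)[OF X] u0_bound[OF y'] ep mol_bound[OF ep(3), of "snd X"] step_bounds[of "snd X / \<epsilon>\<^sup>2"]
      by (intro S_bound[OF X]) (auto simp: \<tau>_def \<tau>'_def)
    then show "\<bar>J X * S w (u0 y') y' \<epsilon> \<tau> \<tau>' X\<bar> \<le>
        j1 * (2 * Kw * (30 / \<epsilon>\<^sup>2 + 1 * (KV * (4 / \<epsilon>))) + Kw * B * 1 + 1 * (2 * KF * (4 / \<epsilon>)))"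
      unfolding abs_mult using J_bounds[OF X] pos by (intro mult_mono) auto
  qed
  have "0 \<le> (\<integral>X. J X * S w (u0 y') y' \<epsilon> \<tau> \<tau>' X \<partial>stm) + (\<integral>y. f3 y \<partial>\<mu>)"
    unfolding f3_def
  proof (rule ent(1)[unfolded entropy_def, rule_format])
    show "\<epsilon> > 0" by (rule ep(1))
    show "(\<tau> has_field_derivative \<tau>' t) (at t)" for t
      unfolding \<tau>_def \<tau>'_def using DERIV_diff[OF DERIV_const DERIV_step_scaled[OF ep(3)], of 1 t] by simp
    show "continuous_on UNIV \<tau>'" unfolding \<tau>'_def by (intro continuous_on_minus mol_continuous ep)
    show "0 \<le> \<tau> t" for t unfolding \<tau>_def using step_bounds by simp
    have "1 \<le> T / \<epsilon>\<^sup>2" using ep by simp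
    then show "\<tau> T = 0" by (simp add: \<tau>_def step_values)
  qed
  also have "(\<integral>X. J X * S w (u0 y') y' \<epsilon> \<tau> \<tau>' X \<partial>stm) \<le> (\<integral>X. f2 X - f1 X \<partial>stm)"
    using le by (intro integral_mono iS Bochner_Integration.integrable_diff i1 i2) (simp add: space_stm)
  also have "(\<integral>X. f2 X - f1 X \<partial>stm) = (\<integral>X. f2 X \<partial>stm) - (\<integral>X. f1 X \<partial>stm)"
    by (rule Bochner_Integration.integral_diff[OF i2 i1])
  finally have main: "(\<integral>X. f1 X \<partial>stm) \<le> (\<integral>X. f2 X \<partial>stm) + (\<integral>y. f3 y \<partial>\<mu>)" by simp
  have "(\<integral>\<^sup>+X. ennreal (f1 X) \<partial>stm) = ennreal (\<integral>X. f1 X \<partial>stm)"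
    by (rule nn_integral_eq_integral[OF i1]) (use f1_0 in \<open>auto simp: space_stm\<close>)
  also have "\<dots> \<le> ennreal ((\<integral>X. f2 X \<partial>stm) + (\<integral>y. f3 y \<partial>\<mu>))" by (rule ennreal_leI[OF main])
  also have "\<dots> = ennreal (\<integral>X. f2 X \<partial>stm) + ennreal (\<integral>y. f3 y \<partial>\<mu>)"
    using f2_0 f3_0 by (intro ennreal_plus) auto
  also have "ennreal (\<integral>y. f3 y \<partial>\<mu>) = (\<integral>\<^sup>+y. ennreal (f3 y) \<partial>\<mu>)"
    by (rule nn_integral_eq_integral[OF i3, symmetric]) (use f3_0 in auto)
  also have "\<dots> \<le> (\<integral>\<^sup>+y. ennreal (\<bar>u0 y - u0 y'\<bar> * indicator {z. norm z < \<epsilon>} (y - y')) \<partial>\<mu>)"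
  proof (intro nn_integral_mono ennreal_leI)
    fix y
    have "\<tau> 0 * bump \<epsilon> (y - y') \<le> indicator {z. norm z < \<epsilon>} (y - y')"
      using bump_bounds[of \<epsilon> "y - y'"] bump_zero(1)[OF ep(1), of "y - y'"]
      by (auto simp: \<tau>_def step_values indicator_def)
    then show "f3 y \<le> \<bar>u0 y - u0 y'\<bar> * indicator {z. norm z < \<epsilon>} (y - y')"
      unfolding f3_def by (intro mult_left_mono) auto
  qed
  also have "ennreal (\<integral>X. f2 X \<partial>stm) = (\<integral>\<^sup>+X. ennreal (f2 X) \<partial>stm)"
    by (rule nn_integral_eq_integral[OF i2, symmetric]) (use f2_0 in auto)
  also have "\<dots> = (\<integral>\<^sup>+y. (\<integral>\<^sup>+t\<in>{0<..<T}. ennreal (f2 (y, t)) \<partial>lborel) \<partial>\<mu>)"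
    using m(2) by (intro nn_integral_stm) simp
  also have "\<dots> \<le> (\<integral>\<^sup>+y. ennreal (j1 * (C3 / \<epsilon>) * \<epsilon>\<^sup>2) * ennreal (indicator {z. norm z < \<kappa>1 * \<epsilon>} (y - y')) \<partial>\<mu>)"
  proof (intro nn_integral_mono)
    fix y
    have "(\<integral>\<^sup>+t\<in>{0<..<T}. ennreal (f2 (y, t)) \<partial>lborel) \<le>
      (\<integral>\<^sup>+t. ennreal (j1 * (C3 / \<epsilon>) * indicator {z. norm z < \<kappa>1 * \<epsilon>} (y - y')) * indicator {0..\<epsilon>\<^sup>2} t \<partial>lborel)"
      by (intro nn_integral_mono) (auto simp: f2_def indicator_def)
    also have "\<dots> = ennreal (j1 * (C3 / \<epsilon>) * indicator {z. norm z < \<kappa>1 * \<epsilon>} (y - y')) * ennreal (\<epsilon>\<^sup>2)"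
      using ep by (subst nn_integral_cmult_indicator) auto
    also have "\<dots> = ennreal (j1 * (C3 / \<epsilon>) * \<epsilon>\<^sup>2) * ennreal (indicator {z. norm z < \<kappa>1 * \<epsilon>} (y - y'))"
      using const_pos pos ep by (auto simp: ennreal_mult[symmetric] indicator_def)
    finally show "(\<integral>\<^sup>+t\<in>{0<..<T}. ennreal (f2 (y, t)) \<partial>lborel) \<le> \<dots>" .
  qed
  also have "\<dots> = ennreal (j1 * (C3 / \<epsilon>) * \<epsilon>\<^sup>2) * emeasure \<mu> (M \<inter> ball y' (\<kappa>1 * \<epsilon>))"
    by (subst nn_integral_cmult) (auto simp: ball_meas)
  also have "\<dots> \<le> ennreal (j1 * (C3 / \<epsilon>) * \<epsilon>\<^sup>2) * ennreal (aU * (\<kappa>1 * \<epsilon>) ^ n)"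
    using const_pos ep by (intro mult_left_mono ball_upper) auto
  also have "\<dots> = ennreal (j1 * C3 * aU * \<kappa>1 ^ n * \<epsilon> * \<epsilon> ^ n)"
    using const_pos pos ep by (subst ennreal_mult[symmetric]) (auto simp: power2_eq_square power_mult_distrib mult_ac)
  finally show ?thesis by (simp add: f1_def add_mono)
qed

section \<open>The integrated doubled inequality\<close>

lemma Z_measurable:
  "(\<lambda>z. Z \<epsilon> (fst z) (snd z)) \<in> borel_measurable (stm \<Otimes>\<^sub>M stm)"
  "(\<lambda>z. Z' \<epsilon> (fst z) (snd z)) \<in> borel_measurable (stm \<Otimes>\<^sub>M stm)"
  unfolding Z_def Z'_def S_def by measurable

lemma G_measurable [measurable (raw)]:
  assumes [measurable]: "f \<in> N \<rightarrow>\<^sub>M stm" "g \<in> N \<rightarrow>\<^sub>M stm"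
  shows "(\<lambda>x. G1 \<epsilon> (f x) (g x)) \<in> borel_measurable N" "(\<lambda>x. G2 \<epsilon> (f x) (g x)) \<in> borel_measurable N"
  unfolding G1_def G2_def d_def by measurable

text \<open>The bound degenerates as \<epsilon> tends to 0; at fixed \<epsilon> it justifies
  Fubini's theorem.\<close>

lemma Z_bounded:
  assumes \<epsilon>: "adm \<epsilon>" and X: "X \<in> \<Omega>" "X' \<in> \<Omega>"
  defines "A \<equiv> 30 / \<epsilon>\<^sup>2 * T" and "A' \<equiv> 60 / (\<epsilon>\<^sup>2)\<^sup>2 * T + 30 / \<epsilon>\<^sup>2 * (\<Lambda> * T + 1)"
  defines "C \<equiv> 2 * Kw * (A' + A * (KV * (4 / \<epsilon>))) + Kw * B * A + A * (2 * KF * (4 / \<epsilon>))"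
  shows "\<bar>Z \<epsilon> X X'\<bar> \<le> C" "\<bar>Z' \<epsilon> X X'\<bar> \<le> C"
proof -
  have ep: "0 < \<epsilon>" "0 < \<epsilon>\<^sup>2" using \<epsilon> by (auto simp: adm_def)
  have t: "snd X \<in> {0..T}" "snd X' \<in> {0..T}" using X by (auto simp: \<Omega>_iff)
  have 1: "\<bar>mol (\<epsilon>\<^sup>2) s * \<psi> r\<bar> \<le> A" "\<bar>mol' (\<epsilon>\<^sup>2) s * \<psi> r\<bar> \<le> 60 / (\<epsilon>\<^sup>2)\<^sup>2 * T"
    "\<bar>mol (\<epsilon>\<^sup>2) s * \<psi>' r\<bar> \<le> 30 / \<epsilon>\<^sup>2 * (\<Lambda> * T + 1)" if "r \<in> {0..T}" for r s
    unfolding A_def abs_mult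
    by (rule mult_mono; use mol_bound[OF ep(2), of s] mol'_bound[OF ep(2), of s] \<psi>_bounds[OF that] ep in simp)+
  have "0 \<le> 30 / \<epsilon>\<^sup>2 * (\<Lambda> * T + 1)" using const_pos(6) T by (intro mult_nonneg_nonneg) auto
  then have A': "60 / (\<epsilon>\<^sup>2)\<^sup>2 * T \<le> A'" unfolding A'_def by linarith
  show "\<bar>Z \<epsilon> X X'\<bar> \<le> C" unfolding Z_def C_def
  proof (rule S_bound[of X w "w' X'"])
    show "\<bar>mol' (\<epsilon>\<^sup>2) (snd X - snd X') * \<psi> (snd X) + mol (\<epsilon>\<^sup>2) (snd X - snd X') * \<psi>' (snd X)\<bar> \<le> A'"
      unfolding A'_def by (intro order_trans[OF abs_triangle_ineq] add_mono 1 t)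
    show "\<bar>mol (\<epsilon>\<^sup>2) (snd X - snd X') * \<psi> (snd X)\<bar> \<le> A" by (rule 1(1)[OF t(1)])
  qed (rule X(1) w_bound(1)[OF X(1)] w_bound(2)[OF X(2)] ep(1))+
  show "\<bar>Z' \<epsilon> X X'\<bar> \<le> C" unfolding Z'_def C_def
  proof (rule S_bound[of X' w' "w X"])
    show "\<bar>- mol' (\<epsilon>\<^sup>2) (snd X - snd X') * \<psi> (snd X)\<bar> \<le> A'"
      using 1(2)[OF t(1), of "snd X - snd X'"] A' by (simp add: abs_mult)
    show "\<bar>mol (\<epsilon>\<^sup>2) (snd X - snd X') * \<psi> (snd X)\<bar> \<le> A" by (rule 1(1)[OF t(1)])
  qed (rule X(2) w_bound(1)[OF X(1)] w_bound(2)[OF X(2)] ep(1))+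
qed

lemma integrable_PP:
  assumes "(\<lambda>z. f (fst z) (snd z)) \<in> borel_measurable (stm \<Otimes>\<^sub>M stm)"
    "\<And>X X'. X \<in> \<Omega> \<Longrightarrow> X' \<in> \<Omega> \<Longrightarrow> \<bar>f X X'\<bar> \<le> (C::real)"
  shows "integrable (stm \<Otimes>\<^sub>M stm) (\<lambda>z. f (fst z) (snd z))"
  by (rule integrable_bounded[OF finite_measure_pair_measure[OF finite_stm finite_stm] assms(1), of C])
    (use assms(2) in \<open>auto simp: space_pair_measure space_stm mem_Times_iff\<close>)

text \<open>The inequality of \<open>w\<close> is integrated over the second point, that of
  \<open>w'\<close> over the first, both weighted by \<open>J\<close>, and
  \<open>Z_pointwise\<close> is applied to the sum. The initial term of the second inequality
  contains \<open>\<bar>u0 - w\<bar>\<close>; after exchanging the integrals it is the quantity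
  bounded in \<open>init_bound\<close>.\<close>

lemma main_inequality:
  assumes \<epsilon>: "adm \<epsilon>"
  shows "(\<integral>\<^sup>+X. \<integral>\<^sup>+X'. ennreal (G1 \<epsilon> X X') \<partial>stm \<partial>stm) \<le> (\<integral>\<^sup>+X. \<integral>\<^sup>+X'. ennreal (G2 \<epsilon> X X') \<partial>stm \<partial>stm) +
    (\<integral>\<^sup>+y'. ennreal T * (\<integral>\<^sup>+X. ennreal (J X * \<bar>w X - u0 y'\<bar> * mol (\<epsilon>\<^sup>2) (snd X) * bump \<epsilon> (P X - y')) \<partial>stm) \<partial>\<mu>)"
proof -
  have ep: "0 < \<epsilon>" "0 < \<epsilon>\<^sup>2" "\<epsilon>\<^sup>2 < T" using \<epsilon> by (auto simp: adm_def)
  define C where "C = (let A = 30 / \<epsilon>\<^sup>2 * T; A' = 60 / (\<epsilon>\<^sup>2)\<^sup>2 * T + 30 / \<epsilon>\<^sup>2 * (\<Lambda> * T + 1)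
    in 2 * Kw * (A' + A * (KV * (4 / \<epsilon>))) + Kw * B * A + A * (2 * KF * (4 / \<epsilon>)))"
  have ZC: "\<bar>Z \<epsilon> X X'\<bar> \<le> C" "\<bar>Z' \<epsilon> X X'\<bar> \<le> C" if "X \<in> \<Omega>" "X' \<in> \<Omega>" for X X'
    using Z_bounded[OF \<epsilon> that] by (simp_all add: C_def Let_def)
  define i where "i = (\<lambda>X y. \<bar>u0 y - w X\<bar> * (mol (\<epsilon>\<^sup>2) (snd X - 0) * \<psi> (snd X) * bump \<epsilon> (y - P X)))"
  define ZJ where "ZJ = (\<lambda>X X'. J X' * (J X * Z \<epsilon> X X'))"
  define ZJ' where "ZJ' = (\<lambda>X X'. J X * (J X' * Z' \<epsilon> X X'))"
  define I where "I = (\<lambda>X. \<integral>y. i X y \<partial>\<mu>)"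
  have JJ: "\<bar>J X * (J X' * z)\<bar> \<le> j1 * (j1 * C)" if "X \<in> \<Omega>" "X' \<in> \<Omega>" "\<bar>z\<bar> \<le> C" for X X' z
    unfolding abs_mult using J_bounds[OF that(1)] J_bounds[OF that(2)] pos that(3)
    by (intro mult_mono mult_nonneg_nonneg) auto
  have J0: "0 \<le> J X" if "X \<in> \<Omega>" for X
    using J_bounds(1)[OF that] pos(4) by linarith
  have iZ: "integrable (stm \<Otimes>\<^sub>M stm) (\<lambda>z. ZJ (fst z) (snd z))" "integrable (stm \<Otimes>\<^sub>M stm) (\<lambda>z. ZJ' (fst z) (snd z))"
    using ZC JJ Z_measurable by (auto intro!: integrable_PP[where C = "j1 * (j1 * C)"] simp: ZJ_def ZJ'_def)
  have kb: "kern (\<epsilon>\<^sup>2) r X X' \<le> 30 / \<epsilon>\<^sup>2" "0 \<le> kern (\<epsilon>\<^sup>2) r X X'" for r X X'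
    using mol_bound[OF ep(2), of "snd X - snd X'"] mol_nonneg[OF ep(2), of "snd X - snd X'"] ep
    by (auto simp: kern_def indicator_def)
  have db: "d X \<le> 2 * Kw" "0 \<le> d X" if "X \<in> \<Omega>" for X
    using w_bound[OF that] by (auto simp: d_def)
  have iG1: "integrable (stm \<Otimes>\<^sub>M stm) (\<lambda>z. G1 \<epsilon> (fst z) (snd z))"
  proof (rule integrable_PP)
    fix X X' assume X: "X \<in> \<Omega>" "X' \<in> \<Omega>"
    have t: "snd X \<in> {0..T}" using X by (auto simp: \<Omega>_iff)
    have "G1 \<epsilon> X X' \<le> 9 / 16 * j0\<^sup>2 * (\<Lambda> * T + 1) * (2 * Kw) * (30 / \<epsilon>\<^sup>2)"
      unfolding G1_def using \<psi>_bounds[OF t] db[OF X(1)] kb[of _ X X'] const_pos(6) T by (intro mult_mono mult_nonneg_nonneg) auto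
    then show "\<bar>G1 \<epsilon> X X'\<bar> \<le> 9 / 16 * j0\<^sup>2 * (\<Lambda> * T + 1) * (2 * Kw) * (30 / \<epsilon>\<^sup>2)"
      using G_nonneg(1)[OF X(1) ep(1)] by simp
  qed measurable
  have iG2: "integrable (stm \<Otimes>\<^sub>M stm) (\<lambda>z. G2 \<epsilon> (fst z) (snd z))"
  proof (rule integrable_PP)
    fix X X' assume X: "X \<in> \<Omega>" "X' \<in> \<Omega>"
    have t: "snd X \<in> {0..T}" using X by (auto simp: \<Omega>_iff)
    have 1: "\<bar>w' X - w' X'\<bar> \<le> 2 * Kw" "\<bar>b X - b X'\<bar> \<le> 2 * B"
      using w_bound(2)[OF X(1)] w_bound(2)[OF X(2)] b_bound[OF X(1)] b_bound[OF X(2)] by auto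
    have 2: "j1\<^sup>2 * C1 * \<psi> (snd X) * d X \<le> j1\<^sup>2 * C1 * T * (2 * Kw)"
      using \<psi>_bounds[OF t] db[OF X(1)] const_pos T by (intro mult_mono mult_nonneg_nonneg) auto
    have 3: "j1\<^sup>2 * C2 * (\<bar>w' X - w' X'\<bar> + \<bar>b X - b X'\<bar>) \<le> j1\<^sup>2 * C2 * (2 * Kw + 2 * B)"
      using 1 const_pos by (intro mult_left_mono add_mono) auto
    have 4: "0 \<le> j1\<^sup>2 * C1 * T * (2 * Kw) + j1\<^sup>2 * C2 * (2 * Kw + 2 * B)"
      using const_pos T pos by (intro add_nonneg_nonneg mult_nonneg_nonneg) auto
    have "G2 \<epsilon> X X' \<le> (j1\<^sup>2 * C1 * T * (2 * Kw) + j1\<^sup>2 * C2 * (2 * Kw + 2 * B)) * (30 / \<epsilon>\<^sup>2)"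
      unfolding G2_def by (rule mult_mono[OF add_mono[OF 2 3] kb(1) 4 kb(2)])
    then show "\<bar>G2 \<epsilon> X X'\<bar> \<le> (j1\<^sup>2 * C1 * T * (2 * Kw) + j1\<^sup>2 * C2 * (2 * Kw + 2 * B)) * (30 / \<epsilon>\<^sup>2)"
      using G_nonneg(2)[OF X(1) ep(1)] by simp
  qed measurable
  have i0: "0 \<le> i X y" if "X \<in> \<Omega>" for X y
    unfolding i_def using mol_nonneg[OF ep(2)] bump_bounds \<psi>_bounds[of "snd X"] that
    by (intro mult_nonneg_nonneg) (auto simp: \<Omega>_iff)
  have ib: "i X y \<le> 2 * Kw * (30 / \<epsilon>\<^sup>2 * T * 1)" if X: "X \<in> \<Omega>" and y: "y \<in> M" for X y
  proof -
    have "snd X \<in> {0..T}" using X by (auto simp: \<Omega>_iff)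
    note p = \<psi>_bounds[OF this]
    have m: "mol (\<epsilon>\<^sup>2) (snd X - 0) \<le> 30 / \<epsilon>\<^sup>2" "0 \<le> mol (\<epsilon>\<^sup>2) (snd X - 0)"
      using mol_bound[OF ep(2), of "snd X - 0"] mol_nonneg[OF ep(2)] by auto
    show ?thesis unfolding i_def
    proof (rule mult_mono)
      show "\<bar>u0 y - w X\<bar> \<le> 2 * Kw" using w_bound(1)[OF X] u0_bound[OF y] by auto
      show "mol (\<epsilon>\<^sup>2) (snd X - 0) * \<psi> (snd X) * bump \<epsilon> (y - P X) \<le> 30 / \<epsilon>\<^sup>2 * T * 1"
        using m p bump_bounds[of \<epsilon> "y - P X"] T by (intro mult_mono mult_nonneg_nonneg) auto
      show "0 \<le> mol (\<epsilon>\<^sup>2) (snd X - 0) * \<psi> (snd X) * bump \<epsilon> (y - P X)"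
        using m p bump_bounds[of \<epsilon> "y - P X"] by (intro mult_nonneg_nonneg) auto
    qed (use pos in simp)
  qed
  have im: "(\<lambda>z. i (fst z) (snd z)) \<in> borel_measurable (stm \<Otimes>\<^sub>M \<mu>)"
    unfolding i_def by measurable
  have Im [measurable]: "I \<in> borel_measurable stm"
    unfolding I_def using im by (intro \<mu>.borel_measurable_lebesgue_integral) (simp add: case_prod_beta')
  have iX: "integrable \<mu> (i X)" if X: "X \<in> \<Omega>" for X
  proof (rule integrable_bounded[OF fin])
    have "X \<in> space stm" using X by (simp add: space_stm)
    then show "i X \<in> borel_measurable \<mu>" using measurable_compose[OF measurable_Pair1' im, of X] by simp
  qed (use i0[OF X] ib[OF X] in \<open>auto simp: space_\<mu>\<close>)
  have I0: "0 \<le> I X" if "X \<in> \<Omega>" for X unfolding I_def using i0[OF that] by (intro integral_nonneg_AE) auto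
  have Ib: "I X \<le> 2 * Kw * (30 / \<epsilon>\<^sup>2 * T * 1) * measure \<mu> M" if X: "X \<in> \<Omega>" for X
  proof -
    let ?C = "2 * Kw * (30 / \<epsilon>\<^sup>2 * T * 1)"
    have "I X \<le> (\<integral>y. ?C \<partial>\<mu>)"
      unfolding I_def by (rule integral_mono[OF iX[OF X] \<mu>.integrable_const]) (rule ib[OF X], simp only: space_\<mu>)
    also have "\<dots> = ?C * measure \<mu> M" by (simp only: lebesgue_integral_const space_\<mu> real_scaleR_def mult.commute)
    finally show ?thesis .
  qed
  have iI: "integrable stm (\<lambda>X. J X * I X)"
  proof (rule integrable_bounded[OF finite_stm])
    fix X assume "X \<in> space stm"
    then have X: "X \<in> \<Omega>" by (simp add: space_stm)
    show "\<bar>J X * I X\<bar> \<le> j1 * (2 * Kw * (30 / \<epsilon>\<^sup>2 * T * 1) * measure \<mu> M)"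
      unfolding abs_mult using J_bounds[OF X] pos I0[OF X] Ib[OF X] by (intro mult_mono) auto
  qed measurable
  have derm: "((\<lambda>s. mol (\<epsilon>\<^sup>2) (s - a)) has_field_derivative mol' (\<epsilon>\<^sup>2) (t - a)) (at t)" for a t
  proof -
    have "((\<lambda>s. mol (\<epsilon>\<^sup>2) (s - a)) has_field_derivative mol' (\<epsilon>\<^sup>2) (t - a) * 1) (at t)"
      by (rule DERIV_chain2[where g = "\<lambda>s. s - a"], rule DERIV_mol[OF ep(2)]) (auto intro!: derivative_eq_intros)
    then show ?thesis by simp
  qed
  have derm': "((\<lambda>s. mol (\<epsilon>\<^sup>2) (a - s)) has_field_derivative - mol' (\<epsilon>\<^sup>2) (a - t)) (at t)" for a t
  proof -
    have "((\<lambda>s. mol (\<epsilon>\<^sup>2) (a - s)) has_field_derivative mol' (\<epsilon>\<^sup>2) (a - t) * (- 1)) (at t)"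
      by (rule DERIV_chain2[where g = "\<lambda>s. a - s"], rule DERIV_mol[OF ep(2)]) (auto intro!: derivative_eq_intros)
    then show ?thesis by simp
  qed
  have psic: "continuous_on UNIV \<psi>" "continuous_on UNIV \<psi>'"
    unfolding \<psi>_def[abs_def] \<psi>'_def[abs_def] by (intro continuous_intros)+
  have 1: "0 \<le> (\<integral>X. J X * Z \<epsilon> X X' \<partial>stm)" if X': "X' \<in> \<Omega>" for X'
  proof -
    let ?\<tau> = "\<lambda>s. mol (\<epsilon>\<^sup>2) (s - snd X') * \<psi> s"
    \<comment> \<open>The second point has positive time, so the argument of the mollifier is
      negative at time 0 and the initial term disappears.\<close>
    have z: "?\<tau> 0 = 0" using X' mol_zero[OF ep(2), of "0 - snd X'"] by (simp add: \<Omega>_iff)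
    have "0 \<le> (\<integral>X. J X * S w (w' X') (P X') \<epsilon> ?\<tau> (\<lambda>s. mol' (\<epsilon>\<^sup>2) (s - snd X') * \<psi> s + mol (\<epsilon>\<^sup>2) (s - snd X') * \<psi>' s) X \<partial>stm)
       + (\<integral>y. \<bar>u0 y - w' X'\<bar> * (?\<tau> 0 * bump \<epsilon> (y - P X')) \<partial>\<mu>)"
    proof (rule ent(1)[unfolded entropy_def, rule_format])
      show "(?\<tau> has_field_derivative mol' (\<epsilon>\<^sup>2) (t - snd X') * \<psi> t + mol (\<epsilon>\<^sup>2) (t - snd X') * \<psi>' t) (at t)" for t
        using DERIV_mult[OF derm DERIV_\<psi>] by (simp add: mult_ac add_ac)
      show "continuous_on UNIV (\<lambda>s. mol' (\<epsilon>\<^sup>2) (s - snd X') * \<psi> s + mol (\<epsilon>\<^sup>2) (s - snd X') * \<psi>' s)"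
        by (intro continuous_on_add continuous_on_mult mol_continuous_compose ep psic) (intro continuous_intros)+
      show "0 \<le> ?\<tau> t" if "t \<in> {0..T}" for t
        using mol_nonneg[OF ep(2)] \<psi>_bounds[OF that] by simp
      show "?\<tau> T = 0" by (simp add: \<psi>_def)
    qed (rule ep(1))
    then show ?thesis unfolding Z_def z by simp
  qed
  have 2: "0 \<le> (\<integral>X'. J X' * Z' \<epsilon> X X' \<partial>stm) + I X" if X: "X \<in> \<Omega>" for X
    unfolding Z'_def I_def i_def
  proof (rule ent(2)[unfolded entropy_def, rule_format])
    have p: "0 \<le> \<psi> (snd X)" using X by (intro \<psi>_bounds) (auto simp: \<Omega>_iff)
    show "((\<lambda>s. mol (\<epsilon>\<^sup>2) (snd X - s) * \<psi> (snd X)) has_field_derivative - mol' (\<epsilon>\<^sup>2) (snd X - t) * \<psi> (snd X)) (at t)" for t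
      by (rule DERIV_cmult_right[OF derm'])
    show "continuous_on UNIV (\<lambda>s. - mol' (\<epsilon>\<^sup>2) (snd X - s) * \<psi> (snd X))"
      by (intro continuous_on_mult continuous_on_minus mol_continuous_compose continuous_on_const) (intro continuous_intros)
    show "0 \<le> mol (\<epsilon>\<^sup>2) (snd X - t) * \<psi> (snd X)" for t using mol_nonneg[OF ep(2)] p by simp
    \<comment> \<open>In its second variable the test function vanishes at the final time because
      \<open>X\<close> comes before \<open>T\<close>.\<close>
    show "mol (\<epsilon>\<^sup>2) (snd X - T) * \<psi> (snd X) = 0" using X mol_zero[OF ep(2), of "snd X - T"] by (simp add: \<Omega>_iff)
  qed (rule ep(1))
  have "0 \<le> (\<integral>X'. J X' * (\<integral>X. J X * Z \<epsilon> X X' \<partial>stm) \<partial>stm)"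
    by (intro Bochner_Integration.integral_nonneg mult_nonneg_nonneg 1 J0) (simp_all add: space_stm)
  also have "\<dots> = (\<integral>X'. \<integral>X. ZJ X X' \<partial>stm \<partial>stm)" by (simp add: ZJ_def)
  also have "\<dots> = (\<integral>z. ZJ (fst z) (snd z) \<partial>(stm \<Otimes>\<^sub>M stm))"
    using iZ(1) by (subst PP.integral_snd) (simp_all add: case_prod_beta')
  finally have E1: "0 \<le> (\<integral>z. ZJ (fst z) (snd z) \<partial>(stm \<Otimes>\<^sub>M stm))" .
  have iA: "integrable stm (\<lambda>X. \<integral>X'. ZJ' X X' \<partial>stm)"
    using PP.integrable_fst'[OF iZ(2)] by simp
  have "0 \<le> (\<integral>X. J X * ((\<integral>X'. J X' * Z' \<epsilon> X X' \<partial>stm) + I X) \<partial>stm)"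
    by (intro Bochner_Integration.integral_nonneg mult_nonneg_nonneg 2 J0) (simp_all add: space_stm)
  also have "\<dots> = (\<integral>X. (\<integral>X'. ZJ' X X' \<partial>stm) + J X * I X \<partial>stm)" by (simp add: ZJ'_def distrib_left)
  also have "\<dots> = (\<integral>X. \<integral>X'. ZJ' X X' \<partial>stm \<partial>stm) + (\<integral>X. J X * I X \<partial>stm)"
    by (rule Bochner_Integration.integral_add[OF iA iI])
  also have "(\<integral>X. \<integral>X'. ZJ' X X' \<partial>stm \<partial>stm) = (\<integral>z. ZJ' (fst z) (snd z) \<partial>(stm \<Otimes>\<^sub>M stm))"
    using PP.integral_fst'[OF iZ(2)] by simp
  finally have "0 \<le> (\<integral>z. ZJ (fst z) (snd z) + ZJ' (fst z) (snd z) \<partial>(stm \<Otimes>\<^sub>M stm)) + (\<integral>X. J X * I X \<partial>stm)"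
    using E1 iZ by simp
  also have "(\<integral>z. ZJ (fst z) (snd z) + ZJ' (fst z) (snd z) \<partial>(stm \<Otimes>\<^sub>M stm)) \<le>
      (\<integral>z. G2 \<epsilon> (fst z) (snd z) - G1 \<epsilon> (fst z) (snd z) \<partial>(stm \<Otimes>\<^sub>M stm))"
  proof (intro integral_mono Bochner_Integration.integrable_diff Bochner_Integration.integrable_add iZ iG1 iG2)
    fix z assume "z \<in> space (stm \<Otimes>\<^sub>M stm)"
    then have "fst z \<in> \<Omega>" "snd z \<in> \<Omega>" by (simp_all add: space_pair_measure space_stm mem_Times_iff)
    from Z_pointwise[OF this \<epsilon>]
    show "ZJ (fst z) (snd z) + ZJ' (fst z) (snd z) \<le> G2 \<epsilon> (fst z) (snd z) - G1 \<epsilon> (fst z) (snd z)"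
      by (simp add: ZJ_def ZJ'_def algebra_simps)
  qed
  finally have R: "(\<integral>z. G1 \<epsilon> (fst z) (snd z) \<partial>(stm \<Otimes>\<^sub>M stm)) \<le>
      (\<integral>z. G2 \<epsilon> (fst z) (snd z) \<partial>(stm \<Otimes>\<^sub>M stm)) + (\<integral>X. J X * I X \<partial>stm)"
    using iG1 iG2 by simp
  have nn: "(\<integral>\<^sup>+X. \<integral>\<^sup>+X'. ennreal (g X X') \<partial>stm \<partial>stm) = ennreal (\<integral>z. g (fst z) (snd z) \<partial>(stm \<Otimes>\<^sub>M stm))"
    if "integrable (stm \<Otimes>\<^sub>M stm) (\<lambda>z. g (fst z) (snd z))" "\<And>X X'. X \<in> \<Omega> \<Longrightarrow> 0 \<le> g X X'" for g
  proof -
    have "(\<integral>\<^sup>+X. \<integral>\<^sup>+X'. ennreal (g X X') \<partial>stm \<partial>stm) = (\<integral>\<^sup>+z. ennreal (g (fst z) (snd z)) \<partial>(stm \<Otimes>\<^sub>M stm))"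
      using stm.nn_integral_fst[of "\<lambda>z. ennreal (g (fst z) (snd z))" stm] borel_measurable_integrable[OF that(1)] by simp
    also have "\<dots> = ennreal (\<integral>z. g (fst z) (snd z) \<partial>(stm \<Otimes>\<^sub>M stm))"
      by (rule nn_integral_eq_integral[OF that(1)])
        (use that(2) in \<open>auto simp: space_pair_measure space_stm\<close>)
    finally show ?thesis .
  qed
  have "ennreal (\<integral>X. J X * I X \<partial>stm) = (\<integral>\<^sup>+X. ennreal (J X * I X) \<partial>stm)"
    by (rule nn_integral_eq_integral[OF iI, symmetric])
      (rule AE_I2, rule mult_nonneg_nonneg, use J0 I0 in \<open>simp_all add: space_stm\<close>)
  also have "\<dots> = (\<integral>\<^sup>+X. \<integral>\<^sup>+y. ennreal (J X * i X y) \<partial>\<mu> \<partial>stm)"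
  proof (rule nn_integral_cong)
    fix X assume "X \<in> space stm"
    then have X: "X \<in> \<Omega>" by (simp add: space_stm)
    have "ennreal (J X * I X) = ennreal (\<integral>y. J X * i X y \<partial>\<mu>)" by (simp add: I_def)
    also have "\<dots> = (\<integral>\<^sup>+y. ennreal (J X * i X y) \<partial>\<mu>)"
      using iX[OF X] i0[OF X] J0[OF X] by (intro nn_integral_eq_integral[symmetric]) auto
    finally show "ennreal (J X * I X) = (\<integral>\<^sup>+y. ennreal (J X * i X y) \<partial>\<mu>)" .
  qed
  \<comment> \<open>Now the initial label is the outer variable: for each fixed label the inner
    integral has the form treated in the initial layer, up to the factor
    \<open>\<psi> \<le> T\<close>.\<close>
  also have "\<dots> = (\<integral>\<^sup>+y. \<integral>\<^sup>+X. ennreal (J X * i X y) \<partial>stm \<partial>\<mu>)"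
    by (rule PM.Fubini'[symmetric]) (unfold i_def case_prod_beta', measurable)
  also have "\<dots> \<le> (\<integral>\<^sup>+y'. ennreal T * (\<integral>\<^sup>+X. ennreal (J X * \<bar>w X - u0 y'\<bar> * mol (\<epsilon>\<^sup>2) (snd X) * bump \<epsilon> (P X - y')) \<partial>stm) \<partial>\<mu>)"
  proof (rule nn_integral_mono)
    fix y assume y: "y \<in> space \<mu>"
    have "(\<integral>\<^sup>+X. ennreal (J X * i X y) \<partial>stm) \<le>
      (\<integral>\<^sup>+X. ennreal T * ennreal (J X * \<bar>w X - u0 y\<bar> * mol (\<epsilon>\<^sup>2) (snd X) * bump \<epsilon> (P X - y)) \<partial>stm)"
    proof (rule nn_integral_mono)
      fix X assume "X \<in> space stm"
      then have X: "X \<in> \<Omega>" by (simp add: space_stm)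
      then have "snd X \<in> {0..T}" by (auto simp: \<Omega>_iff)
      note p = \<psi>_bounds[OF this]
      have "bump \<epsilon> (y - P X) = bump \<epsilon> (P X - y)" using bump_minus(1)[of \<epsilon> "P X - y"] by simp
      then have "J X * i X y = \<psi> (snd X) * (J X * \<bar>w X - u0 y\<bar> * mol (\<epsilon>\<^sup>2) (snd X) * bump \<epsilon> (P X - y))"
        by (simp add: i_def abs_minus_commute)
      also have "\<dots> \<le> T * (J X * \<bar>w X - u0 y\<bar> * mol (\<epsilon>\<^sup>2) (snd X) * bump \<epsilon> (P X - y))"
        using p(2) J_bounds[OF X] pos mol_nonneg[OF ep(2)] bump_bounds by (intro mult_right_mono mult_nonneg_nonneg) auto
      finally show "ennreal (J X * i X y) \<le> ennreal T * ennreal (J X * \<bar>w X - u0 y\<bar> * mol (\<epsilon>\<^sup>2) (snd X) * bump \<epsilon> (P X - y))"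
        using T by (simp add: ennreal_mult'[symmetric] ennreal_leI)
    qed
    also have "\<dots> = ennreal T * (\<integral>\<^sup>+X. ennreal (J X * \<bar>w X - u0 y\<bar> * mol (\<epsilon>\<^sup>2) (snd X) * bump \<epsilon> (P X - y)) \<partial>stm)"
      by (rule nn_integral_cmult) measurable
    finally show "(\<integral>\<^sup>+X. ennreal (J X * i X y) \<partial>stm) \<le> \<dots>" .
  qed
  finally have EI: "ennreal (\<integral>X. J X * I X \<partial>stm) \<le> (\<integral>\<^sup>+y'. ennreal T * (\<integral>\<^sup>+X. ennreal (J X * \<bar>w X - u0 y'\<bar> * mol (\<epsilon>\<^sup>2) (snd X) * bump \<epsilon> (P X - y')) \<partial>stm) \<partial>\<mu>)" .
  have "(\<integral>\<^sup>+X. \<integral>\<^sup>+X'. ennreal (G1 \<epsilon> X X') \<partial>stm \<partial>stm) = ennreal (\<integral>z. G1 \<epsilon> (fst z) (snd z) \<partial>(stm \<Otimes>\<^sub>M stm))"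
    by (rule nn[OF iG1 G_nonneg(1)[OF _ ep(1)]])
  also have "\<dots> \<le> ennreal ((\<integral>z. G2 \<epsilon> (fst z) (snd z) \<partial>(stm \<Otimes>\<^sub>M stm)) + (\<integral>X. J X * I X \<partial>stm))"
    by (rule ennreal_leI[OF R])
  also have "\<dots> \<le> ennreal (\<integral>z. G2 \<epsilon> (fst z) (snd z) \<partial>(stm \<Otimes>\<^sub>M stm)) + ennreal (\<integral>X. J X * I X \<partial>stm)"
  proof (subst ennreal_plus)
    show "0 \<le> (\<integral>z. G2 \<epsilon> (fst z) (snd z) \<partial>(stm \<Otimes>\<^sub>M stm))"
      by (intro Bochner_Integration.integral_nonneg G_nonneg(2) ep(1)) (auto simp: space_pair_measure space_stm)
    show "0 \<le> (\<integral>X. J X * I X \<partial>stm)"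
      by (intro Bochner_Integration.integral_nonneg mult_nonneg_nonneg I0 J0) (simp_all add: space_stm)
  qed simp
  also have "ennreal (\<integral>z. G2 \<epsilon> (fst z) (snd z) \<partial>(stm \<Otimes>\<^sub>M stm)) = (\<integral>\<^sup>+X. \<integral>\<^sup>+X'. ennreal (G2 \<epsilon> X X') \<partial>stm \<partial>stm)"
    by (rule nn[OF iG2 G_nonneg(2)[OF _ ep(1)], symmetric])
  finally show ?thesis using EI by (meson add_left_mono order_trans)
qed

end

lemma tendsto_zero_ennrealI:
  fixes f :: "'f \<Rightarrow> ennreal"
  assumes "\<And>\<eta>::real. \<eta> > 0 \<Longrightarrow> \<forall>\<^sub>F x in F. f x \<le> ennreal \<eta>"
  shows "(f \<longlongrightarrow> 0) F"
proof (rule order_tendstoI)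
  fix a :: ennreal assume "0 < a"
  then obtain z where z: "0 < z" "z < a" using dense by blast
  then obtain r where r: "z = ennreal r" "r > 0"
    by (cases z) (auto simp: top_unique)
  have "\<forall>\<^sub>F x in F. f x \<le> ennreal r" by (rule assms[OF r(2)])
  then show "\<forall>\<^sub>F x in F. f x < a" by eventually_elim (use z r in auto)
qed auto

section \<open>The limit of vanishing scale\<close>

context doubling_entropy
begin

lemma eventually_adm: "\<forall>\<^sub>F \<epsilon> in at_right 0. adm \<epsilon>"
proof -
  define e where "e = min (min 1 (1 / (4 * LP))) (min (r0 / \<kappa>2) (sqrt T))"
  have "e > 0" using pos T const_pos by (simp add: e_def)
  moreover have "adm \<epsilon>" if "0 < \<epsilon>" "\<epsilon> < e" for \<epsilon>
  proof -
    have "\<epsilon> < 1" "\<epsilon> < 1 / (4 * LP)" "\<epsilon> < r0 / \<kappa>2" "\<epsilon> < sqrt T" using that by (auto simp: e_def)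
    moreover have "\<epsilon>\<^sup>2 < (sqrt T)\<^sup>2" using \<open>\<epsilon> < sqrt T\<close> that by (intro power_strict_mono) auto
    ultimately show ?thesis using that pos const_pos T by (simp add: adm_def field_simps)
  qed
  ultimately show ?thesis unfolding eventually_at_right_field by blast
qed

lemma tendsto_linear_zero: "((\<lambda>\<epsilon>::real. C * \<epsilon>) \<longlongrightarrow> 0) (at_right 0)"
proof -
  have "((\<lambda>\<epsilon>::real. C * \<epsilon>) \<longlongrightarrow> C * 0) (at_right 0)" by (intro tendsto_intros)
  then show ?thesis by simp
qed

lemma eventually_small: "r > 0 \<Longrightarrow> \<forall>\<^sub>F \<epsilon> in at_right (0::real). C * \<epsilon> < r"
  by (rule order_tendstoD(2)[OF tendsto_linear_zero])

lemma kern_scaled: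
  assumes \<epsilon>: "adm \<epsilon>" and X: "X \<in> \<Omega>"
  shows "(\<integral>\<^sup>+X'. ennreal (kern (\<epsilon>\<^sup>2) (\<kappa>1 * \<epsilon>) X X') \<partial>stm) \<le> ennreal (aU * \<kappa>1 ^ n) * ennreal (\<epsilon> ^ n)"
    and "(\<integral>\<^sup>+X'. ennreal (kern (\<epsilon>\<^sup>2) (\<kappa>1 * \<epsilon>) X' X) \<partial>stm) \<le> ennreal (aU * \<kappa>1 ^ n) * ennreal (\<epsilon> ^ n)"
    and "ennreal (aL * \<kappa>2 ^ n) * ennreal (\<epsilon> ^ n) * ennreal (step (snd X / \<epsilon>\<^sup>2)) \<le> (\<integral>\<^sup>+X'. ennreal (kern (\<epsilon>\<^sup>2) (\<kappa>2 * \<epsilon>) X X') \<partial>stm)"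
proof -
  have ep: "0 < \<epsilon>" "0 < \<epsilon>\<^sup>2" "\<kappa>2 * \<epsilon> \<le> r0" using \<epsilon> by (auto simp: adm_def)
  have fM: "fst X \<in> M" using X by (auto simp: \<Omega>_iff)
  have up: "emeasure \<mu> (M \<inter> ball (fst X) (\<kappa>1 * \<epsilon>)) \<le> ennreal (aU * \<kappa>1 ^ n) * ennreal (\<epsilon> ^ n)"
    using ball_upper[of "\<kappa>1 * \<epsilon>" "fst X"] const_pos pos ep
    by (simp add: ennreal_mult[symmetric] power_mult_distrib mult_ac)
  show "(\<integral>\<^sup>+X'. ennreal (kern (\<epsilon>\<^sup>2) (\<kappa>1 * \<epsilon>) X' X) \<partial>stm) \<le> ennreal (aU * \<kappa>1 ^ n) * ennreal (\<epsilon> ^ n)"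
    by (rule order_trans[OF kern_integral(2)[OF ep(2) X] up])
  have "(\<integral>\<^sup>+X'. ennreal (kern (\<epsilon>\<^sup>2) (\<kappa>1 * \<epsilon>) X X') \<partial>stm) \<le> emeasure \<mu> (M \<inter> ball (fst X) (\<kappa>1 * \<epsilon>)) * 1"
    unfolding kern_integral(1)[OF ep(2) X] using step_bounds by (intro mult_left_mono) (auto simp: ennreal_le_1)
  then show "(\<integral>\<^sup>+X'. ennreal (kern (\<epsilon>\<^sup>2) (\<kappa>1 * \<epsilon>) X X') \<partial>stm) \<le> ennreal (aU * \<kappa>1 ^ n) * ennreal (\<epsilon> ^ n)"
    using up by simp
  have "ennreal (aL * \<kappa>2 ^ n) * ennreal (\<epsilon> ^ n) = ennreal (aL * (\<kappa>2 * \<epsilon>) ^ n)"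
    using const_pos pos ep by (simp add: ennreal_mult[symmetric] power_mult_distrib mult_ac)
  also have "\<dots> \<le> emeasure \<mu> (M \<inter> ball (fst X) (\<kappa>2 * \<epsilon>))"
    using const_pos ep by (intro ball_lower fM) auto
  finally show "ennreal (aL * \<kappa>2 ^ n) * ennreal (\<epsilon> ^ n) * ennreal (step (snd X / \<epsilon>\<^sup>2)) \<le> (\<integral>\<^sup>+X'. ennreal (kern (\<epsilon>\<^sup>2) (\<kappa>2 * \<epsilon>) X X') \<partial>stm)"
    unfolding kern_integral(1)[OF ep(2) X] by (rule mult_right_mono) simp
qed

text \<open>Division by \<open>\<epsilon> ^ n\<close>, the order of the measure of a ball of radius
  \<epsilon>, gives kernels of bounded though not constant mass.\<close>

definition "Ks \<epsilon> X X' = ennreal (kern (\<epsilon>\<^sup>2) (\<kappa>1 * \<epsilon>) X X') * ennreal (inverse (\<epsilon> ^ n))"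
definition "Km \<epsilon> y y' = ennreal (indicator {z. norm z < \<epsilon>} (y - y' :: 'a)) * ennreal (inverse (\<epsilon> ^ n))"

lemma scale_cancel:
  assumes "\<epsilon> > 0"
  shows "ennreal (\<epsilon> ^ n) * ennreal (inverse (\<epsilon> ^ n)) = 1"
  using assms by (simp add: ennreal_mult[symmetric])

lemma mollifier_stm: "mollifier stm \<Omega> (at_right 0) Ks (aU * \<kappa>1 ^ n)"
proof
  show "sets stm = sets (restrict_space borel \<Omega>)" by (rule sets_stm)
  show "(\<lambda>z. Ks \<epsilon> (fst z) (snd z)) \<in> borel_measurable (stm \<Otimes>\<^sub>M stm)" for \<epsilon>
    unfolding Ks_def by measurable
  have *: "x * ennreal (inverse (\<epsilon> ^ n)) \<le> ennreal (aU * \<kappa>1 ^ n)"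
    if "x \<le> ennreal (aU * \<kappa>1 ^ n) * ennreal (\<epsilon> ^ n)" "adm \<epsilon>" for x \<epsilon>
  proof -
    have "x * ennreal (inverse (\<epsilon> ^ n)) \<le> ennreal (aU * \<kappa>1 ^ n) * ennreal (\<epsilon> ^ n) * ennreal (inverse (\<epsilon> ^ n))"
      using that(1) by (rule mult_right_mono) simp
    then show ?thesis using scale_cancel[of \<epsilon>] that(2) by (simp add: adm_def mult.assoc)
  qed
  show "\<forall>\<^sub>F \<epsilon> in at_right 0. \<forall>x\<in>\<Omega>. (\<integral>\<^sup>+y. Ks \<epsilon> x y \<partial>stm) \<le> ennreal (aU * \<kappa>1 ^ n)"
    using eventually_adm
  proof eventually_elim
    case (elim \<epsilon>)
    show ?case
    proof
      fix X assume X: "X \<in> \<Omega>"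
      then have [measurable]: "X \<in> space stm" by (simp add: space_stm)
      show "(\<integral>\<^sup>+y. Ks \<epsilon> X y \<partial>stm) \<le> ennreal (aU * \<kappa>1 ^ n)"
        unfolding Ks_def using kern_scaled(1)[OF elim X] by (subst nn_integral_multc) (auto intro!: * elim)
    qed
  qed
  show "\<forall>\<^sub>F \<epsilon> in at_right 0. \<forall>y\<in>\<Omega>. (\<integral>\<^sup>+x. Ks \<epsilon> x y \<partial>stm) \<le> ennreal (aU * \<kappa>1 ^ n)"
    using eventually_adm
  proof eventually_elim
    case (elim \<epsilon>)
    show ?case
    proof
      fix X assume X: "X \<in> \<Omega>"
      then have [measurable]: "X \<in> space stm" by (simp add: space_stm)
      show "(\<integral>\<^sup>+y. Ks \<epsilon> y X \<partial>stm) \<le> ennreal (aU * \<kappa>1 ^ n)"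
        unfolding Ks_def using kern_scaled(2)[OF elim X] by (subst nn_integral_multc) (auto intro!: * elim)
    qed
  qed
  fix \<rho> :: real assume \<rho>: "\<rho> > 0"
  show "\<forall>\<^sub>F \<epsilon> in at_right 0. \<forall>x\<in>\<Omega>. \<forall>y\<in>\<Omega>. Ks \<epsilon> x y \<noteq> 0 \<longrightarrow> dist x y < \<rho>"
    using eventually_adm eventually_small[OF \<rho>, of "\<kappa>1 + 1"]
  proof eventually_elim
    case (elim \<epsilon>)
    show ?case
    proof (intro ballI impI)
      fix X X' assume "Ks \<epsilon> X X' \<noteq> 0"
      then have k: "kern (\<epsilon>\<^sup>2) (\<kappa>1 * \<epsilon>) X X' \<noteq> 0" by (auto simp: Ks_def)
      have ep: "0 < \<epsilon>" "\<epsilon> \<le> 1" "0 < \<epsilon>\<^sup>2" using elim by (auto simp: adm_def)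
      have "\<not> (snd X - snd X' \<le> 0 \<or> snd X - snd X' \<ge> \<epsilon>\<^sup>2)"
        using k mol_zero[OF ep(3)] by (auto simp: kern_def)
      then have "\<bar>snd X - snd X'\<bar> < \<epsilon>\<^sup>2" by auto
      moreover have "\<epsilon>\<^sup>2 \<le> \<epsilon>" using ep by (simp add: power2_eq_square mult_left_le)
      moreover have "norm (fst X - fst X') < \<kappa>1 * \<epsilon>" using k by (auto simp: kern_def indicator_def split: if_splits)
      moreover have "dist X X' \<le> dist (fst X) (fst X') + dist (snd X) (snd X')"
        unfolding dist_prod_def by (rule sqrt_sum_squares_le_sum) auto
      ultimately have "dist X X' < (\<kappa>1 + 1) * \<epsilon>" by (simp add: dist_norm algebra_simps)
      then show "dist X X' < \<rho>" using elim by simp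
    qed
  qed
qed (use const_pos pos in simp)

lemma mollifier_\<mu>: "mollifier \<mu> M (at_right 0) Km aU"
proof
  show "sets \<mu> = sets (restrict_space borel M)" by (rule sets_\<mu>)
  show "(\<lambda>z. Km \<epsilon> (fst z) (snd z)) \<in> borel_measurable (\<mu> \<Otimes>\<^sub>M \<mu>)" for \<epsilon>
  proof -
    have [measurable]: "(\<lambda>z. fst z) \<in> \<mu> \<Otimes>\<^sub>M \<mu> \<rightarrow>\<^sub>M borel" "(\<lambda>z. snd z) \<in> \<mu> \<Otimes>\<^sub>M \<mu> \<rightarrow>\<^sub>M borel"
      using measurable_compose[OF measurable_fst id_\<mu>] measurable_compose[OF measurable_snd id_\<mu>] by auto
    show ?thesis unfolding Km_def by measurable
  qed
  have *: "emeasure \<mu> (M \<inter> ball y \<epsilon>) * ennreal (inverse (\<epsilon> ^ n)) \<le> ennreal aU" if "adm \<epsilon>" for y \<epsilon>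
  proof -
    have ep: "0 < \<epsilon>" using that by (simp add: adm_def)
    have "emeasure \<mu> (M \<inter> ball y \<epsilon>) * ennreal (inverse (\<epsilon> ^ n)) \<le> ennreal aU * ennreal (\<epsilon> ^ n) * ennreal (inverse (\<epsilon> ^ n))"
      using ball_upper[OF ep] pos ep by (intro mult_right_mono) (auto simp: ennreal_mult[symmetric])
    then show ?thesis using scale_cancel[OF ep] by (simp add: mult.assoc)
  qed
  show "\<forall>\<^sub>F \<epsilon> in at_right 0. \<forall>x\<in>M. (\<integral>\<^sup>+y. Km \<epsilon> x y \<partial>\<mu>) \<le> ennreal aU"
    using eventually_adm by eventually_elim (simp add: Km_def nn_integral_multc ball_meas *)
  show "\<forall>\<^sub>F \<epsilon> in at_right 0. \<forall>y\<in>M. (\<integral>\<^sup>+x. Km \<epsilon> x y \<partial>\<mu>) \<le> ennreal aU"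
    using eventually_adm by eventually_elim (simp add: Km_def nn_integral_multc ball_meas *)
  fix \<rho> :: real assume \<rho>: "\<rho> > 0"
  show "\<forall>\<^sub>F \<epsilon> in at_right 0. \<forall>x\<in>M. \<forall>y\<in>M. Km \<epsilon> x y \<noteq> 0 \<longrightarrow> dist x y < \<rho>"
    using eventually_small[OF \<rho>, of 1]
    by eventually_elim (auto simp: Km_def dist_norm indicator_def split: if_splits)
qed (rule pos(2))

interpretation ms: mollifier stm \<Omega> "at_right 0" Ks "aU * \<kappa>1 ^ n" by (rule mollifier_stm)
interpretation mm: mollifier \<mu> M "at_right 0" Km aU by (rule mollifier_\<mu>)

lemma avg_limits: "((\<lambda>\<epsilon>. ms.avg \<epsilon> w') \<longlongrightarrow> 0) (at_right 0)" "((\<lambda>\<epsilon>. ms.avg \<epsilon> b) \<longlongrightarrow> 0) (at_right 0)"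
  "((\<lambda>\<epsilon>. mm.avg \<epsilon> u0) \<longlongrightarrow> 0) (at_right 0)"
proof -
  have "integrable stm w'" "integrable stm b" "integrable \<mu> u0"
    using integrable_bounded[OF finite_stm meas_stm(4), of Kw] integrable_bounded[OF finite_stm meas_stm(2), of B]
      integrable_bounded[OF fin meas_stm(7), of Kw] w_bound(2) b_bound u0_bound
    by (auto simp: space_stm space_\<mu>)
  then show "((\<lambda>\<epsilon>. ms.avg \<epsilon> w') \<longlongrightarrow> 0) (at_right 0)" "((\<lambda>\<epsilon>. ms.avg \<epsilon> b) \<longlongrightarrow> 0) (at_right 0)"
    "((\<lambda>\<epsilon>. mm.avg \<epsilon> u0) \<longlongrightarrow> 0) (at_right 0)"
    using ms.avg_tendsto_zero mm.avg_tendsto_zero by (auto intro!: tendsto_zero_ennrealI)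
qed

lemma avg_scaled:
  assumes \<epsilon>: "\<epsilon> > 0" and [measurable]: "g \<in> borel_measurable stm"
  shows "(\<integral>\<^sup>+X. \<integral>\<^sup>+X'. ennreal (\<bar>g X - g X'\<bar> * kern (\<epsilon>\<^sup>2) (\<kappa>1 * \<epsilon>) X X') \<partial>stm \<partial>stm) = ennreal (\<epsilon> ^ n) * ms.avg \<epsilon> g"
proof -
  have "ennreal (\<epsilon> ^ n) * ms.avg \<epsilon> g = (\<integral>\<^sup>+X. ennreal (\<epsilon> ^ n) * (\<integral>\<^sup>+X'. ennreal \<bar>g X - g X'\<bar> * Ks \<epsilon> X X' \<partial>stm) \<partial>stm)"
    unfolding ms.avg_def by (rule nn_integral_cmult[symmetric]) (unfold Ks_def, measurable)
  also have "\<dots> = (\<integral>\<^sup>+X. \<integral>\<^sup>+X'. ennreal (\<epsilon> ^ n) * (ennreal \<bar>g X - g X'\<bar> * Ks \<epsilon> X X') \<partial>stm \<partial>stm)"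
    by (intro nn_integral_cong nn_integral_cmult[symmetric]) (unfold Ks_def, measurable)
  also have "\<dots> = (\<integral>\<^sup>+X. \<integral>\<^sup>+X'. ennreal (\<bar>g X - g X'\<bar> * kern (\<epsilon>\<^sup>2) (\<kappa>1 * \<epsilon>) X X') \<partial>stm \<partial>stm)"
  proof (intro nn_integral_cong)
    fix X X'
    have "ennreal (\<epsilon> ^ n) * (ennreal \<bar>g X - g X'\<bar> * Ks \<epsilon> X X') =
      (ennreal (\<epsilon> ^ n) * ennreal (inverse (\<epsilon> ^ n))) * (ennreal \<bar>g X - g X'\<bar> * ennreal (kern (\<epsilon>\<^sup>2) (\<kappa>1 * \<epsilon>) X X'))"
      by (simp add: Ks_def mult_ac)
    then show "ennreal (\<epsilon> ^ n) * (ennreal \<bar>g X - g X'\<bar> * Ks \<epsilon> X X') = ennreal (\<bar>g X - g X'\<bar> * kern (\<epsilon>\<^sup>2) (\<kappa>1 * \<epsilon>) X X')"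
      using scale_cancel[OF \<epsilon>] by (simp add: ennreal_mult')
  qed
  finally show ?thesis ..
qed

text \<open>The two sides of the limit inequality up to constants. At positive \<epsilon> the lower
  bound only yields \<open>A1s\<close>, whose factor \<open>step\<close> records the mass that the
  backward kernel loses near time 0.\<close>

definition "A1 = (\<integral>\<^sup>+X. ennreal (- \<psi>' (snd X) * d X) \<partial>stm)"
definition "A2 = (\<integral>\<^sup>+X. ennreal (\<psi> (snd X) * d X) \<partial>stm)"
definition "A1s \<epsilon> = (\<integral>\<^sup>+X. ennreal (- \<psi>' (snd X) * d X) * ennreal (step (snd X / \<epsilon>\<^sup>2)) \<partial>stm)"

lemma d_measurable [measurable]: "d \<in> borel_measurable stm"
  unfolding d_def by measurable

lemma snd_bounds: "X \<in> space stm \<Longrightarrow> snd X \<in> {0..T}"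
  by (auto simp: space_stm)

text \<open>Here, in \<open>upper_side\<close> and in \<open>initial_side\<close> the factor
  \<open>\<epsilon> ^ n\<close> is split off on the same side as the terms surviving the limit, so
  that it cancels in \<open>A_inequality\<close>.\<close>

lemma lower_side:
  assumes \<epsilon>: "adm \<epsilon>"
  shows "ennreal (\<epsilon> ^ n) * (ennreal cL * A1s \<epsilon>) \<le> (\<integral>\<^sup>+X. \<integral>\<^sup>+X'. ennreal (G1 \<epsilon> X X') \<partial>stm \<partial>stm)"
proof -
  have "ennreal (\<epsilon> ^ n) * (ennreal cL * A1s \<epsilon>) =
    (\<integral>\<^sup>+X. ennreal (\<epsilon> ^ n) * (ennreal cL * (ennreal (- \<psi>' (snd X) * d X) * ennreal (step (snd X / \<epsilon>\<^sup>2)))) \<partial>stm)"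
    unfolding A1s_def by (simp add: nn_integral_cmult)
  also have "\<dots> \<le> (\<integral>\<^sup>+X. \<integral>\<^sup>+X'. ennreal (G1 \<epsilon> X X') \<partial>stm \<partial>stm)"
  proof (rule nn_integral_mono)
    fix X assume Xs: "X \<in> space stm"
    then have X: "X \<in> \<Omega>" by (simp add: space_stm)
    note [measurable] = Xs
    note p = \<psi>_bounds[OF snd_bounds[OF Xs]]
    have d0: "0 \<le> d X" by (simp add: d_def)
    have c: "ennreal cL = ennreal (9 / 16 * j0\<^sup>2) * ennreal (aL * \<kappa>2 ^ n)"
      using pos const_pos by (simp add: cL_def ennreal_mult[symmetric] mult_ac)
    have "ennreal (\<epsilon> ^ n) * (ennreal cL * (ennreal (- \<psi>' (snd X) * d X) * ennreal (step (snd X / \<epsilon>\<^sup>2)))) =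
      ennreal (9 / 16 * j0\<^sup>2) * ennreal (- \<psi>' (snd X) * d X) * (ennreal (aL * \<kappa>2 ^ n) * ennreal (\<epsilon> ^ n) * ennreal (step (snd X / \<epsilon>\<^sup>2)))"
      unfolding c by (simp only: mult_ac)
    also have "\<dots> \<le> ennreal (9 / 16 * j0\<^sup>2) * ennreal (- \<psi>' (snd X) * d X) * (\<integral>\<^sup>+X'. ennreal (kern (\<epsilon>\<^sup>2) (\<kappa>2 * \<epsilon>) X X') \<partial>stm)"
      by (rule mult_left_mono[OF kern_scaled(3)[OF \<epsilon> X]]) simp
    also have "ennreal (9 / 16 * j0\<^sup>2) * ennreal (- \<psi>' (snd X) * d X) = ennreal (9 / 16 * j0\<^sup>2 * (- \<psi>' (snd X)) * d X)"
    proof -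
      have "0 \<le> - \<psi>' (snd X) * d X" by (intro mult_nonneg_nonneg) (use p d0 in auto)
      then show ?thesis by (subst ennreal_mult[symmetric]) (auto simp: mult_ac)
    qed
    also have "\<dots> * (\<integral>\<^sup>+X'. ennreal (kern (\<epsilon>\<^sup>2) (\<kappa>2 * \<epsilon>) X X') \<partial>stm) =
        (\<integral>\<^sup>+X'. ennreal (9 / 16 * j0\<^sup>2 * (- \<psi>' (snd X)) * d X) * ennreal (kern (\<epsilon>\<^sup>2) (\<kappa>2 * \<epsilon>) X X') \<partial>stm)"
      by (rule nn_integral_cmult[symmetric]) measurable
    also have "\<dots> = (\<integral>\<^sup>+X'. ennreal (G1 \<epsilon> X X') \<partial>stm)"
      unfolding G1_def using p d0 by (intro nn_integral_cong ennreal_mult'[symmetric] mult_nonneg_nonneg) auto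
    finally show "ennreal (\<epsilon> ^ n) * (ennreal cL * (ennreal (- \<psi>' (snd X) * d X) * ennreal (step (snd X / \<epsilon>\<^sup>2))))
      \<le> (\<integral>\<^sup>+X'. ennreal (G1 \<epsilon> X X') \<partial>stm)" .
  qed
  finally show ?thesis .
qed

lemma upper_side:
  assumes \<epsilon>: "adm \<epsilon>"
  shows "(\<integral>\<^sup>+X. \<integral>\<^sup>+X'. ennreal (G2 \<epsilon> X X') \<partial>stm \<partial>stm) \<le>
    ennreal (\<epsilon> ^ n) * (ennreal cU * A2 + ennreal (j1\<^sup>2 * C2) * (ms.avg \<epsilon> w' + ms.avg \<epsilon> b))"
proof -
  have ep: "0 < \<epsilon>" "0 < \<epsilon>\<^sup>2" using \<epsilon> by (auto simp: adm_def)
  let ?k = "kern (\<epsilon>\<^sup>2) (\<kappa>1 * \<epsilon>)"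
  have k0: "0 \<le> ?k X X'" for X X' by (rule kern_nonneg[OF ep(2)])
  have "(\<integral>\<^sup>+X. \<integral>\<^sup>+X'. ennreal (G2 \<epsilon> X X') \<partial>stm \<partial>stm) =
    (\<integral>\<^sup>+X. ennreal (j1\<^sup>2 * C1 * \<psi> (snd X) * d X) * (\<integral>\<^sup>+X'. ennreal (?k X X') \<partial>stm) +
      ennreal (j1\<^sup>2 * C2) * ((\<integral>\<^sup>+X'. ennreal (\<bar>w' X - w' X'\<bar> * ?k X X') \<partial>stm) + (\<integral>\<^sup>+X'. ennreal (\<bar>b X - b X'\<bar> * ?k X X') \<partial>stm)) \<partial>stm)"
  proof (rule nn_integral_cong)
    fix X assume Xs[measurable]: "X \<in> space stm"
    note p = \<psi>_bounds[OF snd_bounds[OF Xs]]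
    have a0: "0 \<le> j1\<^sup>2 * C1 * \<psi> (snd X) * d X" using p const_pos by (simp add: d_def)
    have b0: "0 \<le> j1\<^sup>2 * C2" using const_pos by simp
    have "ennreal (G2 \<epsilon> X X') = ennreal (j1\<^sup>2 * C1 * \<psi> (snd X) * d X) * ennreal (?k X X') +
        ennreal (j1\<^sup>2 * C2) * (ennreal (\<bar>w' X - w' X'\<bar> * ?k X X') + ennreal (\<bar>b X - b X'\<bar> * ?k X X'))" for X'
    proof -
      have "G2 \<epsilon> X X' = j1\<^sup>2 * C1 * \<psi> (snd X) * d X * ?k X X' + j1\<^sup>2 * C2 * (\<bar>w' X - w' X'\<bar> * ?k X X' + \<bar>b X - b X'\<bar> * ?k X X')"
        by (simp add: G2_def algebra_simps)
      then show ?thesis using a0 b0 k0[of X X']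
        by (simp only: ennreal_plus ennreal_mult mult_nonneg_nonneg add_nonneg_nonneg abs_ge_zero)
    qed
    then show "(\<integral>\<^sup>+X'. ennreal (G2 \<epsilon> X X') \<partial>stm) = ennreal (j1\<^sup>2 * C1 * \<psi> (snd X) * d X) * (\<integral>\<^sup>+X'. ennreal (?k X X') \<partial>stm) +
      ennreal (j1\<^sup>2 * C2) * ((\<integral>\<^sup>+X'. ennreal (\<bar>w' X - w' X'\<bar> * ?k X X') \<partial>stm) + (\<integral>\<^sup>+X'. ennreal (\<bar>b X - b X'\<bar> * ?k X X') \<partial>stm))"
      by (simp add: nn_integral_add nn_integral_cmult)
  qed
  also have "\<dots> = (\<integral>\<^sup>+X. ennreal (j1\<^sup>2 * C1 * \<psi> (snd X) * d X) * (\<integral>\<^sup>+X'. ennreal (?k X X') \<partial>stm) \<partial>stm) +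
      ennreal (j1\<^sup>2 * C2) * ((\<integral>\<^sup>+X. \<integral>\<^sup>+X'. ennreal (\<bar>w' X - w' X'\<bar> * ?k X X') \<partial>stm \<partial>stm)
        + (\<integral>\<^sup>+X. \<integral>\<^sup>+X'. ennreal (\<bar>b X - b X'\<bar> * ?k X X') \<partial>stm \<partial>stm))"
    by (subst nn_integral_add, measurable, subst nn_integral_cmult, measurable, subst nn_integral_add, measurable)
  also have "\<dots> = (\<integral>\<^sup>+X. ennreal (j1\<^sup>2 * C1 * \<psi> (snd X) * d X) * (\<integral>\<^sup>+X'. ennreal (?k X X') \<partial>stm) \<partial>stm) +
      ennreal (j1\<^sup>2 * C2) * (ennreal (\<epsilon> ^ n) * ms.avg \<epsilon> w' + ennreal (\<epsilon> ^ n) * ms.avg \<epsilon> b)"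
    by (simp only: avg_scaled[OF ep(1) meas_stm(4)] avg_scaled[OF ep(1) meas_stm(2)])
  finally have eq: "(\<integral>\<^sup>+X. \<integral>\<^sup>+X'. ennreal (G2 \<epsilon> X X') \<partial>stm \<partial>stm) =
      (\<integral>\<^sup>+X. ennreal (j1\<^sup>2 * C1 * \<psi> (snd X) * d X) * (\<integral>\<^sup>+X'. ennreal (?k X X') \<partial>stm) \<partial>stm) +
      ennreal (j1\<^sup>2 * C2) * (ennreal (\<epsilon> ^ n) * ms.avg \<epsilon> w' + ennreal (\<epsilon> ^ n) * ms.avg \<epsilon> b)" .
  have "(\<integral>\<^sup>+X. ennreal (j1\<^sup>2 * C1 * \<psi> (snd X) * d X) * (\<integral>\<^sup>+X'. ennreal (?k X X') \<partial>stm) \<partial>stm) \<le>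
      (\<integral>\<^sup>+X. ennreal (\<epsilon> ^ n) * (ennreal cU * ennreal (\<psi> (snd X) * d X)) \<partial>stm)"
  proof (rule nn_integral_mono)
    fix X assume Xs: "X \<in> space stm"
    then have X: "X \<in> \<Omega>" by (simp add: space_stm)
    note p = \<psi>_bounds[OF snd_bounds[OF Xs]]
    have d0: "0 \<le> \<psi> (snd X) * d X" using p by (simp add: d_def)
    have "ennreal (j1\<^sup>2 * C1 * \<psi> (snd X) * d X) * (\<integral>\<^sup>+X'. ennreal (?k X X') \<partial>stm) \<le>
      ennreal (j1\<^sup>2 * C1 * (\<psi> (snd X) * d X)) * (ennreal (aU * \<kappa>1 ^ n) * ennreal (\<epsilon> ^ n))"
      using kern_scaled(1)[OF \<epsilon> X] by (auto intro!: mult_left_mono simp: mult.assoc)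
    also have "\<dots> = ennreal (\<epsilon> ^ n) * (ennreal cU * ennreal (\<psi> (snd X) * d X))"
    proof -
      have nn: "0 \<le> j1\<^sup>2 * C1 * (\<psi> (snd X) * d X)" "0 \<le> aU * \<kappa>1 ^ n" "0 \<le> \<epsilon> ^ n" "0 \<le> cU" "0 \<le> aU * \<kappa>1 ^ n * \<epsilon> ^ n"
          "0 \<le> cU * (\<psi> (snd X) * d X)"
        using d0 const_pos pos ep by simp_all
      show ?thesis
        unfolding ennreal_mult[OF nn(2,3), symmetric] ennreal_mult[OF nn(1,5), symmetric]
          ennreal_mult[OF nn(4) d0, symmetric] ennreal_mult[OF nn(3,6), symmetric]
        by (simp add: cU_def mult_ac)
    qed
    finally show "ennreal (j1\<^sup>2 * C1 * \<psi> (snd X) * d X) * (\<integral>\<^sup>+X'. ennreal (?k X X') \<partial>stm) \<le> \<dots>" .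
  qed
  also have "(\<integral>\<^sup>+X. ennreal (\<epsilon> ^ n) * (ennreal cU * ennreal (\<psi> (snd X) * d X)) \<partial>stm) = ennreal (\<epsilon> ^ n) * (ennreal cU * A2)"
    unfolding A2_def by (subst nn_integral_cmult, measurable, subst nn_integral_cmult, measurable)
  finally have le: "(\<integral>\<^sup>+X. ennreal (j1\<^sup>2 * C1 * \<psi> (snd X) * d X) * (\<integral>\<^sup>+X'. ennreal (?k X X') \<partial>stm) \<partial>stm) \<le> ennreal (\<epsilon> ^ n) * (ennreal cU * A2)" .
  have "ennreal (j1\<^sup>2 * C2) * (ennreal (\<epsilon> ^ n) * ms.avg \<epsilon> w' + ennreal (\<epsilon> ^ n) * ms.avg \<epsilon> b) =
      ennreal (\<epsilon> ^ n) * (ennreal (j1\<^sup>2 * C2) * (ms.avg \<epsilon> w' + ms.avg \<epsilon> b))"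
    by (simp only: distrib_left mult.left_commute)
  then show ?thesis unfolding eq distrib_left[of "ennreal (\<epsilon> ^ n)" "ennreal cU * A2"]
    using add_right_mono[OF le] by simp
qed

definition "Q = T * (j1 * C3 * aU * \<kappa>1 ^ n) * measure \<mu> M"

lemma initial_side:
  assumes \<epsilon>: "adm \<epsilon>"
  shows "(\<integral>\<^sup>+y'. ennreal T * (\<integral>\<^sup>+X. ennreal (J X * \<bar>w X - u0 y'\<bar> * mol (\<epsilon>\<^sup>2) (snd X) * bump \<epsilon> (P X - y')) \<partial>stm) \<partial>\<mu>) \<le>
    ennreal (\<epsilon> ^ n) * (ennreal (Q * \<epsilon>) + ennreal T * mm.avg \<epsilon> u0)"
proof -
  have ep: "0 < \<epsilon>" using \<epsilon> by (auto simp: adm_def)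
  have [measurable]: "(\<lambda>y. u0 y) \<in> borel_measurable \<mu>" by measurable
  have "(\<integral>\<^sup>+y'. ennreal T * (\<integral>\<^sup>+X. ennreal (J X * \<bar>w X - u0 y'\<bar> * mol (\<epsilon>\<^sup>2) (snd X) * bump \<epsilon> (P X - y')) \<partial>stm) \<partial>\<mu>) \<le>
    (\<integral>\<^sup>+y'. ennreal (T * (j1 * C3 * aU * \<kappa>1 ^ n) * \<epsilon> * \<epsilon> ^ n) + ennreal (\<epsilon> ^ n) * (ennreal T * (\<integral>\<^sup>+y. ennreal \<bar>u0 y' - u0 y\<bar> * Km \<epsilon> y' y \<partial>\<mu>)) \<partial>\<mu>)"
  proof (rule nn_integral_mono)
    fix y' assume y': "y' \<in> space \<mu>"
    have yM: "y' \<in> M" using y' by (simp add: space_\<mu>)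
    have Kmm: "(\<lambda>y. ennreal \<bar>u0 y' - u0 y\<bar> * Km \<epsilon> y' y) \<in> borel_measurable \<mu>" unfolding Km_def by measurable
    have "(\<integral>\<^sup>+y. ennreal (\<bar>u0 y - u0 y'\<bar> * indicator {z. norm z < \<epsilon>} (y - y')) \<partial>\<mu>) =
      (\<integral>\<^sup>+y. ennreal (\<epsilon> ^ n) * (ennreal \<bar>u0 y' - u0 y\<bar> * Km \<epsilon> y' y) \<partial>\<mu>)"
    proof (rule nn_integral_cong)
      fix y
      have 1: "(indicator {z. norm z < \<epsilon>} (y - y') :: real) = indicator {z. norm z < \<epsilon>} (y' - y)"
        by (simp add: indicator_def norm_minus_commute)
      have "ennreal (\<epsilon> ^ n) * (ennreal \<bar>u0 y' - u0 y\<bar> * Km \<epsilon> y' y) = (ennreal (\<epsilon> ^ n) * ennreal (inverse (\<epsilon> ^ n))) *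
         (ennreal \<bar>u0 y' - u0 y\<bar> * ennreal (indicator {z. norm z < \<epsilon>} (y' - y)))"
        by (simp add: Km_def mult_ac)
      then show "ennreal (\<bar>u0 y - u0 y'\<bar> * indicator {z. norm z < \<epsilon>} (y - y')) = ennreal (\<epsilon> ^ n) * (ennreal \<bar>u0 y' - u0 y\<bar> * Km \<epsilon> y' y)"
        unfolding 1 using scale_cancel[OF ep] by (simp add: ennreal_mult' abs_minus_commute)
    qed
    also have "\<dots> = ennreal (\<epsilon> ^ n) * (\<integral>\<^sup>+y. ennreal \<bar>u0 y' - u0 y\<bar> * Km \<epsilon> y' y \<partial>\<mu>)" by (rule nn_integral_cmult[OF Kmm])
    finally have "ennreal T * (\<integral>\<^sup>+X. ennreal (J X * \<bar>w X - u0 y'\<bar> * mol (\<epsilon>\<^sup>2) (snd X) * bump \<epsilon> (P X - y')) \<partial>stm) \<le>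
      ennreal T * (ennreal (j1 * C3 * aU * \<kappa>1 ^ n * \<epsilon> * \<epsilon> ^ n) + ennreal (\<epsilon> ^ n) * (\<integral>\<^sup>+y. ennreal \<bar>u0 y' - u0 y\<bar> * Km \<epsilon> y' y \<partial>\<mu>))"
      using init_bound[OF yM \<epsilon>] by (simp add: mult_left_mono)
    also have "\<dots> = ennreal (T * (j1 * C3 * aU * \<kappa>1 ^ n) * \<epsilon> * \<epsilon> ^ n) + ennreal (\<epsilon> ^ n) * (ennreal T * (\<integral>\<^sup>+y. ennreal \<bar>u0 y' - u0 y\<bar> * Km \<epsilon> y' y \<partial>\<mu>))"
      using T const_pos pos ep by (simp add: distrib_left ennreal_mult'[symmetric] mult_ac)
    finally show "ennreal T * (\<integral>\<^sup>+X. ennreal (J X * \<bar>w X - u0 y'\<bar> * mol (\<epsilon>\<^sup>2) (snd X) * bump \<epsilon> (P X - y')) \<partial>stm) \<le> \<dots>" .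
  qed
  also have "\<dots> = (\<integral>\<^sup>+y'. ennreal (T * (j1 * C3 * aU * \<kappa>1 ^ n) * \<epsilon> * \<epsilon> ^ n) \<partial>\<mu>) + ennreal (\<epsilon> ^ n) * (ennreal T * mm.avg \<epsilon> u0)"
  proof -
    define f where "f = (\<lambda>y'. \<integral>\<^sup>+y. ennreal \<bar>u0 y' - u0 y\<bar> * Km \<epsilon> y' y \<partial>\<mu>)"
    have [measurable]: "f \<in> borel_measurable \<mu>" unfolding f_def by measurable
    have fe: "(\<integral>\<^sup>+y. ennreal \<bar>u0 y' - u0 y\<bar> * Km \<epsilon> y' y \<partial>\<mu>) = f y'" for y' by (simp add: f_def)
    show ?thesis unfolding mm.avg_def fe by (simp add: nn_integral_add nn_integral_cmult)
  qed
  also have "(\<integral>\<^sup>+y'. ennreal (T * (j1 * C3 * aU * \<kappa>1 ^ n) * \<epsilon> * \<epsilon> ^ n) \<partial>\<mu>) = ennreal (\<epsilon> ^ n) * ennreal (Q * \<epsilon>)"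
  proof -
    let ?a = "T * (j1 * C3 * aU * \<kappa>1 ^ n) * \<epsilon> * \<epsilon> ^ n"
    have nn: "0 \<le> ?a" "0 \<le> \<epsilon> ^ n" "0 \<le> Q * \<epsilon>" using T const_pos pos ep by (simp_all add: Q_def)
    have "ennreal ?a * ennreal (measure \<mu> M) = ennreal (?a * measure \<mu> M)"
      by (rule ennreal_mult[OF nn(1) measure_nonneg, symmetric])
    also have "?a * measure \<mu> M = \<epsilon> ^ n * (Q * \<epsilon>)" by (simp add: Q_def mult_ac)
    also have "ennreal \<dots> = ennreal (\<epsilon> ^ n) * ennreal (Q * \<epsilon>)" by (rule ennreal_mult[OF nn(2,3)])
    finally show ?thesis by (simp only: nn_integral_const \<mu>.emeasure_eq_measure space_\<mu>)
  qed
  finally show ?thesis by (simp add: distrib_left)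
qed

definition "E = (\<Lambda> * T + 1) * (2 * Kw) * measure \<mu> M"

text \<open>The factor \<open>step\<close> differs from 1 only for times below
  \<open>\<epsilon>\<^sup>2\<close>, a set of small measure on which the integrand is
  bounded.\<close>

lemma A1_le:
  assumes \<epsilon>: "adm \<epsilon>"
  shows "A1 \<le> A1s \<epsilon> + ennreal (E * \<epsilon>)"
proof -
  have ep: "0 < \<epsilon>" "\<epsilon> \<le> 1" "0 < \<epsilon>\<^sup>2" using \<epsilon> by (auto simp: adm_def)
  let ?D = "(\<Lambda> * T + 1) * (2 * Kw)"
  have D0: "0 \<le> ?D" using const_pos T pos by (intro mult_nonneg_nonneg add_nonneg_nonneg) auto
  have "A1 \<le> (\<integral>\<^sup>+X. ennreal (- \<psi>' (snd X) * d X) * ennreal (step (snd X / \<epsilon>\<^sup>2)) + ennreal (?D * indicator {..<\<epsilon>\<^sup>2} (snd X)) \<partial>stm)"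
    unfolding A1_def
  proof (rule nn_integral_mono)
    fix X assume Xs: "X \<in> space stm"
    then have X: "X \<in> \<Omega>" by (simp add: space_stm)
    note p = \<psi>_bounds[OF snd_bounds[OF Xs]]
    show "ennreal (- \<psi>' (snd X) * d X) \<le> ennreal (- \<psi>' (snd X) * d X) * ennreal (step (snd X / \<epsilon>\<^sup>2)) + ennreal (?D * indicator {..<\<epsilon>\<^sup>2} (snd X))"
    proof (cases "snd X < \<epsilon>\<^sup>2")
      case True
      have "- \<psi>' (snd X) * d X \<le> ?D"
        using p const_pos T w_bound[OF X] by (intro mult_mono) (auto simp: d_def)
      then have "ennreal (- \<psi>' (snd X) * d X) \<le> ennreal (?D * indicator {..<\<epsilon>\<^sup>2} (snd X))" using True by (simp add: ennreal_leI)
      then show ?thesis by (rule order_trans) simp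
    next
      case False
      then have "1 \<le> snd X / \<epsilon>\<^sup>2" using ep by simp
      then show ?thesis by (simp add: step_values)
    qed
  qed
  also have "\<dots> = A1s \<epsilon> + (\<integral>\<^sup>+X. ennreal (?D * indicator {..<\<epsilon>\<^sup>2} (snd X)) \<partial>stm)"
    unfolding A1s_def by (intro nn_integral_add) measurable
  also have "(\<integral>\<^sup>+X. ennreal (?D * indicator {..<\<epsilon>\<^sup>2} (snd X)) \<partial>stm) =
      (\<integral>\<^sup>+y. (\<integral>\<^sup>+t\<in>{0<..<T}. ennreal (?D * indicator {..<\<epsilon>\<^sup>2} t) \<partial>lborel) \<partial>\<mu>)"
    by (subst nn_integral_stm) auto
  also have "\<dots> \<le> (\<integral>\<^sup>+y. ennreal (?D * \<epsilon>) \<partial>\<mu>)"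
  proof (rule nn_integral_mono)
    fix y
    have "(\<integral>\<^sup>+t\<in>{0<..<T}. ennreal (?D * indicator {..<\<epsilon>\<^sup>2} t) \<partial>lborel) \<le> (\<integral>\<^sup>+t. ennreal ?D * indicator {0..\<epsilon>\<^sup>2} t \<partial>lborel)"
      by (intro nn_integral_mono) (auto simp: indicator_def)
    also have "\<dots> = ennreal (?D * \<epsilon>\<^sup>2)" using D0 ep by (subst nn_integral_cmult_indicator) (auto simp: ennreal_mult)
    also have "\<dots> \<le> ennreal (?D * \<epsilon>)"
      using D0 ep by (intro ennreal_leI mult_left_mono) (auto simp: power2_eq_square mult_left_le)
    finally show "(\<integral>\<^sup>+t\<in>{0<..<T}. ennreal (?D * indicator {..<\<epsilon>\<^sup>2} t) \<partial>lborel) \<le> ennreal (?D * \<epsilon>)" .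
  qed
  also have "\<dots> = ennreal (E * \<epsilon>)"
  proof -
    have "0 \<le> ?D * \<epsilon>" using D0 ep by simp
    then have "ennreal (?D * \<epsilon>) * ennreal (measure \<mu> M) = ennreal (?D * \<epsilon> * measure \<mu> M)"
      by (intro ennreal_mult[symmetric]) auto
    then show ?thesis by (simp only: nn_integral_const \<mu>.emeasure_eq_measure space_\<mu> E_def mult_ac)
  qed
  finally show ?thesis by (simp add: add_left_mono)
qed

lemma A_inequality: "ennreal cL * A1 \<le> ennreal cU * A2"
proof -
  let ?h = "\<lambda>\<epsilon>. ennreal cU * A2 + (ennreal (j1\<^sup>2 * C2) * (ms.avg \<epsilon> w' + ms.avg \<epsilon> b) + (ennreal (Q * \<epsilon>) + ennreal T * mm.avg \<epsilon> u0)
      + ennreal cL * ennreal (E * \<epsilon>))"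
  have lin: "((\<lambda>\<epsilon>. ennreal (C * \<epsilon>)) \<longlongrightarrow> 0) (at_right 0)" for C
    using tendsto_ennrealI[OF tendsto_linear_zero] by simp
  have "(?h \<longlongrightarrow> ennreal cU * A2 + (ennreal (j1\<^sup>2 * C2) * (0 + 0) + (0 + ennreal T * 0) + ennreal cL * 0)) (at_right 0)"
    by (intro tendsto_add tendsto_const ennreal_tendsto_cmult avg_limits lin) auto
  then have lim: "(?h \<longlongrightarrow> ennreal cU * A2) (at_right 0)" by simp
  have "\<forall>\<^sub>F \<epsilon> in at_right 0. ennreal cL * A1 \<le> ?h \<epsilon>"
    using eventually_adm
  proof eventually_elim
    case (elim \<epsilon>)
    have ep: "0 < \<epsilon>" using elim by (auto simp: adm_def)
    let ?R = "ennreal cU * A2 + ennreal (j1\<^sup>2 * C2) * (ms.avg \<epsilon> w' + ms.avg \<epsilon> b) + (ennreal (Q * \<epsilon>) + ennreal T * mm.avg \<epsilon> u0)"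
    have "ennreal (\<epsilon> ^ n) * (ennreal cL * A1s \<epsilon>) \<le> ennreal (\<epsilon> ^ n) * ?R"
      unfolding distrib_left[of "ennreal (\<epsilon> ^ n)" "_ + _"]
      by (rule order_trans[OF lower_side[OF elim] order_trans[OF main_inequality[OF elim] add_mono[OF upper_side[OF elim] initial_side[OF elim]]]])
    \<comment> \<open>The common factor \<open>\<epsilon> ^ n\<close> is positive and finite, so it
      may be cancelled in the extended reals.\<close>
    then have le: "ennreal cL * A1s \<epsilon> \<le> ?R"
      using ep by (subst (asm) ennreal_mult_le_mult_iff) auto
    have "ennreal cL * A1 \<le> ennreal cL * (A1s \<epsilon> + ennreal (E * \<epsilon>))" by (rule mult_left_mono[OF A1_le[OF elim]]) simp
    also have "\<dots> = ennreal cL * A1s \<epsilon> + ennreal cL * ennreal (E * \<epsilon>)" by (rule distrib_left)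
    also have "\<dots> \<le> ?R + ennreal cL * ennreal (E * \<epsilon>)" using le by (rule add_right_mono)
    finally show ?case by (simp only: add.assoc)
  qed
  then show ?thesis using lim by (intro tendsto_lowerbound) (auto simp: trivial_limit_at_right_real)
qed

text \<open>By the choice of \<psi>,
  \<open>- \<psi>' t = \<Lambda> * \<psi> t + exp (- \<Lambda> * t)\<close>, and
  \<open>cL * \<Lambda> = cU\<close>. The terms with \<open>A2\<close> therefore cancel in
  \<open>A_inequality\<close>, and the integral of \<open>d\<close> with a strictly positive weight
  is 0.\<close>

theorem AE_equal: "AE X in stm. w X = w' X"
proof -
  let ?e = "\<lambda>X. exp (- \<Lambda> * snd X) * d X"
  have "A1 = (\<integral>\<^sup>+X. ennreal \<Lambda> * ennreal (\<psi> (snd X) * d X) + ennreal (?e X) \<partial>stm)"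
    unfolding A1_def
  proof (rule nn_integral_cong)
    fix X assume "X \<in> space stm"
    note p = \<psi>_bounds[OF snd_bounds[OF this]]
    have "- \<psi>' (snd X) * d X = \<Lambda> * (\<psi> (snd X) * d X) + ?e X" by (simp add: \<psi>'_def algebra_simps)
    also have "ennreal \<dots> = ennreal (\<Lambda> * (\<psi> (snd X) * d X)) + ennreal (?e X)"
      using p const_pos by (intro ennreal_plus mult_nonneg_nonneg) (auto simp: d_def)
    also have "ennreal (\<Lambda> * (\<psi> (snd X) * d X)) = ennreal \<Lambda> * ennreal (\<psi> (snd X) * d X)"
      using const_pos by (intro ennreal_mult') simp
    finally show "ennreal (- \<psi>' (snd X) * d X) = ennreal \<Lambda> * ennreal (\<psi> (snd X) * d X) + ennreal (?e X)" .
  qed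
  also have "\<dots> = ennreal \<Lambda> * A2 + (\<integral>\<^sup>+X. ennreal (?e X) \<partial>stm)"
    unfolding A2_def by (subst nn_integral_add, measurable, subst nn_integral_cmult, measurable)
  finally have "ennreal cL * A1 = ennreal cU * A2 + ennreal cL * (\<integral>\<^sup>+X. ennreal (?e X) \<partial>stm)"
    using const_pos by (simp add: distrib_left mult.assoc[symmetric] ennreal_mult[symmetric] \<Lambda>_def)
  with A_inequality have le: "ennreal cU * A2 + ennreal cL * (\<integral>\<^sup>+X. ennreal (?e X) \<partial>stm) \<le> ennreal cU * A2 + 0" by simp
  have "A2 \<le> (\<integral>\<^sup>+X. ennreal (T * (2 * Kw)) \<partial>stm)"
    unfolding A2_def
  proof (intro nn_integral_mono ennreal_leI)
    fix X assume Xs: "X \<in> space stm"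
    then have X: "X \<in> \<Omega>" by (simp add: space_stm)
    show "\<psi> (snd X) * d X \<le> T * (2 * Kw)"
      using \<psi>_bounds[OF snd_bounds[OF Xs]] w_bound[OF X] T by (intro mult_mono) (auto simp: d_def)
  qed
  also have "\<dots> < \<infinity>" by (simp add: ennreal_mult_less_top stm.emeasure_eq_measure)
  \<comment> \<open>Finiteness permits the cancellation of this summand in the extended
    reals.\<close>
  finally have "ennreal cU * A2 \<noteq> \<infinity>" by (simp add: ennreal_mult_eq_top_iff)
  with le have "ennreal cL * (\<integral>\<^sup>+X. ennreal (?e X) \<partial>stm) = 0" unfolding ennreal_add_left_cancel_le by simp
  then have "(\<integral>\<^sup>+X. ennreal (?e X) \<partial>stm) = 0" using const_pos by simp
  then have "AE X in stm. ennreal (?e X) = 0" by (subst (asm) nn_integral_0_iff_AE) auto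
  then show ?thesis
  proof eventually_elim
    case (elim X)
    then have "?e X \<le> 0" by (simp add: ennreal_eq_0_iff)
    then have "d X \<le> 0" by (simp add: mult_le_0_iff)
    then show ?case by (simp add: d_def)
  qed
qed

end

section \<open>The flow map\<close>

text \<open>Expanding the direction in the basis reduces joint continuity in base point and
  direction to the directionwise continuity in \<open>c1\<close>.\<close>

lemma c1_deriv_continuous:
  fixes g :: "'a::euclidean_space \<Rightarrow> 'b::real_normed_vector"
  assumes g: "c1 U g" and p: "continuous_on S p" "p ` S \<subseteq> U" and h: "continuous_on S h"
  shows "continuous_on S (\<lambda>s. frechet_derivative g (at (p s)) (h s))"
proof -
  have "continuous_on S (\<lambda>s. \<Sum>b\<in>Basis. (h s \<bullet> b) *\<^sub>R frechet_derivative g (at (p s)) b)"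
    by (intro continuous_intros h continuous_on_compose2[OF c1_continuous_deriv[OF g] p(1)] p(2))
  moreover have "(\<Sum>b\<in>Basis. (h s \<bullet> b) *\<^sub>R frechet_derivative g (at (p s)) b) = frechet_derivative g (at (p s)) (h s)"
    if "s \<in> S" for s
  proof -
    have lin: "linear (frechet_derivative g (at (p s)))" using c1_linear[OF g] p(2) that by blast
    have "frechet_derivative g (at (p s)) (h s) = frechet_derivative g (at (p s)) (\<Sum>b\<in>Basis. (h s \<bullet> b) *\<^sub>R b)"
      by (simp add: euclidean_representation)
    then show ?thesis by (simp add: linear_sum[OF lin] linear_scale[OF lin])
  qed
  ultimately show ?thesis by (simp cong: continuous_on_cong)
qed

lemma norm_prod_le: "norm (p - q) \<le> norm (fst p - fst q) + \<bar>snd p - snd (q :: 'a::real_normed_vector \<times> real)\<bar>"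
  using norm_Pair_le[of "fst p - fst q" "snd p - snd q"] by (simp add: minus_prod_def)

text \<open>A smooth extension \<open>G\<close> of the flow to an open set is fixed once, so that
  derivatives are ordinary ones also at times 0 and \<open>T\<close> and in directions transversal
  to \<open>\<Gamma> 0\<close>.\<close>

locale flow =
  fixes T :: real and \<Gamma> :: "real \<Rightarrow> ('n::finite) ambient set" and \<Phi> :: "'n ambient \<Rightarrow> real \<Rightarrow> 'n ambient"
    and v :: "'n ambient \<times> real \<Rightarrow> 'n ambient" and G :: "'n ambient \<times> real \<Rightarrow> 'n ambient" and W :: "('n ambient \<times> real) set"
  assumes ev: "evolving_hypersurface T \<Gamma> \<Phi> v"
    and ext: "smooth_extension (\<Gamma> 0 \<times> {0..T}) (\<lambda>(y, t). \<Phi> y t) W G"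
begin

lemma T_pos: "T > 0" and hyp: "t \<in> {0..T} \<Longrightarrow> closed_hypersurface (\<Gamma> t)"
  and \<Phi>_0: "y \<in> \<Gamma> 0 \<Longrightarrow> \<Phi> y 0 = y"
  and bij: "t \<in> {0..T} \<Longrightarrow> bij_betw (\<lambda>y. \<Phi> y t) (\<Gamma> 0) (\<Gamma> t)"
  and inv_smooth: "t \<in> {0..T} \<Longrightarrow> smooth_on (\<Gamma> t) (inv_into (\<Gamma> 0) (\<lambda>y. \<Phi> y t))"
  and vel: "y \<in> \<Gamma> 0 \<Longrightarrow> t \<in> {0..T} \<Longrightarrow> ((\<lambda>s. \<Phi> y s) has_vector_derivative v (\<Phi> y t, t)) (at t within {0..T})"
  using ev unfolding evolving_hypersurface_def by blast+

abbreviation "K \<equiv> \<Gamma> 0 \<times> {0..T}"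

lemma hyp0: "closed_hypersurface (\<Gamma> 0)" using hyp T_pos by simp

lemma compact_\<Gamma>: "t \<in> {0..T} \<Longrightarrow> compact (\<Gamma> t)"
  using hyp by (auto simp: closed_hypersurface_def)

lemma compact_\<Gamma>0: "compact (\<Gamma> 0)" using hyp0 by (simp add: closed_hypersurface_def)

lemma compact_K: "compact K" by (intro compact_Times compact_\<Gamma>0 compact_Icc)

lemma K_W: "K \<subseteq> W" and G_eq: "p \<in> K \<Longrightarrow> G p = \<Phi> (fst p) (snd p)"
  using ext by (auto simp: smooth_extension_def case_prod_beta')

lemma K_in_W: "y \<in> \<Gamma> 0 \<Longrightarrow> t \<in> {0..T} \<Longrightarrow> (y, t) \<in> W" using K_W by blast

lemma G_\<Phi>: "y \<in> \<Gamma> 0 \<Longrightarrow> t \<in> {0..T} \<Longrightarrow> G (y, t) = \<Phi> y t"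
  using G_eq[of "(y, t)"] by simp

lemma c1_G: "c1 W (iter_deriv vs G)"
  by (rule smooth_extension_c1[OF ext])

lemma c1_G0: "c1 W G" using c1_G[of "[]"] by simp

lemma \<Phi>_in: "y \<in> \<Gamma> 0 \<Longrightarrow> t \<in> {0..T} \<Longrightarrow> \<Phi> y t \<in> \<Gamma> t"
  using bij by (auto simp: bij_betw_def)

lemma \<Phi>_inj: "y \<in> \<Gamma> 0 \<Longrightarrow> y' \<in> \<Gamma> 0 \<Longrightarrow> t \<in> {0..T} \<Longrightarrow> \<Phi> y t = \<Phi> y' t \<Longrightarrow> y = y'"
  using bij by (auto simp: bij_betw_def inj_on_def)

lemma \<Phi>_image: "t \<in> {0..T} \<Longrightarrow> (\<lambda>y. \<Phi> y t) ` \<Gamma> 0 = \<Gamma> t"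
  using bij by (auto simp: bij_betw_def)

lemma continuous_\<Phi>: "continuous_on K (\<lambda>p. \<Phi> (fst p) (snd p))"
proof -
  have "continuous_on K G" using c1_continuous_on[OF c1_G0] K_W by (rule continuous_on_subset)
  then show ?thesis by (rule continuous_on_eq) (use G_eq in auto)
qed

lemma continuous_\<Phi>t: "t \<in> {0..T} \<Longrightarrow> continuous_on (\<Gamma> 0) (\<lambda>y. \<Phi> y t)"
  by (rule continuous_on_compose2[OF continuous_\<Phi>, of _ "\<lambda>y. (y, t)", simplified]) (auto intro!: continuous_intros)

lemma \<Phi>_lipschitz:
  obtains L where "L > 0" "\<And>y y' t t'. y \<in> \<Gamma> 0 \<Longrightarrow> y' \<in> \<Gamma> 0 \<Longrightarrow> t \<in> {0..T} \<Longrightarrow> t' \<in> {0..T} \<Longrightarrow>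
    norm (\<Phi> y t - \<Phi> y' t') \<le> L * (norm (y - y') + \<bar>t - t'\<bar>)"
proof -
  obtain L where L: "L > 0" "\<And>p q. p \<in> K \<Longrightarrow> q \<in> K \<Longrightarrow> norm (G p - G q) \<le> L * norm (p - q)"
    using c1_lipschitz_on_compact[OF c1_G0 compact_K K_W] by metis
  have "norm (\<Phi> y t - \<Phi> y' t') \<le> L * (norm (y - y') + \<bar>t - t'\<bar>)"
    if "y \<in> \<Gamma> 0" "y' \<in> \<Gamma> 0" "t \<in> {0..T}" "t' \<in> {0..T}" for y y' t t'
  proof -
    have "norm (\<Phi> y t - \<Phi> y' t') \<le> L * norm ((y, t) - (y', t'))"
      using L(2)[of "(y, t)" "(y', t')"] that by (simp add: G_\<Phi>)
    also have "\<dots> \<le> L * (norm (y - y') + \<bar>t - t'\<bar>)"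
      using norm_prod_le[of "(y, t)" "(y', t')"] L(1) by (intro mult_left_mono) auto
    finally show ?thesis .
  qed
  then show thesis using that L(1) by blast
qed

text \<open>At the fixed time \<open>t\<close> the smooth inverse is locally Lipschitz. At a nearby
  time \<open>s\<close> the differences of the flow at two labels have the same linear part as at
  time \<open>t\<close>, by strict differentiability of \<open>G\<close> at \<open>(y, t)\<close>;
  so the bound persists with a worse constant.\<close>

lemma \<Phi>_lower_local:
  assumes y: "y \<in> \<Gamma> 0" and t: "t \<in> {0..T}"
  shows "\<exists>\<delta>>0. \<exists>C. \<forall>y1\<in>\<Gamma> 0 \<inter> ball y \<delta>. \<forall>y2\<in>\<Gamma> 0 \<inter> ball y \<delta>. \<forall>s\<in>{0..T} \<inter> ball t \<delta>.
    norm (y1 - y2) \<le> C * norm (\<Phi> y1 s - \<Phi> y2 s)"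
proof -
  let ?I = "inv_into (\<Gamma> 0) (\<lambda>y. \<Phi> y t)"
  obtain U' I where I: "smooth_extension (\<Gamma> t) ?I U' I" using inv_smooth[OF t] by (auto simp: smooth_on_def)
  have cI: "c1 U' I" using smooth_extension_c1[OF I, of "[]"] by simp
  have xU: "\<Phi> y t \<in> U'" using I \<Phi>_in[OF y t] by (auto simp: smooth_extension_def)
  obtain \<eta> L where \<eta>: "\<eta> > 0" "L > 0"
    "\<And>a b. a \<in> ball (\<Phi> y t) \<eta> \<Longrightarrow> b \<in> ball (\<Phi> y t) \<eta> \<Longrightarrow> norm (I a - I b) \<le> L * norm (a - b)"
    using c1_locally_lipschitz[OF cI xU] by metis
  have inj: "inj_on (\<lambda>y. \<Phi> y t) (\<Gamma> 0)" using bij[OF t] by (rule bij_betw_imp_inj_on)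
  have I\<Phi>: "I (\<Phi> y' t) = y'" if "y' \<in> \<Gamma> 0" for y'
  proof -
    have "I (\<Phi> y' t) = ?I (\<Phi> y' t)" using I \<Phi>_in[OF that t] unfolding smooth_extension_def by blast
    then show ?thesis using inv_into_f_f[OF inj that] by simp
  qed
  obtain LP where LP: "LP > 0" "\<And>y y' t t'. y \<in> \<Gamma> 0 \<Longrightarrow> y' \<in> \<Gamma> 0 \<Longrightarrow> t \<in> {0..T} \<Longrightarrow> t' \<in> {0..T} \<Longrightarrow>
    norm (\<Phi> y t - \<Phi> y' t') \<le> LP * (norm (y - y') + \<bar>t - t'\<bar>)"
    using \<Phi>_lipschitz by metis
  have pW: "(y, t) \<in> W" by (rule K_in_W[OF y t])
  \<comment> \<open>The comparison of the two times costs \<open>2 * e * norm (y1 - y2)\<close>;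
    multiplied by \<open>L\<close> this is half of the left side and is absorbed.\<close>
  define e where "e = 1 / (4 * L)"
  have e: "e > 0" using \<eta> by (simp add: e_def)
  let ?D = "frechet_derivative G (at (y, t))"
  obtain \<eta>' where \<eta>': "\<eta>' > 0" "\<And>p q. p \<in> ball (y, t) \<eta>' \<Longrightarrow> q \<in> ball (y, t) \<eta>' \<Longrightarrow> norm (G p - G q - ?D (p - q)) \<le> e * norm (p - q)"
    using c1_strict_derivative[OF c1_G0 pW e] by metis
  define \<delta> where "\<delta> = min (\<eta> / LP) (\<eta>' / 2)"
  have \<delta>: "\<delta> > 0" "\<delta> \<le> \<eta> / LP" "\<delta> \<le> \<eta>' / 2" unfolding \<delta>_def using \<eta>(1) \<eta>'(1) LP(1) by (simp, simp) (rule min.cobounded2)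
  have "norm (y1 - y2) \<le> 2 * L * norm (\<Phi> y1 s - \<Phi> y2 s)"
    if y1: "y1 \<in> \<Gamma> 0" "dist y y1 < \<delta>" and y2: "y2 \<in> \<Gamma> 0" "dist y y2 < \<delta>" and s: "s \<in> {0..T}" "dist t s < \<delta>" for y1 y2 s
  proof -
    have near: "\<Phi> y' t \<in> ball (\<Phi> y t) \<eta>" if "y' \<in> \<Gamma> 0" "dist y y' < \<delta>" for y'
    proof -
      have "norm (\<Phi> y t - \<Phi> y' t) \<le> LP * norm (y - y')" using LP(2)[OF y that(1) t t] by simp
      also have "\<dots> < LP * \<delta>" using that LP by (simp add: dist_norm)
      also have "\<dots> \<le> \<eta>" using \<delta> LP by (simp add: field_simps)
      finally show ?thesis by (simp add: dist_norm)
    qed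
    have 1: "norm (y1 - y2) \<le> L * norm (\<Phi> y1 t - \<Phi> y2 t)"
      using \<eta>(3)[OF near[OF y1] near[OF y2]] by (simp add: I\<Phi> y1 y2)
    have pball: "(y', s') \<in> ball (y, t) \<eta>'" if "dist y y' < \<delta>" "dist t s' < \<delta>" for y' s'
    proof -
      have "dist (y, t) (y', s') \<le> dist y y' + dist t s'"
        unfolding dist_prod_def by (rule sqrt_sum_squares_le_sum[THEN order_trans]) auto
      then show ?thesis using that \<delta> by simp
    qed
    have tt: "dist t t < \<delta>" using \<delta> by simp
    have 2: "norm (G (y1, s') - G (y2, s') - ?D (y1 - y2, 0)) \<le> e * norm (y1 - y2)" if "dist t s' < \<delta>" for s'
      using \<eta>'(2)[OF pball[OF y1(2) that] pball[OF y2(2) that]] by (simp add: norm_Pair)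
    have "norm (\<Phi> y1 t - \<Phi> y2 t) \<le> norm (\<Phi> y1 s - \<Phi> y2 s) + 2 * e * norm (y1 - y2)"
      using 2[OF s(2)] 2[OF tt] norm_triangle_ineq[of "\<Phi> y1 s - \<Phi> y2 s" "(\<Phi> y1 t - \<Phi> y2 t - ?D (y1 - y2, 0)) - (\<Phi> y1 s - \<Phi> y2 s - ?D (y1 - y2, 0))"]
        norm_triangle_ineq4[of "\<Phi> y1 t - \<Phi> y2 t - ?D (y1 - y2, 0)" "\<Phi> y1 s - \<Phi> y2 s - ?D (y1 - y2, 0)"]
      by (simp add: G_\<Phi>[OF y1(1) s(1)] G_\<Phi>[OF y2(1) s(1)] G_\<Phi>[OF y1(1) t] G_\<Phi>[OF y2(1) t])
    with 1 have "norm (y1 - y2) \<le> L * (norm (\<Phi> y1 s - \<Phi> y2 s) + 2 * e * norm (y1 - y2))"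
      using \<eta>(2) by (meson less_imp_le mult_left_mono order_trans)
    then show ?thesis using \<eta>(2) by (simp add: e_def field_simps)
  qed
  then show ?thesis using \<delta>(1) by (intro exI[of _ \<delta>] exI[of _ "2 * L"] conjI) auto
qed

text \<open>The distance of the images vanishes only for equal labels, by injectivity at each time;
  near such triples \<open>\<Phi>_lower_local\<close> applies, and compactness makes the constant
  uniform also in time.\<close>

lemma \<Phi>_lower:
  obtains \<kappa> where "\<kappa> > 0" "\<And>y y' t. y \<in> \<Gamma> 0 \<Longrightarrow> y' \<in> \<Gamma> 0 \<Longrightarrow> t \<in> {0..T} \<Longrightarrow> norm (y - y') \<le> \<kappa> * norm (\<Phi> y t - \<Phi> y' t)"
proof -
  let ?K = "\<Gamma> 0 \<times> \<Gamma> 0 \<times> {0..T}"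
  have c: "continuous_on ?K (\<lambda>z. \<Phi> (fst z) (snd (snd z)))" "continuous_on ?K (\<lambda>z. \<Phi> (fst (snd z)) (snd (snd z)))"
    by (rule continuous_on_compose2[OF continuous_\<Phi>, of _ "\<lambda>z. (fst z, snd (snd z))", simplified];
        auto intro!: continuous_intros)
       (rule continuous_on_compose2[OF continuous_\<Phi>, of _ "\<lambda>z. (fst (snd z), snd (snd z))", simplified];
        auto intro!: continuous_intros)
  obtain C where C: "C > 0" "\<And>z. z \<in> ?K \<Longrightarrow> norm (fst z - fst (snd z)) \<le> C * norm (\<Phi> (fst z) (snd (snd z)) - \<Phi> (fst (snd z)) (snd (snd z)))"
  proof (rule compact_local_bound[of ?K "\<lambda>z. norm (fst z - fst (snd z))" "\<lambda>z. norm (\<Phi> (fst z) (snd (snd z)) - \<Phi> (fst (snd z)) (snd (snd z)))"])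
    show "compact ?K" by (intro compact_Times compact_\<Gamma>0 compact_Icc)
    show "continuous_on ?K (\<lambda>z. norm (fst z - fst (snd z)))" by (intro continuous_intros)
    show "continuous_on ?K (\<lambda>z. norm (\<Phi> (fst z) (snd (snd z)) - \<Phi> (fst (snd z)) (snd (snd z))))"
      by (intro continuous_intros c)
    fix z assume z: "z \<in> ?K" "norm (\<Phi> (fst z) (snd (snd z)) - \<Phi> (fst (snd z)) (snd (snd z))) = 0"
    obtain y y' t where zz: "z = (y, y', t)" by (cases z)
    then have yt: "y \<in> \<Gamma> 0" "t \<in> {0..T}" "y' = y" using z \<Phi>_inj[of y y' t] by auto
    obtain \<delta> C where \<delta>: "\<delta> > 0" "\<forall>y1\<in>\<Gamma> 0 \<inter> ball y \<delta>. \<forall>y2\<in>\<Gamma> 0 \<inter> ball y \<delta>. \<forall>s\<in>{0..T} \<inter> ball t \<delta>.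
      norm (y1 - y2) \<le> C * norm (\<Phi> y1 s - \<Phi> y2 s)"
      using \<Phi>_lower_local[OF yt(1,2)] by blast
    have "open (ball y \<delta> \<times> ball y \<delta> \<times> ball t \<delta>)" by (intro open_Times open_ball)
    moreover have "z \<in> ball y \<delta> \<times> ball y \<delta> \<times> ball t \<delta>" using zz yt \<delta> by simp
    moreover have "\<forall>x\<in>(ball y \<delta> \<times> ball y \<delta> \<times> ball t \<delta>) \<inter> ?K. norm (fst x - fst (snd x)) \<le> C * norm (\<Phi> (fst x) (snd (snd x)) - \<Phi> (fst (snd x)) (snd (snd x)))"
    proof
      fix x assume "x \<in> (ball y \<delta> \<times> ball y \<delta> \<times> ball t \<delta>) \<inter> ?K"
      then have "fst x \<in> \<Gamma> 0 \<inter> ball y \<delta>" "fst (snd x) \<in> \<Gamma> 0 \<inter> ball y \<delta>" "snd (snd x) \<in> {0..T} \<inter> ball t \<delta>"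
        unfolding mem_Times_iff Int_iff by blast+
      then show "norm (fst x - fst (snd x)) \<le> C * norm (\<Phi> (fst x) (snd (snd x)) - \<Phi> (fst (snd x)) (snd (snd x)))"
        using \<delta>(2) by blast
    qed
    ultimately show "\<exists>N C. open N \<and> z \<in> N \<and> (\<forall>y\<in>N \<inter> ?K. norm (fst y - fst (snd y)) \<le> C * norm (\<Phi> (fst y) (snd (snd y)) - \<Phi> (fst (snd y)) (snd (snd y))))"
      by blast
  qed auto
  then show thesis using that[of C] by force
qed

text \<open>Expresses the velocity through the extension, which yields its Lipschitz bound. At the
  end times the derivative is one-sided, but still unique because the interval is
  nondegenerate.\<close>

lemma velocity:
  assumes y: "y \<in> \<Gamma> 0" and t: "t \<in> {0..T}"
  shows "v (\<Phi> y t, t) = frechet_derivative G (at (y, t)) (0, 1)"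
proof -
  have pW: "(y, t) \<in> W" by (rule K_in_W[OF y t])
  have "((\<lambda>s. (y, s)) has_derivative (\<lambda>h. (0, h))) (at t within {0..T})"
    by (auto intro!: derivative_eq_intros)
  from has_derivative_compose[OF this c1_has_derivative[OF c1_G0 pW]]
  have "((\<lambda>s. G (y, s)) has_derivative (\<lambda>h. frechet_derivative G (at (y, t)) (0, h))) (at t within {0..T})" .
  moreover have "(\<lambda>h. frechet_derivative G (at (y, t)) (0, h)) = (\<lambda>h. h *\<^sub>R frechet_derivative G (at (y, t)) (0, 1))"
  proof
    fix h show "frechet_derivative G (at (y, t)) (0, h) = h *\<^sub>R frechet_derivative G (at (y, t)) (0, 1)"
      using linear_scale[OF c1_linear[OF c1_G0 pW], of h "(0, 1)"] by (simp only: scaleR_Pair scaleR_zero_right real_scaleR_def mult_1_right)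
  qed
  ultimately have "((\<lambda>s. G (y, s)) has_vector_derivative frechet_derivative G (at (y, t)) (0, 1)) (at t within {0..T})"
    unfolding has_vector_derivative_def by (rule subst[rotated])
  then have "((\<lambda>s. \<Phi> y s) has_vector_derivative frechet_derivative G (at (y, t)) (0, 1)) (at t within {0..T})"
    by (rule has_vector_derivative_transform[OF t, rotated]) (rule G_\<Phi>[OF y, symmetric])
  then show ?thesis
    using vector_derivative_unique_within_closed_interval[OF T_pos t[unfolded cbox_interval[symmetric]]] vel[OF y t]
    unfolding cbox_interval by blast
qed

lemma velocity_props:
  obtains KV LV where "KV > 0" "LV > 0"
    "continuous_on K (\<lambda>p. v (\<Phi> (fst p) (snd p), snd p))"
    "\<And>p. p \<in> K \<Longrightarrow> norm (v (\<Phi> (fst p) (snd p), snd p)) \<le> KV"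
    "\<And>p q. p \<in> K \<Longrightarrow> q \<in> K \<Longrightarrow> norm (v (\<Phi> (fst p) (snd p), snd p) - v (\<Phi> (fst q) (snd q), snd q))
      \<le> LV * (norm (fst p - fst q) + \<bar>snd p - snd q\<bar>)"
proof -
  let ?h = "iter_deriv [(0, 1)] G"
  have h: "v (\<Phi> (fst p) (snd p), snd p) = ?h p" if "p \<in> K" for p
    using velocity[of "fst p" "snd p"] that by (auto simp: mem_Times_iff)
  have c1h: "c1 W ?h" by (rule c1_G)
  have ch: "continuous_on K ?h" using c1_continuous_on[OF c1h] K_W by (rule continuous_on_subset)
  obtain L where L: "L > 0" "\<And>p q. p \<in> K \<Longrightarrow> q \<in> K \<Longrightarrow> norm (?h p - ?h q) \<le> L * norm (p - q)"
    using c1_lipschitz_on_compact[OF c1h compact_K K_W] by metis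
  have "bounded (?h ` K)" using compact_continuous_image[OF ch compact_K] by (rule compact_imp_bounded)
  then obtain KV where KV: "KV > 0" "\<And>p. p \<in> K \<Longrightarrow> norm (?h p) \<le> KV" by (auto simp: bounded_pos)
  show thesis
  proof (rule that[OF KV(1) L(1)])
    show "continuous_on K (\<lambda>p. v (\<Phi> (fst p) (snd p), snd p))" by (rule continuous_on_eq[OF ch]) (rule h[symmetric])
    show "norm (v (\<Phi> (fst p) (snd p), snd p)) \<le> KV" if "p \<in> K" for p unfolding h[OF that] by (rule KV(2)[OF that])
    show "norm (v (\<Phi> (fst p) (snd p), snd p) - v (\<Phi> (fst q) (snd q), snd q)) \<le> L * (norm (fst p - fst q) + \<bar>snd p - snd q\<bar>)"
      if "p \<in> K" "q \<in> K" for p q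
      unfolding h[OF that(1)] h[OF that(2)]
      by (rule order_trans[OF L(2)[OF that] mult_left_mono[OF norm_prod_le]]) (use L(1) in simp)
  qed
qed

section \<open>Charts carried along by the flow\<close>

lemma homeo:
  assumes t: "t \<in> {0..T}"
  shows "homeomorphism (\<Gamma> 0) (\<Gamma> t) (\<lambda>y. \<Phi> y t) (inv_into (\<Gamma> 0) (\<lambda>y. \<Phi> y t))"
proof -
  have inj: "inj_on (\<lambda>y. \<Phi> y t) (\<Gamma> 0)" using bij[OF t] by (auto simp: bij_betw_def)
  obtain g where g: "homeomorphism (\<Gamma> 0) (\<Gamma> t) (\<lambda>y. \<Phi> y t) g"
    using homeomorphism_compact[OF compact_\<Gamma>0 continuous_\<Phi>t[OF t] \<Phi>_image[OF t] inj] by blast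
  have "g x = inv_into (\<Gamma> 0) (\<lambda>y. \<Phi> y t) x" if "x \<in> \<Gamma> t" for x
  proof -
    have "g x \<in> \<Gamma> 0" "\<Phi> (g x) t = x" using g that by (auto simp: homeomorphism_def)
    then show ?thesis using inv_into_f_f[OF inj, of "g x"] by simp
  qed
  then show ?thesis
    using g continuous_on_eq[of "\<Gamma> t" g "inv_into (\<Gamma> 0) (\<lambda>y. \<Phi> y t)"]
    unfolding homeomorphism_def by (simp add: inv_into_f_f[OF inj] cong: image_cong ball_cong)
qed

lemma flow_derivative:
  assumes X: "c1 U X" "X ` U \<subseteq> \<Gamma> 0" and t: "t \<in> {0..T}" and z: "z \<in> U"
  shows "((\<lambda>z. \<Phi> (X z) t) has_derivative (\<lambda>h. frechet_derivative G (at (X z, t)) (frechet_derivative X (at z) h, 0))) (at z)"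
proof -
  have pW: "(X z, t) \<in> W" using K_in_W[OF _ t] X(2) z by blast
  have "((\<lambda>z. (X z, t)) has_derivative (\<lambda>h. (frechet_derivative X (at z) h, 0))) (at z)"
    by (intro has_derivative_Pair c1_has_derivative[OF X(1) z] has_derivative_const)
  from has_derivative_compose[OF this c1_has_derivative[OF c1_G0 pW]]
  have "((\<lambda>z. G (X z, t)) has_derivative (\<lambda>h. frechet_derivative G (at (X z, t)) (frechet_derivative X (at z) h, 0))) (at z)" .
  then show ?thesis
    by (rule has_derivative_transform_within_open[OF _ c1_open[OF X(1)] z]) (use X(2) t in \<open>auto simp: G_\<Phi>\<close>)
qed

text \<open>Injectivity of the derivative follows from the two-point lower bound
  \<open>\<Phi>_lower\<close> and the lower bound for \<open>X\<close>, passed to the limit by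
  \<open>derivative_lower_bound\<close>; the remaining properties are transported by the
  homeomorphism.\<close>

lemma flow_chart:
  assumes X: "c1_param (\<Gamma> 0) U X" and t: "t \<in> {0..T}"
  shows "c1_param (\<Gamma> t) U (\<lambda>z. \<Phi> (X z) t)"
proof -
  have c1X: "c1 U X" using X by (simp add: c1_param_def)
  have XU: "X ` U \<subseteq> \<Gamma> 0" by (rule c1_param_image[OF X])
  note der = flow_derivative[OF c1X XU t]
  have fd: "frechet_derivative (\<lambda>z. \<Phi> (X z) t) (at z) = (\<lambda>h. frechet_derivative G (at (X z, t)) (frechet_derivative X (at z) h, 0))"
    if "z \<in> U" for z using frechet_derivative_at[OF der[OF that]] by simp
  have "continuous_on U (\<lambda>z. frechet_derivative G (at (X z, t)) (frechet_derivative X (at z) h, 0))" for h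
    using K_in_W[OF _ t] XU
    by (intro c1_deriv_continuous[OF c1_G0] continuous_intros c1_continuous_on[OF c1X] c1_continuous_deriv[OF c1X])
      (simp add: image_subset_iff)
  then have "continuous_on U (\<lambda>z. frechet_derivative (\<lambda>z. \<Phi> (X z) t) (at z) h)" for h
    by (rule continuous_on_eq) (simp add: fd)
  then have c1Y: "c1 U (\<lambda>z. \<Phi> (X z) t)"
    unfolding c1_def using c1_open[OF c1X] der differentiableI by blast
  obtain \<kappa> where \<kappa>: "\<kappa> > 0" "\<And>y y' t. y \<in> \<Gamma> 0 \<Longrightarrow> y' \<in> \<Gamma> 0 \<Longrightarrow> t \<in> {0..T} \<Longrightarrow> norm (y - y') \<le> \<kappa> * norm (\<Phi> y t - \<Phi> y' t)"
    using \<Phi>_lower by metis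
  have inj: "inj (frechet_derivative (\<lambda>z. \<Phi> (X z) t) (at z))" if z: "z \<in> U" for z
  proof -
    have "inj (frechet_derivative X (at z))" using X z by (auto simp: c1_param_def)
    then obtain \<eta> k where \<eta>: "\<eta> > 0" "k > 0" "ball z \<eta> \<subseteq> U"
      "\<And>a b. a \<in> ball z \<eta> \<Longrightarrow> b \<in> ball z \<eta> \<Longrightarrow> k * norm (a - b) \<le> norm (X a - X b)"
      using c1_locally_bilipschitz[OF c1X z] by metis
    have "\<forall>\<^sub>F a in nhds z. a \<in> ball z \<eta>" using \<eta>(1) by (intro eventually_nhds_in_open) auto
    then have low: "\<forall>\<^sub>F a in nhds z. k / \<kappa> * norm (a - z) \<le> norm (\<Phi> (X a) t - \<Phi> (X z) t)"
    proof eventually_elim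
      case (elim a)
      have "k * norm (a - z) \<le> norm (X a - X z)" using \<eta>(4)[OF elim, of z] \<eta>(1) by simp
      also have "\<dots> \<le> \<kappa> * norm (\<Phi> (X a) t - \<Phi> (X z) t)" using \<kappa>(2)[OF _ _ t] XU \<eta>(3) elim z by blast
      finally show ?case using \<kappa>(1) by (simp add: field_simps)
    qed
    let ?D = "frechet_derivative (\<lambda>z. \<Phi> (X z) t) (at z)"
    have lb: "k / \<kappa> * norm h \<le> norm (?D h)" for h
      by (rule derivative_lower_bound[OF c1_has_derivative[OF c1Y z] low])
    show ?thesis
    proof (rule injI)
      fix a b assume "?D a = ?D b"
      then have "k / \<kappa> * norm (a - b) \<le> 0" using lb[of "a - b"] linear_diff[OF c1_linear[OF c1Y z], of a b] by simp
      then show "a = b" using \<eta>(2) \<kappa>(1) by (simp add: mult_le_0_iff divide_le_0_iff)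
    qed
  qed
  obtain Xi where Xi: "homeomorphism U (X ` U) X Xi" using X by (auto simp: c1_param_def)
  have img: "(\<lambda>z. \<Phi> (X z) t) ` U = (\<lambda>y. \<Phi> y t) ` (X ` U)" by auto
  have "homeomorphism (X ` U) ((\<lambda>y. \<Phi> y t) ` (X ` U)) (\<lambda>y. \<Phi> y t) (inv_into (\<Gamma> 0) (\<lambda>y. \<Phi> y t))"
    by (rule homeomorphism_of_subsets[OF homeo[OF t] XU order_refl]) simp
  from homeomorphism_compose[OF Xi this]
  have hom: "\<exists>Y. homeomorphism U ((\<lambda>z. \<Phi> (X z) t) ` U) (\<lambda>z. \<Phi> (X z) t) Y" unfolding img by (auto simp: o_def)
  have "openin (top_of_set (\<Gamma> 0)) (X ` U)" using X by (simp add: c1_param_def)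
  then have "openin (top_of_set (\<Gamma> t)) ((\<lambda>z. \<Phi> (X z) t) ` U)"
    unfolding img by (rule homeomorphism_imp_open_map[OF homeo[OF t]])
  then show ?thesis using c1Y inj hom by (simp add: c1_param_def)
qed

definition dens :: "(real^'n \<Rightarrow> 'n ambient) \<Rightarrow> (real^'n) \<times> real \<Rightarrow> real" where
  "dens X p = area_density (\<lambda>z. \<Phi> (X z) (snd p)) (fst p)"

lemma dens_pos: "c1_param (\<Gamma> 0) U X \<Longrightarrow> p \<in> U \<times> {0..T} \<Longrightarrow> dens X p > 0"
  unfolding dens_def by (rule c1_param_density_pos[OF flow_chart]) auto

lemma dens_continuous:
  assumes X: "c1_param (\<Gamma> 0) U X"
  shows "continuous_on (U \<times> {0..T}) (dens X)"
proof -
  have c1X: "c1 U X" using X by (simp add: c1_param_def)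
  have XU: "X ` U \<subseteq> \<Gamma> 0" by (rule c1_param_image[OF X])
  let ?A = "\<lambda>p h. frechet_derivative G (at (X (fst p), snd p)) (frechet_derivative X (at (fst p)) h, 0)"
  have fd: "frechet_derivative (\<lambda>z. \<Phi> (X z) (snd p)) (at (fst p)) = ?A p" if "p \<in> U \<times> {0..T}" for p
    using frechet_derivative_at[OF flow_derivative[OF c1X XU]] that by (auto simp: mem_Times_iff)
  have "continuous_on (U \<times> {0..T}) (\<lambda>p. ?A p h)" for h
    using K_in_W XU
    by (intro c1_deriv_continuous[OF c1_G0] continuous_intros continuous_on_compose2[OF c1_continuous_on[OF c1X]]
        continuous_on_compose2[OF c1_continuous_deriv[OF c1X]]) (auto simp: image_subset_iff)
  then have "continuous_on (U \<times> {0..T}) (\<lambda>p. sqrt (gram (?A p)))"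
    by (intro continuous_intros continuous_on_gram)
  then show ?thesis by (rule continuous_on_eq) (simp add: dens_def area_density_gram fd)
qed

end

section \<open>The Jacobian of the flow\<close>

lemma nn_integral_surface_measure:
  fixes S :: "('n::finite) ambient set"
  assumes S: "closed_hypersurface S" and Y: "c1_param S U Y" and h: "h \<in> borel_measurable borel"
  shows "(\<integral>\<^sup>+x\<in>Y ` U. h x \<partial>surface_measure S) = (\<integral>\<^sup>+z\<in>U. ennreal (area_density Y z) * h (Y z) \<partial>lborel)"
proof -
  obtain N X c r where "atlas S N X c r" using closed_hypersurface_atlas[OF S] .
  then interpret atlas S N X c r .
  note [measurable] = h image_borel[OF Y] S_borel
  have id: "(\<lambda>x. x) \<in> surface_measure S \<rightarrow>\<^sub>M borel"
    unfolding measurable_cong_sets[OF sets_surface_measure[OF S] refl] by (rule measurable_restrict_space1) simp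
  let ?D = "distr (surface_measure S) borel (\<lambda>x. x)"
  have "density ?D (indicator (Y ` U)) = density (chart_measure U Y) (indicator (Y ` U))"
  proof (rule measure_eqI)
    fix A assume "A \<in> sets (density ?D (indicator (Y ` U)))"
    then have [measurable]: "A \<in> sets borel" by simp
    have "Y ` U \<inter> A \<subseteq> S" using c1_param_image[OF Y] by blast
    then have "emeasure ?D (Y ` U \<inter> A) = emeasure (surface_measure S) (Y ` U \<inter> A)"
      by (subst emeasure_distr[OF id]) (auto simp: space_surface_measure[OF S] Int_absorb2)
    also have "\<dots> = emeasure (chart_measure U Y) (Y ` U \<inter> A)"
      by (rule emeasure_surface_measure[OF S Y]) auto
    finally show "emeasure (density ?D (indicator (Y ` U))) A = emeasure (density (chart_measure U Y) (indicator (Y ` U))) A"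
      by (simp add: emeasure_density indicator_inter_arith[symmetric] nn_integral_indicator)
  qed simp
  then have "(\<integral>\<^sup>+x. h x \<partial>density ?D (indicator (Y ` U))) = (\<integral>\<^sup>+x. h x \<partial>density (chart_measure U Y) (indicator (Y ` U)))"
    by simp
  then have "(\<integral>\<^sup>+x. indicator (Y ` U) x * h x \<partial>?D) = (\<integral>\<^sup>+x. indicator (Y ` U) x * h x \<partial>chart_measure U Y)"
    by (simp add: nn_integral_density)
  moreover have "(\<integral>\<^sup>+x. indicator (Y ` U) x * h x \<partial>?D) = (\<integral>\<^sup>+x\<in>Y ` U. h x \<partial>surface_measure S)"
    by (subst nn_integral_distr[OF id]) (simp_all add: mult.commute)
  moreover have "(\<integral>\<^sup>+x. indicator (Y ` U) x * h x \<partial>chart_measure U Y) = (\<integral>\<^sup>+z\<in>U. ennreal (area_density Y z) * h (Y z) \<partial>lborel)"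
    by (subst nn_integral_chart_measure[OF Y]) (auto intro!: nn_integral_cong simp: indicator_def)
  ultimately show ?thesis by simp
qed

locale flow_atlas = flow T \<Gamma> \<Phi> v G W + atlas "\<Gamma> 0" N X c r
  for T :: real and \<Gamma> :: "real \<Rightarrow> ('n::finite) ambient set" and \<Phi> v G W N X c r
begin

abbreviation "\<sigma> \<equiv> surface_measure (\<Gamma> 0)"

definition Xi :: "nat \<Rightarrow> 'n ambient \<Rightarrow> real^'n" where
  "Xi i = inv_into (B i) (X i)"

text \<open>The density of the carried chart relative to that of the chart itself, which is
  \<open>dens\<close> at time 0. Assigning one chart to each piece makes \<open>J\<close> well
  defined without comparing charts.\<close>

definition ratio :: "nat \<Rightarrow> 'n ambient \<times> real \<Rightarrow> real" where
  "ratio i p = dens (X i) (Xi i (fst p), snd p) / dens (X i) (Xi i (fst p), 0)"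

text \<open>\<open>J (\<cdot>, t)\<close> is the Jacobian of \<open>\<Phi> \<cdot> t\<close> with respect to the surface measures.\<close>

definition J :: "'n ambient \<times> real \<Rightarrow> real" where
  "J p = (\<Sum>i<N. indicator (piece i \<times> {0..T}) p * ratio i p)"

lemma zero_in: "0 \<in> {0..T}" using T_pos by simp

lemma Xi_in: "y \<in> X i ` B i \<Longrightarrow> Xi i y \<in> B i" "y \<in> X i ` B i \<Longrightarrow> X i (Xi i y) = y"
  unfolding Xi_def by (rule inv_into_into, assumption) (rule f_inv_into_f)

lemma Xi_X: "i < N \<Longrightarrow> z \<in> B i \<Longrightarrow> Xi i (X i z) = z"
  unfolding Xi_def by (rule inv_into_f_f[OF c1_param_inj_on[OF c1_chart]])

lemma continuous_Xi:
  assumes i: "i < N" shows "continuous_on (X i ` B i) (Xi i)"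
proof -
  obtain Y where Y: "homeomorphism (B i) (X i ` B i) (X i) Y" using c1_chart[OF i] unfolding c1_param_def by blast
  show ?thesis
  proof (rule continuous_on_eq[OF homeomorphism_cont2[OF Y]])
    fix y assume "y \<in> X i ` B i"
    then obtain z where z: "z \<in> B i" "y = X i z" by blast
    then show "Y y = Xi i y" using Xi_X[OF i z(1)] homeomorphism_apply1[OF Y z(1)] by simp
  qed
qed

lemma dens_0: "i < N \<Longrightarrow> z \<in> B i \<Longrightarrow> dens (X i) (z, 0) = area_density (X i) z"
proof -
  assume i: "i < N" and z: "z \<in> B i"
  have XB: "X i ` B i \<subseteq> \<Gamma> 0" by (rule c1_param_image[OF c1_chart[OF i]])
  have "c1 (B i) (X i)" using c1_chart[OF i] unfolding c1_param_def by blast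
  then have d: "X i differentiable (at z)" using z unfolding c1_def by blast
  have "frechet_derivative (\<lambda>z. \<Phi> (X i z) 0) (at z) = frechet_derivative (X i) (at z)"
    by (rule frechet_derivative_cong_open(2)[OF open_ball z _ d]) (metis XB \<Phi>_0 image_subset_iff)
  then show ?thesis unfolding dens_def area_density_gram by simp
qed

lemma dens_bounds:
  obtains m M where "m > 0" "M > 0"
    "\<And>i z t. i < N \<Longrightarrow> z \<in> B i \<Longrightarrow> t \<in> {0..T} \<Longrightarrow> m \<le> dens (X i) (z, t) \<and> dens (X i) (z, t) \<le> M"
proof -
  have *: "continuous_on (cball (c i) (r i) \<times> {0..T}) (dens (X i))"
    "\<And>p. p \<in> cball (c i) (r i) \<times> {0..T} \<Longrightarrow> dens (X i) p > 0" if "i < N" for i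
  proof -
    obtain U where U: "cball (c i) (r i) \<subseteq> U" "c1_param (\<Gamma> 0) U (X i)"
      using chart[OF \<open>i < N\<close>] local_param_imp_c1_param by blast
    have sub: "cball (c i) (r i) \<times> {0..T} \<subseteq> U \<times> {0..T}" using U(1) by blast
    show "continuous_on (cball (c i) (r i) \<times> {0..T}) (dens (X i))"
      using dens_continuous[OF U(2)] sub by (rule continuous_on_subset)
    show "\<And>p. p \<in> cball (c i) (r i) \<times> {0..T} \<Longrightarrow> dens (X i) p > 0"
      using dens_pos[OF U(2)] sub by blast
  qed
  have cpt: "compact (cball (c i) (r i) \<times> {0..T})" for i by (intro compact_Times compact_cball compact_Icc)
  have "\<exists>m>0. \<forall>i<N. \<forall>p\<in>cball (c i) (r i) \<times> {0..T}. m \<le> dens (X i) p"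
  proof (rule finite_uniform_lower[of N "\<lambda>i m. \<forall>p\<in>cball (c i) (r i) \<times> {0..T}. m \<le> dens (X i) p"])
    show "\<exists>m>0. \<forall>p\<in>cball (c i) (r i) \<times> {0..T}. m \<le> dens (X i) p" if "i < N" for i
      by (rule continuous_compact_bounds(1)[OF cpt *[OF that]])
  qed (meson order_trans)
  then obtain m where m: "m > 0" "\<And>i. i < N \<Longrightarrow> \<forall>p\<in>cball (c i) (r i) \<times> {0..T}. m \<le> dens (X i) p"
    by blast
  have "\<exists>M>0. \<forall>i<N. \<forall>p\<in>cball (c i) (r i) \<times> {0..T}. dens (X i) p \<le> M"
  proof (rule finite_uniform_upper[of N "\<lambda>i M. \<forall>p\<in>cball (c i) (r i) \<times> {0..T}. dens (X i) p \<le> M"])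
    show "\<exists>M. \<forall>p\<in>cball (c i) (r i) \<times> {0..T}. dens (X i) p \<le> M" if "i < N" for i
      by (rule continuous_compact_bounds(2)[OF cpt *[OF that]])
  qed (meson order_trans)
  then obtain M where M: "M > 0" "\<And>i. i < N \<Longrightarrow> \<forall>p\<in>cball (c i) (r i) \<times> {0..T}. dens (X i) p \<le> M"
    by blast
  show thesis
  proof (rule that[OF m(1) M(1)])
    fix i z t assume i: "i < N" and z: "z \<in> B i" and t: "t \<in> {0..T}"
    have "(z, t) \<in> cball (c i) (r i) \<times> {0..T}" using z t by simp
    then show "m \<le> dens (X i) (z, t) \<and> dens (X i) (z, t) \<le> M" using m(2)[OF i] M(2)[OF i] by blast
  qed
qed

lemma J_piece:
  assumes i: "i < N" and y: "y \<in> piece i" and t: "t \<in> {0..T}"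
  shows "J (y, t) = ratio i (y, t)"
proof -
  have z: "y \<notin> piece j" if "j < N" "j \<noteq> i" for j
    using piece_disjoint y i that unfolding disjoint_family_on_def by blast
  have "J (y, t) = (\<Sum>j\<in>{i}. indicator (piece j \<times> {0..T}) (y, t) * ratio j (y, t))"
    unfolding J_def by (rule sum.mono_neutral_right) (use i z in \<open>auto simp: indicator_def\<close>)
  then show ?thesis using y t by (simp add: indicator_def)
qed

lemma J_bounds:
  obtains j0 j1 where "j0 > 0" "j1 > 0" "\<And>y t. y \<in> \<Gamma> 0 \<Longrightarrow> t \<in> {0..T} \<Longrightarrow> j0 \<le> J (y, t) \<and> J (y, t) \<le> j1"
proof -
  obtain m M where mM: "m > 0" "M > 0"
    "\<And>i z t. i < N \<Longrightarrow> z \<in> B i \<Longrightarrow> t \<in> {0..T} \<Longrightarrow> m \<le> dens (X i) (z, t) \<and> dens (X i) (z, t) \<le> M"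
    using dens_bounds by metis
  show thesis
  proof (rule that[of "m / M" "M / m"])
    fix y t assume y: "y \<in> \<Gamma> 0" and t: "t \<in> {0..T}"
    obtain i where i: "i < N" "y \<in> piece i" using piece_cover y by blast
    have z: "Xi i y \<in> B i" using Xi_in(1) i(2) piece_image by blast
    show "m / M \<le> J (y, t) \<and> J (y, t) \<le> M / m"
      unfolding J_piece[OF i t] ratio_def
      using mM(1,2) mM(3)[OF i(1) z t] mM(3)[OF i(1) z zero_in]
      by (auto intro!: frac_le)
  qed (use mM in auto)
qed

lemma J_density:
  assumes i: "i < N" and z: "z \<in> B i" "X i z \<in> piece i" and t: "t \<in> {0..T}"
  shows "area_density (X i) z * J (X i z, t) = dens (X i) (z, t)" "J (X i z, t) \<ge> 0"
proof -
  have p0: "dens (X i) (z, 0) > 0" "dens (X i) (z, t) > 0"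
    using dens_pos[OF c1_chart[OF i]] z(1) t zero_in by auto
  show "area_density (X i) z * J (X i z, t) = dens (X i) (z, t)" "J (X i z, t) \<ge> 0"
    unfolding J_piece[OF i z(2) t] ratio_def using p0 by (simp_all add: Xi_X[OF i z(1)] dens_0[OF i z(1)])
qed

lemma J_borel [measurable]: "J \<in> borel_measurable borel"
proof -
  have "(\<lambda>p. indicator (piece i \<times> {0..T}) p * ratio i p) \<in> borel_measurable borel" if i: "i < N" for i
  proof -
    let ?E = "X i ` B i \<times> {0..T}"
    have cXi: "continuous_on ?E (\<lambda>p. Xi i (fst p))"
      by (rule continuous_on_compose2[OF continuous_Xi[OF i]]) (auto intro!: continuous_intros)
    have cd: "continuous_on (B i \<times> {0..T}) (dens (X i))" by (rule dens_continuous[OF c1_chart[OF i]])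
    have "continuous_on ?E (\<lambda>p. dens (X i) (Xi i (fst p), snd p))"
      by (rule continuous_on_compose2[OF cd]) (use Xi_in in \<open>auto intro!: continuous_intros cXi\<close>)
    moreover have "continuous_on ?E (\<lambda>p. dens (X i) (Xi i (fst p), 0))"
      by (rule continuous_on_compose2[OF cd]) (use Xi_in zero_in in \<open>auto intro!: continuous_intros cXi\<close>)
    moreover have "dens (X i) (Xi i (fst p), 0) \<noteq> 0" if "p \<in> ?E" for p
    proof -
      have "Xi i (fst p) \<in> B i" using Xi_in that by auto
      then show ?thesis using dens_pos[OF c1_chart[OF i], of "(Xi i (fst p), 0)"] zero_in by simp
    qed
    ultimately have "continuous_on ?E (ratio i)" unfolding ratio_def[abs_def] by (intro continuous_on_divide) blast+
    moreover have [measurable]: "?E \<in> sets borel" unfolding borel_prod[symmetric]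
      by (intro pair_measureI image_borel[OF c1_chart[OF i]]) simp
    ultimately have [measurable]: "(\<lambda>p. indicator ?E p *\<^sub>R ratio i p) \<in> borel_measurable borel"
      by (intro borel_measurable_continuous_on_indicator)
    have [measurable]: "piece i \<times> {0..T} \<in> sets borel" unfolding borel_prod[symmetric]
      by (intro pair_measureI piece_borel[OF i]) simp
    have "(\<lambda>p. indicator (piece i \<times> {0..T}) p * (indicator ?E p *\<^sub>R ratio i p)) \<in> borel_measurable borel"
      by measurable
    moreover have "(\<lambda>p. indicator (piece i \<times> {0..T}) p * (indicator ?E p *\<^sub>R ratio i p)) = (\<lambda>p. indicator (piece i \<times> {0..T}) p * ratio i p)"
      using piece_image[of i] by (auto simp: fun_eq_iff indicator_def)
    ultimately show ?thesis by simp
  qed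
  then show ?thesis unfolding J_def[abs_def] by (intro borel_measurable_sum) simp
qed

lemma preimage_borel:
  assumes t: "t \<in> {0..T}" and A: "A \<in> sets borel"
  shows "{y \<in> \<Gamma> 0. \<Phi> y t \<in> A} \<in> sets borel"
proof -
  have m: "(\<lambda>y. indicator (\<Gamma> 0) y *\<^sub>R \<Phi> y t) \<in> borel_measurable borel"
    by (rule borel_measurable_continuous_on_indicator[OF S_borel continuous_\<Phi>t[OF t]])
  have "\<Gamma> 0 \<inter> (\<lambda>y. indicator (\<Gamma> 0) y *\<^sub>R \<Phi> y t) -` A \<in> sets borel"
    using measurable_sets_borel[OF m A] S_borel by blast
  also have "\<Gamma> 0 \<inter> (\<lambda>y. indicator (\<Gamma> 0) y *\<^sub>R \<Phi> y t) -` A = {y \<in> \<Gamma> 0. \<Phi> y t \<in> A}" by auto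
  finally show ?thesis .
qed

lemma image_\<Phi>_borel:
  assumes t: "t \<in> {0..T}" and C: "C \<in> sets borel" "C \<subseteq> \<Gamma> 0"
  shows "(\<lambda>y. \<Phi> y t) ` C \<in> sets borel"
proof -
  let ?I = "inv_into (\<Gamma> 0) (\<lambda>y. \<Phi> y t)"
  have cl: "\<Gamma> t \<in> sets borel" by (intro borel_closed compact_imp_closed compact_\<Gamma> t)
  have m: "(\<lambda>y. indicator (\<Gamma> t) y *\<^sub>R ?I y) \<in> borel_measurable borel"
    by (rule borel_measurable_continuous_on_indicator[OF cl homeomorphism_cont2[OF homeo[OF t]]])
  have "\<Gamma> t \<inter> (\<lambda>y. indicator (\<Gamma> t) y *\<^sub>R ?I y) -` C \<in> sets borel"
    using measurable_sets_borel[OF m C(1)] cl by blast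
  also have "\<Gamma> t \<inter> (\<lambda>y. indicator (\<Gamma> t) y *\<^sub>R ?I y) -` C = (\<lambda>y. \<Phi> y t) ` C"
  proof (intro subset_antisym subsetI)
    fix x assume "x \<in> \<Gamma> t \<inter> (\<lambda>y. indicator (\<Gamma> t) y *\<^sub>R ?I y) -` C"
    then have "x \<in> \<Gamma> t" "?I x \<in> C" by auto
    then show "x \<in> (\<lambda>y. \<Phi> y t) ` C" using homeomorphism_apply2[OF homeo[OF t], of x] by (intro image_eqI[of _ _ "?I x"]) auto
  next
    fix x assume "x \<in> (\<lambda>y. \<Phi> y t) ` C"
    then obtain y where y: "y \<in> C" "x = \<Phi> y t" by blast
    then have "?I x = y" "x \<in> \<Gamma> t" using homeomorphism_apply1[OF homeo[OF t], of y] C(2) \<Phi>_in[OF _ t] by auto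
    then show "x \<in> \<Gamma> t \<inter> (\<lambda>y. indicator (\<Gamma> t) y *\<^sub>R ?I y) -` C" using y by auto
  qed
  finally show ?thesis .
qed

text \<open>On each piece both sides are computed over the same parameter ball, the left in the
  carried chart and the right in the original one; \<open>J\<close> is the quotient of the two
  densities.\<close>

lemma emeasure_flow:
  assumes t: "t \<in> {0..T}" and A: "A \<in> sets borel" "A \<subseteq> \<Gamma> t"
  shows "emeasure (surface_measure (\<Gamma> t)) A = (\<integral>\<^sup>+y. ennreal (J (y, t)) * indicator A (\<Phi> y t) \<partial>\<sigma>)"
proof -
  let ?P = "\<lambda>i. (\<lambda>y. \<Phi> y t) ` piece i"
  let ?A' = "{y \<in> \<Gamma> 0. \<Phi> y t \<in> A}"
  let ?h = "\<lambda>i y. ennreal (J (y, t)) * indicator ?A' y * indicator (piece i) y"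
  have A'[measurable]: "?A' \<in> sets borel" by (rule preimage_borel[OF t A(1)])
  have P: "?P i \<in> sets borel" if "i < N" for i by (rule image_\<Phi>_borel[OF t piece_borel[OF that] piece_subset[OF that]])
  have "A = (\<Union>i<N. A \<inter> ?P i)"
  proof (intro subset_antisym subsetI)
    fix x assume x: "x \<in> A"
    then have "x \<in> (\<lambda>y. \<Phi> y t) ` \<Gamma> 0" using A(2) \<Phi>_image[OF t] by blast
    then obtain y where y: "y \<in> \<Gamma> 0" "x = \<Phi> y t" by blast
    then obtain i where "i < N" "y \<in> piece i" using piece_cover by blast
    then show "x \<in> (\<Union>i<N. A \<inter> ?P i)" using x y(2) by blast
  qed blast
  moreover have "(\<Sum>i<N. emeasure (surface_measure (\<Gamma> t)) (A \<inter> ?P i)) = emeasure (surface_measure (\<Gamma> t)) (\<Union>i<N. A \<inter> ?P i)"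
  proof (rule sum_emeasure)
    show "(\<lambda>i. A \<inter> ?P i) ` {..<N} \<subseteq> sets (surface_measure (\<Gamma> t))"
    proof
      fix C assume "C \<in> (\<lambda>i. A \<inter> ?P i) ` {..<N}"
      then obtain i where i: "i < N" "C = A \<inter> ?P i" by blast
      have "C \<in> sets borel" using i A P by simp
      moreover have "C \<subseteq> \<Gamma> t" using i A by blast
      ultimately show "C \<in> sets (surface_measure (\<Gamma> t))"
        unfolding sets_surface_measure[OF hyp[OF t]] sets_restrict_space by blast
    qed
    show "disjoint_family_on (\<lambda>i. A \<inter> ?P i) {..<N}"
      unfolding disjoint_family_on_def
    proof (intro ballI impI equals0I)
      fix i j x assume ij: "i \<in> {..<N}" "j \<in> {..<N}" "i \<noteq> j" and "x \<in> A \<inter> ?P i \<inter> (A \<inter> ?P j)"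
      then obtain y y' where y: "y \<in> piece i" "y' \<in> piece j" "\<Phi> y t = \<Phi> y' t" by auto
      then have "y = y'" using \<Phi>_inj[OF _ _ t] ij piece_subset by blast
      then show False using y ij piece_disjoint unfolding disjoint_family_on_def by blast
    qed
  qed simp
  ultimately have "emeasure (surface_measure (\<Gamma> t)) A = (\<Sum>i<N. emeasure (surface_measure (\<Gamma> t)) (A \<inter> ?P i))"
    by simp
  also have "\<dots> = (\<Sum>i<N. \<integral>\<^sup>+y. ?h i y \<partial>\<sigma>)"
  proof (rule sum.cong[OF refl])
    fix i assume "i \<in> {..<N}"
    then have i: "i < N" by simp
    note [measurable] = piece_borel[OF i]
    let ?Y = "\<lambda>z. \<Phi> (X i z) t"
    note Y = flow_chart[OF c1_chart[OF i] t]
    have XB: "X i ` B i \<subseteq> \<Gamma> 0" by (rule c1_param_image[OF c1_chart[OF i]])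
    have sub: "A \<inter> ?P i \<subseteq> ?Y ` B i" using piece_image[of i] by blast
    \<comment> \<open>Injectivity of the flow at time \<open>t\<close> brings membership in the
      moved piece back to the piece.\<close>
    have mem: "\<Phi> (X i z) t \<in> A \<inter> ?P i \<longleftrightarrow> X i z \<in> ?A' \<inter> piece i" if z: "z \<in> B i" for z
    proof -
      have "X i z \<in> \<Gamma> 0" using XB z by blast
      moreover have "X i z \<in> piece i" if P: "\<Phi> (X i z) t \<in> ?P i"
      proof -
        obtain y where y: "y \<in> piece i" "\<Phi> (X i z) t = \<Phi> y t" using P by blast
        then show ?thesis using \<Phi>_inj[OF \<open>X i z \<in> \<Gamma> 0\<close> _ t] piece_subset[OF i] by blast
      qed
      ultimately show ?thesis by blast
    qed
    have Jm[measurable]: "(\<lambda>y. J (y, t)) \<in> borel_measurable borel"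
      by (rule measurable_compose[OF _ J_borel]) simp
    have hm: "?h i \<in> borel_measurable borel" by measurable
    have "emeasure (surface_measure (\<Gamma> t)) (A \<inter> ?P i) = emeasure (chart_measure (B i) ?Y) (A \<inter> ?P i)"
      using A P[OF i] by (intro emeasure_surface_measure[OF hyp[OF t] Y] sub) simp
    also have "\<dots> = (\<integral>\<^sup>+z\<in>{z\<in>B i. ?Y z \<in> A \<inter> ?P i}. ennreal (area_density ?Y z) \<partial>lborel)"
      using A P[OF i] by (intro emeasure_chart_measure[OF Y]) simp
    also have "\<dots> = (\<integral>\<^sup>+z\<in>B i. ennreal (area_density (X i) z) * ?h i (X i z) \<partial>lborel)"
    proof (rule nn_integral_cong)
      fix z :: "real^'n"
      show "ennreal (area_density ?Y z) * indicator {z\<in>B i. ?Y z \<in> A \<inter> ?P i} z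
        = ennreal (area_density (X i) z) * ?h i (X i z) * indicator (B i) z"
      proof (cases "z \<in> B i \<and> ?Y z \<in> A \<inter> ?P i")
        case True
        then have z: "z \<in> B i" "X i z \<in> ?A'" "X i z \<in> piece i" using mem by blast+
        have "area_density ?Y z = area_density (X i) z * J (X i z, t)"
          using J_density(1)[OF i z(1,3) t] by (simp add: dens_def)
        moreover have "area_density (X i) z \<ge> 0" using c1_param_density_pos[OF c1_chart[OF i] z(1)] by simp
        ultimately show ?thesis using True z by (simp add: ennreal_mult J_density(2)[OF i z(1,3) t])
      next
        case False
        then have "z \<in> B i \<Longrightarrow> X i z \<notin> ?A' \<inter> piece i" using mem by blast
        then show ?thesis using False by (auto simp: indicator_def)
      qed
    qed
    also have "\<dots> = (\<integral>\<^sup>+y\<in>X i ` B i. ?h i y \<partial>\<sigma>)"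
      by (rule nn_integral_surface_measure[OF hyp0 c1_chart[OF i] hm, symmetric])
    also have "\<dots> = (\<integral>\<^sup>+y. ?h i y \<partial>\<sigma>)"
      by (rule nn_integral_cong) (use piece_image[of i] in \<open>auto simp: indicator_def\<close>)
    finally show "emeasure (surface_measure (\<Gamma> t)) (A \<inter> ?P i) = (\<integral>\<^sup>+y. ?h i y \<partial>\<sigma>)" .
  qed
  also have "\<dots> = (\<integral>\<^sup>+y. (\<Sum>i<N. ?h i y) \<partial>\<sigma>)"
  proof (rule nn_integral_sum[symmetric])
    fix i assume "i \<in> {..<N}"
    then have [measurable]: "piece i \<in> sets borel" by (simp add: piece_borel)
    have "?h i \<in> borel_measurable borel" by (intro borel_measurable_times_ennreal measurable_compose[OF _ measurable_ennreal] measurable_compose[OF _ J_borel]) auto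
    then show "?h i \<in> borel_measurable \<sigma>"
      using measurable_restrict_space1 measurable_cong_sets[OF sets_surface_measure[OF hyp0] refl] by blast
  qed
  also have "\<dots> = (\<integral>\<^sup>+y. ennreal (J (y, t)) * indicator A (\<Phi> y t) \<partial>\<sigma>)"
  proof (rule nn_integral_cong)
    fix y assume "y \<in> space \<sigma>"
    then have y: "y \<in> \<Gamma> 0" by (simp add: space_surface_measure[OF hyp0])
    then obtain i where i: "i < N" "y \<in> piece i" using piece_cover by blast
    have z: "y \<notin> piece j" if "j < N" "j \<noteq> i" for j
      using piece_disjoint i that unfolding disjoint_family_on_def by blast
    have "(\<Sum>j<N. ?h j y) = (\<Sum>j\<in>{i}. ?h j y)"
      by (rule sum.mono_neutral_right) (use i z in \<open>auto simp: indicator_def\<close>)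
    then show "(\<Sum>j<N. ?h j y) = ennreal (J (y, t)) * indicator A (\<Phi> y t)"
      using y i by (simp add: indicator_def)
  qed
  finally show ?thesis .
qed

end

section \<open>The space-time measure\<close>

context flow_atlas
begin

definition Q :: "('n ambient \<times> real) measure" where
  "Q = \<sigma> \<Otimes>\<^sub>M restrict_space lborel {0<..<T}"

definition \<Psi> :: "'n ambient \<times> real \<Rightarrow> 'n ambient \<times> real" where
  "\<Psi> p = (\<Phi> (fst p) (snd p), snd p)"

lemma space_\<sigma>: "space \<sigma> = \<Gamma> 0" by (rule space_surface_measure[OF hyp0])

lemma sets_\<sigma>: "sets \<sigma> = sets (restrict_space borel (\<Gamma> 0))" by (rule sets_surface_measure[OF hyp0])

lemma measurable_\<sigma>: "f \<in> borel_measurable borel \<Longrightarrow> f \<in> \<sigma> \<rightarrow>\<^sub>M borel"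
  unfolding measurable_cong_sets[OF sets_\<sigma> refl] by (rule measurable_restrict_space1)

lemma J_pos: "y \<in> \<Gamma> 0 \<Longrightarrow> t \<in> {0..T} \<Longrightarrow> 0 < J (y, t)"
proof -
  assume y: "y \<in> \<Gamma> 0" and t: "t \<in> {0..T}"
  obtain j0 j1 where "j0 > 0" "\<And>y t. y \<in> \<Gamma> 0 \<Longrightarrow> t \<in> {0..T} \<Longrightarrow> j0 \<le> J (y, t)" using J_bounds by metis
  then show "0 < J (y, t)" using y t by (metis less_le_trans)
qed

lemma \<Phi>t_measurable:
  assumes t: "t \<in> {0..T}" shows "(\<lambda>y. \<Phi> y t) \<in> \<sigma> \<rightarrow>\<^sub>M restrict_space borel (\<Gamma> t)"
proof (rule measurable_restrict_space2)
  show "(\<lambda>y. \<Phi> y t) \<in> \<sigma> \<rightarrow>\<^sub>M borel"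
    unfolding measurable_cong_sets[OF sets_\<sigma> refl]
    by (rule borel_measurable_continuous_on_restrict[OF continuous_\<Phi>t[OF t]])
qed (use \<Phi>_in[OF _ t] in \<open>simp add: space_\<sigma>\<close>)

lemma Jt_measurable: "(\<lambda>y. J (y, t)) \<in> borel_measurable \<sigma>"
  by (rule measurable_\<sigma>) (rule measurable_compose[OF _ J_borel], simp)

lemma surface_flow_distr:
  assumes t: "t \<in> {0..T}"
  shows "surface_measure (\<Gamma> t) = distr (density \<sigma> (\<lambda>y. ennreal (J (y, t)))) (restrict_space borel (\<Gamma> t)) (\<lambda>y. \<Phi> y t)"
    (is "?S = ?D")
proof (rule measure_eqI)
  show s: "sets ?S = sets ?D" by (simp add: sets_surface_measure[OF hyp[OF t]])
  fix A assume "A \<in> sets ?S"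
  then have A: "A \<in> sets (restrict_space borel (\<Gamma> t))" by (simp add: sets_surface_measure[OF hyp[OF t]])
  have "\<Gamma> t \<in> sets borel" by (intro borel_closed compact_imp_closed compact_\<Gamma> t)
  then have A': "A \<in> sets borel" "A \<subseteq> \<Gamma> t" using A by (auto simp: sets_restrict_space)
  have m: "(\<lambda>y. \<Phi> y t) \<in> density \<sigma> (\<lambda>y. ennreal (J (y, t))) \<rightarrow>\<^sub>M restrict_space borel (\<Gamma> t)"
    unfolding measurable_cong_sets[OF sets_density refl] by (rule \<Phi>t_measurable[OF t])
  have m': "(\<lambda>y. \<Phi> y t) -` A \<inter> space \<sigma> \<in> sets \<sigma>" by (rule measurable_sets[OF \<Phi>t_measurable[OF t] A])
  have "emeasure ?D A = emeasure (density \<sigma> (\<lambda>y. ennreal (J (y, t)))) ((\<lambda>y. \<Phi> y t) -` A \<inter> space \<sigma>)"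
    by (subst emeasure_distr[OF m A]) simp
  also have "\<dots> = (\<integral>\<^sup>+y. ennreal (J (y, t)) * indicator ((\<lambda>y. \<Phi> y t) -` A \<inter> space \<sigma>) y \<partial>\<sigma>)"
    using Jt_measurable m' by (intro emeasure_density) auto
  also have "\<dots> = (\<integral>\<^sup>+y. ennreal (J (y, t)) * indicator A (\<Phi> y t) \<partial>\<sigma>)"
    by (rule nn_integral_cong) (simp add: indicator_def)
  finally show "emeasure ?S A = emeasure ?D A" using emeasure_flow[OF t A'] by simp
qed

text \<open>Measurability is assumed for the pulled-back integrand, the form in which it is known
  for integrands with \<open>tgrad\<close> and \<open>material_deriv\<close>; the inverse
  homeomorphism carries it to \<open>\<Gamma> t\<close>.\<close>

lemma integral_flow:
  fixes g :: "'n ambient \<Rightarrow> real"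
  assumes t: "t \<in> {0..T}" and g: "(\<lambda>y. g (\<Phi> y t)) \<in> borel_measurable \<sigma>"
  shows "(\<integral>x. g x \<partial>surface_measure (\<Gamma> t)) = (\<integral>y. J (y, t) * g (\<Phi> y t) \<partial>\<sigma>)"
proof -
  let ?I = "inv_into (\<Gamma> 0) (\<lambda>y. \<Phi> y t)"
  have I: "?I \<in> restrict_space borel (\<Gamma> t) \<rightarrow>\<^sub>M \<sigma>"
    unfolding measurable_cong_sets[OF refl sets_\<sigma>]
  proof (rule measurable_restrict_space2)
    show "?I \<in> restrict_space borel (\<Gamma> t) \<rightarrow>\<^sub>M borel"
      by (rule borel_measurable_continuous_on_restrict[OF homeomorphism_cont2[OF homeo[OF t]]])
    show "?I \<in> space (restrict_space borel (\<Gamma> t)) \<rightarrow> \<Gamma> 0"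
      using homeomorphism_image2[OF homeo[OF t]] by (auto simp: space_restrict_space)
  qed
  have "(\<lambda>x. g (\<Phi> (?I x) t)) \<in> borel_measurable (restrict_space borel (\<Gamma> t))"
    by (rule measurable_compose[OF I g])
  moreover have "g (\<Phi> (?I x) t) = g x" if "x \<in> space (restrict_space borel (\<Gamma> t))" for x
    using homeomorphism_apply2[OF homeo[OF t], of x] that by (simp add: space_restrict_space)
  ultimately have g': "g \<in> borel_measurable (restrict_space borel (\<Gamma> t))"
    by (subst measurable_cong) auto
  have m: "(\<lambda>y. \<Phi> y t) \<in> density \<sigma> (\<lambda>y. ennreal (J (y, t))) \<rightarrow>\<^sub>M restrict_space borel (\<Gamma> t)"
    unfolding measurable_cong_sets[OF sets_density refl] by (rule \<Phi>t_measurable[OF t])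
  have "(\<integral>x. g x \<partial>surface_measure (\<Gamma> t)) = (\<integral>y. g (\<Phi> y t) \<partial>density \<sigma> (\<lambda>y. ennreal (J (y, t))))"
    unfolding surface_flow_distr[OF t] by (rule integral_distr[OF m g'])
  also have "\<dots> = (\<integral>y. J (y, t) *\<^sub>R g (\<Phi> y t) \<partial>\<sigma>)"
    by (rule integral_density[OF g Jt_measurable])
      (rule AE_I2, use J_pos[OF _ t] in \<open>simp add: space_\<sigma> less_imp_le\<close>)
  finally show ?thesis by simp
qed

lemma space_Q: "space Q = \<Gamma> 0 \<times> {0<..<T}"
  by (simp add: Q_def space_pair_measure space_\<sigma> space_restrict_space)

lemma sets_Q: "sets Q = sets (restrict_space borel (\<Gamma> 0 \<times> {0<..<T}))"
proof -
  have "sets Q = sets (restrict_space borel (\<Gamma> 0) \<Otimes>\<^sub>M restrict_space borel {0<..<T})"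
    unfolding Q_def by (intro sets_pair_measure_cong sets_\<sigma> sets_restrict_space_cong) simp
  then show ?thesis by (simp only: sets_pair_restrict_borel)
qed

lemma measurable_Q_continuous:
  fixes g :: "'n ambient \<times> real \<Rightarrow> 'b::topological_space"
  assumes "continuous_on K g" shows "g \<in> borel_measurable Q"
proof -
  have "continuous_on (\<Gamma> 0 \<times> {0<..<T}) g"
    by (rule continuous_on_subset[OF assms]) (rule Sigma_mono[OF order_refl], rule greaterThanLessThan_subseteq_atLeastAtMost_iff[THEN iffD2], simp)
  then show ?thesis
    unfolding measurable_cong_sets[OF sets_Q refl] by (rule borel_measurable_continuous_on_restrict)
qed

lemma Q_in_K: "p \<in> space Q \<Longrightarrow> p \<in> K" by (auto simp: space_Q)

lemma J_Q: "J \<in> borel_measurable Q"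
  unfolding measurable_cong_sets[OF sets_Q refl] by (rule measurable_restrict_space1[OF J_borel])

lemma continuous_\<Psi>: "continuous_on K \<Psi>"
  unfolding \<Psi>_def by (intro continuous_intros continuous_\<Phi>)

lemma \<Psi>_in: "p \<in> space Q \<Longrightarrow> \<Psi> p \<in> spacetime T \<Gamma>"
  using \<Phi>_in[of "fst p" "snd p"] by (auto simp: space_Q \<Psi>_def spacetime_def mem_Times_iff)

lemma \<Psi>_measurable: "\<Psi> \<in> Q \<rightarrow>\<^sub>M restrict_space borel (spacetime T \<Gamma>)"
  by (rule measurable_restrict_space2[OF _ measurable_Q_continuous[OF continuous_\<Psi>]]) (use \<Psi>_in in auto)

lemma finite_\<sigma>: "finite_measure \<sigma>" by (rule finite_measure_surface_measure[OF hyp0])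

lemma finite_I: "finite_measure (restrict_space lborel {0<..<T})"
  by (rule finite_measureI) (use T_pos in \<open>simp add: emeasure_restrict_space space_restrict_space\<close>)

lemma pair_Q: "pair_sigma_finite \<sigma> (restrict_space lborel {0<..<T})"
  using finite_\<sigma> finite_I by (simp add: pair_sigma_finite_def finite_measure_def)

lemma finite_Q: "finite_measure Q"
  unfolding Q_def by (rule finite_measure_pair_measure[OF finite_I finite_\<sigma>])

text \<open>\<open>measure_of\<close> is meaningful only for a countably additive set function.
  Identifying the set function with the push-forward measure, by \<open>emeasure_flow\<close> at
  each time and Tonelli's theorem, settles this and describes the measure at once.\<close>

lemma spacetime_measure_eq:
  "spacetime_measure T \<Gamma> = distr (density Q (\<lambda>p. ennreal (J p))) (restrict_space borel (spacetime T \<Gamma>)) \<Psi>"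
    (is "_ = ?D")
proof -
  interpret pair_sigma_finite \<sigma> "restrict_space lborel {0<..<T}" by (rule pair_Q)
  let ?A = "sets (restrict_space borel (spacetime T \<Gamma>))"
  have sub: "?A \<subseteq> Pow (spacetime T \<Gamma>)" using sets.sets_into_space[of _ "restrict_space borel (spacetime T \<Gamma>)"]
    by (auto simp: space_restrict_space)
  have m: "\<Psi> \<in> density Q (\<lambda>p. ennreal (J p)) \<rightarrow>\<^sub>M restrict_space borel (spacetime T \<Gamma>)"
    unfolding measurable_cong_sets[OF sets_density refl] by (rule \<Psi>_measurable)
  have "(\<integral>\<^sup>+t\<in>{0<..<T}. emeasure (surface_measure (\<Gamma> t)) {x. (x, t) \<in> A} \<partial>lborel) = emeasure ?D A"
    if A: "A \<in> ?A" for A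
  proof -
    obtain C where C: "C \<in> sets borel" "A = spacetime T \<Gamma> \<inter> C" using A by (auto simp: sets_restrict_space)
    have pre: "\<Psi> -` A \<inter> space Q \<in> sets Q" by (rule measurable_sets[OF \<Psi>_measurable A])
    let ?h = "\<lambda>p. ennreal (J p) * indicator (\<Psi> -` A \<inter> space Q) p"
    have hm: "?h \<in> borel_measurable (\<sigma> \<Otimes>\<^sub>M restrict_space lborel {0<..<T})"
      unfolding Q_def[symmetric] using J_Q pre by (intro borel_measurable_times_ennreal) auto
    have "emeasure ?D A = emeasure (density Q (\<lambda>p. ennreal (J p))) (\<Psi> -` A \<inter> space Q)"
      by (subst emeasure_distr[OF m A]) simp
    also have "\<dots> = (\<integral>\<^sup>+p. ?h p \<partial>Q)"
      using J_Q pre by (intro emeasure_density) auto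
    also have "\<dots> = (\<integral>\<^sup>+t. (\<integral>\<^sup>+y. ?h (y, t) \<partial>\<sigma>) \<partial>restrict_space lborel {0<..<T})"
      unfolding Q_def by (rule nn_integral_snd[symmetric, OF hm[unfolded Q_def]])
    also have "\<dots> = (\<integral>\<^sup>+t\<in>{0<..<T}. (\<integral>\<^sup>+y. ?h (y, t) \<partial>\<sigma>) \<partial>lborel)"
      by (rule nn_integral_restrict_space) simp
    also have "\<dots> = (\<integral>\<^sup>+t\<in>{0<..<T}. emeasure (surface_measure (\<Gamma> t)) {x. (x, t) \<in> A} \<partial>lborel)"
    proof (rule nn_integral_cong)
      fix t :: real
      show "(\<integral>\<^sup>+y. ?h (y, t) \<partial>\<sigma>) * indicator {0<..<T} t = emeasure (surface_measure (\<Gamma> t)) {x. (x, t) \<in> A} * indicator {0<..<T} t"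
      proof (cases "t \<in> {0<..<T}")
        case True
        then have t: "t \<in> {0..T}" by simp
        have eq: "{x. (x, t) \<in> A} = \<Gamma> t \<inter> (\<lambda>x. (x, t)) -` C"
          using True C(2) by (auto simp: spacetime_def)
        have "(\<lambda>x. (x, t)) -` C \<in> sets borel"
          by (rule measurable_sets_borel[OF _ C(1)]) (intro borel_measurable_continuous_onI continuous_intros)
        moreover have "\<Gamma> t \<in> sets borel" by (intro borel_closed compact_imp_closed compact_\<Gamma> t)
        ultimately have "{x. (x, t) \<in> A} \<in> sets borel" "{x. (x, t) \<in> A} \<subseteq> \<Gamma> t" unfolding eq by auto
        then have "emeasure (surface_measure (\<Gamma> t)) {x. (x, t) \<in> A} = (\<integral>\<^sup>+y. ennreal (J (y, t)) * indicator {x. (x, t) \<in> A} (\<Phi> y t) \<partial>\<sigma>)"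
          by (rule emeasure_flow[OF t])
        also have "\<dots> = (\<integral>\<^sup>+y. ?h (y, t) \<partial>\<sigma>)"
          by (rule nn_integral_cong) (use True in \<open>simp add: indicator_def \<Psi>_def space_Q space_\<sigma>\<close>)
        finally show ?thesis by simp
      qed simp
    qed
    finally show ?thesis by simp
  qed
  then have "measure_of (spacetime T \<Gamma>) ?A (\<lambda>A. \<integral>\<^sup>+t\<in>{0<..<T}. emeasure (surface_measure (\<Gamma> t)) {x. (x, t) \<in> A} \<partial>lborel)
    = measure_of (spacetime T \<Gamma>) ?A (emeasure ?D)"
    using sets.sigma_sets_eq[of "restrict_space borel (spacetime T \<Gamma>)"]
    by (intro measure_of_eq[OF sub]) (simp add: space_restrict_space)
  also have "\<dots> = ?D" using measure_of_of_measure[of ?D] by (simp add: space_restrict_space)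
  finally show ?thesis unfolding spacetime_measure_def .
qed

lemma sets_spacetime_measure: "sets (spacetime_measure T \<Gamma>) = sets (restrict_space borel (spacetime T \<Gamma>))"
  by (simp add: spacetime_measure_eq)

lemma spacetime_pull_measurable:
  "h \<in> borel_measurable (spacetime_measure T \<Gamma>) \<Longrightarrow> (\<lambda>p. h (\<Psi> p)) \<in> borel_measurable Q"
  unfolding measurable_cong_sets[OF sets_spacetime_measure refl] by (rule measurable_compose[OF \<Psi>_measurable])

lemma density_measurable: "\<Psi> \<in> density Q (\<lambda>p. ennreal (J p)) \<rightarrow>\<^sub>M restrict_space borel (spacetime T \<Gamma>)"
  unfolding measurable_cong_sets[OF sets_density refl] by (rule \<Psi>_measurable)

lemma J_pos_Q: "p \<in> space Q \<Longrightarrow> 0 < J p"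
  using J_pos[of "fst p" "snd p"] by (auto simp: space_Q mem_Times_iff)

lemma AE_density_Q: "(AE p in density Q (\<lambda>p. ennreal (J p)). P p) \<longleftrightarrow> (AE p in Q. P p)"
proof -
  have "(AE p in density Q (\<lambda>p. ennreal (J p)). P p) \<longleftrightarrow> (AE p in Q. 0 < ennreal (J p) \<longrightarrow> P p)"
    using J_Q by (intro AE_density) simp
  also have "\<dots> \<longleftrightarrow> (AE p in Q. P p)" by (rule AE_cong) (simp add: J_pos_Q)
  finally show ?thesis .
qed

lemma AE_spacetime_pull: "(AE z in spacetime_measure T \<Gamma>. P z) \<Longrightarrow> AE p in Q. P (\<Psi> p)"
  unfolding spacetime_measure_eq AE_density_Q[symmetric] by (rule AE_distrD[OF density_measurable])

lemma AE_spacetime_push: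
  fixes h h' :: "'n ambient \<times> real \<Rightarrow> real"
  assumes "h \<in> borel_measurable (spacetime_measure T \<Gamma>)" "h' \<in> borel_measurable (spacetime_measure T \<Gamma>)"
    and "AE p in Q. h (\<Psi> p) = h' (\<Psi> p)"
  shows "AE z in spacetime_measure T \<Gamma>. h z = h' z"
proof -
  have "{z \<in> space (restrict_space borel (spacetime T \<Gamma>)). h z = h' z} \<in> sets (restrict_space borel (spacetime T \<Gamma>))"
    using assms(1,2) unfolding measurable_cong_sets[OF sets_spacetime_measure refl] by (intro borel_measurable_eq)
  then show ?thesis
    unfolding spacetime_measure_eq using assms(3) by (subst AE_distr_iff[OF density_measurable]) (simp_all add: AE_density_Q)
qed

lemma integral_spacetime:
  fixes H :: "'n ambient \<times> real \<Rightarrow> real"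
  assumes H: "(\<lambda>p. H (\<Psi> p)) \<in> borel_measurable Q" and int: "integrable Q (\<lambda>p. J p * H (\<Psi> p))"
  shows "(LINT t:{0<..<T}|lborel. LINT x|surface_measure (\<Gamma> t). H (x, t)) = (\<integral>p. J p * H (\<Psi> p) \<partial>Q)"
proof -
  interpret pair_sigma_finite \<sigma> "restrict_space lborel {0<..<T}" by (rule pair_Q)
  have "(LINT t:{0<..<T}|lborel. LINT x|surface_measure (\<Gamma> t). H (x, t))
    = (LINT t:{0<..<T}|lborel. \<integral>y. J (y, t) * H (\<Psi> (y, t)) \<partial>\<sigma>)"
  proof (rule set_lebesgue_integral_cong)
    show "\<forall>t. t \<in> {0<..<T} \<longrightarrow> (LINT x|surface_measure (\<Gamma> t). H (x, t)) = (\<integral>y. J (y, t) * H (\<Psi> (y, t)) \<partial>\<sigma>)"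
    proof (intro allI impI)
      fix t assume t: "t \<in> {0<..<T}"
      have "(\<lambda>y. (y, t)) \<in> \<sigma> \<rightarrow>\<^sub>M Q"
        unfolding Q_def by (rule measurable_Pair2') (use t in \<open>simp add: space_restrict_space\<close>)
      from measurable_compose[OF this H] have "(\<lambda>y. H (\<Phi> y t, t)) \<in> borel_measurable \<sigma>" by (simp add: \<Psi>_def)
      then show "(LINT x|surface_measure (\<Gamma> t). H (x, t)) = (\<integral>y. J (y, t) * H (\<Psi> (y, t)) \<partial>\<sigma>)"
        using integral_flow[of t "\<lambda>x. H (x, t)"] t by (simp add: \<Psi>_def)
    qed
  qed simp
  also have "\<dots> = (\<integral>t. (\<integral>y. J (y, t) * H (\<Psi> (y, t)) \<partial>\<sigma>) \<partial>restrict_space lborel {0<..<T})"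
    unfolding set_lebesgue_integral_def by (rule integral_restrict_space[symmetric]) simp
  also have "\<dots> = (\<integral>p. J p * H (\<Psi> p) \<partial>Q)"
    using integral_snd[of "\<lambda>y t. J (y, t) * H (\<Psi> (y, t))"] int unfolding Q_def by (simp add: case_prod_beta')
  finally show ?thesis .
qed

text \<open>The flux is extended around the closure of the open space-time surface; this shows that
  its neighbourhood contains the surfaces at times 0 and \<open>T\<close>, so compactness of
  \<open>K\<close> can be used.\<close>

lemma \<Psi>_closure: "p \<in> K \<Longrightarrow> \<Psi> p \<in> closure (spacetime T \<Gamma>)"
proof -
  assume p: "p \<in> K"
  have K: "closure (\<Gamma> 0 \<times> {0<..<T}) = K"
    using T_pos compact_imp_closed[OF compact_\<Gamma>0] by (simp add: closure_Times)
  have "\<Psi> ` closure (\<Gamma> 0 \<times> {0<..<T}) \<subseteq> closure (spacetime T \<Gamma>)"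
  proof (rule image_closure_subset)
    show "continuous_on (closure (\<Gamma> 0 \<times> {0<..<T})) \<Psi>" unfolding K by (rule continuous_\<Psi>)
    show "\<Psi> ` (\<Gamma> 0 \<times> {0<..<T}) \<subseteq> closure (spacetime T \<Gamma>)"
      using \<Psi>_in closure_subset unfolding space_Q by blast
  qed simp
  then show ?thesis using p K by blast
qed

end

section \<open>Pulling back the entropy inequality\<close>

text \<open>Solutions, divergence and initial datum are bounded almost everywhere; clipping gives
  representatives bounded everywhere, as the locale \<open>doubling\<close> demands.\<close>

definition clip :: "real \<Rightarrow> real \<Rightarrow> real" where
  "clip C s = max (- C) (min C s)"

lemma clip_bound: "C \<ge> 0 \<Longrightarrow> \<bar>clip C s\<bar> \<le> C" and clip_eq: "\<bar>s\<bar> \<le> C \<Longrightarrow> clip C s = s"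
  by (auto simp: clip_def)

lemma clip_measurable [measurable]: "clip C \<in> borel_measurable borel"
  unfolding clip_def[abs_def] by measurable

definition bump_test :: "real \<Rightarrow> 'a::euclidean_space \<Rightarrow> (real \<Rightarrow> real) \<Rightarrow> 'a \<times> real \<Rightarrow> real" where
  "bump_test \<epsilon> q \<tau> z = \<tau> (snd z) * bump \<epsilon> (fst z - q)"

lemma bump_test_derivative:
  assumes \<tau>: "\<And>t. (\<tau> has_field_derivative \<tau>' t) (at t)"
  shows "(bump_test \<epsilon> q \<tau> has_derivative
    (\<lambda>h. \<tau>' (snd z) * snd h * bump \<epsilon> (fst z - q) + \<tau> (snd z) * (fst h \<bullet> bump_grad \<epsilon> (fst z - q)))) (at z)"
proof -
  have 1: "((\<lambda>z::'a \<times> real. \<tau> (snd z)) has_derivative (\<lambda>h. \<tau>' (snd z) * snd h)) (at z)"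
    using has_derivative_compose[OF has_derivative_snd[OF has_derivative_ident] \<tau>[unfolded has_field_derivative_def]] .
  have "((\<lambda>z::'a \<times> real. fst z - q) has_derivative fst) (at z)"
    by (auto intro!: derivative_eq_intros)
  from has_derivative_compose[OF this bump_has_derivative]
  have 2: "((\<lambda>z::'a \<times> real. bump \<epsilon> (fst z - q)) has_derivative (\<lambda>h. fst h \<bullet> bump_grad \<epsilon> (fst z - q))) (at z)" .
  show ?thesis
    unfolding bump_test_def[abs_def] by (rule has_derivative_eq_rhs[OF has_derivative_mult[OF 1 2]]) (auto simp: algebra_simps)
qed

lemma bump_test_C1:
  fixes q :: "'a::euclidean_space"
  assumes \<tau>: "\<And>t. (\<tau> has_field_derivative \<tau>' t) (at t)" and \<tau>': "continuous_on UNIV \<tau>'"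
  shows "C1_on S (bump_test \<epsilon> q \<tau>)"
proof -
  note d = bump_test_derivative[OF \<tau>, where \<epsilon> = \<epsilon> and q = q]
  have c\<tau>: "continuous_on UNIV \<tau>" using \<tau> by (meson DERIV_isCont continuous_at_imp_continuous_on)
  have "continuous_on UNIV (\<lambda>z. frechet_derivative (bump_test \<epsilon> q \<tau>) (at z) h)" for h
    unfolding frechet_derivative_at[OF d, symmetric]
    by (intro continuous_intros continuous_on_compose2[OF c\<tau>] continuous_on_compose2[OF \<tau>']
        continuous_on_compose2[OF continuous_on_bump[of UNIV]] continuous_on_compose2[OF continuous_on_bump_grad[of UNIV]]) auto
  moreover have "bump_test \<epsilon> q \<tau> differentiable (at z)" for z using d unfolding differentiable_def by blast
  ultimately show ?thesis
    unfolding C1_on_def by (intro exI[of _ UNIV] exI[of _ "bump_test \<epsilon> q \<tau>"] conjI ballI allI) simp_all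
qed

context flow_atlas
begin

definition bd :: "('n ambient \<times> real \<Rightarrow> 'b::real_normed_vector) \<Rightarrow> bool" where
  "bd g \<longleftrightarrow> (\<exists>C\<ge>0. \<forall>p\<in>space Q. norm (g p) \<le> C)"

lemma bdI: "(\<And>p. p \<in> space Q \<Longrightarrow> norm (g p) \<le> C) \<Longrightarrow> bd g"
  unfolding bd_def by (intro exI[of _ "max 0 C"] conjI ballI) (simp, meson max.cobounded2 order_trans)

lemma bd_add: "bd g \<Longrightarrow> bd h \<Longrightarrow> bd (\<lambda>p. g p + h p)"
  and bd_diff: "bd g \<Longrightarrow> bd h \<Longrightarrow> bd (\<lambda>p. g p - h p)"
proof -
  assume "bd g" "bd h"
  then obtain C D where "\<forall>p\<in>space Q. norm (g p) \<le> C" "\<forall>p\<in>space Q. norm (h p) \<le> D" unfolding bd_def by blast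
  then have *: "norm (g p + h p) \<le> C + D" "norm (g p - h p) \<le> C + D" if "p \<in> space Q" for p
    using that by (auto intro: norm_triangle_mono norm_triangle_le_diff add_mono)
  show "bd (\<lambda>p. g p + h p)" "bd (\<lambda>p. g p - h p)" by (rule bdI[OF *(1)], assumption, rule bdI[OF *(2)], assumption)
qed

lemma bd_mult: "bd g \<Longrightarrow> bd h \<Longrightarrow> bd (\<lambda>p. g p * h p :: real)"
proof -
  assume "bd g" "bd h"
  then obtain C D where "C \<ge> 0" "D \<ge> 0" "\<forall>p\<in>space Q. norm (g p) \<le> C" "\<forall>p\<in>space Q. norm (h p) \<le> D" unfolding bd_def by blast
  then have "norm (g p * h p) \<le> C * D" if "p \<in> space Q" for p
    using that unfolding norm_mult by (intro mult_mono) auto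
  then show ?thesis by (rule bdI)
qed

lemma bd_inner: "bd g \<Longrightarrow> bd h \<Longrightarrow> bd (\<lambda>p. g p \<bullet> h p)"
proof -
  assume "bd g" "bd h"
  then obtain C D where CD: "C \<ge> 0" "D \<ge> 0" "\<forall>p\<in>space Q. norm (g p) \<le> C" "\<forall>p\<in>space Q. norm (h p) \<le> D" unfolding bd_def by blast
  have "norm (g p \<bullet> h p) \<le> C * D" if "p \<in> space Q" for p
  proof -
    have "norm (g p) * norm (h p) \<le> C * D" using CD that by (intro mult_mono) auto
    then show ?thesis using Cauchy_Schwarz_ineq2[of "g p" "h p"] by simp
  qed
  then show ?thesis by (rule bdI)
qed

lemma bd_continuous: "continuous_on K g \<Longrightarrow> bd g"
proof -
  assume "continuous_on K g"
  then have "bounded (g ` K)" using compact_K compact_continuous_image compact_imp_bounded by blast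
  then obtain C where "\<And>p. p \<in> K \<Longrightarrow> norm (g p) \<le> C" unfolding bounded_iff by blast
  then show ?thesis by (intro bdI) (use Q_in_K in auto)
qed

lemma bd_integrable: "bd g \<Longrightarrow> g \<in> borel_measurable Q \<Longrightarrow> integrable Q (g :: _ \<Rightarrow> real)"
proof -
  assume "bd g" and m: "g \<in> borel_measurable Q"
  then obtain C where "\<And>p. p \<in> space Q \<Longrightarrow> norm (g p) \<le> C" unfolding bd_def by blast
  then show ?thesis
    by (intro finite_measure.integrable_const_bound[OF finite_Q _ m, of C]) (auto intro: AE_I2)
qed

lemma bd_J: "bd J"
proof -
  obtain j1 where j: "\<And>y t. y \<in> \<Gamma> 0 \<Longrightarrow> t \<in> {0..T} \<Longrightarrow> J (y, t) \<le> j1" using J_bounds by metis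
  show ?thesis
  proof (rule bdI)
    fix p assume p: "p \<in> space Q"
    then have "J p \<le> j1" using j[of "fst p" "snd p"] Q_in_K[OF p] by (simp add: mem_Times_iff)
    then show "norm (J p) \<le> j1" using J_pos_Q[OF p] by simp
  qed
qed

end

section \<open>The flux and the entropy inequality over the initial surface\<close>

locale flux = flow_atlas T \<Gamma> \<Phi> v G W N X c r
  for T :: real and \<Gamma> :: "real \<Rightarrow> ('n::finite) ambient set" and \<Phi> v G W N X c r +
  fixes f :: "'n ambient \<times> real \<Rightarrow> real \<Rightarrow> 'n ambient" and U g
  assumes f_tangent: "\<And>t x s. t \<in> {0..T} \<Longrightarrow> x \<in> \<Gamma> t \<Longrightarrow> f (x, t) s \<in> tangent_space (\<Gamma> t) x"
    and f_ext: "smooth_extension (closure (spacetime T \<Gamma>) \<times> UNIV) (\<lambda>(z, s). f z s) U g"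
begin

definition F :: "'n ambient \<times> real \<Rightarrow> real \<Rightarrow> 'n ambient" where "F p s = f (\<Psi> p) s"

definition V :: "'n ambient \<times> real \<Rightarrow> 'n ambient" where "V p = v (\<Psi> p)"

lemma F_in_U: "p \<in> K \<Longrightarrow> (\<Psi> p, s) \<in> U" and g_F: "p \<in> K \<Longrightarrow> g (\<Psi> p, s) = F p s"
proof -
  assume "p \<in> K"
  then have *: "(\<Psi> p, s) \<in> closure (spacetime T \<Gamma>) \<times> UNIV" using \<Psi>_closure by blast
  show "(\<Psi> p, s) \<in> U" using f_ext * unfolding smooth_extension_def by blast
  have "g (\<Psi> p, s) = (\<lambda>(z, s). f z s) (\<Psi> p, s)" using f_ext * unfolding smooth_extension_def by blast
  then show "g (\<Psi> p, s) = F p s" by (simp add: F_def)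
qed

lemma c1_g: "c1 U (iter_deriv vs g)" by (rule smooth_extension_c1[OF f_ext])

lemma c1_g0: "c1 U g" using c1_g[of "[]"] by simp

lemma continuous_F: "continuous_on (K \<times> UNIV) (\<lambda>q. F (fst q) (snd q))"
proof -
  have "continuous_on (K \<times> UNIV) (\<lambda>q. g (\<Psi> (fst q), snd q))"
    by (rule continuous_on_compose2[OF c1_continuous_on[OF c1_g0]])
      (use F_in_U in \<open>auto intro!: continuous_intros continuous_on_compose2[OF continuous_\<Psi>]\<close>)
  then show ?thesis by (rule continuous_on_eq) (use g_F in auto)
qed

lemma F_bound:
  obtains C where "C > 0" "\<And>p s. p \<in> K \<Longrightarrow> \<bar>s\<bar> \<le> R \<Longrightarrow> norm (F p s) \<le> C"
proof -
  have "bounded ((\<lambda>q. F (fst q) (snd q)) ` (K \<times> {- R..R}))"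
    by (rule compact_imp_bounded, rule compact_continuous_image[OF continuous_on_subset[OF continuous_F]])
      (auto intro!: compact_Times[OF compact_K])
  then obtain C where C: "C > 0" "\<And>q. q \<in> K \<times> {- R..R} \<Longrightarrow> norm (F (fst q) (snd q)) \<le> C"
    by (auto simp: bounded_pos)
  show thesis
  proof (rule that[OF C(1)])
    fix p :: "'n ambient \<times> real" and s assume "p \<in> K" "\<bar>s\<bar> \<le> R"
    then have "(p, s) \<in> K \<times> {- R..R}" by auto
    from C(2)[OF this] show "norm (F p s) \<le> C" by simp
  qed
qed

lemma \<Psi>_lipschitz:
  obtains L where "L > 0" "\<And>p p'. p \<in> K \<Longrightarrow> p' \<in> K \<Longrightarrow> norm (\<Psi> p - \<Psi> p') \<le> L * (norm (fst p - fst p') + \<bar>snd p - snd p'\<bar>)"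
proof -
  obtain L where L: "L > 0" "\<And>y y' t t'. y \<in> \<Gamma> 0 \<Longrightarrow> y' \<in> \<Gamma> 0 \<Longrightarrow> t \<in> {0..T} \<Longrightarrow> t' \<in> {0..T} \<Longrightarrow>
    norm (\<Phi> y t - \<Phi> y' t') \<le> L * (norm (y - y') + \<bar>t - t'\<bar>)" using \<Phi>_lipschitz by metis
  show thesis
  proof (rule that[of "L + 1"])
    fix p p' :: "'n ambient \<times> real" assume p: "p \<in> K" "p' \<in> K"
    have "norm (\<Psi> p - \<Psi> p') \<le> norm (\<Phi> (fst p) (snd p) - \<Phi> (fst p') (snd p')) + \<bar>snd p - snd p'\<bar>"
      using norm_prod_le[of "\<Psi> p" "\<Psi> p'"] by (simp add: \<Psi>_def)
    also have "\<dots> \<le> L * (norm (fst p - fst p') + \<bar>snd p - snd p'\<bar>) + 1 * (norm (fst p - fst p') + \<bar>snd p - snd p'\<bar>)"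
      using L(2)[of "fst p" "fst p'" "snd p" "snd p'"] p by (intro add_mono) (auto simp: mem_Times_iff)
    finally show "norm (\<Psi> p - \<Psi> p') \<le> (L + 1) * (norm (fst p - fst p') + \<bar>snd p - snd p'\<bar>)" by (simp only: distrib_right)
  qed (use L in simp)
qed

text \<open>Mean value inequality in the state variable for the flux difference between two points:
  its derivative is the difference of the state derivatives of the flux, which is Lipschitz in the
  point on a compact set.\<close>

lemma F_lipschitz:
  obtains L where "L > 0" "\<And>p p' s s'. p \<in> K \<Longrightarrow> p' \<in> K \<Longrightarrow> \<bar>s\<bar> \<le> R \<Longrightarrow> \<bar>s'\<bar> \<le> R \<Longrightarrow>
    norm ((F p s - F p' s) - (F p s' - F p' s')) \<le> L * (norm (fst p - fst p') + \<bar>snd p - snd p'\<bar>) * \<bar>s - s'\<bar>"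
proof -
  let ?g = "iter_deriv [(0, 1)] g"
  let ?C = "\<Psi> ` K \<times> {- R..R}"
  have cC: "compact ?C" by (intro compact_Times compact_continuous_image[OF continuous_\<Psi>] compact_K compact_Icc)
  have CU: "?C \<subseteq> U" using F_in_U by auto
  obtain L where L: "L > 0" "\<And>x y. x \<in> ?C \<Longrightarrow> y \<in> ?C \<Longrightarrow> norm (?g x - ?g y) \<le> L * norm (x - y)"
    using c1_lipschitz_on_compact[OF c1_g cC CU] by metis
  obtain LP where LP: "LP > 0" "\<And>p p'. p \<in> K \<Longrightarrow> p' \<in> K \<Longrightarrow> norm (\<Psi> p - \<Psi> p') \<le> LP * (norm (fst p - fst p') + \<bar>snd p - snd p'\<bar>)"
    using \<Psi>_lipschitz by metis
  show thesis
  proof (rule that[of "L * LP"])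
    fix p p' :: "'n ambient \<times> real" and s s' assume p: "p \<in> K" "p' \<in> K" and s: "\<bar>s\<bar> \<le> R" "\<bar>s'\<bar> \<le> R"
    let ?h = "\<lambda>s. F p s - F p' s"
    have der: "((\<lambda>s. F p s) has_vector_derivative ?g (\<Psi> p, s)) (at s within {- R..R})" if "p \<in> K" for p s
    proof -
      have "((\<lambda>s. (\<Psi> p, s)) has_derivative (\<lambda>h. (0, h))) (at s within {- R..R})"
        by (auto intro!: derivative_eq_intros)
      from has_derivative_compose[OF this c1_has_derivative[OF c1_g0 F_in_U[OF that]]]
      have "((\<lambda>s. g (\<Psi> p, s)) has_derivative (\<lambda>h. frechet_derivative g (at (\<Psi> p, s)) (0, h))) (at s within {- R..R})" .
      moreover have "(\<lambda>h. frechet_derivative g (at (\<Psi> p, s)) (0, h)) = (\<lambda>h. h *\<^sub>R frechet_derivative g (at (\<Psi> p, s)) (0, 1))"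
      proof
        have lin: "linear (frechet_derivative g (at (\<Psi> p, s)))" by (rule c1_linear[OF c1_g0 F_in_U[OF that]])
        fix h show "frechet_derivative g (at (\<Psi> p, s)) (0, h) = h *\<^sub>R frechet_derivative g (at (\<Psi> p, s)) (0, 1)"
          using linear_scale[OF lin, of h "(0, 1)"] by (simp only: scaleR_Pair scaleR_zero_right real_scaleR_def mult_1_right)
      qed
      ultimately have "((\<lambda>s. g (\<Psi> p, s)) has_vector_derivative frechet_derivative g (at (\<Psi> p, s)) (0, 1)) (at s within {- R..R})"
        unfolding has_vector_derivative_def by (rule subst[rotated])
      then show ?thesis by (simp only: g_F[OF that] iter_deriv.simps)
    qed
    have "norm (?h s - ?h s') \<le> (L * norm (\<Psi> p - \<Psi> p')) * norm (s - s')"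
    proof (rule differentiable_bound[of "{- R..R}" ?h "\<lambda>s h. h *\<^sub>R (?g (\<Psi> p, s) - ?g (\<Psi> p', s))"])
      fix s assume s: "s \<in> {- R..R}"
      show "(?h has_derivative (\<lambda>h. h *\<^sub>R (?g (\<Psi> p, s) - ?g (\<Psi> p', s)))) (at s within {- R..R})"
        using has_vector_derivative_diff[OF der[OF p(1)] der[OF p(2)]] unfolding has_vector_derivative_def .
      have "norm (?g (\<Psi> p, s) - ?g (\<Psi> p', s)) \<le> L * norm ((\<Psi> p, s) - (\<Psi> p', s))" using L(2) p s by blast
      also have "norm ((\<Psi> p, s) - (\<Psi> p', s)) = norm (\<Psi> p - \<Psi> p')" by (simp add: norm_Pair)
      finally show "onorm (\<lambda>h::real. h *\<^sub>R (?g (\<Psi> p, s) - ?g (\<Psi> p', s))) \<le> L * norm (\<Psi> p - \<Psi> p')"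
        by (intro onorm_le) (simp add: mult.commute[of "\<bar>_\<bar>"] mult_right_mono)
    qed (use s in auto)
    also have "\<dots> \<le> (L * (LP * (norm (fst p - fst p') + \<bar>snd p - snd p'\<bar>))) * norm (s - s')"
      using LP(2)[OF p] L(1) by (intro mult_right_mono mult_left_mono) auto
    finally show "norm ((F p s - F p' s) - (F p s' - F p' s')) \<le> L * LP * (norm (fst p - fst p') + \<bar>snd p - snd p'\<bar>) * \<bar>s - s'\<bar>"
      by (simp only: mult.assoc real_norm_def)
  qed (use L LP in simp)
qed

lemma F_measurable: "(\<lambda>q. F (fst q) (snd q)) \<in> borel_measurable (Q \<Otimes>\<^sub>M borel)"
proof -
  have "sets (Q \<Otimes>\<^sub>M (borel :: real measure)) = sets (restrict_space borel (\<Gamma> 0 \<times> {0<..<T}) \<Otimes>\<^sub>M restrict_space borel UNIV)"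
    by (intro sets_pair_measure_cong sets_Q) simp
  also have "\<dots> = sets (restrict_space borel ((\<Gamma> 0 \<times> {0<..<T}) \<times> UNIV))" by (rule sets_pair_restrict_borel)
  finally have s: "sets (Q \<Otimes>\<^sub>M (borel :: real measure)) = sets (restrict_space borel ((\<Gamma> 0 \<times> {0<..<T}) \<times> UNIV))" .
  show ?thesis
    unfolding measurable_cong_sets[OF s refl]
    by (rule borel_measurable_continuous_on_restrict, rule continuous_on_subset[OF continuous_F]) auto
qed

lemma F_compose: "w \<in> borel_measurable Q \<Longrightarrow> (\<lambda>p. F p (w p)) \<in> borel_measurable Q"
  using measurable_compose[OF measurable_Pair[OF measurable_ident_sets[OF refl]] F_measurable, of w] by simp

lemma V_eq: "V p = v (\<Phi> (fst p) (snd p), snd p)" by (simp add: V_def \<Psi>_def)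

lemma continuous_V: "continuous_on K V"
  unfolding V_eq[abs_def] using velocity_props by metis

lemma material_deriv_bump_test:
  assumes \<tau>: "\<And>t. (\<tau> has_field_derivative \<tau>' t) (at t)" and p: "p \<in> space Q"
  shows "material_deriv T \<Gamma> \<Phi> (bump_test \<epsilon> q \<tau>) (\<Psi> p)
    = \<tau>' (snd p) * bump \<epsilon> (fst (\<Psi> p) - q) + \<tau> (snd p) * (V p \<bullet> bump_grad \<epsilon> (fst (\<Psi> p) - q))"
proof -
  obtain y t where yt: "p = (y, t)" "y \<in> \<Gamma> 0" "t \<in> {0..T}" using Q_in_K[OF p] by auto
  have inj: "inj_on (\<lambda>y. \<Phi> y t) (\<Gamma> 0)" using bij[OF yt(3)] by (rule bij_betw_imp_inj_on)
  have "((\<lambda>s. (\<Phi> y s, s)) has_vector_derivative (v (\<Phi> y t, t), 1)) (at t within {0..T})"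
    by (intro has_vector_derivative_Pair vel[OF yt(2,3)] has_vector_derivative_id)
  then have "((\<lambda>s. (\<Phi> y s, s)) has_derivative (\<lambda>h. h *\<^sub>R (v (\<Phi> y t, t), 1))) (at t within {0..T})"
    unfolding has_vector_derivative_def .
  from has_derivative_compose[OF this bump_test_derivative[OF \<tau>, where z = "(\<Phi> y t, t)" and \<epsilon> = \<epsilon> and q = q]]
  have "((\<lambda>s. bump_test \<epsilon> q \<tau> (\<Phi> y s, s)) has_vector_derivative
      (\<tau>' t * bump \<epsilon> (\<Phi> y t - q) + \<tau> t * (v (\<Phi> y t, t) \<bullet> bump_grad \<epsilon> (\<Phi> y t - q)))) (at t within cbox 0 T)"
    unfolding has_vector_derivative_def cbox_interval by (rule has_derivative_eq_rhs) (auto simp: algebra_simps)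
  from vector_derivative_within_cbox[OF T_pos _ this] yt(3)
  show ?thesis
    by (simp add: material_deriv_def \<Psi>_def yt(1) V_def Let_def inv_into_f_f[OF inj yt(2)])
qed

lemma tgrad_bump_test:
  assumes p: "p \<in> space Q"
  shows "(f (\<Psi> p) a - f (\<Psi> p) k) \<bullet> tgrad (\<Gamma> (snd p)) (\<lambda>y. bump_test \<epsilon> q \<tau> (y, snd p)) (fst (\<Psi> p))
    = \<tau> (snd p) * ((F p a - F p k) \<bullet> bump_grad \<epsilon> (fst (\<Psi> p) - q))"
proof -
  obtain y t where yt: "p = (y, t)" "y \<in> \<Gamma> 0" "t \<in> {0..T}" using Q_in_K[OF p] by auto
  have x: "\<Phi> y t \<in> \<Gamma> t" by (rule \<Phi>_in[OF yt(2,3)])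
  have "((\<lambda>y. y - q) has_derivative (\<lambda>h. h)) (at (\<Phi> y t))" by (auto intro!: derivative_eq_intros)
  from has_derivative_mult_right[OF has_derivative_compose[OF this bump_has_derivative], of "\<tau> t" \<epsilon>]
  have "GDERIV (\<lambda>y. bump_test \<epsilon> q \<tau> (y, t)) (\<Phi> y t) :> \<tau> t *\<^sub>R bump_grad \<epsilon> (\<Phi> y t - q)"
    by (simp add: gderiv_def bump_test_def)
  note * = inner_tgrad[OF hyp[OF yt(3)] x f_tangent[OF yt(3) x] this]
  show ?thesis
    unfolding inner_diff_left F_def by (simp add: \<Psi>_def yt(1) * inner_diff_left algebra_simps)
qed

text \<open>All functions known almost everywhere are replaced by bounded Borel representatives.
  Integrability is evident for these and passes to the original integrand, which makes Fubini's
  theorem applicable.\<close>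

lemma entropy_pull:
  assumes kr: "kruzkov_entropy_solution T \<Gamma> \<Phi> v f u0 u"
    and div: "(\<lambda>(x, t). tdiv (\<Gamma> t) (\<lambda>y. v (y, t)) x) \<in> borel_measurable (spacetime_measure T \<Gamma>)"
    and w: "w \<in> borel_measurable Q" "AE p in Q. u (\<Psi> p) = w p" "bd w"
    and b: "b \<in> borel_measurable Q" "AE p in Q. tdiv (\<Gamma> (snd p)) (\<lambda>y. v (y, snd p)) (fst (\<Psi> p)) = b p" "bd b"
    and u0c: "u0 \<in> borel_measurable \<sigma>" "u0c \<in> borel_measurable \<sigma>" "AE y in \<sigma>. u0 y = u0c y"
    and \<tau>: "\<And>t. (\<tau> has_field_derivative \<tau>' t) (at t)" and \<tau>': "continuous_on UNIV \<tau>'"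
    and \<tau>_nonneg: "\<And>t. t \<in> {0..T} \<Longrightarrow> 0 \<le> \<tau> t" and \<tau>T: "\<tau> T = 0" and \<epsilon>: "\<epsilon> > 0"
  shows "0 \<le> (\<integral>p. J p *
      (\<bar>w p - k\<bar> * (\<tau>' (snd p) * bump \<epsilon> (fst (\<Psi> p) - q) + \<tau> (snd p) * (V p \<bullet> bump_grad \<epsilon> (fst (\<Psi> p) - q)))
       - sgn (w p - k) * k * b p * (\<tau> (snd p) * bump \<epsilon> (fst (\<Psi> p) - q))
       + sgn (w p - k) * \<tau> (snd p) * ((F p (w p) - F p k) \<bullet> bump_grad \<epsilon> (fst (\<Psi> p) - q))) \<partial>Q)
    + (\<integral>y. \<bar>u0c y - k\<bar> * (\<tau> 0 * bump \<epsilon> (y - q)) \<partial>\<sigma>)"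
proof -
  define \<phi> where "\<phi> = bump_test \<epsilon> q \<tau>"
  define E where "E w b p = \<bar>w - k\<bar> * (\<tau>' (snd p) * bump \<epsilon> (fst (\<Psi> p) - q) + \<tau> (snd p) * (V p \<bullet> bump_grad \<epsilon> (fst (\<Psi> p) - q)))
       - sgn (w - k) * k * b * (\<tau> (snd p) * bump \<epsilon> (fst (\<Psi> p) - q))
       + sgn (w - k) * \<tau> (snd p) * ((F p w - F p k) \<bullet> bump_grad \<epsilon> (fst (\<Psi> p) - q))" for w b p
  define H where "H z = \<bar>u z - k\<bar> * material_deriv T \<Gamma> \<Phi> \<phi> z
           - sgn (u z - k) * k * tdiv (\<Gamma> (snd z)) (\<lambda>y. v (y, snd z)) (fst z) * \<phi> z
           + sgn (u z - k) * ((f z (u z) - f z k) \<bullet> tgrad (\<Gamma> (snd z)) (\<lambda>y. \<phi> (y, snd z)) (fst z))" for z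
  define d where "d p = tdiv (\<Gamma> (snd p)) (\<lambda>y. v (y, snd p)) (fst (\<Psi> p))" for p
  \<comment> \<open>A test function has to be nonnegative on the closure, whose points have times in
    \<open>{0..T}\<close>, where \<tau> is known to be nonnegative.\<close>
  have zE: "0 \<le> \<tau> t" if "(x, t) \<in> closure (spacetime T \<Gamma>)" for x t
  proof -
    have "spacetime T \<Gamma> \<subseteq> UNIV \<times> {0..T}" by (auto simp: spacetime_def)
    then have "closure (spacetime T \<Gamma>) \<subseteq> UNIV \<times> {0..T}" by (intro closure_minimal closed_Times) auto
    then show ?thesis using that \<tau>_nonneg[of t] by auto
  qed
  have "\<phi> \<in> test_functions T \<Gamma>"
    unfolding test_functions_def
  proof (intro CollectI conjI ballI)
    show "C1_on (closure (spacetime T \<Gamma>)) \<phi>" unfolding \<phi>_def by (rule bump_test_C1[OF \<tau> \<tau>'])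
    show "0 \<le> \<phi> z" if "z \<in> closure (spacetime T \<Gamma>)" for z
      using zE[of "fst z" "snd z"] that bump_bounds(1)[of \<epsilon> "fst z - q"] by (simp add: \<phi>_def bump_test_def)
    show "\<phi> (x, T) = 0" for x by (simp add: \<phi>_def bump_test_def \<tau>T)
  qed
  with kr have ineq: "0 \<le> (LINT t:{0<..<T}|lborel. LINT x|surface_measure (\<Gamma> t). H (x, t))
      + (\<integral>y. \<bar>u0 y - k\<bar> * \<phi> (y, 0) \<partial>\<sigma>)"
    unfolding kruzkov_entropy_solution_def H_def by simp
  have c\<tau>: "continuous_on UNIV \<tau>" using \<tau> by (meson DERIV_isCont continuous_at_imp_continuous_on)
  have cP: "continuous_on K (\<lambda>p. fst (\<Psi> p) - q)" by (intro continuous_intros continuous_\<Psi>)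
  have cont: "continuous_on K (\<lambda>p. \<tau> (snd p))" "continuous_on K (\<lambda>p. \<tau>' (snd p))"
    "continuous_on K (\<lambda>p. bump \<epsilon> (fst (\<Psi> p) - q))" "continuous_on K (\<lambda>p. bump_grad \<epsilon> (fst (\<Psi> p) - q))"
    "continuous_on K (\<lambda>p. F p k)"
  proof -
    show "continuous_on K (\<lambda>p. \<tau> (snd p))" "continuous_on K (\<lambda>p. \<tau>' (snd p))"
      by (rule continuous_on_compose2[OF c\<tau>] continuous_on_compose2[OF \<tau>'], intro continuous_intros, simp)+
    show "continuous_on K (\<lambda>p. bump \<epsilon> (fst (\<Psi> p) - q))" "continuous_on K (\<lambda>p. bump_grad \<epsilon> (fst (\<Psi> p) - q))"
      by (rule continuous_on_compose2[OF continuous_on_bump[of UNIV] cP] continuous_on_compose2[OF continuous_on_bump_grad[of UNIV] cP], simp)+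
    show "continuous_on K (\<lambda>p. F p k)"
      using continuous_on_compose2[OF continuous_F, of K "\<lambda>p. (p, k)"] by (simp add: continuous_intros image_subset_iff)
  qed
  have Em: "(\<lambda>p. E (w p) (b p) p) \<in> borel_measurable Q" if "w \<in> borel_measurable Q" "b \<in> borel_measurable Q" for w b
  proof -
    note [measurable] = that F_compose[OF that(1)] cont[THEN measurable_Q_continuous] measurable_Q_continuous[OF continuous_V]
    show ?thesis unfolding E_def by measurable
  qed
  have H_E: "H (\<Psi> p) = E (u (\<Psi> p)) (d p) p" if p: "p \<in> space Q" for p
  proof -
    have "snd (\<Psi> p) = snd p" by (simp add: \<Psi>_def)
    then show ?thesis
      unfolding H_def E_def d_def \<phi>_def material_deriv_bump_test[OF \<tau> p]
      using tgrad_bump_test[OF p, of "u (\<Psi> p)" k \<epsilon> q \<tau>] by (simp add: bump_test_def)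
  qed
  have um: "(\<lambda>p. u (\<Psi> p)) \<in> borel_measurable Q"
    using kr by (intro spacetime_pull_measurable) (simp add: kruzkov_entropy_solution_def Linfty_def)
  have dm: "d \<in> borel_measurable Q"
    using spacetime_pull_measurable[OF div] by (simp add: d_def[abs_def] \<Psi>_def case_prod_beta')
  have Hm: "(\<lambda>p. H (\<Psi> p)) \<in> borel_measurable Q"
    using Em[OF um dm] by (subst measurable_cong[OF H_E])
  have ae: "AE p in Q. H (\<Psi> p) = E (w p) (b p) p"
    using w(2) b(2) AE_space[of Q] by eventually_elim (simp add: H_E d_def)
  have bdF: "bd (\<lambda>p. F p (w p))"
  proof -
    obtain R where R: "\<forall>p\<in>space Q. norm (w p) \<le> R" using w(3) unfolding bd_def by blast
    obtain C where "\<And>p s. p \<in> K \<Longrightarrow> \<bar>s\<bar> \<le> R \<Longrightarrow> norm (F p s) \<le> C" using F_bound[of R] by metis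
    then show ?thesis by (intro bdI[of _ C]) (use R Q_in_K in auto)
  qed
  have const: "bd (\<lambda>p. a)" for a :: real by (rule bdI[of _ "norm a"]) simp
  have bsgn: "bd (\<lambda>p. sgn (w p - k))" by (rule bdI[of _ 1]) (simp add: sgn_if)
  have babs: "bd (\<lambda>p. \<bar>w p - k\<bar>)" using bd_diff[OF w(3) const[of k]] by (simp add: bd_def)
  have bdE: "bd (\<lambda>p. E (w p) (b p) p)"
    unfolding E_def
    by (intro bd_add bd_diff bd_mult bd_inner bsgn babs const b(3) bdF cont[THEN bd_continuous] bd_continuous[OF continuous_V])
  have JE: "integrable Q (\<lambda>p. J p * E (w p) (b p) p)"
    using J_Q Em[OF w(1) b(1)] by (intro bd_integrable bd_mult bd_J bdE) simp
  have JHm: "(\<lambda>p. J p * H (\<Psi> p)) \<in> borel_measurable Q" using J_Q Hm by simp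
  have aeJ: "AE p in Q. J p * H (\<Psi> p) = J p * E (w p) (b p) p" using ae by eventually_elim simp
  have JH: "integrable Q (\<lambda>p. J p * H (\<Psi> p))"
    using JE integrable_cong_AE[OF JHm borel_measurable_integrable[OF JE] aeJ] by simp
  have "(LINT t:{0<..<T}|lborel. LINT x|surface_measure (\<Gamma> t). H (x, t)) = (\<integral>p. J p * E (w p) (b p) p \<partial>Q)"
    unfolding integral_spacetime[OF Hm JH] by (rule integral_cong_AE[OF JHm borel_measurable_integrable[OF JE] aeJ])
  moreover have "(\<integral>y. \<bar>u0 y - k\<bar> * \<phi> (y, 0) \<partial>\<sigma>) = (\<integral>y. \<bar>u0c y - k\<bar> * (\<tau> 0 * bump \<epsilon> (y - q)) \<partial>\<sigma>)"
  proof (rule integral_cong_AE)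
    have [measurable]: "(\<lambda>y. bump \<epsilon> (y - q)) \<in> borel_measurable \<sigma>"
      by (intro measurable_\<sigma> borel_measurable_continuous_onI continuous_on_compose2[OF continuous_on_bump[of UNIV]] continuous_intros) auto
    note [measurable] = u0c(1,2)
    show "(\<lambda>y. \<bar>u0 y - k\<bar> * \<phi> (y, 0)) \<in> borel_measurable \<sigma>" unfolding \<phi>_def bump_test_def fst_conv snd_conv by measurable
    show "(\<lambda>y. \<bar>u0c y - k\<bar> * (\<tau> 0 * bump \<epsilon> (y - q))) \<in> borel_measurable \<sigma>" by measurable
    show "AE y in \<sigma>. \<bar>u0 y - k\<bar> * \<phi> (y, 0) = \<bar>u0c y - k\<bar> * (\<tau> 0 * bump \<epsilon> (y - q))"
      using u0c(3) by eventually_elim (simp add: \<phi>_def bump_test_def)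
  qed
  ultimately show ?thesis using ineq unfolding E_def by simp
qed

end

section \<open>Bounded representatives and conclusion\<close>

lemma Linfty_bound: "u \<in> Linfty M \<Longrightarrow> u \<in> borel_measurable M" "u \<in> Linfty M \<Longrightarrow> \<exists>C. AE z in M. \<bar>u z\<bar> \<le> C"
  by (auto simp: Linfty_def)

context flux
begin

lemma clip_pull:
  assumes u: "u \<in> borel_measurable (spacetime_measure T \<Gamma>)" and bound: "AE z in spacetime_measure T \<Gamma>. \<bar>u z\<bar> \<le> C"
    and C: "0 \<le> C'" "C \<le> C'"
  shows "(\<lambda>p. clip C' (u (\<Psi> p))) \<in> borel_measurable Q" "AE p in Q. u (\<Psi> p) = clip C' (u (\<Psi> p))"
    "bd (\<lambda>p. clip C' (u (\<Psi> p)))"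
proof -
  show "(\<lambda>p. clip C' (u (\<Psi> p))) \<in> borel_measurable Q"
    by (rule measurable_compose[OF spacetime_pull_measurable[OF u] clip_measurable])
  show "AE p in Q. u (\<Psi> p) = clip C' (u (\<Psi> p))"
    using AE_spacetime_pull[OF bound] by eventually_elim (use C in \<open>simp add: clip_eq\<close>)
  show "bd (\<lambda>p. clip C' (u (\<Psi> p)))" by (rule bdI[of _ C']) (use clip_bound[OF C(1)] in simp)
qed

lemma uniqueness:
  assumes div: "(\<lambda>(x, t). tdiv (\<Gamma> t) (\<lambda>y. v (y, t)) x) \<in> Linfty (spacetime_measure T \<Gamma>)"
    and u0: "u0 \<in> Linfty \<sigma>"
    and kr: "kruzkov_entropy_solution T \<Gamma> \<Phi> v f u0 u" "kruzkov_entropy_solution T \<Gamma> \<Phi> v f u0 u'"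
  shows "AE z in spacetime_measure T \<Gamma>. u z = u' z"
proof -
  have uL: "u \<in> Linfty (spacetime_measure T \<Gamma>)" "u' \<in> Linfty (spacetime_measure T \<Gamma>)"
    using kr by (simp_all add: kruzkov_entropy_solution_def)
  obtain C1 C2 C3 C4 where C: "AE z in spacetime_measure T \<Gamma>. \<bar>u z\<bar> \<le> C1" "AE z in spacetime_measure T \<Gamma>. \<bar>u' z\<bar> \<le> C2"
    "AE y in \<sigma>. \<bar>u0 y\<bar> \<le> C3" "AE z in spacetime_measure T \<Gamma>. \<bar>(\<lambda>(x, t). tdiv (\<Gamma> t) (\<lambda>y. v (y, t)) x) z\<bar> \<le> C4"
    using Linfty_bound(2)[OF uL(1)] Linfty_bound(2)[OF uL(2)] Linfty_bound(2)[OF u0] Linfty_bound(2)[OF div] by blast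
  \<comment> \<open>One bound for both solutions, the initial datum and the divergence; the entry 1
    makes it positive.\<close>
  define R where "R = Max {1, C1, C2, C3, C4}"
  have R: "R > 0" "0 \<le> R" "C1 \<le> R" "C2 \<le> R" "C3 \<le> R" "C4 \<le> R"
    unfolding R_def by (auto simp: less_max_iff_disj le_max_iff_disj)
  define w where "w p = clip R (u (\<Psi> p))" for p
  define w' where "w' p = clip R (u' (\<Psi> p))" for p
  define b where "b p = clip R ((\<lambda>(x, t). tdiv (\<Gamma> t) (\<lambda>y. v (y, t)) x) (\<Psi> p))" for p
  define u0c where "u0c y = clip R (u0 y)" for y
  note w = clip_pull[OF Linfty_bound(1)[OF uL(1)] C(1) R(2,3), folded w_def]
  note w' = clip_pull[OF Linfty_bound(1)[OF uL(2)] C(2) R(2,4), folded w'_def]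
  note b = clip_pull[OF Linfty_bound(1)[OF div] C(4) R(2,6), folded b_def]
  have u0c: "u0c \<in> borel_measurable \<sigma>" "AE y in \<sigma>. u0 y = u0c y"
  proof -
    show "u0c \<in> borel_measurable \<sigma>"
      unfolding u0c_def[abs_def] by (rule measurable_compose[OF Linfty_bound(1)[OF u0] clip_measurable])
    show "AE y in \<sigma>. u0 y = u0c y" using C(3) by eventually_elim (use R in \<open>simp add: u0c_def clip_eq\<close>)
  qed
  have bound: "\<bar>w p\<bar> \<le> R" "\<bar>w' p\<bar> \<le> R" "\<bar>b p\<bar> \<le> R" "\<bar>u0c y\<bar> \<le> R" for p y
    by (simp_all add: w_def w'_def b_def u0c_def clip_bound R(2))
  obtain aL aU r0 where ball: "aL > 0" "aU > 0" "r0 > 0"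
    "\<And>x \<rho>. x \<in> \<Gamma> 0 \<Longrightarrow> 0 < \<rho> \<Longrightarrow> \<rho> \<le> r0 \<Longrightarrow> ennreal (aL * \<rho> ^ CARD('n)) \<le> emeasure \<sigma> (\<Gamma> 0 \<inter> ball x \<rho>)"
    "\<And>x \<rho>. 0 < \<rho> \<Longrightarrow> emeasure \<sigma> (\<Gamma> 0 \<inter> ball x \<rho>) \<le> ennreal (aU * \<rho> ^ CARD('n))"
    using surface_measure_ball[OF hyp0] by metis
  obtain j0 j1 where j: "j0 > 0" "j1 > 0" "\<And>y t. y \<in> \<Gamma> 0 \<Longrightarrow> t \<in> {0..T} \<Longrightarrow> j0 \<le> J (y, t) \<and> J (y, t) \<le> j1"
    using J_bounds by metis
  obtain KV LV where vel: "KV > 0" "LV > 0" "continuous_on K (\<lambda>p. v (\<Phi> (fst p) (snd p), snd p))"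
    "\<And>p. p \<in> K \<Longrightarrow> norm (v (\<Phi> (fst p) (snd p), snd p)) \<le> KV"
    "\<And>p q. p \<in> K \<Longrightarrow> q \<in> K \<Longrightarrow> norm (v (\<Phi> (fst p) (snd p), snd p) - v (\<Phi> (fst q) (snd q), snd q))
      \<le> LV * (norm (fst p - fst q) + \<bar>snd p - snd q\<bar>)"
  proof (rule velocity_props, goal_cases)
    case (1 KV LV)
    show ?case by (rule 1(1)[OF 1(2-6)])
  qed
  note V = vel(1,2,4,5)[folded V_eq]
  obtain KF where KF: "KF > 0" "\<And>p s. p \<in> K \<Longrightarrow> \<bar>s\<bar> \<le> R \<Longrightarrow> norm (F p s) \<le> KF" using F_bound[of R] by metis
  obtain LF where LF: "LF > 0" "\<And>p p' s s'. p \<in> K \<Longrightarrow> p' \<in> K \<Longrightarrow> \<bar>s\<bar> \<le> R \<Longrightarrow> \<bar>s'\<bar> \<le> R \<Longrightarrow>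
    norm ((F p s - F p' s) - (F p s' - F p' s')) \<le> LF * (norm (fst p - fst p') + \<bar>snd p - snd p'\<bar>) * \<bar>s - s'\<bar>"
    using F_lipschitz[of R] by metis
  obtain LP where LP: "LP > 0" "\<And>y y' t t'. y \<in> \<Gamma> 0 \<Longrightarrow> y' \<in> \<Gamma> 0 \<Longrightarrow> t \<in> {0..T} \<Longrightarrow> t' \<in> {0..T} \<Longrightarrow>
    norm (\<Phi> y t - \<Phi> y' t') \<le> LP * (norm (y - y') + \<bar>t - t'\<bar>)" using \<Phi>_lipschitz by metis
  obtain \<kappa> where \<kappa>: "\<kappa> > 0" "\<And>y y' t. y \<in> \<Gamma> 0 \<Longrightarrow> y' \<in> \<Gamma> 0 \<Longrightarrow> t \<in> {0..T} \<Longrightarrow> norm (y - y') \<le> \<kappa> * norm (\<Phi> y t - \<Phi> y' t)"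
    using \<Phi>_lower by metis
  have \<Omega>K: "p \<in> K" if "p \<in> \<Gamma> 0 \<times> {0<..<T}" for p using Q_in_K that by (simp add: space_Q)
  have P: "fst (\<Psi> (y, t)) = \<Phi> y t" for y t by (simp add: \<Psi>_def)
  have mP: "(\<lambda>p. fst (\<Psi> p)) \<in> borel_measurable Q"
    by (rule measurable_Q_continuous) (intro continuous_intros continuous_\<Psi>)
  \<comment> \<open>The two occurrences of \<open>R\<close> are the bound of the divergence and that
    of the solutions and the initial datum; the exponent of the ball growth is the dimension of the
    hypersurface.\<close>
  interpret D: doubling \<sigma> "\<Gamma> 0" T "CARD('n)" "\<lambda>p. fst (\<Psi> p)" V F J b w w' u0c aL aU r0 j0 j1 R R KV KF LP \<kappa> LV LF
  proof (rule doubling.intro)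
    show "j0 \<le> J p" "J p \<le> j1" if "p \<in> \<Gamma> 0 \<times> {0<..<T}" for p
      using j(3)[of "fst p" "snd p"] \<Omega>K[OF that] by (auto simp: mem_Times_iff)
    show "norm (V p) \<le> KV" if "p \<in> \<Gamma> 0 \<times> {0<..<T}" for p by (rule V(3)[OF \<Omega>K[OF that]])
    show "norm (V p - V q) \<le> LV * (norm (fst p - fst q) + \<bar>snd p - snd q\<bar>)"
      if "p \<in> \<Gamma> 0 \<times> {0<..<T}" "q \<in> \<Gamma> 0 \<times> {0<..<T}" for p q by (rule V(4)[OF that[THEN \<Omega>K]])
    show "norm (F p s) \<le> KF" if "p \<in> \<Gamma> 0 \<times> {0<..<T}" "\<bar>s\<bar> \<le> R" for p s by (rule KF(2)[OF \<Omega>K[OF that(1)] that(2)])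
    show "norm ((F p s - F p' s) - (F p s' - F p' s')) \<le> LF * (norm (fst p - fst p') + \<bar>snd p - snd p'\<bar>) * \<bar>s - s'\<bar>"
      if "p \<in> \<Gamma> 0 \<times> {0<..<T}" "p' \<in> \<Gamma> 0 \<times> {0<..<T}" "\<bar>s\<bar> \<le> R" "\<bar>s'\<bar> \<le> R" for p p' s s'
      by (rule LF(2)[OF that(1,2)[THEN \<Omega>K] that(3,4)])
    show "norm (fst (\<Psi> (y, t)) - fst (\<Psi> (y', t'))) \<le> LP * (norm (y - y') + \<bar>t - t'\<bar>)"
      if "y \<in> \<Gamma> 0" "y' \<in> \<Gamma> 0" "t \<in> {0..T}" "t' \<in> {0..T}" for y y' t t'
      unfolding P by (rule LP(2)[OF that])
    show "norm (y - y') \<le> \<kappa> * norm (fst (\<Psi> (y, t)) - fst (\<Psi> (y', t)))"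
      if "y \<in> \<Gamma> 0" "y' \<in> \<Gamma> 0" "t \<in> {0..T}" for y y' t
      unfolding P by (rule \<kappa>(2)[OF that])
    show "fst (\<Psi> (y, 0)) = y" if "y \<in> \<Gamma> 0" for y unfolding P by (rule \<Phi>_0[OF that])
  qed (fact T_pos finite_\<sigma> sets_\<sigma> ball j(1,2) R(1) V(1,2) KF(1) LF(1) LP(1) \<kappa>(1) u0c(1)
      J_Q[unfolded Q_def] b(1)[unfolded Q_def] w(1)[unfolded Q_def] w'(1)[unfolded Q_def] mP[unfolded Q_def]
      measurable_Q_continuous[OF continuous_V, unfolded Q_def] F_measurable[unfolded Q_def] | rule bound)+
  have stm: "D.stm = Q" by (simp add: D.stm_def Q_def)
  have b2: "AE p in Q. tdiv (\<Gamma> (snd p)) (\<lambda>y. v (y, snd p)) (fst (\<Psi> p)) = b p"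
    using b(2) by (simp add: \<Psi>_def)
  have ent: "D.entropy z" if k: "kruzkov_entropy_solution T \<Gamma> \<Phi> v f u0 h"
    and z: "z \<in> borel_measurable Q" "AE p in Q. h (\<Psi> p) = z p" "bd z" for h z
    unfolding D.entropy_def D.S_def stm
  proof (intro allI impI)
    fix k :: real and q :: "'n ambient" and \<epsilon> :: real and \<tau> \<tau>' :: "real \<Rightarrow> real"
    assume "\<epsilon> > 0" "\<forall>t. (\<tau> has_field_derivative \<tau>' t) (at t)" "continuous_on UNIV \<tau>'" "\<forall>t\<in>{0..T}. 0 \<le> \<tau> t" "\<tau> T = 0"
    then show "0 \<le> (\<integral>p. J p *
      (\<bar>z p - k\<bar> * (\<tau>' (snd p) * bump \<epsilon> (fst (\<Psi> p) - q) + \<tau> (snd p) * (V p \<bullet> bump_grad \<epsilon> (fst (\<Psi> p) - q)))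
       - sgn (z p - k) * k * b p * (\<tau> (snd p) * bump \<epsilon> (fst (\<Psi> p) - q))
       + sgn (z p - k) * \<tau> (snd p) * ((F p (z p) - F p k) \<bullet> bump_grad \<epsilon> (fst (\<Psi> p) - q))) \<partial>Q)
    + (\<integral>y. \<bar>u0c y - k\<bar> * (\<tau> 0 * bump \<epsilon> (y - q)) \<partial>\<sigma>)"
      by (intro entropy_pull[OF k Linfty_bound(1)[OF div] z b(1) b2 b(3) Linfty_bound(1)[OF u0] u0c]) auto
  qed
  interpret D: doubling_entropy \<sigma> "\<Gamma> 0" T "CARD('n)" "\<lambda>p. fst (\<Psi> p)" V F J b w w' u0c aL aU r0 j0 j1 R R KV KF LP \<kappa> LV LF
    by unfold_locales (rule ent[OF kr(1) w], rule ent[OF kr(2) w'])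
  have "AE p in Q. w p = w' p" using D.AE_equal unfolding stm .
  then have "AE p in Q. u (\<Psi> p) = u' (\<Psi> p)"
    using w(2) w'(2) by eventually_elim simp
  then show ?thesis by (rule AE_spacetime_push[OF Linfty_bound(1)[OF uL(1)] Linfty_bound(1)[OF uL(2)]])
qed

end

theorem theorem9p4:
  fixes T :: real
    and \<Gamma> :: "real \<Rightarrow> ('n::finite) ambient set"
    and \<Phi> :: "'n ambient \<Rightarrow> real \<Rightarrow> 'n ambient"
    and v :: "'n ambient \<times> real \<Rightarrow> 'n ambient"
    and f :: "'n ambient \<times> real \<Rightarrow> real \<Rightarrow> 'n ambient"
    and u0 :: "'n ambient \<Rightarrow> real"
    and u u' :: "'n ambient \<times> real \<Rightarrow> real"
  assumes "evolving_hypersurface T \<Gamma> \<Phi> v"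
    and "admissible_flux T \<Gamma> f"
    and "(\<lambda>(x, t). tdiv (\<Gamma> t) (\<lambda>y. v (y, t)) x) \<in> Linfty (spacetime_measure T \<Gamma>)"
    and "\<exists>L. \<forall>z\<in>spacetime T \<Gamma>.
           L-lipschitz_on UNIV (\<lambda>s. material_deriv T \<Gamma> \<Phi> (\<lambda>w. f w s) z)"
    and "\<exists>L. \<forall>(x, t)\<in>spacetime T \<Gamma>. \<forall>j.
           L-lipschitz_on UNIV (\<lambda>s. tgrad (\<Gamma> t) (\<lambda>y. f (y, t) s $ j) x)"
    and "u0 \<in> Linfty (surface_measure (\<Gamma> 0))"
    and "kruzkov_entropy_solution T \<Gamma> \<Phi> v f u0 u"
    and "kruzkov_entropy_solution T \<Gamma> \<Phi> v f u0 u'"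
  shows "AE z in spacetime_measure T \<Gamma>. u z = u' z"
proof -
  obtain W G where ext: "smooth_extension (\<Gamma> 0 \<times> {0..T}) (\<lambda>(y, t). \<Phi> y t) W G"
    using assms(1) unfolding evolving_hypersurface_def smooth_on_def by blast
  interpret flow T \<Gamma> \<Phi> v G W by (rule flow.intro[OF assms(1) ext])
  obtain N X c r where atlas: "atlas (\<Gamma> 0) N X c r" using closed_hypersurface_atlas[OF hyp0] .
  obtain U g where fext: "smooth_extension (closure (spacetime T \<Gamma>) \<times> UNIV) (\<lambda>(z, s). f z s) U g"
    using assms(2) unfolding admissible_flux_def smooth_bounded_derivs_on_def by blast
  interpret flux T \<Gamma> \<Phi> v G W N X c r f U g
  proof (intro flux.intro flux_axioms.intro flow_atlas.intro flow_axioms atlas fext)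
    show "f (x, t) s \<in> tangent_space (\<Gamma> t) x" if "t \<in> {0..T}" "x \<in> \<Gamma> t" for t x s
      using assms(2) that unfolding admissible_flux_def by blast
  qed
  show ?thesis by (rule uniqueness[OF assms(3,6,7,8)])
qed

end
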